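(* Let $\lambda\ge 0$ and let $(X,\mathfrak m,\mathscr E,\mathscr F(X))$ be a locally smoothing strongly local Dirichlet space. (a) If $f\in L^1_{\mathrm{loc}}(X,\mathfrak m)$ is locally $\lambda$-shift defective and $f\in\mathscr F_{\mathrm{loc}}(X)$, then $f$ is weakly $\lambda$-subharmonic. In particular, if $f\in L^\infty_{\mathrm{loc}}(X,\mathfrak m)$ is locally $\lambda$-shift defective, then $f$ is weakly $\lambda$-subharmonic. (b) If $f\in\mathscr F_{\mathrm{loc}}(X)$ is weakly $\lambda$-subharmonic and locally bounded above, then $f$ is locally $\lambda$-shift defective.
   Context: Function spaces are real; inequalities between classes of functions hold $\mathfrak m$-a.e. A strongly local Dirichlet space is a quadruple $(X,\mathfrak m,\mathscr E,\mathscr F(X))$, where $X$ is a locally compact, separable, metrizable space, $\mathfrak m$ is a Radon measure on $X$ with full support, and $\mathscr E$ is a closed, symmetric, nonnegative bilinear form in $L^2(X,\mathfrak m)$ with dense domain $\mathscr F(X)$ such that: (Markov) for all contractions $T:\mathbb R\to\mathbb R$ with $T(0)=0$ and $f\in\mathscr F(X)$ one has $T\circ f\in\mathscr F(X)$ and $\mathscr E(T\circ f,T\circ f)\le\mathscr E(f,f)$; (regular) $\mathscr F(X)\cap C_c(X)$ is dense in $C_c(X)$ w.r.t. $\|\cdot\|_\infty$ and in $\mathscr F(X)$ w.r.t. $\mathscr E_1(u,v)=\mathscr E(u,v)+\int uv\,d\mathfrak m$; (strongly local) $\mathscr E(u,v)=0$ whenever $u,v\in\mathscr F(X)$ and $u$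 is constant on the support of $v$. For open $U,V\subset X$, $U\Subset V$ means that $\overline U$ is a compact subset of $X$ with $\overline U\subset V$. $\mathscr F_{\mathrm{loc}}(X)$ is the set of $f\in L^2_{\mathrm{loc}}(X,\mathfrak m)$ such that for every open $U\Subset X$ there is $h\in\mathscr F(X)$ with $f=h$ on $U$; $\mathscr F_c(X)$ is the set of elements of $\mathscr F(X)$ with compact $\mathfrak m$-support. $\mathscr E$ extends to $\mathscr F_{\mathrm{loc}}(X)\times\mathscr F_c(X)$ by $\mathscr E(f,\phi):=\mathscr E(h,\phi)$ with $h\in\mathscr F(X)$ equal to $f$ in an open neighbourhood of the support of $\phi$; $\mathscr E_\lambda(u,v):=\mathscr E(u,v)+\lambda\int uv\,d\mathfrak m$. A function $f\in\mathscr F_{\mathrm{loc}}(X)$ is weakly $\lambda$-subharmonic if $\mathscr E_\lambda(f,\phi)\le 0$ for all $0\le\phi\in\mathscr F_c(X)$, and weakly $\lambda$-harmonic if both $f$ and $-f$ are weakly $\lambda$-subharmonic. The prefix $\lambda$ is dropped if $\lambda=0$. $H\ge0$ is the self-adjoint operator in $L^2(X,\mathfrak m)$ induced by $\mathscr E$, and $P_t=e^{-tH}$, extended consistently to a positivity preserving contraction semigroup on all $L^q(X,\mathfrak m)$, $q\in[1,\infty]$. For open $U\subset X$, $\mathscr F(U)$ is the closure of $C_c(U)\cap\mathscr F(X)$ w.r.t. $\mathscr E_1$; then $(U,\mathfrak m,\mathscr E,\mathscr F(U))$ is again a strongly local Dirichlet space, with semigroup denoted $P^U_t$; notions "on $U$"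 refer to this space. For $f\in\mathscr F(X)\cap L^\infty$ the energy measure $\Gamma(f)$ is defined by $\int\phi\,d\Gamma(f)=\mathscr E(f,\phi f)-\frac12\mathscr E(f^2,\phi)$ for $\phi\in\mathscr F(X)\cap C_c(X)$; it extends to $\mathscr F(X)$ and, by locality, to $\mathscr F_{\mathrm{loc}}(X)$. The space is: ultracontractive if $P_t(L^1(X,\mathfrak m))\subset L^\infty(X,\mathfrak m)$ for all $t>0$; doubly Feller if $P_t:C_0(X)\to C_0(X)$ for all $t\ge0$, $P_t:L^\infty(X,\mathfrak m)\to C(X)$ for all $t>0$, and $\lim_{t\to0+}P_tf(x)=f(x)$ for all $f\in C_0(X)$, $x\in X$ ($C_0$ = continuous functions vanishing at infinity); irreducible if every $f\in\mathscr F_{\mathrm{loc}}(X)$ with $\Gamma(f)=0$ is constant. It is locally smoothing if for every open $U\Subset X$: $(U,\mathfrak m,\mathscr E,\mathscr F(U))$ is ultracontractive, and there is an open $U'\subset X$ with $U\subset U'$, $U'\setminus\overline U\ne\emptyset$, such that $(U',\mathfrak m,\mathscr E,\mathscr F(U'))$ is doubly Feller and irreducible. A function $f\in L^1_{\mathrm{loc}}(X,\mathfrak m)$ is locally $\lambda$-shift defective if for every open $U\Subset X$ there is a weakly $\lambda$-harmonic $g\in C_b(U)$ on $U$ with $e^{-t\lambda}P^U_t(f|_U-g)\ge f|_U-g$ for all $t>0$. *)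

theory Defs
  imports "HOL-Analysis.Analysis"
begin

text \<open>
  Elements of the spaces \<open>L\<^sup>q\<close> are represented by measurable functions \<open>'a \<Rightarrow> real\<close>; only their
  values on the underlying space matter, and all classes below are closed under a.e. equality.
\<close>

record 'a dirichlet =
  top_of :: "'a topology"
  msr :: "'a measure"
  frm :: "('a \<Rightarrow> real) \<Rightarrow> ('a \<Rightarrow> real) \<Rightarrow> real"
  fdom :: "('a \<Rightarrow> real) set"


section \<open>Function spaces\<close>

definition L1 :: "'a measure \<Rightarrow> ('a \<Rightarrow> real) set" where
  "L1 m = {f. integrable m f}"

definition L2 :: "'a measure \<Rightarrow> ('a \<Rightarrow> real) set" where
  "L2 m = {f \<in> borel_measurable m. integrable m (\<lambda>x. (f x)\<^sup>2)}"

definition Linf :: "'a measure \<Rightarrow> ('a \<Rightarrow> real) set" where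
  "Linf m = {f \<in> borel_measurable m. \<exists>C. AE x in m. \<bar>f x\<bar> \<le> C}"

definition L2norm :: "'a measure \<Rightarrow> ('a \<Rightarrow> real) \<Rightarrow> real" where
  "L2norm m f = sqrt (\<integral>x. (f x)\<^sup>2 \<partial>m)"

definition L1loc :: "'a topology \<Rightarrow> 'a measure \<Rightarrow> ('a \<Rightarrow> real) set" where
  "L1loc X m = {f \<in> borel_measurable m. \<forall>K. compactin X K \<longrightarrow> set_integrable m K f}"

definition L2loc :: "'a topology \<Rightarrow> 'a measure \<Rightarrow> ('a \<Rightarrow> real) set" where
  "L2loc X m = {f \<in> borel_measurable m. \<forall>K. compactin X K \<longrightarrow> set_integrable m K (\<lambda>x. (f x)\<^sup>2)}"

definition Linfloc :: "'a topology \<Rightarrow> 'a measure \<Rightarrow> ('a \<Rightarrow> real) set" where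
  "Linfloc X m = {f \<in> borel_measurable m.
     \<forall>K. compactin X K \<longrightarrow> (\<exists>C. AE x in m. x \<in> K \<longrightarrow> \<bar>f x\<bar> \<le> C)}"

definition locally_bounded_above :: "'a topology \<Rightarrow> 'a measure \<Rightarrow> ('a \<Rightarrow> real) \<Rightarrow> bool" where
  "locally_bounded_above X m f \<longleftrightarrow>
     (\<forall>x\<in>topspace X. \<exists>V C. openin X V \<and> x \<in> V \<and> (AE y in m. y \<in> V \<longrightarrow> f y \<le> C))"

definition Cont :: "'a topology \<Rightarrow> ('a \<Rightarrow> real) set" where
  "Cont X = {f. continuous_map X euclideanreal f}"

definition Cb :: "'a topology \<Rightarrow> ('a \<Rightarrow> real) set" where
  "Cb X = {f \<in> Cont X. \<exists>C. \<forall>x\<in>topspace X. \<bar>f x\<bar> \<le> C}"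

definition C0 :: "'a topology \<Rightarrow> ('a \<Rightarrow> real) set" where
  "C0 X = {f \<in> Cont X. \<forall>e>0. \<exists>K. compactin X K \<and> (\<forall>x\<in>topspace X - K. \<bar>f x\<bar> < e)}"

definition csupport :: "'a topology \<Rightarrow> ('a \<Rightarrow> real) \<Rightarrow> 'a set" where
  "csupport X f = X closure_of {x \<in> topspace X. f x \<noteq> 0}"

definition Cc :: "'a topology \<Rightarrow> ('a \<Rightarrow> real) set" where
  "Cc X = {f \<in> Cont X. compactin X (csupport X f)}"

definition msupport :: "'a topology \<Rightarrow> 'a measure \<Rightarrow> ('a \<Rightarrow> real) \<Rightarrow> 'a set" where
  "msupport X m f =
     topspace X - \<Union>{V. openin X V \<and> (AE x in m. x \<in> V \<longrightarrow> f x = 0)}"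

definition rel_compact_open :: "'a topology \<Rightarrow> 'a set \<Rightarrow> bool" where
  "rel_compact_open X U \<longleftrightarrow> openin X U \<and> compactin X (X closure_of U)"

definition radon_measure :: "'a topology \<Rightarrow> 'a measure \<Rightarrow> bool" where
  "radon_measure X m \<longleftrightarrow>
     space m = topspace X \<and>
     sets m = sigma_sets (topspace X) {U. openin X U} \<and>
     (\<forall>K. compactin X K \<longrightarrow> emeasure m K < \<infinity>) \<and>
     (\<forall>A\<in>sets m. emeasure m A = (SUP K\<in>{K. compactin X K \<and> K \<subseteq> A}. emeasure m K))"


section \<open>Strongly local Dirichlet spaces\<close>

definition form1 :: "'a dirichlet \<Rightarrow> ('a \<Rightarrow> real) \<Rightarrow> ('a \<Rightarrow> real) \<Rightarrow> real" where
  "form1 D u v = frm D u v + (\<integral>x. u x * v x \<partial>msr D)"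

definition norm1 :: "'a dirichlet \<Rightarrow> ('a \<Rightarrow> real) \<Rightarrow> real" where
  "norm1 D u = sqrt (form1 D u u)"

text \<open>The first two conditions say that the form and its domain live on a.e. classes.\<close>

definition symmetric_form :: "'a dirichlet \<Rightarrow> bool" where
  "symmetric_form D \<longleftrightarrow>
     (let m = msr D; F = fdom D; E = frm D in
       (\<forall>f\<in>F. \<forall>g\<in>borel_measurable m. (AE x in m. f x = g x) \<longrightarrow> g \<in> F) \<and>
       (\<forall>f\<in>F. \<forall>g\<in>F. \<forall>h\<in>F. (AE x in m. f x = g x) \<longrightarrow> E f h = E g h) \<and>
       F \<subseteq> L2 m \<and> (\<lambda>x. 0) \<in> F \<and>
       (\<forall>f\<in>F. \<forall>g\<in>F. (\<lambda>x. f x + g x) \<in> F) \<and>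
       (\<forall>f\<in>F. \<forall>c. (\<lambda>x. c * f x) \<in> F) \<and>
       (\<forall>f\<in>F. \<forall>g\<in>F. \<forall>h\<in>F. E (\<lambda>x. f x + g x) h = E f h + E g h) \<and>
       (\<forall>f\<in>F. \<forall>h\<in>F. \<forall>c. E (\<lambda>x. c * f x) h = c * E f h) \<and>
       (\<forall>f\<in>F. \<forall>g\<in>F. E f g = E g f) \<and>
       (\<forall>f\<in>F. 0 \<le> E f f))"

definition densely_defined_form :: "'a dirichlet \<Rightarrow> bool" where
  "densely_defined_form D \<longleftrightarrow>
     (\<forall>f\<in>L2 (msr D). \<forall>e>0. \<exists>g\<in>fdom D. L2norm (msr D) (\<lambda>x. f x - g x) < e)"

definition closed_form :: "'a dirichlet \<Rightarrow> bool" where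
  "closed_form D \<longleftrightarrow>
     (\<forall>u :: nat \<Rightarrow> 'a \<Rightarrow> real.
        (\<forall>n. u n \<in> fdom D) \<and>
        (\<forall>e>0. \<exists>N. \<forall>i\<ge>N. \<forall>j\<ge>N. norm1 D (\<lambda>x. u i x - u j x) < e) \<longrightarrow>
        (\<exists>f\<in>fdom D. (\<lambda>n. norm1 D (\<lambda>x. u n x - f x)) \<longlonglongrightarrow> 0))"

definition markov_form :: "'a dirichlet \<Rightarrow> bool" where
  "markov_form D \<longleftrightarrow>
     (\<forall>T :: real \<Rightarrow> real. (\<forall>s t. \<bar>T s - T t\<bar> \<le> \<bar>s - t\<bar>) \<and> T 0 = 0 \<longrightarrow>
        (\<forall>f\<in>fdom D. T \<circ> f \<in> fdom D \<and> frm D (T \<circ> f) (T \<circ> f) \<le> frm D f f))"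

definition regular_form :: "'a dirichlet \<Rightarrow> bool" where
  "regular_form D \<longleftrightarrow>
     (\<forall>f\<in>Cc (top_of D). \<forall>e>0. \<exists>g\<in>fdom D \<inter> Cc (top_of D).
        \<forall>x\<in>topspace (top_of D). \<bar>f x - g x\<bar> < e) \<and>
     (\<forall>f\<in>fdom D. \<forall>e>0. \<exists>g\<in>fdom D \<inter> Cc (top_of D). norm1 D (\<lambda>x. f x - g x) < e)"

definition strongly_local_form :: "'a dirichlet \<Rightarrow> bool" where
  "strongly_local_form D \<longleftrightarrow>
     (\<forall>u\<in>fdom D. \<forall>v\<in>fdom D.
        (\<exists>c. AE x in msr D. x \<in> msupport (top_of D) (msr D) v \<longrightarrow> u x = c) \<longrightarrow> frm D u v = 0)"

definition strongly_local_dirichlet_space :: "'a dirichlet \<Rightarrow> bool" where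
  "strongly_local_dirichlet_space D \<longleftrightarrow>
     locally_compact_space (top_of D) \<and> separable_space (top_of D) \<and> metrizable_space (top_of D) \<and>
     radon_measure (top_of D) (msr D) \<and>
     (\<forall>U. openin (top_of D) U \<and> U \<noteq> {} \<longrightarrow> emeasure (msr D) U > 0) \<and>
     symmetric_form D \<and> densely_defined_form D \<and> closed_form D \<and>
     markov_form D \<and> regular_form D \<and> strongly_local_form D"

text \<open>
  \<open>fdom_open D U\<close> is \<open>\<F>(U)\<close> as a set of functions on all of \<open>X\<close>; its elements vanish a.e. off \<open>U\<close>.
  \<open>restrict_dirichlet D U\<close> is the same space on \<open>U\<close>: a function on \<open>U\<close> is
  identified with its extension by zero.
\<close>

definition fdom_open :: "'a dirichlet \<Rightarrow> 'a set \<Rightarrow> ('a \<Rightarrow> real) set" where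
  "fdom_open D U = {f \<in> fdom D. \<forall>e>0. \<exists>g\<in>fdom D \<inter> Cc (top_of D).
     csupport (top_of D) g \<subseteq> U \<and> norm1 D (\<lambda>x. f x - g x) < e}"

definition restrict_dirichlet :: "'a dirichlet \<Rightarrow> 'a set \<Rightarrow> 'a dirichlet" where
  "restrict_dirichlet D U =
     \<lparr>top_of = subtopology (top_of D) U,
      msr = restrict_space (msr D) U,
      frm = (\<lambda>f g. frm D (\<lambda>x. indicator U x * f x) (\<lambda>x. indicator U x * g x)),
      fdom = {f. (\<lambda>x. indicator U x * f x) \<in> fdom_open D U}\<rparr>"


section \<open>Local domain and weakly subharmonic functions\<close>

definition Floc :: "'a dirichlet \<Rightarrow> ('a \<Rightarrow> real) set" where
  "Floc D = {f \<in> L2loc (top_of D) (msr D).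
     \<forall>U. rel_compact_open (top_of D) U \<longrightarrow>
       (\<exists>h\<in>fdom D. AE x in msr D. x \<in> U \<longrightarrow> f x = h x)}"

definition Fcomp :: "'a dirichlet \<Rightarrow> ('a \<Rightarrow> real) set" where
  "Fcomp D = {f \<in> fdom D. compactin (top_of D) (msupport (top_of D) (msr D) f)}"

text \<open>By strong locality the value below does not depend on \<open>h\<close> and \<open>V\<close>.\<close>

definition form_loc :: "'a dirichlet \<Rightarrow> ('a \<Rightarrow> real) \<Rightarrow> ('a \<Rightarrow> real) \<Rightarrow> real" where
  "form_loc D f \<phi> = (THE r. \<exists>h\<in>fdom D. \<exists>V. openin (top_of D) V \<and>
     msupport (top_of D) (msr D) \<phi> \<subseteq> V \<and>
     (AE x in msr D. x \<in> V \<longrightarrow> f x = h x) \<and> r = frm D h \<phi>)"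

definition weakly_subharmonic :: "real \<Rightarrow> 'a dirichlet \<Rightarrow> ('a \<Rightarrow> real) \<Rightarrow> bool" where
  "weakly_subharmonic lam D f \<longleftrightarrow> f \<in> Floc D \<and>
     (\<forall>\<phi>\<in>Fcomp D. (AE x in msr D. 0 \<le> \<phi> x) \<longrightarrow>
        form_loc D f \<phi> + lam * (\<integral>x. f x * \<phi> x \<partial>msr D) \<le> 0)"

definition weakly_harmonic :: "real \<Rightarrow> 'a dirichlet \<Rightarrow> ('a \<Rightarrow> real) \<Rightarrow> bool" where
  "weakly_harmonic lam D f \<longleftrightarrow>
     weakly_subharmonic lam D f \<and> weakly_subharmonic lam D (\<lambda>x. - f x)"


section \<open>The heat semigroup\<close>

text \<open>Graph of the self-adjoint operator \<open>H\<close> induced by the form.\<close>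

definition form_operator :: "'a dirichlet \<Rightarrow> (('a \<Rightarrow> real) \<times> ('a \<Rightarrow> real)) set" where
  "form_operator D = {(f, g). f \<in> fdom D \<and> g \<in> L2 (msr D) \<and>
     (\<forall>v\<in>fdom D. frm D f v = (\<integral>x. g x * v x \<partial>msr D))}"

definition C0_semigroup :: "'a measure \<Rightarrow> (real \<Rightarrow> ('a \<Rightarrow> real) \<Rightarrow> ('a \<Rightarrow> real)) \<Rightarrow> bool" where
  "C0_semigroup m P \<longleftrightarrow>
     (\<forall>t\<ge>0. \<forall>f\<in>L2 m. P t f \<in> L2 m) \<and>
     (\<forall>t\<ge>0. \<forall>f\<in>L2 m. \<forall>g\<in>L2 m. (AE x in m. f x = g x) \<longrightarrow> (AE x in m. P t f x = P t g x)) \<and>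
     (\<forall>t\<ge>0. \<forall>f\<in>L2 m. \<forall>g\<in>L2 m. AE x in m. P t (\<lambda>y. f y + g y) x = P t f x + P t g x) \<and>
     (\<forall>t\<ge>0. \<forall>f\<in>L2 m. \<forall>c. AE x in m. P t (\<lambda>y. c * f y) x = c * P t f x) \<and>
     (\<forall>t\<ge>0. \<exists>C. \<forall>f\<in>L2 m. L2norm m (P t f) \<le> C * L2norm m f) \<and>
     (\<forall>f\<in>L2 m. AE x in m. P 0 f x = f x) \<and>
     (\<forall>s\<ge>0. \<forall>t\<ge>0. \<forall>f\<in>L2 m. AE x in m. P (s + t) f x = P s (P t f) x) \<and>
     (\<forall>f\<in>L2 m. ((\<lambda>t. L2norm m (\<lambda>x. P t f x - f x)) \<longlongrightarrow> 0) (at_right 0))"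

definition generator ::
  "'a measure \<Rightarrow> (real \<Rightarrow> ('a \<Rightarrow> real) \<Rightarrow> ('a \<Rightarrow> real)) \<Rightarrow> (('a \<Rightarrow> real) \<times> ('a \<Rightarrow> real)) set" where
  "generator m P = {(f, g). f \<in> L2 m \<and> g \<in> L2 m \<and>
     ((\<lambda>t. L2norm m (\<lambda>x. (P t f x - f x) / t - g x)) \<longlongrightarrow> 0) (at_right 0)}"

text \<open>
  \<open>e\<^sup>-\<^sup>t\<^sup>H\<close> is the strongly continuous semigroup generated by \<open>-H\<close>, which determines it up to
  a.e. equality; \<open>SOME\<close> only chooses representatives.
\<close>

definition heat_L2 :: "'a dirichlet \<Rightarrow> real \<Rightarrow> ('a \<Rightarrow> real) \<Rightarrow> ('a \<Rightarrow> real)" where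
  "heat_L2 D = (SOME P. C0_semigroup (msr D) P \<and>
     generator (msr D) P = {(f, \<lambda>x. - g x) | f g. (f, g) \<in> form_operator D})"

text \<open>
  Simultaneous extension to all \<open>L\<^sup>q\<close>, \<open>1 \<le> q \<le> \<infinity>\<close>: for \<open>f \<ge> 0\<close> it is the monotone limit of the
  semigroup along any sequence in \<open>L\<^sup>2\<close> increasing to \<open>f\<close> (the limit does not depend on the
  sequence, the semigroup being positivity preserving). For \<open>q < \<infinity>\<close> this is the extension by
  density from \<open>L\<^sup>2 \<inter> L\<^sup>q\<close>; for \<open>q = \<infinity>\<close> it is the adjoint of the extension to \<open>L\<^sup>1\<close>.
\<close>

definition heat_pos_ext :: "'a dirichlet \<Rightarrow> real \<Rightarrow> ('a \<Rightarrow> real) \<Rightarrow> ('a \<Rightarrow> real) \<Rightarrow> bool" where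
  "heat_pos_ext D t f g \<longleftrightarrow> g \<in> borel_measurable (msr D) \<and>
     (\<exists>u :: nat \<Rightarrow> 'a \<Rightarrow> real.
        (\<forall>n. u n \<in> L2 (msr D)) \<and>
        (AE x in msr D. \<forall>n. 0 \<le> u n x \<and> u n x \<le> u (Suc n) x) \<and>
        (AE x in msr D. (\<lambda>n. u n x) \<longlonglongrightarrow> f x) \<and>
        (AE x in msr D. (\<lambda>n. heat_L2 D t (u n) x) \<longlonglongrightarrow> g x))"

definition heat :: "'a dirichlet \<Rightarrow> real \<Rightarrow> ('a \<Rightarrow> real) \<Rightarrow> ('a \<Rightarrow> real)" where
  "heat D t f = (SOME g. \<exists>p q. heat_pos_ext D t (\<lambda>x. max (f x) 0) p \<and>
     heat_pos_ext D t (\<lambda>x. max (- f x) 0) q \<and> g = (\<lambda>x. p x - q x))"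


section \<open>Energy measures\<close>

definition energy_measure_bdd :: "'a dirichlet \<Rightarrow> ('a \<Rightarrow> real) \<Rightarrow> 'a measure" where
  "energy_measure_bdd D f = (THE \<mu>. radon_measure (top_of D) \<mu> \<and>
     (\<forall>\<phi>\<in>fdom D \<inter> Cc (top_of D).
        (\<integral>x. \<phi> x \<partial>\<mu>) = frm D f (\<lambda>x. \<phi> x * f x) - 1/2 * frm D (\<lambda>x. (f x)\<^sup>2) \<phi>))"

text \<open>Continuous extension from bounded functions to the whole domain, setwise on Borel sets.\<close>

definition energy_measure_dom :: "'a dirichlet \<Rightarrow> ('a \<Rightarrow> real) \<Rightarrow> 'a measure" where
  "energy_measure_dom D f = (THE \<mu>. radon_measure (top_of D) \<mu> \<and>
     (\<forall>u :: nat \<Rightarrow> 'a \<Rightarrow> real.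
        (\<forall>n. u n \<in> fdom D \<inter> Linf (msr D)) \<and> (\<lambda>n. norm1 D (\<lambda>x. u n x - f x)) \<longlonglongrightarrow> 0 \<longrightarrow>
        (\<forall>A\<in>sets (msr D). (\<lambda>n. emeasure (energy_measure_bdd D (u n)) A) \<longlonglongrightarrow> emeasure \<mu> A)))"

definition energy_measure :: "'a dirichlet \<Rightarrow> ('a \<Rightarrow> real) \<Rightarrow> 'a measure" where
  "energy_measure D f = (THE \<mu>. radon_measure (top_of D) \<mu> \<and>
     (\<forall>U. rel_compact_open (top_of D) U \<longrightarrow>
        (\<forall>h\<in>fdom D. (AE x in msr D. x \<in> U \<longrightarrow> f x = h x) \<longrightarrow>
           (\<forall>A\<in>sets (msr D). A \<subseteq> U \<longrightarrow> emeasure \<mu> A = emeasure (energy_measure_dom D h) A))))"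


section \<open>Smoothing properties\<close>

definition ultracontractive :: "'a dirichlet \<Rightarrow> bool" where
  "ultracontractive D \<longleftrightarrow> (\<forall>t>0. \<forall>f\<in>L1 (msr D). heat D t f \<in> Linf (msr D))"

text \<open>
  In the first and third property \<open>u t\<close> is the continuous representative of \<open>P\<^sub>t f\<close>, which is unique
  since the measure has full support.
\<close>

definition doubly_feller :: "'a dirichlet \<Rightarrow> bool" where
  "doubly_feller D \<longleftrightarrow>
     (\<forall>f\<in>C0 (top_of D). \<exists>u :: real \<Rightarrow> 'a \<Rightarrow> real.
        (\<forall>t\<ge>0. u t \<in> C0 (top_of D) \<and> (AE x in msr D. heat D t f x = u t x)) \<and>
        (\<forall>x\<in>topspace (top_of D). ((\<lambda>t. u t x) \<longlongrightarrow> f x) (at_right 0))) \<and>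
     (\<forall>t>0. \<forall>f\<in>Linf (msr D). \<exists>g\<in>Cont (top_of D). AE x in msr D. heat D t f x = g x)"

definition irreducible_dirichlet :: "'a dirichlet \<Rightarrow> bool" where
  "irreducible_dirichlet D \<longleftrightarrow>
     (\<forall>f\<in>Floc D. energy_measure D f = null_measure (msr D) \<longrightarrow> (\<exists>c. AE x in msr D. f x = c))"

definition locally_smoothing :: "'a dirichlet \<Rightarrow> bool" where
  "locally_smoothing D \<longleftrightarrow>
     (\<forall>U. rel_compact_open (top_of D) U \<longrightarrow>
        ultracontractive (restrict_dirichlet D U) \<and>
        (\<exists>U'. openin (top_of D) U' \<and> U \<subseteq> U' \<and> U' - top_of D closure_of U \<noteq> {} \<and>
           doubly_feller (restrict_dirichlet D U') \<and>
           irreducible_dirichlet (restrict_dirichlet D U')))"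

definition locally_shift_defective :: "real \<Rightarrow> 'a dirichlet \<Rightarrow> ('a \<Rightarrow> real) \<Rightarrow> bool" where
  "locally_shift_defective lam D f \<longleftrightarrow> f \<in> L1loc (top_of D) (msr D) \<and>
     (\<forall>U. rel_compact_open (top_of D) U \<longrightarrow>
        (\<exists>g\<in>Cb (subtopology (top_of D) U).
           weakly_harmonic lam (restrict_dirichlet D U) g \<and>
           (\<forall>t>0. AE x in restrict_space (msr D) U.
              exp (- t * lam) * heat (restrict_dirichlet D U) t (\<lambda>y. f y - g y) x \<ge> f x - g x)))"

end

theory Submission
  imports Defs "HOL-Library.Function_Algebras"
begin

text \<open>
  Write \<open>R\<^sub>a = a (H + a)\<^sup>-\<^sup>1\<close>. By Laplace transform and Euler approximation, \<open>v \<le> e\<^sup>-\<^sup>\<lambda>\<^sup>t P\<^sub>t v\<close> for all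
  \<open>t > 0\<close> means \<open>a / (a - \<lambda>) v \<le> R\<^sub>a v\<close> for all \<open>a > \<lambda>\<close>, and the latter can be tested with the form.

  (a) For \<open>v = f - g \<le> C\<close> on \<open>U\<close> (such a \<open>C\<close> exists by ultracontractivity), \<open>s = C - v\<close> is almost excessive. Its
  truncations \<open>q = min s (k \<eta>)\<close> by multiples of a cutoff function lie in \<open>\<F>(U)\<close>, because the
  approximating forms \<open>a \<langle>q - R\<^sub>a q, q\<rangle>\<close> stay bounded, and \<open>\<E>(q, \<phi>) \<ge> \<lambda> \<integral> v \<phi>\<close>. By locality \<open>C\<close> drops out, and
  \<open>k\<close> tends to infinity.

  (b) Take \<open>g = M (1 - w)\<close>, where \<open>M\<close> bounds \<open>f\<close> and \<open>w\<close> is the potential of \<open>\<lambda>\<close> on \<open>U\<close>. The maximum principle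
  yields \<open>f \<le> g\<close> and then the resolvent inequality. That \<open>w\<close> is continuous is where the Feller property
  enters: near a point, \<open>w\<close> differs from a resolvent of a bounded function on \<open>U'\<close> by at most the
  resolvent of a barrier, which is the positive part of a difference of two potentials.
\<close>

text \<open>\<open>heat\<close> rests on a \<open>SOME\<close> over all strongly continuous
  semigroups with a prescribed generator, so nothing is known of it before such a semigroup is shown
  to exist and to be unique up to null functions. Hence the generation theorem at the start, for a
  merely semidefinite inner product, since vectors are functions and not classes. Limits in forms
  are taken by one device: bounded energy together with convergence in \<open>L2\<close>. In (a)
  truncation is forced because C - v need not vanish at the boundary of U; on the support of a test
  function, min (C - v) (C + n) and max v (-n) add up to C, which is why locality removes C. In (b)
  the Feller property speaks of U' only, and nothing is known about the boundary of U, so continuity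
  of w is decided by comparison on a small neighbourhood of each point. The comparison function must
  be small near the point for all short times at once, and bounded below on a surrounding compact
  set. The positive part of a difference of two potentials can vanish near a point, and under the
  semigroup it loses at most a multiple of t; the second property extends an estimate at one time to
  all earlier ones.\<close>

instantiation "fun" :: (type, real_vector) real_vector
begin

definition scaleR_fun :: "real \<Rightarrow> ('a \<Rightarrow> 'b) \<Rightarrow> 'a \<Rightarrow> 'b" where
  "scaleR_fun c f = (\<lambda>x. c *\<^sub>R f x)"

instance
  by standard (auto simp: scaleR_fun_def fun_eq_iff scaleR_add_left scaleR_add_right)

end

section \<open>Complete spaces with a semidefinite inner product\<close>

text \<open>The vectors will be functions that matter only almost everywhere, so the inner product
  is merely semidefinite, and equality of vectors is replaced throughout by
  \<open>nrm (x - y) = 0\<close>. A carrier \<open>V\<close> is kept because the functions in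
  question do not form a type.\<close>

locale semi_inner =
  fixes V :: "'v::real_vector set" and ip :: "'v \<Rightarrow> 'v \<Rightarrow> real"
  assumes zero_in [simp]: "0 \<in> V"
    and add_in [simp]: "x \<in> V \<Longrightarrow> y \<in> V \<Longrightarrow> x + y \<in> V"
    and scale_in [simp]: "x \<in> V \<Longrightarrow> c *\<^sub>R x \<in> V"
    and ip_sym: "x \<in> V \<Longrightarrow> y \<in> V \<Longrightarrow> ip x y = ip y x"
    and ip_add: "x \<in> V \<Longrightarrow> y \<in> V \<Longrightarrow> z \<in> V \<Longrightarrow> ip (x + y) z = ip x z + ip y z"
    and ip_scale: "x \<in> V \<Longrightarrow> z \<in> V \<Longrightarrow> ip (c *\<^sub>R x) z = c * ip x z"
    and ip_nonneg: "x \<in> V \<Longrightarrow> 0 \<le> ip x x"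
begin

definition nrm :: "'v \<Rightarrow> real" where "nrm x = sqrt (ip x x)"

lemma minus_in [simp]: "x \<in> V \<Longrightarrow> - x \<in> V"
  using scale_in[of x "-1"] by simp

lemma diff_in [simp]: "x \<in> V \<Longrightarrow> y \<in> V \<Longrightarrow> x - y \<in> V"
  using add_in[of x "-y"] by simp

lemma ip_minus: "x \<in> V \<Longrightarrow> z \<in> V \<Longrightarrow> ip (- x) z = - ip x z"
  using ip_scale[of x z "-1"] by simp

lemma ip_diff: "x \<in> V \<Longrightarrow> y \<in> V \<Longrightarrow> z \<in> V \<Longrightarrow> ip (x - y) z = ip x z - ip y z"
  using ip_add[of x "-y" z] by (simp add: ip_minus)

lemma ip_add_right: "x \<in> V \<Longrightarrow> y \<in> V \<Longrightarrow> z \<in> V \<Longrightarrow> ip z (x + y) = ip z x + ip z y"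
  by (simp add: ip_add ip_sym[of z])

lemma ip_diff_right: "x \<in> V \<Longrightarrow> y \<in> V \<Longrightarrow> z \<in> V \<Longrightarrow> ip z (x - y) = ip z x - ip z y"
  by (simp add: ip_diff ip_sym[of z])

lemma ip_scale_right: "x \<in> V \<Longrightarrow> z \<in> V \<Longrightarrow> ip z (c *\<^sub>R x) = c * ip z x"
  by (simp add: ip_scale ip_sym[of z])

lemma ip_minus_right: "x \<in> V \<Longrightarrow> z \<in> V \<Longrightarrow> ip z (- x) = - ip z x"
  by (simp add: ip_minus ip_sym[of z])

lemmas ip_simps = ip_add ip_diff ip_scale ip_minus ip_add_right ip_diff_right ip_scale_right
  ip_minus_right

lemma nrm_nonneg [simp]: "x \<in> V \<Longrightarrow> 0 \<le> nrm x"
  by (simp add: nrm_def ip_nonneg)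

lemma nrm_sq: "x \<in> V \<Longrightarrow> (nrm x)\<^sup>2 = ip x x"
  by (simp add: nrm_def ip_nonneg)

lemma ip_zero [simp]: "z \<in> V \<Longrightarrow> ip 0 z = 0"
  using ip_scale[of 0 z 0] by simp

lemma nrm_zero [simp]: "nrm 0 = 0"
  by (simp add: nrm_def)

lemma nrm_scale: "x \<in> V \<Longrightarrow> nrm (c *\<^sub>R x) = \<bar>c\<bar> * nrm x"
  by (simp add: nrm_def ip_simps real_sqrt_mult flip: mult.assoc power2_eq_square)

lemma nrm_minus: "x \<in> V \<Longrightarrow> nrm (- x) = nrm x"
  by (simp add: nrm_def ip_simps)

lemma nrm_diff_commute: "x \<in> V \<Longrightarrow> y \<in> V \<Longrightarrow> nrm (x - y) = nrm (y - x)"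
  using nrm_minus[of "x - y"] by simp

text \<open>The polynomial \<open>ip (x - r *\<^sub>R y) (x - r *\<^sub>R y)\<close> in r is
  nonnegative. Since \<open>ip y y = 0\<close> does not force y = 0, the degenerate case is a
  genuine one: there a nonnegative affine function of r must be constant.\<close>

lemma ip_cauchy_schwarz_sq:
  assumes x: "x \<in> V" and y: "y \<in> V"
  shows "(ip x y)\<^sup>2 \<le> ip x x * ip y y"
proof -
  define a where "a = ip x y"
  define b where "b = ip y y"
  define c where "c = ip x x"
  have yx: "ip y x = a" using assms by (simp add: a_def ip_sym)
  have q: "0 \<le> c - 2 * r * a + r\<^sup>2 * b" for r
    using ip_nonneg[of "x - r *\<^sub>R y"] x y yx
    by (simp add: ip_simps a_def[symmetric] b_def[symmetric] c_def[symmetric] power2_eq_square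
        algebra_simps)
  have "a\<^sup>2 \<le> c * b"
  proof (cases "b = 0")
    case True
    have "a = 0"
    proof (rule ccontr)
      assume "a \<noteq> 0"
      \<comment> \<open>At this r the affine function takes the value -1.\<close>
      then show False using q[of "(c + 1) / (2 * a)"] True by simp
    qed
    then show ?thesis using True by simp
  next
    case False
    then have "b > 0" using ip_nonneg[OF y] b_def by simp
    have "0 \<le> c - a\<^sup>2 / b"
      using q[of "a / b"] False by (simp add: power2_eq_square field_simps)
    then show ?thesis using \<open>b > 0\<close> by (simp add: field_simps)
  qed
  then show ?thesis by (simp add: a_def b_def c_def)
qed

lemma ip_cauchy_schwarz:
  assumes x: "x \<in> V" and y: "y \<in> V"
  shows "\<bar>ip x y\<bar> \<le> nrm x * nrm y"
proof -
  have "\<bar>ip x y\<bar> = sqrt ((ip x y)\<^sup>2)" by simp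
  also have "\<dots> \<le> sqrt (ip x x * ip y y)"
    using ip_cauchy_schwarz_sq[OF assms] by (rule real_sqrt_le_mono)
  finally show ?thesis by (simp add: nrm_def real_sqrt_mult)
qed

lemma nrm_triangle:
  assumes x: "x \<in> V" and y: "y \<in> V"
  shows "nrm (x + y) \<le> nrm x + nrm y"
proof (rule power2_le_imp_le)
  have "(nrm (x + y))\<^sup>2 = (nrm x)\<^sup>2 + 2 * ip x y + (nrm y)\<^sup>2"
    using x y by (simp add: nrm_sq ip_simps ip_sym[of y x])
  also have "\<dots> \<le> (nrm x + nrm y)\<^sup>2"
    using ip_cauchy_schwarz[OF x y] by (simp add: power2_sum)
  finally show "(nrm (x + y))\<^sup>2 \<le> (nrm x + nrm y)\<^sup>2" .
qed (use x y in simp)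

lemma nrm_triangle_diff:
  "x \<in> V \<Longrightarrow> y \<in> V \<Longrightarrow> z \<in> V \<Longrightarrow> nrm (x - z) \<le> nrm (x - y) + nrm (y - z)"
  using nrm_triangle[of "x - y" "y - z"] by simp

lemma nrm_triangle_sub: "x \<in> V \<Longrightarrow> y \<in> V \<Longrightarrow> nrm x \<le> nrm y + nrm (x - y)"
  using nrm_triangle[of y "x - y"] by simp

text \<open>Replaces substitution of equals: by Cauchy-Schwarz, \<open>ip\<close> does not see null
  vectors.\<close>

lemma nrm_null_ip:
  assumes "x \<in> V" "y \<in> V" "z \<in> V" "nrm (x - y) = 0"
  shows "ip x z = ip y z"
  using ip_cauchy_schwarz[of "x - y" z] assms by (simp add: ip_simps)

lemma nrm_null:
  assumes "x \<in> V" "y \<in> V" "nrm (x - y) = 0"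
  shows "nrm x = nrm y"
  using nrm_triangle_sub[of x y] nrm_triangle_sub[of y x] assms by (simp add: nrm_diff_commute)

lemma nrm_null_trans:
  assumes "x \<in> V" "y \<in> V" "z \<in> V" "nrm (x - y) = 0" "nrm (y - z) = 0"
  shows "nrm (x - z) = 0"
  using nrm_triangle_diff[of x y z] assms by (auto intro: antisym)

lemma nrm_tendsto:
  assumes "\<And>n. X n \<in> V" "x \<in> V" "((\<lambda>n. nrm (X n - x)) \<longlongrightarrow> 0) F"
  shows "((\<lambda>n. nrm (X n)) \<longlongrightarrow> nrm x) F"
proof (rule tendsto_sandwich)
  show "\<forall>\<^sub>F n in F. nrm x - nrm (X n - x) \<le> nrm (X n)"
    using nrm_triangle_sub[of x "X _"] assms
    by (intro always_eventually) (auto simp: nrm_diff_commute add.commute diff_le_eq)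
  show "\<forall>\<^sub>F n in F. nrm (X n) \<le> nrm x + nrm (X n - x)"
    using nrm_triangle_sub[of "X _" x] assms by (intro always_eventually) auto
  show "((\<lambda>n. nrm x - nrm (X n - x)) \<longlongrightarrow> nrm x) F"
    using tendsto_diff[OF tendsto_const assms(3), of "nrm x"] by simp
  show "((\<lambda>n. nrm x + nrm (X n - x)) \<longlongrightarrow> nrm x) F"
    using tendsto_add[OF tendsto_const assms(3), of "nrm x"] by simp
qed

lemma ip_tendsto:
  assumes "\<And>n. X n \<in> V" "x \<in> V" "y \<in> V" "((\<lambda>n. nrm (X n - x)) \<longlongrightarrow> 0) F"
  shows "((\<lambda>n. ip (X n) y) \<longlongrightarrow> ip x y) F"
proof -
  have "((\<lambda>n. ip (X n) y - ip x y) \<longlongrightarrow> 0) F"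
  proof (rule Lim_null_comparison)
    show "\<forall>\<^sub>F n in F. norm (ip (X n) y - ip x y) \<le> nrm (X n - x) * nrm y"
      using ip_cauchy_schwarz[of "X _ - x" y] assms
      by (intro always_eventually) (auto simp: ip_simps)
    show "((\<lambda>n. nrm (X n - x) * nrm y) \<longlongrightarrow> 0) F"
      using tendsto_mult_right[OF assms(4), of "nrm y"] by simp
  qed
  then show ?thesis by (simp add: LIM_zero_iff)
qed

lemma nrm_lim_unique:
  assumes "\<And>n::nat. X n \<in> V" "x \<in> V" "y \<in> V"
    "(\<lambda>n. nrm (X n - x)) \<longlonglongrightarrow> 0" "(\<lambda>n. nrm (X n - y)) \<longlonglongrightarrow> 0"
  shows "nrm (x - y) = 0"
proof -
  have "nrm (x - y) \<le> nrm (X n - x) + nrm (X n - y)" for n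
    using nrm_triangle_diff[of x "X n" y] assms by (simp add: nrm_diff_commute)
  moreover have "(\<lambda>n. nrm (X n - x) + nrm (X n - y)) \<longlonglongrightarrow> 0"
    using tendsto_add[OF assms(4,5)] by simp
  ultimately have "nrm (x - y) \<le> 0"
    by (intro LIMSEQ_le_const) auto
  then show ?thesis using assms by (simp add: antisym)
qed

end

locale semi_hilbert = semi_inner +
  assumes complete: "(\<And>n::nat. X n \<in> V) \<Longrightarrow> (\<And>e. e > 0 \<Longrightarrow> \<exists>N. \<forall>i\<ge>N. \<forall>j\<ge>N. nrm (X i - X j) < e) \<Longrightarrow>
    \<exists>x\<in>V. (\<lambda>n. nrm (X n - x)) \<longlonglongrightarrow> 0"
begin

text \<open>The shape of the bound is what the parallelogram law gives for a minimizing sequence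
  with slack 1/(n+1).\<close>

lemma Cauchy_of_sq_bound:
  assumes X: "\<And>n. X n \<in> V"
    and b: "\<And>i j. (nrm (X i - X j))\<^sup>2 \<le> C * (1 / Suc i + 1 / Suc j)"
    and e: "e > 0"
  shows "\<exists>N. \<forall>i\<ge>N. \<forall>j\<ge>N. nrm (X i - X j) < e"
proof -
  have "(\<lambda>n. \<bar>C\<bar> * (1 / Suc n + 1 / Suc n)) \<longlonglongrightarrow> \<bar>C\<bar> * (0 + 0)"
    by (intro tendsto_intros LIMSEQ_Suc lim_1_over_n)
  then have "\<forall>\<^sub>F n in sequentially. \<bar>C\<bar> * (1 / Suc n + 1 / Suc n) < e\<^sup>2"
    using e by (intro order_tendstoD) auto
  then obtain N where N: "\<bar>C\<bar> * (1 / Suc N + 1 / Suc N) < e\<^sup>2"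
    by (auto simp: eventually_sequentially)
  show ?thesis
  proof (intro exI[of _ N] allI impI)
    fix i j assume "i \<ge> N" "j \<ge> N"
    have "(nrm (X i - X j))\<^sup>2 \<le> C * (1 / Suc i + 1 / Suc j)" by (rule b)
    also have "\<dots> \<le> \<bar>C\<bar> * (1 / Suc i + 1 / Suc j)" by (intro mult_right_mono) auto
    also have "\<dots> \<le> \<bar>C\<bar> * (1 / Suc N + 1 / Suc N)"
      using \<open>i \<ge> N\<close> \<open>j \<ge> N\<close> by (intro mult_left_mono add_mono) (auto simp: field_simps)
    also have "\<dots> < e\<^sup>2" by (rule N)
    finally show "nrm (X i - X j) < e" using e by (simp add: power2_less_imp_less)
  qed
qed

text \<open>Minimizes \<open>ip v v - 2 * L v\<close>. A minimizing sequence is Cauchy by the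
  parallelogram law, and the vanishing of the first variation at its limit is the equation
  \<open>ip u w = L w\<close>.\<close>

lemma riesz:
  assumes L_add: "\<And>x y. x \<in> V \<Longrightarrow> y \<in> V \<Longrightarrow> L (x + y) = L x + L y"
    and L_scale: "\<And>x c. x \<in> V \<Longrightarrow> L (c *\<^sub>R x) = c * L x"
    and L_bdd: "\<And>x. x \<in> V \<Longrightarrow> \<bar>L x\<bar> \<le> C * nrm x"
  shows "\<exists>u\<in>V. \<forall>v\<in>V. ip u v = L v"
proof -
  have L_diff: "L (x - y) = L x - L y" if "x \<in> V" "y \<in> V" for x y
    using L_add[of x "(-1) *\<^sub>R y"] L_scale[of y "-1"] that by simp
  define q where "q v = ip v v - 2 * L v" for v
  have q_lower: "- (C\<^sup>2) \<le> q v" if "v \<in> V" for v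
  proof -
    have "L v \<le> C * nrm v" using L_bdd[OF that] by simp
    moreover have "0 \<le> (nrm v - C)\<^sup>2" by simp
    ultimately show ?thesis
      using nrm_sq[OF that] by (simp add: q_def power2_diff algebra_simps)
  qed
  define I where "I = Inf (q ` V)"
  have bdd: "bdd_below (q ` V)" using q_lower by (auto intro!: bdd_belowI)
  have I_le: "I \<le> q v" if "v \<in> V" for v
    unfolding I_def using bdd that by (intro cInf_lower) auto
  have "\<exists>v\<in>V. q v < I + 1 / Suc n" for n
    using cInf_lessD[of "q ` V" "I + 1 / Suc n"] zero_in by (fastforce simp: I_def)
  then obtain v where v: "\<And>n. v n \<in> V" "\<And>n. q (v n) < I + 1 / Suc n" by metis
  \<comment> \<open>Parallelogram law for q: the linear parts cancel because L is additive.\<close>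
  have par: "(nrm (x - y))\<^sup>2 = 2 * q x + 2 * q y - 4 * q ((1/2) *\<^sub>R (x + y))"
    if "x \<in> V" "y \<in> V" for x y
    using that by (simp add: nrm_sq q_def ip_simps L_add L_scale ip_sym[of y x] algebra_simps)
  have b: "(nrm (v i - v j))\<^sup>2 \<le> 2 * (1 / Suc i + 1 / Suc j)" for i j
    using par[OF v(1) v(1), of i j] v(2)[of i] v(2)[of j] I_le[of "(1/2) *\<^sub>R (v i + v j)"] v(1)
    by (simp add: algebra_simps)
  from complete[OF v(1) Cauchy_of_sq_bound[OF v(1) b]]
  obtain u where u: "u \<in> V" "(\<lambda>n. nrm (v n - u)) \<longlonglongrightarrow> 0" by auto
  have Lt: "(\<lambda>n. L (v n)) \<longlonglongrightarrow> L u"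
  proof -
    have "(\<lambda>n. L (v n) - L u) \<longlonglongrightarrow> 0"
    proof (rule Lim_null_comparison)
      show "\<forall>\<^sub>F n in sequentially. norm (L (v n) - L u) \<le> C * nrm (v n - u)"
        using L_bdd[of "v _ - u"] v(1) u(1) L_diff by (intro always_eventually) auto
      show "(\<lambda>n. C * nrm (v n - u)) \<longlonglongrightarrow> 0" using tendsto_mult_left[OF u(2), of C] by simp
    qed
    then show ?thesis by (simp add: LIM_zero_iff)
  qed
  have "(\<lambda>n. (nrm (v n))\<^sup>2 - 2 * L (v n)) \<longlonglongrightarrow> (nrm u)\<^sup>2 - 2 * L u"
    by (intro tendsto_intros nrm_tendsto Lt u v)
  then have qt: "(\<lambda>n. q (v n)) \<longlonglongrightarrow> q u" by (simp add: q_def nrm_sq u v)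
  have "(\<lambda>n. I + 1 / Suc n) \<longlonglongrightarrow> I + 0"
    by (intro tendsto_intros LIMSEQ_Suc lim_1_over_n)
  then have qu: "q u \<le> I"
    using v(2) by (intro LIMSEQ_le[OF qt, of "\<lambda>n. I + 1 / Suc n" I]) (auto intro: less_imp_le)
  have "ip u w = L w" if w: "w \<in> V" for w
  proof (rule ccontr)
    define a where "a = ip u w - L w"
    assume "ip u w \<noteq> L w"
    then have a: "a \<noteq> 0" by (simp add: a_def)
    define b where "b = ip w w"
    have b: "b \<ge> 0" using ip_nonneg[OF w] by (simp add: b_def)
    have "0 \<le> t\<^sup>2 * b + 2 * t * a" for t
      using I_le[of "u + t *\<^sub>R w"] qu u w
      by (simp add: q_def ip_simps L_add L_scale a_def b_def ip_sym[of w u] power2_eq_square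
          algebra_simps)
    then have 0: "0 \<le> (- r)\<^sup>2 * b + 2 * (- r) * a" for r by blast
    \<comment> \<open>Moving from u by -r times w changes q by
      \<open>r\<^sup>2 * b - 2 * r * a\<close>, which is \<open>- (r\<^sup>2 * (b + 2))\<close>
      because \<open>a = r * (b + 1)\<close>. The summand 1 keeps the quotient meaningful when w is
      null.\<close>
    define r where "r = a / (b + 1)"
    have "a = r * (b + 1)" using b by (simp add: r_def)
    then have "r\<^sup>2 * (b + 2) \<le> 0"
      using 0[of r] by (simp add: power2_eq_square algebra_simps)
    moreover have "r\<^sup>2 * (b + 2) > 0" using a b by (simp add: r_def)
    ultimately show False by simp
  qed
  then show ?thesis using u by auto
qed

end

section \<open>The semigroup generated by a monotone operator\<close>

text \<open>The cross term of the square is nonnegative. Applied to a pair of a monotone operator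
  this is the contraction property of its resolvent.\<close>

lemma (in semi_inner) nrm_le_of_ip_nonneg:
  assumes "d \<in> V" "e \<in> V" "0 \<le> ip d e" "0 \<le> t"
  shows "nrm d \<le> nrm (d + t *\<^sub>R e)"
proof (rule power2_le_imp_le)
  have "(nrm (d + t *\<^sub>R e))\<^sup>2 = (nrm d)\<^sup>2 + 2 * t * ip d e + t\<^sup>2 * (nrm e)\<^sup>2"
    using assms by (simp add: nrm_sq ip_simps ip_sym[of e d] algebra_simps)
      (simp add: power2_eq_square algebra_simps)
  then show "(nrm d)\<^sup>2 \<le> (nrm (d + t *\<^sub>R e))\<^sup>2" using assms by simp
qed (use assms in simp)

definition (in semi_inner) gen :: "(real \<Rightarrow> 'v \<Rightarrow> 'v) \<Rightarrow> ('v \<times> 'v) set" where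
  "gen P = {(x, y). x \<in> V \<and> y \<in> V \<and>
     ((\<lambda>t. nrm ((1 / t) *\<^sub>R (P t x - x) - y)) \<longlongrightarrow> 0) (at_right 0)}"

text \<open>A maximal monotone linear operator, given by its graph because its values are determined
  only up to null vectors; \<open>A_null\<close> says that the graph respects them.
  \<open>A_range\<close> is the solvability of u + t A u = f for every step size t, from which the
  semigroup is built by backward Euler steps.\<close>

locale monotone_op = semi_hilbert V ip
  for V :: "'v::real_vector set" and ip +
  fixes A :: "('v \<times> 'v) set"
  assumes A_sub: "(x, y) \<in> A \<Longrightarrow> x \<in> V \<and> y \<in> V"
    and A_add: "(x, y) \<in> A \<Longrightarrow> (x', y') \<in> A \<Longrightarrow> (x + x', y + y') \<in> A"
    and A_scale: "(x, y) \<in> A \<Longrightarrow> (c *\<^sub>R x, c *\<^sub>R y) \<in> A"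
    and A_null: "(x, y) \<in> A \<Longrightarrow> x' \<in> V \<Longrightarrow> y' \<in> V \<Longrightarrow> nrm (x' - x) = 0 \<Longrightarrow> nrm (y' - y) = 0 \<Longrightarrow>
      (x', y') \<in> A"
    and A_mono: "(x, y) \<in> A \<Longrightarrow> 0 \<le> ip x y"
    and A_range: "f \<in> V \<Longrightarrow> t > 0 \<Longrightarrow> \<exists>u. (u, (1 / t) *\<^sub>R (f - u)) \<in> A"
    and A_dense: "x \<in> V \<Longrightarrow> e > 0 \<Longrightarrow> \<exists>u g. (u, g) \<in> A \<and> nrm (x - u) < e"
begin

lemma A_in: "(x, y) \<in> A \<Longrightarrow> x \<in> V" "(x, y) \<in> A \<Longrightarrow> y \<in> V"
  using A_sub by auto

lemma A_diff: "(x, y) \<in> A \<Longrightarrow> (x', y') \<in> A \<Longrightarrow> (x - x', y - y') \<in> A"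
  using A_add[of x y "(-1) *\<^sub>R x'" "(-1) *\<^sub>R y'"] A_scale[of x' y' "-1"] by simp

lemma A_zero: "(0, 0) \<in> A"
  using A_range[of 0 1] A_scale[of _ _ 0] by fastforce

text \<open>One backward Euler step, the inverse of 1 + t A. The choice of a representative is
  arbitrary, so identities for \<open>J\<close> hold only up to null vectors. The value t = 0 is set
  apart because the defining relation degenerates there.\<close>

definition J :: "real \<Rightarrow> 'v \<Rightarrow> 'v" where
  "J t f = (if t = 0 then f else SOME u. (u, (1 / t) *\<^sub>R (f - u)) \<in> A)"

lemma J_zero [simp]: "J 0 f = f"
  by (simp add: J_def)

lemma J_zero_id: "J 0 = id"
  by (simp add: fun_eq_iff)

lemma J_in_A: "f \<in> V \<Longrightarrow> t > 0 \<Longrightarrow> (J t f, (1 / t) *\<^sub>R (f - J t f)) \<in> A"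
  using someI_ex[OF A_range[of f t]] by (simp add: J_def)

lemma J_in [simp]: "f \<in> V \<Longrightarrow> 0 \<le> t \<Longrightarrow> J t f \<in> V"
  using A_in(1)[OF J_in_A[of f t]] by (cases "t = 0") auto

text \<open>For a pair of A, x is itself the resolvent of x + t y, so this is the contraction
  property with the second right-hand side left explicit. Uniqueness, linearity and commutation of
  resolvents result from choosing f such that the bound is 0.\<close>

lemma nrm_J_diff:
  assumes "(x, y) \<in> A" "f \<in> V" "0 \<le> t"
  shows "nrm (J t f - x) \<le> nrm (f - x - t *\<^sub>R y)"
proof (cases "t = 0")
  case False
  define g where "g = (1 / t) *\<^sub>R (f - J t f)"
  have g: "(J t f, g) \<in> A" using J_in_A[of f t] assms False by (simp add: g_def)
  have eq: "f - x - t *\<^sub>R y = (J t f - x) + t *\<^sub>R (g - y)"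
    using False by (simp add: g_def scaleR_diff_right)
  show ?thesis unfolding eq
    using A_diff[OF g assms(1)] assms(3) by (intro nrm_le_of_ip_nonneg A_mono) (auto dest: A_in)
qed simp

lemma J_contr: "f \<in> V \<Longrightarrow> f' \<in> V \<Longrightarrow> 0 \<le> t \<Longrightarrow> nrm (J t f - J t f') \<le> nrm (f - f')"
  using nrm_J_diff[OF J_in_A, of f' t f t] by (cases "t = 0") auto

lemma nrm_J_le: "f \<in> V \<Longrightarrow> 0 \<le> t \<Longrightarrow> nrm (J t f) \<le> nrm f"
  using nrm_J_diff[OF A_zero, of f t] by simp

text \<open>Let g be the value of A at J t x. Linearity of the graph puts g = (x - J t x) / t into
  the domain with value (y - g) / t, which is the equation that defines J t y. Hence A commutes with
  its resolvent.\<close>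

lemma J_eq:
  assumes "(x, y) \<in> A" "0 \<le> t"
  shows "(J t x, J t y) \<in> A" "nrm (x - J t x - t *\<^sub>R J t y) = 0"
proof -
  note xy = A_in[OF assms(1)]
  have "(J t x, J t y) \<in> A \<and> nrm (x - J t x - t *\<^sub>R J t y) = 0"
  proof (cases "t = 0")
    case True
    then show ?thesis using assms by simp
  next
    case False
    define g where "g = (1 / t) *\<^sub>R (x - J t x)"
    have g: "(J t x, g) \<in> A" using J_in_A[of x t] assms False xy by (simp add: g_def)
    have xg: "x - J t x = t *\<^sub>R g" using False by (simp add: g_def)
    have "((1 / t) *\<^sub>R (x - J t x), (1 / t) *\<^sub>R (y - g)) \<in> A"
      by (intro A_scale A_diff assms g)
    then have "(g, (1 / t) *\<^sub>R (y - g)) \<in> A" by (simp add: g_def)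
    from nrm_J_diff[OF this xy(2) assms(2)] have "nrm (J t y - g) \<le> nrm 0"
      using False by simp
    then have 0: "nrm (J t y - g) = 0"
      using xy assms A_in[OF g] by (simp add: antisym)
    moreover have "x - J t x - t *\<^sub>R J t y = (- t) *\<^sub>R (J t y - g)"
      by (simp add: xg scaleR_diff_right)
    ultimately have "nrm (x - J t x - t *\<^sub>R J t y) = 0"
      using xy assms A_in[OF g] by (simp only: nrm_scale diff_in J_in)
    then show ?thesis using A_null[OF g, of "J t x" "J t y"] 0 xy assms by simp
  qed
  then show "(J t x, J t y) \<in> A" "nrm (x - J t x - t *\<^sub>R J t y) = 0" by auto
qed

lemma nrm_sub_J:
  assumes "(x, y) \<in> A" "0 \<le> t"
  shows "nrm (x - J t x) \<le> t * nrm y"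
proof -
  note xy = A_in[OF assms(1)]
  have "nrm (x - J t x) = nrm (t *\<^sub>R J t y)"
    using J_eq(2)[OF assms] xy assms by (intro nrm_null) auto
  also have "\<dots> \<le> t * nrm y"
    using xy assms nrm_J_le[of y t] by (simp add: nrm_scale mult_left_mono)
  finally show ?thesis .
qed

lemma J_linear:
  assumes "x \<in> V" "y \<in> V" "0 \<le> t"
  shows "nrm (J t (x + c *\<^sub>R y) - (J t x + c *\<^sub>R J t y)) = 0"
proof (cases "t = 0")
  case False
  have "(J t x + c *\<^sub>R J t y, (1 / t) *\<^sub>R (x - J t x) + c *\<^sub>R ((1 / t) *\<^sub>R (y - J t y))) \<in> A"
    using assms False by (intro A_add A_scale J_in_A) auto
  from nrm_J_diff[OF this, of "x + c *\<^sub>R y" t] assms False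
  have "nrm (J t (x + c *\<^sub>R y) - (J t x + c *\<^sub>R J t y)) \<le> nrm 0"
    by (simp add: algebra_simps scaleR_left_commute[of t])
  then show ?thesis using assms by (simp add: antisym)
qed (simp add: assms)

lemma J_commute:
  assumes "f \<in> V" "0 \<le> s" "0 \<le> t"
  shows "nrm (J s (J t f) - J t (J s f)) = 0"
proof (cases "t = 0")
  case False
  define u where "u = J t f"
  define g where "g = (1 / t) *\<^sub>R (f - u)"
  have ug: "(u, g) \<in> A" using J_in_A[of f t] assms False by (simp add: u_def g_def)
  note in_V = A_in[OF ug]
  have f: "f = u + t *\<^sub>R g" using False by (simp add: g_def)
  have "nrm (J t (J s f) - J s u) \<le> nrm (J s f - J s u - t *\<^sub>R J s g)"
    using assms in_V by (intro nrm_J_diff J_eq(1)[OF ug]) auto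
  also have "J s f - J s u - t *\<^sub>R J s g = J s (u + t *\<^sub>R g) - (J s u + t *\<^sub>R J s g)"
    using f by simp
  also have "nrm \<dots> = 0" using in_V assms by (intro J_linear) auto
  finally show ?thesis using assms in_V
    by (simp add: u_def[symmetric] nrm_diff_commute[of "J s u"] antisym)
qed (simp add: assms)

lemma J_pow_in [simp]: "f \<in> V \<Longrightarrow> 0 \<le> t \<Longrightarrow> (J t ^^ n) f \<in> V"
  by (induction n) auto

lemma J_pow_contr:
  "f \<in> V \<Longrightarrow> f' \<in> V \<Longrightarrow> 0 \<le> t \<Longrightarrow> nrm ((J t ^^ n) f - (J t ^^ n) f') \<le> nrm (f - f')"
proof (induction n)
  case (Suc n)
  then show ?case using J_contr[of "(J t ^^ n) f" "(J t ^^ n) f'" t] by simp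
qed simp

lemma J_pow_commute:
  assumes "f \<in> V" "0 \<le> s" "0 \<le> t"
  shows "nrm ((J s ^^ n) (J t f) - J t ((J s ^^ n) f)) = 0"
proof (induction n)
  case (Suc n)
  have "nrm (J s ((J s ^^ n) (J t f)) - J s (J t ((J s ^^ n) f))) \<le> 0"
    using J_contr[of "(J s ^^ n) (J t f)" "J t ((J s ^^ n) f)" s] Suc assms by simp
  then have "nrm (J s ((J s ^^ n) (J t f)) - J s (J t ((J s ^^ n) f))) = 0"
    using assms by (simp add: antisym)
  moreover have "nrm (J s (J t ((J s ^^ n) f)) - J t (J s ((J s ^^ n) f))) = 0"
    using assms by (intro J_commute) auto
  ultimately show ?case
    using assms nrm_null_trans[of "J s ((J s ^^ n) (J t f))" "J s (J t ((J s ^^ n) f))"] by simp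
qed (simp add: assms)

lemma comp_pow_Suc: "((a \<circ> b) ^^ Suc n) f = a (b (((a \<circ> b) ^^ n) f))"
  by simp

lemma pow_Suc_apply: "(a ^^ Suc n) f = a ((a ^^ n) f)"
  by simp

lemma JJ_pow_in [simp]: "f \<in> V \<Longrightarrow> 0 \<le> s \<Longrightarrow> 0 \<le> t \<Longrightarrow> ((J s \<circ> J t) ^^ n) f \<in> V"
  by (induction n) auto

lemma JJ_pow:
  assumes "f \<in> V" "0 \<le> s" "0 \<le> t"
  shows "nrm (((J s \<circ> J t) ^^ n) f - (J s ^^ n) ((J t ^^ n) f)) = 0"
proof (induction n)
  case (Suc n)
  let ?K = "((J s \<circ> J t) ^^ n) f" and ?L = "(J s ^^ n) ((J t ^^ n) f)"
  have in_V: "?K \<in> V" "?L \<in> V" using assms by auto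
  have "nrm (J s (J t ?K) - J s (J t ?L)) \<le> nrm (?K - ?L)"
    using J_contr[of "J t ?K" "J t ?L" s] J_contr[of ?K ?L t] in_V assms by simp
  then have 1: "nrm (J s (J t ?K) - J s (J t ?L)) = 0"
    using Suc in_V assms by (simp add: antisym)
  have "nrm (J s ((J s ^^ n) (J t ((J t ^^ n) f))) - J s (J t ?L)) \<le>
      nrm ((J s ^^ n) (J t ((J t ^^ n) f)) - J t ?L)"
    using in_V assms by (intro J_contr) auto
  also have "\<dots> = 0" using assms by (intro J_pow_commute) auto
  finally have 2: "nrm (J s (J t ?L) - J s ((J s ^^ n) (J t ((J t ^^ n) f)))) = 0"
    using in_V assms by (simp add: nrm_diff_commute[of "J s (J t ?L)"] antisym)
  have "nrm (J s (J t ?K) - J s ((J s ^^ n) (J t ((J t ^^ n) f)))) = 0"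
    using in_V assms by (intro nrm_null_trans[OF _ _ _ 1 2]) auto
  then show ?case
    by (simp only: comp_pow_Suc pow_Suc_apply[of _ "J s"] pow_Suc_apply[of _ "J t"])
qed (simp add: assms)

text \<open>The product of 1 + s A and 1 + t A exceeds 1 + (s + t) A by s t A^2. So one long step
  and two short ones differ to second order on the domain of A^2, and z is the value A^2 x.\<close>

lemma nrm_J_add_sub_JJ:
  assumes "(x, y) \<in> A" "(y, z) \<in> A" "0 \<le> s" "0 \<le> t"
  shows "nrm (J (s + t) x - J s (J t x)) \<le> s * t * nrm z"
proof -
  note in_V = A_in[OF assms(1)] A_in[OF assms(2)]
  note t = J_eq[OF assms(1,4)] and t' = J_eq[OF assms(2,4)]
  note s = J_eq[OF t(1) assms(3)]
  have "nrm (J (s + t) x - J s (J t x)) \<le> nrm (x - J s (J t x) - (s + t) *\<^sub>R J s (J t y))"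
    using assms in_V by (intro nrm_J_diff s(1)) auto
  also have "x - J s (J t x) - (s + t) *\<^sub>R J s (J t y) =
      (x - J t x - t *\<^sub>R J t y) + ((J t x - J s (J t x) - s *\<^sub>R J s (J t y)) +
        t *\<^sub>R (J t y - J s (J t y)))"
    by (simp add: algebra_simps)
  also have "nrm \<dots> \<le> nrm (x - J t x - t *\<^sub>R J t y) + (nrm (J t x - J s (J t x) - s *\<^sub>R J s (J t y)) +
        nrm (t *\<^sub>R (J t y - J s (J t y))))"
    using in_V assms by (intro order_trans[OF nrm_triangle] add_left_mono) auto
  also have "\<dots> = t * nrm (J t y - J s (J t y))"
    using t(2) s(2) in_V assms by (simp add: nrm_scale)
  also have "\<dots> \<le> t * (s * nrm (J t z))"
    using nrm_sub_J[OF t'(1) assms(3)] assms by (intro mult_left_mono) auto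
  also have "\<dots> \<le> t * (s * nrm z)"
    using nrm_J_le[of z t] in_V assms by (intro mult_left_mono) auto
  finally show ?thesis by (simp add: ac_simps)
qed

text \<open>The local errors just add up because each step is a contraction. The induction moves the
  starting point, hence the generalization over x, y, z: the image pairs stay in the graph and the
  norm of z only shrinks.\<close>

lemma nrm_J_add_pow:
  assumes "(x, y) \<in> A" "(y, z) \<in> A" "0 \<le> s" "0 \<le> t"
  shows "nrm ((J (s + t) ^^ n) x - ((J s \<circ> J t) ^^ n) x) \<le> n * (s * t) * nrm z"
  using assms(1,2)
proof (induction n arbitrary: x y z)
  case 0
  then show ?case by simp
next
  case (Suc n)
  note in_V = A_in[OF Suc.prems(1)] A_in[OF Suc.prems(2)]
  let ?K = "J s \<circ> J t"
  have K: "(?K x, ?K y) \<in> A" "(?K y, ?K z) \<in> A"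
    using J_eq(1)[OF J_eq(1)[OF Suc.prems(1)]] J_eq(1)[OF J_eq(1)[OF Suc.prems(2)]] assms by auto
  have "nrm ((J (s + t) ^^ Suc n) x - (?K ^^ Suc n) x) =
      nrm ((J (s + t) ^^ n) (J (s + t) x) - (?K ^^ n) (?K x))"
    by (simp only: funpow_Suc_right o_apply)
  also have "\<dots> \<le> nrm ((J (s + t) ^^ n) (J (s + t) x) - (J (s + t) ^^ n) (?K x)) +
      nrm ((J (s + t) ^^ n) (?K x) - (?K ^^ n) (?K x))"
    using in_V assms by (intro nrm_triangle_diff) auto
  also have "\<dots> \<le> s * t * nrm z + n * (s * t) * nrm (?K z)"
  proof (intro add_mono)
    show "nrm ((J (s + t) ^^ n) (J (s + t) x) - (J (s + t) ^^ n) (?K x)) \<le> s * t * nrm z"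
      using in_V assms
      by (intro order_trans[OF J_pow_contr order_trans[OF _ nrm_J_add_sub_JJ[OF Suc.prems]]]) auto
  qed (rule Suc.IH[OF K])
  also have "nrm (?K z) \<le> nrm z"
    using nrm_J_le[of "J t z" s] nrm_J_le[of z t] in_V assms by simp
  then have "s * t * nrm z + n * (s * t) * nrm (?K z) \<le> s * t * nrm z + n * (s * t) * nrm z"
    using assms by (intro add_left_mono mult_left_mono) auto
  also have "\<dots> = Suc n * (s * t) * nrm z" by (simp add: algebra_simps)
  finally show ?case .
qed

lemma nrm_J_pow_sub:
  assumes "(x, y) \<in> A" "0 \<le> t"
  shows "nrm ((J t ^^ n) x - x) \<le> n * t * nrm y"
  using assms(1)
proof (induction n)
  case (Suc n)
  note in_V = A_in[OF assms(1)]
  have "nrm ((J t ^^ Suc n) x - x) \<le> nrm ((J t ^^ n) (J t x) - (J t ^^ n) x) + nrm ((J t ^^ n) x - x)"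
    using in_V assms by (simp only: funpow_Suc_right o_apply) (intro nrm_triangle_diff, auto)
  also have "\<dots> \<le> t * nrm y + n * t * nrm y"
    using J_pow_contr[of "J t x" x t n] nrm_sub_J[OF assms] Suc in_V assms
    by (intro add_mono) (auto simp: nrm_diff_commute[of "J t x"])
  finally show ?case by (simp add: algebra_simps)
qed simp

lemma J_pow_linear:
  assumes "x \<in> V" "y \<in> V" "0 \<le> t"
  shows "nrm ((J t ^^ n) (x + c *\<^sub>R y) - ((J t ^^ n) x + c *\<^sub>R (J t ^^ n) y)) = 0"
proof (induction n)
  case (Suc n)
  let ?L = "(J t ^^ n) x + c *\<^sub>R (J t ^^ n) y"
  have "nrm (J t ((J t ^^ n) (x + c *\<^sub>R y)) - J t ?L) = 0"
    using J_contr[of "(J t ^^ n) (x + c *\<^sub>R y)" ?L t] Suc assms by (simp add: antisym)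
  moreover have "nrm (J t ?L - (J t ((J t ^^ n) x) + c *\<^sub>R J t ((J t ^^ n) y))) = 0"
    using assms by (intro J_linear) auto
  ultimately show ?case
    using assms nrm_null_trans[of "J t ((J t ^^ n) (x + c *\<^sub>R y))" "J t ?L"] by simp
qed (simp add: assms)

text \<open>Backward Euler with 2^k steps. Only powers of two occur, so that passing from k to k + 1
  halves every step and \<open>nrm_J_add_pow\<close> applies with equal halves.\<close>

definition eul :: "nat \<Rightarrow> real \<Rightarrow> 'v \<Rightarrow> 'v" where
  "eul k t x = (J (t / 2 ^ k) ^^ 2 ^ k) x"

lemma eul_in [simp]: "x \<in> V \<Longrightarrow> 0 \<le> t \<Longrightarrow> eul k t x \<in> V"
  by (simp add: eul_def)

lemma eul_contr: "x \<in> V \<Longrightarrow> y \<in> V \<Longrightarrow> 0 \<le> t \<Longrightarrow> nrm (eul k t x - eul k t y) \<le> nrm (x - y)"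
  by (simp add: eul_def J_pow_contr)

lemma nrm_eul_Suc:
  assumes "(x, y) \<in> A" "(y, z) \<in> A" "0 \<le> t"
  shows "nrm (eul k t x - eul (Suc k) t x) \<le> t\<^sup>2 / 4 / 2 ^ k * nrm z"
proof -
  define h where "h = t / 2 ^ Suc k"
  have h: "t / 2 ^ k = h + h" "0 \<le> h" using assms by (auto simp: h_def field_simps)
  have "eul (Suc k) t x = ((J h \<circ> J h) ^^ 2 ^ k) x"
    using funpow_mult[of "2 ^ k" 2 "J h"] by (simp add: eul_def h_def numeral_2_eq_2 ac_simps)
  moreover have "eul k t x = (J (h + h) ^^ 2 ^ k) x" by (simp add: eul_def h)
  ultimately have "nrm (eul k t x - eul (Suc k) t x) \<le> (2 ^ k) * (h * h) * nrm z"
    using nrm_J_add_pow[OF assms(1,2) h(2) h(2), of "2 ^ k"] by simp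
  also have "(2 ^ k) * (h * h) = t\<^sup>2 / 4 / 2 ^ k"
    by (simp add: h_def power2_eq_square field_simps)
  finally show ?thesis .
qed

lemma nrm_eul_add:
  assumes "(x, y) \<in> A" "(y, z) \<in> A" "0 \<le> t"
  shows "nrm (eul k t x - eul (k + p) t x) \<le> t\<^sup>2 / 2 / 2 ^ k * nrm z"
proof -
  \<comment> \<open>The partial sum of the geometric series has to be kept for the induction on
    p.\<close>
  have "nrm (eul k t x - eul (k + p) t x) \<le> t\<^sup>2 / 2 / 2 ^ k * (1 - 1 / 2 ^ p) * nrm z"
  proof (induction p)
    case (Suc p)
    note in_V = A_in[OF assms(1)]
    have "nrm (eul k t x - eul (k + Suc p) t x) \<le>
        nrm (eul k t x - eul (k + p) t x) + nrm (eul (k + p) t x - eul (Suc (k + p)) t x)"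
      using in_V assms nrm_triangle_diff[of "eul k t x" "eul (k + p) t x" "eul (k + Suc p) t x"]
      by simp
    also have "\<dots> \<le> t\<^sup>2 / 2 / 2 ^ k * (1 - 1 / 2 ^ p) * nrm z + t\<^sup>2 / 4 / 2 ^ (k + p) * nrm z"
      by (intro add_mono Suc nrm_eul_Suc[OF assms])
    also have "\<dots> = t\<^sup>2 / 2 / 2 ^ k * (1 - 1 / 2 ^ Suc p) * nrm z"
      by (simp add: power_add field_simps)
    finally show ?case .
  qed (use assms A_in in simp)
  also have "\<dots> \<le> t\<^sup>2 / 2 / 2 ^ k * 1 * nrm z"
    using A_in(2)[OF assms(2)] by (intro mult_right_mono mult_left_mono) auto
  finally show ?thesis by simp
qed

lemma J_approx:
  assumes "x \<in> V" "e > 0"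
  shows "\<exists>t>0. nrm (x - J t x) < e"
proof -
  obtain u g where ug: "(u, g) \<in> A" "nrm (x - u) < e / 4"
    using A_dense[of x "e / 4"] assms by auto
  note in_V = A_in[OF ug(1)]
  define t where "t = e / (4 * (nrm g + 1))"
  have t: "t > 0" using assms in_V by (simp add: t_def add_nonneg_pos)
  have "nrm (u - J t u) \<le> t * nrm g" using nrm_sub_J[OF ug(1)] t by simp
  also have "\<dots> \<le> t * (nrm g + 1)" using t by simp
  also have "\<dots> = e / 4"
    using nrm_nonneg[OF in_V(2)] by (simp add: t_def field_simps)
  finally have "nrm (u - J t u) \<le> e / 4" .
  moreover have "nrm (x - J t x) \<le> nrm (x - u) + (nrm (u - J t u) + nrm (J t u - J t x))"
    using in_V assms t
    by (intro order_trans[OF nrm_triangle_diff[of _ u]] add_left_mono nrm_triangle_diff) auto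
  moreover have "nrm (J t u - J t x) \<le> nrm (x - u)"
    using J_contr[of u x t] in_V assms t by (simp add: nrm_diff_commute)
  ultimately show ?thesis using ug t assms by (intro exI[of _ t]) auto
qed

text \<open>\<open>J t\<close> maps the domain of A into that of A^2 and tends to the identity as t
  tends to 0.\<close>

lemma A2_dense:
  assumes "x \<in> V" "e > 0"
  shows "\<exists>u v w. (u, v) \<in> A \<and> (v, w) \<in> A \<and> nrm (x - u) < e"
proof -
  obtain u g where ug: "(u, g) \<in> A" "nrm (x - u) < e / 2"
    using A_dense[of x "e / 2"] assms by auto
  note in_V = A_in[OF ug(1)]
  obtain t where t: "t > 0" "nrm (u - J t u) < e / 2" using J_approx[of u "e / 2"] in_V assms by auto
  then have "nrm (x - J t u) < e"
    using nrm_triangle_diff[of x u "J t u"] ug assms in_V by simp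
  then show ?thesis
    using J_eq(1)[OF ug(1), of t] J_in_A[of g t] t in_V by fastforce
qed

text \<open>On the domain of A^2 the refinements differ by the tail of a geometric series; by
  density and the contraction property the approximations are Cauchy for every x.\<close>

lemma eul_converges:
  assumes x: "x \<in> V" and t: "0 \<le> t"
  shows "\<exists>l\<in>V. (\<lambda>k. nrm (eul k t x - l)) \<longlonglongrightarrow> 0"
proof (rule complete)
  fix e :: real assume e: "e > 0"
  obtain u v w where u: "(u, v) \<in> A" "(v, w) \<in> A" "nrm (x - u) < e / 8"
    using A2_dense[of x "e / 8"] x e by auto
  note in_V = A_in[OF u(1)] A_in[OF u(2)]
  have "(\<lambda>k. t\<^sup>2 / 2 * nrm w / 2 ^ k) \<longlonglongrightarrow> 0"
    by (rule LIMSEQ_divide_realpow_zero) simp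
  from order_tendstoD(2)[OF this, of "e / 8"] e
  obtain N where "t\<^sup>2 / 2 * nrm w / 2 ^ N < e / 8" by (auto simp: eventually_sequentially)
  then have N: "t\<^sup>2 / 2 / 2 ^ N * nrm w < e / 8" by simp
  have *: "nrm (eul N t x - eul i t x) < e / 2" if "i \<ge> N" for i
  proof -
    have "nrm (eul N t x - eul i t x) \<le> nrm (eul N t x - eul N t u) + nrm (eul N t u - eul i t x)"
      using x t in_V by (intro nrm_triangle_diff) auto
    also have "nrm (eul N t u - eul i t x) \<le> nrm (eul N t u - eul i t u) + nrm (eul i t u - eul i t x)"
      using x t in_V by (intro nrm_triangle_diff) auto
    also have "nrm (eul N t u - eul i t u) < e / 8"
      using order_le_less_trans[OF nrm_eul_add[OF u(1,2) t, of N "i - N"] N] that by simp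
    also have "nrm (eul i t u - eul i t x) < e / 8"
      using eul_contr[of u x t i] u x t in_V by (simp add: nrm_diff_commute)
    also have "nrm (eul N t x - eul N t u) < e / 8"
      using eul_contr[of x u t N] u x t in_V by simp
    finally show ?thesis using e by simp
  qed
  show "\<exists>N. \<forall>i\<ge>N. \<forall>j\<ge>N. nrm (eul i t x - eul j t x) < e"
  proof (intro exI allI impI)
    fix i j assume "i \<ge> N" "j \<ge> N"
    have "nrm (eul i t x - eul j t x) \<le> nrm (eul i t x - eul N t x) + nrm (eul N t x - eul j t x)"
      using x t by (intro nrm_triangle_diff) auto
    then show "nrm (eul i t x - eul j t x) < e"
      using *[OF \<open>i \<ge> N\<close>] *[OF \<open>j \<ge> N\<close>] x t by (simp add: nrm_diff_commute)
  qed
qed (use assms in simp)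

definition S :: "real \<Rightarrow> 'v \<Rightarrow> 'v" where
  "S t x = (SOME l. l \<in> V \<and> (\<lambda>k. nrm (eul k t x - l)) \<longlonglongrightarrow> 0)"

lemma
  assumes "x \<in> V" "0 \<le> t"
  shows S_in [simp]: "S t x \<in> V"
    and S_lim: "(\<lambda>k. nrm (eul k t x - S t x)) \<longlonglongrightarrow> 0"
  using someI_ex[OF eul_converges[OF assms, unfolded Bex_def]] by (auto simp: S_def)

lemma S_le_of_eul_le:
  assumes "x \<in> V" "y \<in> V" "0 \<le> t" "\<And>k. nrm (eul k t x - y) \<le> c"
  shows "nrm (S t x - y) \<le> c"
proof -
  have "(\<lambda>k. nrm (eul k t x - y)) \<longlonglongrightarrow> nrm (S t x - y)"
    using S_lim[of x t] assms by (intro nrm_tendsto) auto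
  then show ?thesis using assms(4) by (intro LIMSEQ_le_const2) auto
qed

lemma nrm_S_le:
  assumes "x \<in> V" "0 \<le> t"
  shows "nrm (S t x) \<le> nrm x"
proof -
  have "nrm ((J s ^^ n) x) \<le> nrm x" if "0 \<le> s" for s n
    using that assms by (induction n) (auto intro: order_trans[OF nrm_J_le])
  then show ?thesis using S_le_of_eul_le[OF assms(1) zero_in assms(2), of "nrm x"] assms by (simp add: eul_def)
qed

lemma S_linear:
  assumes "x \<in> V" "y \<in> V" "0 \<le> t"
  shows "nrm (S t (x + c *\<^sub>R y) - (S t x + c *\<^sub>R S t y)) = 0"
proof (rule nrm_lim_unique)
  show "(\<lambda>k. nrm (eul k t (x + c *\<^sub>R y) - S t (x + c *\<^sub>R y))) \<longlonglongrightarrow> 0"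
    using assms by (intro S_lim) auto
  show "(\<lambda>k. nrm (eul k t (x + c *\<^sub>R y) - (S t x + c *\<^sub>R S t y))) \<longlonglongrightarrow> 0"
  proof (rule Lim_null_comparison)
    show "\<forall>\<^sub>F k in sequentially. norm (nrm (eul k t (x + c *\<^sub>R y) - (S t x + c *\<^sub>R S t y))) \<le>
        nrm (eul k t x - S t x) + \<bar>c\<bar> * nrm (eul k t y - S t y)"
    proof (intro always_eventually allI)
      fix k
      have "nrm (eul k t (x + c *\<^sub>R y) - (S t x + c *\<^sub>R S t y)) \<le>
          nrm (eul k t (x + c *\<^sub>R y) - (eul k t x + c *\<^sub>R eul k t y)) +
          nrm ((eul k t x + c *\<^sub>R eul k t y) - (S t x + c *\<^sub>R S t y))"
        using assms by (intro nrm_triangle_diff) auto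
      also have "nrm (eul k t (x + c *\<^sub>R y) - (eul k t x + c *\<^sub>R eul k t y)) = 0"
        using J_pow_linear assms by (simp add: eul_def)
      also have "(eul k t x + c *\<^sub>R eul k t y) - (S t x + c *\<^sub>R S t y) =
          (eul k t x - S t x) + c *\<^sub>R (eul k t y - S t y)"
        by (simp add: algebra_simps)
      also have "nrm \<dots> \<le> nrm (eul k t x - S t x) + nrm (c *\<^sub>R (eul k t y - S t y))"
        using assms by (intro nrm_triangle) auto
      finally show "norm (nrm (eul k t (x + c *\<^sub>R y) - (S t x + c *\<^sub>R S t y))) \<le>
        nrm (eul k t x - S t x) + \<bar>c\<bar> * nrm (eul k t y - S t y)"
        using assms by (simp add: nrm_scale)
    qed
    show "(\<lambda>k. nrm (eul k t x - S t x) + \<bar>c\<bar> * nrm (eul k t y - S t y)) \<longlonglongrightarrow> 0"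
      using tendsto_add[OF S_lim tendsto_mult_right_zero[OF S_lim], of x t y t "\<bar>c\<bar>"] assms
      by simp
  qed
qed (use assms in simp_all)

lemma S_contr:
  assumes "x \<in> V" "y \<in> V" "0 \<le> t"
  shows "nrm (S t x - S t y) \<le> nrm (x - y)"
proof -
  have "nrm (S t (x - y)) = nrm (S t x - S t y)"
    using S_linear[OF assms, of "-1"] assms by (intro nrm_null) auto
  then show ?thesis using nrm_S_le[of "x - y" t] assms by simp
qed

lemma S_null: "x \<in> V \<Longrightarrow> y \<in> V \<Longrightarrow> 0 \<le> t \<Longrightarrow> nrm (x - y) = 0 \<Longrightarrow> nrm (S t x - S t y) = 0"
  using S_contr[of x y t] by (simp add: antisym)

lemma S_zero: "x \<in> V \<Longrightarrow> nrm (S 0 x - x) = 0"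
  using S_lim[of x 0]
  by (intro nrm_lim_unique[of "\<lambda>k. x"]) (auto simp: eul_def J_zero_id nrm_diff_commute)

text \<open>A single backward step is the approximation with k = 0, so its distance to the limit is
  the whole geometric series.\<close>

lemma S_J_diff:
  assumes "(x, y) \<in> A" "(y, z) \<in> A" "0 \<le> t"
  shows "nrm (S t x - J t x) \<le> t\<^sup>2 / 2 * nrm z"
proof (rule LIMSEQ_le_const2)
  note in_V = A_in[OF assms(1)]
  have "(\<lambda>k. nrm (eul k t x - J t x)) \<longlonglongrightarrow> nrm (S t x - J t x)"
    using S_lim[of x t] assms in_V by (intro nrm_tendsto) auto
  then show "(\<lambda>k. nrm (eul k t x - J t x)) \<longlonglongrightarrow> nrm (S t x - J t x)" .
  show "\<exists>N. \<forall>k\<ge>N. nrm (eul k t x - J t x) \<le> t\<^sup>2 / 2 * nrm z"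
    using nrm_eul_add[OF assms, of 0] in_V assms
    by (auto simp: eul_def[of 0] nrm_diff_commute[of "J t x"])
qed

lemma S_sub:
  assumes "(x, y) \<in> A" "0 \<le> t"
  shows "nrm (S t x - x) \<le> t * nrm y"
proof (rule S_le_of_eul_le)
  show "nrm (eul k t x - x) \<le> t * nrm y" for k
    using nrm_J_pow_sub[OF assms(1), of "t / 2 ^ k" "2 ^ k"] assms by (simp add: eul_def)
qed (use A_in[OF assms(1)] assms in auto)

text \<open>Compared through the discrete schemes: 2^k steps of length (s + t) / 2^k against 2^k
  pairs of steps of lengths s / 2^k and t / 2^k, which commute and can be sorted. On the domain of
  A^2 the error is s t |A^2 u| / 2^k, and that domain is dense.\<close>

lemma S_add:
  assumes x: "x \<in> V" and s: "0 \<le> s" and t: "0 \<le> t"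
  shows "nrm (S (s + t) x - S s (S t x)) = 0"
proof (rule ccontr)
  assume "nrm (S (s + t) x - S s (S t x)) \<noteq> 0"
  then have e: "nrm (S (s + t) x - S s (S t x)) > 0" (is "?e > 0")
    using x s t nrm_nonneg[of "S (s + t) x - S s (S t x)"] by (simp del: nrm_nonneg)
  obtain u v w where u: "(u, v) \<in> A" "(v, w) \<in> A" "nrm (x - u) < ?e / 2"
    using A2_dense[of x "?e / 2"] x e by auto
  note in_V = A_in[OF u(1)] A_in[OF u(2)]
  have "nrm (S (s + t) u - S s (S t u)) = 0"
  proof (rule nrm_lim_unique)
    show "(\<lambda>k. nrm (eul k (s + t) u - S (s + t) u)) \<longlonglongrightarrow> 0"
      using in_V s t by (intro S_lim) auto
    show "(\<lambda>k. nrm (eul k (s + t) u - S s (S t u))) \<longlonglongrightarrow> 0"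
    proof (rule Lim_null_comparison)
      show "\<forall>\<^sub>F k in sequentially. norm (nrm (eul k (s + t) u - S s (S t u))) \<le>
         s * t * nrm w / 2 ^ k + (nrm (eul k t u - S t u) + nrm (eul k s (S t u) - S s (S t u)))"
      proof (intro always_eventually allI)
        fix k
        let ?s = "s / 2 ^ k" and ?t = "t / 2 ^ k"
        let ?JJ = "((J ?s \<circ> J ?t) ^^ 2 ^ k) u"
        have st: "(s + t) / 2 ^ k = ?s + ?t" "0 \<le> ?s" "0 \<le> ?t" using s t by (auto simp: field_simps)
        have "nrm (eul k (s + t) u - S s (S t u)) \<le>
          nrm (eul k (s + t) u - ?JJ) + (nrm (?JJ - eul k s (eul k t u)) +
            (nrm (eul k s (eul k t u) - eul k s (S t u)) + nrm (eul k s (S t u) - S s (S t u))))"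
          using in_V s t st
          by (intro order_trans[OF nrm_triangle_diff[of _ ?JJ]] add_left_mono
            order_trans[OF nrm_triangle_diff[of _ "eul k s (eul k t u)"]]
            nrm_triangle_diff) auto
        also have "nrm (?JJ - eul k s (eul k t u)) = 0"
          using JJ_pow[OF in_V(1) st(2,3)] by (simp add: eul_def)
        also have "nrm (eul k (s + t) u - ?JJ) \<le> 2 ^ k * (?s * ?t) * nrm w"
          using nrm_J_add_pow[OF u(1,2) st(2,3), of "2 ^ k"] by (simp add: eul_def st(1))
        also have "2 ^ k * (?s * ?t) * nrm w = s * t * nrm w / 2 ^ k" by simp
        also have "nrm (eul k s (eul k t u) - eul k s (S t u)) \<le> nrm (eul k t u - S t u)"
          using in_V s t by (intro eul_contr) auto
        finally show "norm (nrm (eul k (s + t) u - S s (S t u))) \<le>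
         s * t * nrm w / 2 ^ k + (nrm (eul k t u - S t u) + nrm (eul k s (S t u) - S s (S t u)))"
          using in_V s t by simp
      qed
      have "(\<lambda>k. s * t * nrm w / 2 ^ k) \<longlonglongrightarrow> 0"
        by (rule LIMSEQ_divide_realpow_zero) simp
      then have "(\<lambda>k. s * t * nrm w / 2 ^ k +
          (nrm (eul k t u - S t u) + nrm (eul k s (S t u) - S s (S t u)))) \<longlonglongrightarrow> 0 + (0 + 0)"
        using in_V s t by (intro tendsto_intros S_lim) auto
      then show "(\<lambda>k. s * t * nrm w / 2 ^ k +
          (nrm (eul k t u - S t u) + nrm (eul k s (S t u) - S s (S t u)))) \<longlonglongrightarrow> 0" by simp
    qed
  qed (use in_V s t in auto)
  moreover have "?e \<le> nrm (S (s + t) x - S (s + t) u) + (nrm (S (s + t) u - S s (S t u)) +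
      nrm (S s (S t u) - S s (S t x)))"
    using in_V x s t
    by (intro order_trans[OF nrm_triangle_diff[of _ "S (s + t) u"]] add_left_mono
        nrm_triangle_diff) auto
  moreover have "nrm (S (s + t) x - S (s + t) u) \<le> nrm (x - u)"
    using in_V x s t by (intro S_contr) auto
  moreover have "nrm (S s (S t u) - S s (S t x)) \<le> nrm (u - x)"
    using S_contr[of "S t u" "S t x" s] S_contr[of u x t] in_V x s t by simp
  ultimately show False using u(3) nrm_diff_commute[of u x] in_V x by linarith
qed

lemma S_cont_zero:
  assumes x: "x \<in> V"
  shows "((\<lambda>t. nrm (S t x - x)) \<longlongrightarrow> 0) (at_right 0)"
proof (rule tendstoI)
  fix e :: real assume e: "e > 0"
  obtain u g where u: "(u, g) \<in> A" "nrm (x - u) < e / 4"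
    using A_dense[of x "e / 4"] x e by auto
  note in_V = A_in[OF u(1)]
  have "nrm (S t x - x) < e" if "0 < t" "t < e / (4 * (nrm g + 1))" for t
  proof -
    have "t * nrm g \<le> t * (nrm g + 1)" using that by simp
    also have "\<dots> < e / 4"
      using that in_V nrm_nonneg[OF in_V(2)] by (simp add: field_simps del: nrm_nonneg)
    finally have "t * nrm g < e / 4" .
    moreover have "nrm (S t x - x) \<le> nrm (S t x - S t u) + (nrm (S t u - u) + nrm (u - x))"
      using in_V x that
      by (intro order_trans[OF nrm_triangle_diff[of _ "S t u"]] add_left_mono
        nrm_triangle_diff) auto
    moreover have "nrm (S t x - S t u) \<le> nrm (x - u)" "nrm (S t u - u) \<le> t * nrm g"
      using S_contr[of x u t] S_sub[OF u(1), of t] in_V x that by auto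
    ultimately show ?thesis
      using u(2) nrm_diff_commute[of u x] in_V x e by linarith
  qed
  moreover have "e / (4 * (nrm g + 1)) > 0" using e in_V by (simp add: add_nonneg_pos)
  ultimately have "\<forall>\<^sub>F t in at_right 0. nrm (S t x - x) < e"
    unfolding eventually_at_right_field by blast
  then have "\<forall>\<^sub>F t in at_right 0. nrm (S t x - x) < e \<and> 0 < t"
    by (intro eventually_conj eventually_at_right_less)
  then show "\<forall>\<^sub>F t in at_right 0. dist (nrm (S t x - x)) 0 < e"
    by eventually_elim (use x in simp)
qed

end

section \<open>The generator of the constructed semigroup\<close>

lemma (in semi_inner) gen_in: "(x, y) \<in> gen P \<Longrightarrow> x \<in> V" "(x, y) \<in> gen P \<Longrightarrow> y \<in> V"
  by (auto simp: gen_def)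

lemma (in semi_inner) nrm_triangle_minus:
  "x \<in> V \<Longrightarrow> y \<in> V \<Longrightarrow> nrm (x - y) \<le> nrm x + nrm y"
  using nrm_triangle[of x "- y"] by (simp add: nrm_minus)

lemma (in semi_inner) nrm_quotient_le:
  "z \<in> V \<Longrightarrow> 0 < t \<Longrightarrow> nrm z \<le> t * c \<Longrightarrow> nrm ((1 / t) *\<^sub>R z) \<le> c"
  by (simp add: nrm_scale field_simps)

lemma (in semi_inner) genD:
  assumes "(x, y) \<in> gen P" "e > 0"
  shows "\<exists>d>0. \<forall>t. 0 < t \<and> t < d \<longrightarrow> nrm ((1 / t) *\<^sub>R (P t x - x) - y) < e"
proof -
  have "\<forall>\<^sub>F t in at_right 0. dist (nrm ((1 / t) *\<^sub>R (P t x - x) - y)) 0 < e"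
    using assms by (intro tendstoD) (auto simp: gen_def)
  then show ?thesis unfolding eventually_at_right_field by fastforce
qed

lemma (in semi_inner) genI:
  assumes "x \<in> V" "y \<in> V" "\<And>t. 0 \<le> t \<Longrightarrow> P t x \<in> V"
    and "\<And>e. e > 0 \<Longrightarrow> \<exists>d>0. \<forall>t. 0 < t \<and> t < d \<longrightarrow> nrm ((1 / t) *\<^sub>R (P t x - x) - y) < e"
  shows "(x, y) \<in> gen P"
proof -
  have "((\<lambda>t. nrm ((1 / t) *\<^sub>R (P t x - x) - y)) \<longlongrightarrow> 0) (at_right 0)"
  proof (rule tendstoI)
    fix e :: real assume "e > 0"
    from assms(4)[OF this] obtain d where "d > 0"
      "\<And>t. 0 < t \<Longrightarrow> t < d \<Longrightarrow> nrm ((1 / t) *\<^sub>R (P t x - x) - y) < e" by auto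
    then show "\<forall>\<^sub>F t in at_right 0. dist (nrm ((1 / t) *\<^sub>R (P t x - x) - y)) 0 < e"
      unfolding eventually_at_right_field using assms(1-3) by (intro exI[of _ d]) auto
  qed
  then show ?thesis using assms by (simp add: gen_def)
qed

context monotone_op
begin

text \<open>The quadratic bound \<open>S_J_diff\<close> needs the domain of A^2, whereas x lies only
  in that of A. So x is replaced by u = J r x. The difference quotient of the remainder x - u is
  bounded by the norm of y - v through \<open>S_sub\<close>, uniformly in t, so r can be fixed
  before t tends to 0.\<close>

lemma A_imp_gen:
  assumes xy: "(x, y) \<in> A"
  shows "(x, - y) \<in> gen S"
proof (rule genI)
  note in_V = A_in[OF xy]
  show "x \<in> V" "- y \<in> V" "\<And>t. 0 \<le> t \<Longrightarrow> S t x \<in> V" using in_V by auto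
  fix e :: real assume e: "e > 0"
  obtain r where r: "r > 0" "nrm (y - J r y) < e / 4"
    using J_approx[of y "e / 4"] in_V e by auto
  define u v w where "u = J r x" "v = J r y" "w = (1 / r) *\<^sub>R (y - J r y)"
  have uv: "(u, v) \<in> A" using J_eq(1)[OF xy, of r] r by (simp add: u_v_w_def)
  have vw: "(v, w) \<in> A" using J_in_A[of y r] r in_V by (simp add: u_v_w_def)
  note in_V = in_V A_in[OF uv] A_in[OF vw]
  define d where "d = e / (4 * (nrm w + 1))"
  have d: "d > 0" using e in_V by (simp add: d_def add_nonneg_pos)
  have "nrm ((1 / t) *\<^sub>R (S t x - x) - - y) < e" if t: "0 < t" "t < d" for t
  proof -
    \<comment> \<open>\<open>?a\<close> and \<open>?f\<close> are null vectors; they record that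
      linearity of \<open>S t\<close> and the resolvent equation hold only up to null
      vectors.\<close>
    let ?a = "(1 / t) *\<^sub>R (S t x - (S t (x - u) + 1 *\<^sub>R S t u))"
    let ?b = "(1 / t) *\<^sub>R (S t (x - u) - (x - u))"
    let ?c = "(1 / t) *\<^sub>R (S t u - J t u)"
    let ?f = "(- 1 / t) *\<^sub>R (u - J t u - t *\<^sub>R J t v)"
    have eq: "(1 / t) *\<^sub>R (S t x - x) - - y = ?a + (?b + (?c + (?f + ((v - J t v) + (y - v)))))"
      using t by (simp add: algebra_simps)
    have "nrm (x - u + 1 *\<^sub>R u - x) = 0" by simp
    have a: "nrm ?a = 0"
      using S_linear[of "x - u" u t 1] in_V t by (simp add: nrm_scale)
    have b: "nrm ?b \<le> nrm (y - v)"
      using S_sub[OF A_diff[OF xy uv], of t] in_V t by (intro nrm_quotient_le) auto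
    have c: "nrm ?c \<le> t / 2 * nrm w"
      using S_J_diff[OF uv vw, of t] in_V t
      by (intro nrm_quotient_le) (auto simp: power2_eq_square)
    have "nrm (u - J t u - t *\<^sub>R J t v) = 0" using t by (intro J_eq(2)[OF uv]) simp
    then have f: "nrm ?f = 0" using in_V t by (subst nrm_scale) auto
    have g: "nrm (v - J t v) \<le> t * nrm w" using nrm_sub_J[OF vw] t by simp
    have "nrm ((1 / t) *\<^sub>R (S t x - x) - - y) \<le>
      nrm ?a + (nrm ?b + (nrm ?c + (nrm ?f + (nrm (v - J t v) + nrm (y - v)))))"
      unfolding eq using in_V t
      by (intro order_trans[OF nrm_triangle] add_left_mono order_refl) auto
    also have "\<dots> \<le> 0 + (nrm (y - v) + (t / 2 * nrm w + (0 + (t * nrm w + nrm (y - v)))))"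
      by (intro add_mono b c g order_refl) (simp_all only: a f order_refl)
    also have "\<dots> = 2 * nrm (y - v) + 3 / 2 * (t * nrm w)" by (simp add: field_simps)
    also have "nrm (y - v) < e / 4" using r by (simp add: u_v_w_def)
    also have "t * nrm w \<le> d * (nrm w + 1)" using t in_V by (intro mult_mono) auto
    also have "\<dots> = e / 4"
      using nrm_nonneg[OF A_in(2)[OF vw]] by (simp add: d_def field_simps)
    finally show ?thesis using e by simp
  qed
  then show "\<exists>d>0. \<forall>t. 0 < t \<and> t < d \<longrightarrow> nrm ((1 / t) *\<^sub>R (S t x - x) - - y) < e"
    using d by blast
qed

lemma gen_dissipative:
  assumes "(x, y) \<in> gen S"
  shows "ip y x \<le> 0"
proof (rule tendsto_upperbound)
  note in_V = gen_in[OF assms]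
  \<comment> \<open>\<open>ip_tendsto\<close> wants membership in V for every index, and
    \<open>S t x\<close> is known to be in V only for t \<ge> 0; the absolute value changes nothing
    along \<open>at_right 0\<close>.\<close>
  have "((\<lambda>t. ip ((1 / \<bar>t\<bar>) *\<^sub>R (S \<bar>t\<bar> x - x)) x) \<longlongrightarrow> ip y x) (at_right 0)"
  proof (rule ip_tendsto)
    have "((\<lambda>t. nrm ((1 / t) *\<^sub>R (S t x - x) - y)) \<longlongrightarrow> 0) (at_right 0)"
      using assms by (simp add: gen_def)
    then show "((\<lambda>t. nrm ((1 / \<bar>t\<bar>) *\<^sub>R (S \<bar>t\<bar> x - x) - y)) \<longlongrightarrow> 0) (at_right 0)"
      by (rule Lim_transform_eventually)
        (auto intro: eventually_mono[OF eventually_at_right_less[of 0]])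
  qed (use in_V in auto)
  then show "((\<lambda>t. ip ((1 / \<bar>t\<bar>) *\<^sub>R (S \<bar>t\<bar> x - x)) x) \<longlongrightarrow> ip y x) (at_right 0)" .
  have "ip ((1 / \<bar>t\<bar>) *\<^sub>R (S \<bar>t\<bar> x - x)) x \<le> 0" for t
  proof -
    have "ip (S \<bar>t\<bar> x) x \<le> nrm (S \<bar>t\<bar> x) * nrm x"
      using ip_cauchy_schwarz[of "S \<bar>t\<bar> x" x] in_V by simp
    also have "\<dots> \<le> nrm x * nrm x"
      using nrm_S_le[of x "\<bar>t\<bar>"] in_V by (intro mult_right_mono) auto
    also have "\<dots> = ip x x" using nrm_sq[of x] in_V by (simp add: power2_eq_square)
    finally show ?thesis using in_V by (simp add: ip_simps divide_le_0_iff)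
  qed
  then show "\<forall>\<^sub>F t in at_right 0. ip ((1 / \<bar>t\<bar>) *\<^sub>R (S \<bar>t\<bar> x - x)) x \<le> 0"
    by (intro always_eventually) auto
qed simp

lemma gen_S_diff:
  assumes "(x, y) \<in> gen S" "(x', y') \<in> gen S"
  shows "(x - x', y - y') \<in> gen S"
proof (rule genI)
  note in_V = gen_in[OF assms(1)] gen_in[OF assms(2)]
  show "x - x' \<in> V" "y - y' \<in> V" "\<And>t. 0 \<le> t \<Longrightarrow> S t (x - x') \<in> V" using in_V by auto
  fix e :: real assume e: "e > 0"
  obtain d1 where d1: "d1 > 0" "\<And>t. 0 < t \<Longrightarrow> t < d1 \<Longrightarrow> nrm ((1 / t) *\<^sub>R (S t x - x) - y) < e / 2"
    using genD[OF assms(1), of "e / 2"] e by auto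
  obtain d2 where d2: "d2 > 0" "\<And>t. 0 < t \<Longrightarrow> t < d2 \<Longrightarrow> nrm ((1 / t) *\<^sub>R (S t x' - x') - y') < e / 2"
    using genD[OF assms(2), of "e / 2"] e by auto
  have "nrm ((1 / t) *\<^sub>R (S t (x - x') - (x - x')) - (y - y')) < e" if t: "0 < t" "t < min d1 d2" for t
  proof -
    let ?a = "(1 / t) *\<^sub>R (S t (x + (-1) *\<^sub>R x') - (S t x + (-1) *\<^sub>R S t x'))"
    let ?b = "(1 / t) *\<^sub>R (S t x - x) - y" and ?c = "(1 / t) *\<^sub>R (S t x' - x') - y'"
    have eq: "(1 / t) *\<^sub>R (S t (x - x') - (x - x')) - (y - y') = ?a + (?b - ?c)"
      by (simp add: algebra_simps)
    have "nrm ((1 / t) *\<^sub>R (S t (x - x') - (x - x')) - (y - y')) \<le> nrm ?a + (nrm ?b + nrm ?c)"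
      unfolding eq using in_V t
      by (intro order_trans[OF nrm_triangle] add_left_mono nrm_triangle_minus) auto
    also have "nrm ?a = 0" using S_linear[of x x' t "-1"] in_V t by (simp add: nrm_scale)
    finally show ?thesis using d1(2)[of t] d2(2)[of t] t by simp
  qed
  then show "\<exists>d>0. \<forall>t. 0 < t \<and> t < d \<longrightarrow> nrm ((1 / t) *\<^sub>R (S t (x - x') - (x - x')) - (y - y')) < e"
    using d1 d2 by (intro exI[of _ "min d1 d2"]) auto
qed

text \<open>A monotone operator with full range has no proper dissipative extension: solving u + A u
  = x - y puts the pair (x - u, x - u) into the generator, and dissipativity forces x - u to be
  null.\<close>

theorem gen_S_iff: "(x, y) \<in> gen S \<longleftrightarrow> (x, - y) \<in> A"
proof
  assume "(x, - y) \<in> A"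
  from A_imp_gen[OF this] show "(x, y) \<in> gen S" by simp
next
  assume xy: "(x, y) \<in> gen S"
  note in_V = gen_in[OF xy]
  define u where "u = J 1 (x - y)"
  have u: "(u, x - y - u) \<in> A" using J_in_A[of "x - y" 1] in_V by (simp add: u_def)
  have uV: "u \<in> V" using A_in[OF u] by simp
  have "(x - u, y - - (x - y - u)) \<in> gen S" by (intro gen_S_diff xy A_imp_gen u)
  then have "(x - u, x - u) \<in> gen S" by simp
  then have "ip (x - u) (x - u) \<le> 0" by (rule gen_dissipative)
  then have "ip (x - u) (x - u) = 0" using in_V uV by (intro antisym ip_nonneg) auto
  then have "nrm (x - u) = 0" by (simp add: nrm_def)
  then show "(x, - y) \<in> A"
    using in_V uV by (intro A_null[OF u]) (auto simp: nrm_diff_commute[of u])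
qed

end

section \<open>Uniqueness of the semigroup with a given generator\<close>

text \<open>Boundedness is assumed for each t separately and continuity only at 0 for each vector,
  as in \<open>C0_semigroup\<close>. Everything uniform in t, and with it continuity from the left,
  has to be derived.\<close>

locale c0_semigroup = semi_hilbert V ip
  for V :: "'v::real_vector set" and ip +
  fixes P :: "real \<Rightarrow> 'v \<Rightarrow> 'v"
  assumes P_in [simp]: "0 \<le> t \<Longrightarrow> x \<in> V \<Longrightarrow> P t x \<in> V"
    and P_linear: "0 \<le> t \<Longrightarrow> x \<in> V \<Longrightarrow> y \<in> V \<Longrightarrow> nrm (P t (x + c *\<^sub>R y) - (P t x + c *\<^sub>R P t y)) = 0"
    and P_bdd: "0 \<le> t \<Longrightarrow> \<exists>C. \<forall>x\<in>V. nrm (P t x) \<le> C * nrm x"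
    and P_zero: "x \<in> V \<Longrightarrow> nrm (P 0 x - x) = 0"
    and P_add: "0 \<le> s \<Longrightarrow> 0 \<le> t \<Longrightarrow> x \<in> V \<Longrightarrow> nrm (P (s + t) x - P s (P t x)) = 0"
    and P_cont: "x \<in> V \<Longrightarrow> ((\<lambda>t. nrm (P t x - x)) \<longlongrightarrow> 0) (at_right 0)"
begin

lemma P_diff: "0 \<le> t \<Longrightarrow> x \<in> V \<Longrightarrow> y \<in> V \<Longrightarrow> nrm (P t (x - y) - (P t x - P t y)) = 0"
  using P_linear[of t x y "-1"] by simp

lemma nrm_P_diff: "0 \<le> t \<Longrightarrow> x \<in> V \<Longrightarrow> y \<in> V \<Longrightarrow> nrm (P t x - P t y) = nrm (P t (x - y))"
  using P_diff[of t x y] by (intro nrm_null) (auto simp: nrm_diff_commute)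

text \<open>Gliding hump: a sequence of badly bounded \<open>P h\<close> with \<open>h\<close> tending to 0 yields a vector on which
  strong continuity at 0 fails.\<close>

lemma P_locally_bounded: "\<exists>d>0. \<exists>C. \<forall>h. 0 \<le> h \<and> h \<le> d \<longrightarrow> (\<forall>x\<in>V. nrm (P h x) \<le> C * nrm x)"
proof (rule ccontr)
  assume neg: "\<not> ?thesis"
  have "\<exists>h x. 0 \<le> h \<and> h \<le> 1 / Suc n \<and> x \<in> V \<and> nrm (P h x) > C * nrm x" for n C
  proof -
    have "(1::real) / Suc n > 0" by simp
    then have "\<not> (\<forall>h. 0 \<le> h \<and> h \<le> 1 / Suc n \<longrightarrow> (\<forall>x\<in>V. nrm (P h x) \<le> C * nrm x))"
      using neg by blast
    then show ?thesis by (auto simp: not_le)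
  qed
  \<comment> \<open>The growth is calibrated to the weights 3^-n chosen below: a quarter of 3^-n
    times the operator norm must still be at least n.\<close>
  then have "\<exists>h. 0 \<le> h \<and> h \<le> 1 / Suc n \<and> (\<exists>x\<in>V. nrm (P h x) > (4 * n * 3 ^ n) * nrm x)" for n
    by metis
  then obtain h where h: "\<And>n. 0 \<le> h n" "\<And>n. h n \<le> 1 / Suc n"
    "\<And>n. \<exists>x\<in>V. nrm (P (h n) x) > (4 * n * 3 ^ n) * nrm x" by metis
  define B where "B n = {nrm (P (h n) x) |x. x \<in> V \<and> nrm x \<le> 1}" for n
  define N where "N n = Sup (B n)" for n
  have B_bdd: "bdd_above (B n)" for n
  proof -
    obtain C where C: "\<forall>x\<in>V. nrm (P (h n) x) \<le> C * nrm x" using P_bdd[OF h(1)[of n]] by auto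
    have "nrm (P (h n) x) \<le> \<bar>C\<bar>" if "x \<in> V" "nrm x \<le> 1" for x
    proof -
      have "nrm (P (h n) x) \<le> C * nrm x" using C that by blast
      also have "\<dots> \<le> \<bar>C\<bar> * nrm x" using that by (intro mult_right_mono) auto
      also have "\<dots> \<le> \<bar>C\<bar> * 1" using that by (intro mult_left_mono) auto
      finally show ?thesis by simp
    qed
    then show ?thesis by (auto simp: B_def intro!: bdd_aboveI[of _ "\<bar>C\<bar>"])
  qed
  have B_ne: "B n \<noteq> {}" for n by (auto simp: B_def intro!: exI[of _ 0])
  have N_ge: "nrm (P (h n) x) \<le> N n" if "x \<in> V" "nrm x \<le> 1" for n x
    unfolding N_def using that by (intro cSup_upper B_bdd) (auto simp: B_def)
  have P_scale: "nrm (P (h n) (c *\<^sub>R x)) = \<bar>c\<bar> * nrm (P (h n) x)" if "x \<in> V" for n c x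
  proof -
    obtain C where "\<forall>x\<in>V. nrm (P (h n) x) \<le> C * nrm x" using P_bdd[OF h(1)[of n]] by auto
    then have "nrm (P (h n) 0) \<le> C * nrm 0" using zero_in by blast
    then have "nrm (P (h n) 0) = 0" using h(1)[of n] by (simp add: antisym)
    have "nrm (P (h n) (0 + c *\<^sub>R x)) = nrm (P (h n) 0 + c *\<^sub>R P (h n) x)"
      using P_linear[of "h n" 0 x c] h that by (intro nrm_null) auto
    also have "\<dots> = nrm (c *\<^sub>R P (h n) x)"
      using h that \<open>nrm (P (h n) 0) = 0\<close> by (intro nrm_null) auto
    finally show ?thesis using h that by (simp add: nrm_scale)
  qed
  have N_bound: "nrm (P (h n) x) \<le> N n * nrm x" if x: "x \<in> V" for n x
  proof (cases "nrm x = 0")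
    case True
    obtain C where "\<forall>x\<in>V. nrm (P (h n) x) \<le> C * nrm x" using P_bdd[OF h(1)[of n]] by auto
    then show ?thesis using True x by force
  next
    case False
    then have pos: "nrm x > 0" using nrm_nonneg[OF x] by simp
    have "nrm (P (h n) ((1 / nrm x) *\<^sub>R x)) \<le> N n"
      using x pos by (intro N_ge) (auto simp: nrm_scale)
    then show ?thesis using P_scale[OF x, of n "1 / nrm x"] pos by (simp add: field_simps)
  qed
  have N_large: "4 * n * 3 ^ n \<le> N n" for n
  proof -
    obtain x where x: "x \<in> V" "nrm (P (h n) x) > (4 * n * 3 ^ n) * nrm x" using h(3) by auto
    have lt: "(4 * n * 3 ^ n) * nrm x < N n * nrm x" using x N_bound[OF x(1), of n] by simp
    show ?thesis
    proof (rule ccontr)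
      assume "\<not> ?thesis"
      then have "N n * nrm x \<le> (4 * n * 3 ^ n) * nrm x"
        using x(1) by (intro mult_right_mono) auto
      with lt show False by simp
    qed
  qed
  have "\<exists>y\<in>V. nrm y \<le> 1 \<and> nrm (P (h n) y) \<ge> 3 / 4 * N n" for n
  proof (cases "N n > 0")
    case True
    then have "3 / 4 * N n < Sup (B n)" by (simp add: N_def)
    from less_cSupD[OF B_ne this] show ?thesis by (auto simp: B_def intro: less_imp_le)
  next
    case False
    then show ?thesis using h by (intro bexI[of _ 0]) (auto intro: order_trans[of _ 0])
  qed
  then obtain y where y: "\<And>n. y n \<in> V" "\<And>n. nrm (y n) \<le> 1" "\<And>n. nrm (P (h n) (y n)) \<ge> 3 / 4 * N n"
    by metis
  define r :: "nat \<Rightarrow> real" where "r n = 1 / 3 ^ n" for n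
  \<comment> \<open>The sign of the n-th summand is decided by P (h n): of two vectors that differ
    by 2 r y, at least one has an image as large as that of r y. Hence the earlier summands cannot
    spoil the size, whatever they are.\<close>
  define z where "z = rec_nat 0 (\<lambda>n x. if nrm (P (h n) (x + r n *\<^sub>R y n)) \<ge> r n * (3 / 4 * N n)
      then x + r n *\<^sub>R y n else x - r n *\<^sub>R y n)"
  have z_Suc: "z (Suc n) = (if nrm (P (h n) (z n + r n *\<^sub>R y n)) \<ge> r n * (3 / 4 * N n)
      then z n + r n *\<^sub>R y n else z n - r n *\<^sub>R y n)" for n
    by (simp add: z_def)
  have z_in [simp]: "z n \<in> V" for n
    by (induction n) (auto simp: z_Suc y, simp add: z_def)
  have z_step: "nrm (z (Suc n) - z n) \<le> r n" for n
    using y(2)[of n] y(1)[of n] by (auto simp: z_Suc nrm_scale nrm_minus r_def field_simps)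
  have z_large: "nrm (P (h n) (z (Suc n))) \<ge> r n * (3 / 4 * N n)" for n
  proof (cases "nrm (P (h n) (z n + r n *\<^sub>R y n)) \<ge> r n * (3 / 4 * N n)")
    case False
    have "2 * r n * (3 / 4 * N n) \<le> 2 * r n * nrm (P (h n) (y n))"
      using y(3)[of n] by (intro mult_left_mono) (auto simp: r_def)
    also have "\<dots> = nrm (P (h n) ((2 * r n) *\<^sub>R y n))" using y by (simp add: P_scale r_def)
    also have "(2 * r n) *\<^sub>R y n = (z n + r n *\<^sub>R y n) - (z n - r n *\<^sub>R y n)"
      unfolding mult_2 scaleR_add_left by simp
    also have "nrm (P (h n) \<dots>) = nrm (P (h n) (z n + r n *\<^sub>R y n) - P (h n) (z n - r n *\<^sub>R y n))"
      using h y by (intro nrm_P_diff[symmetric]) auto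
    also have "\<dots> \<le> nrm (P (h n) (z n + r n *\<^sub>R y n)) + nrm (P (h n) (z n - r n *\<^sub>R y n))"
      using nrm_triangle[of "P (h n) (z n + r n *\<^sub>R y n)" "- P (h n) (z n - r n *\<^sub>R y n)"] h y
      by (simp add: nrm_minus)
    finally show ?thesis using False by (simp add: z_Suc algebra_simps)
  qed (simp add: z_Suc)
  have z_tail: "nrm (z (n + p) - z n) \<le> 3 / 2 * r n * (1 - r p)" for n p
  proof (induction p)
    case (Suc p)
    have "nrm (z (n + Suc p) - z n) \<le> nrm (z (Suc (n + p)) - z (n + p)) + nrm (z (n + p) - z n)"
      using nrm_triangle_diff[of "z (n + Suc p)" "z (n + p)" "z n"] by simp
    also have "\<dots> \<le> r (n + p) + 3 / 2 * r n * (1 - r p)"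
      by (intro add_mono z_step Suc)
    also have "\<dots> = 3 / 2 * r n * (1 - r (Suc p))"
      by (simp add: r_def power_add field_simps)
    finally show ?case .
  qed (simp add: r_def)
  have z_tail': "nrm (z m - z n) \<le> 3 / 2 * r n" if "m \<ge> n" for m n
  proof -
    have "nrm (z m - z n) \<le> 3 / 2 * r n * (1 - r (m - n))" using z_tail[of n "m - n"] that by simp
    also have "\<dots> \<le> 3 / 2 * r n * 1" by (intro mult_left_mono) (auto simp: r_def)
    finally show ?thesis by simp
  qed
  have r_lim: "r \<longlonglongrightarrow> 0"
    using LIMSEQ_inverse_realpow_zero[of 3] by (simp add: r_def[abs_def] inverse_eq_divide)
  have "\<exists>x\<in>V. (\<lambda>n. nrm (z n - x)) \<longlonglongrightarrow> 0"
  proof (rule complete)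
    fix e :: real assume "e > 0"
    then obtain M where M: "r M < e / 4"
      using order_tendstoD(2)[OF r_lim, of "e / 4"] by (auto simp: eventually_sequentially)
    show "\<exists>N. \<forall>i\<ge>N. \<forall>j\<ge>N. nrm (z i - z j) < e"
    proof (intro exI allI impI)
      fix i j assume "i \<ge> M" "j \<ge> M"
      then have "nrm (z i - z j) \<le> 3 / 2 * r M + 3 / 2 * r M"
        using nrm_triangle_diff[of "z i" "z M" "z j"] z_tail'[of M i] z_tail'[of M j]
        by (simp add: nrm_diff_commute[of "z M"])
      then show "nrm (z i - z j) < e" using M \<open>e > 0\<close> by simp
    qed
  qed simp
  then obtain x where x: "x \<in> V" "(\<lambda>n. nrm (z n - x)) \<longlonglongrightarrow> 0" by auto
  have zx: "nrm (z n - x) \<le> 3 / 2 * r n" for n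
  proof -
    have "(\<lambda>m. nrm (z m - z n)) \<longlonglongrightarrow> nrm (x - z n)"
      using x by (intro nrm_tendsto) auto
    then have "nrm (x - z n) \<le> 3 / 2 * r n"
      using z_tail' by (intro LIMSEQ_le_const2) auto
    then show ?thesis using x by (simp add: nrm_diff_commute)
  qed
  \<comment> \<open>The tail after step n is at most 3/2 * 3^-(n+1) = 1/2 * 3^-n. It costs 1/2 of
    the 3/4 gained in step n and leaves 1/4.\<close>
  have large: "nrm (P (h n) x) \<ge> n" for n
  proof -
    have Nn: "0 \<le> N n" using N_large[of n] by (rule order_trans[rotated]) simp
    have "r n * (3 / 4 * N n) \<le> nrm (P (h n) (z (Suc n)))" by (rule z_large)
    also have "\<dots> \<le> nrm (P (h n) x) + nrm (P (h n) (z (Suc n)) - P (h n) x)"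
      using h x by (intro nrm_triangle_sub) auto
    also have "nrm (P (h n) (z (Suc n)) - P (h n) x) = nrm (P (h n) (z (Suc n) - x))"
      using h x by (intro nrm_P_diff) auto
    also have "\<dots> \<le> N n * nrm (z (Suc n) - x)" using x by (intro N_bound) auto
    also have "\<dots> \<le> N n * (3 / 2 * r (Suc n))" by (intro mult_left_mono zx Nn)
    also have "\<dots> = r n * (1 / 2 * N n)" by (simp add: r_def)
    finally have "r n * (1 / 4 * N n) \<le> nrm (P (h n) x)" by (simp add: algebra_simps)
    moreover have "n \<le> r n * (1 / 4 * N n)"
      using N_large[of n] by (simp add: r_def field_simps)
    ultimately show ?thesis by simp
  qed
  have "\<forall>\<^sub>F t in at_right 0. dist (nrm (P t x - x)) 0 < 1"
    using P_cont[OF x(1)] by (intro tendstoD) auto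
  then obtain d where d: "d > 0" "\<And>t. 0 < t \<Longrightarrow> t < d \<Longrightarrow> nrm (P t x - x) < 1"
    unfolding eventually_at_right_field by fastforce
  obtain n where n: "1 / d < real n" "nrm x + 1 < real n"
    using reals_Archimedean2[of "max (1 / d) (nrm x + 1)"] by auto
  have "h n < d"
  proof -
    have "h n \<le> 1 / Suc n" by (rule h)
    also have "\<dots> < d" using n d by (simp add: field_simps)
    finally show ?thesis .
  qed
  then have "nrm (P (h n) x - x) < 1"
    using d(2)[of "h n"] h(1)[of n] P_zero[OF x(1)] by (cases "h n = 0") auto
  then have "nrm (P (h n) x) < nrm x + 1"
    using nrm_triangle_sub[of "P (h n) x" x] x h by simp
  then show False using large[of n] n by simp
qed

text \<open>By the semigroup law the time is reduced by d at a stroke, each reduction costing a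
  factor D \<ge> 1.\<close>

lemma P_bounded_on: "\<exists>C\<ge>1. \<forall>t. 0 \<le> t \<and> t \<le> T \<longrightarrow> (\<forall>x\<in>V. nrm (P t x) \<le> C * nrm x)"
proof -
  obtain d C where dC: "d > 0" "\<And>h x. 0 \<le> h \<Longrightarrow> h \<le> d \<Longrightarrow> x \<in> V \<Longrightarrow> nrm (P h x) \<le> C * nrm x"
    using P_locally_bounded by auto
  define D where "D = max C 1"
  have D: "nrm (P h x) \<le> D * nrm x" if "0 \<le> h" "h \<le> d" "x \<in> V" for h x
    using that by (intro order_trans[OF dC(2)] mult_right_mono) (auto simp: D_def)
  have "\<forall>t x. 0 \<le> t \<longrightarrow> t \<le> n * d \<longrightarrow> x \<in> V \<longrightarrow> nrm (P t x) \<le> D ^ Suc n * nrm x" for n :: nat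
  proof (induction n)
    case 0
    then show ?case using D dC(1) by auto
  next
    case (Suc n)
    show ?case
    proof (intro allI impI)
      fix t x assume t: "0 \<le> t" "t \<le> Suc n * d" and x: "x \<in> V"
      show "nrm (P t x) \<le> D ^ Suc (Suc n) * nrm x"
      proof (cases "t \<le> d")
        case True
        have "nrm (P t x) \<le> D * nrm x" using D True t x by simp
        also have "\<dots> \<le> D ^ Suc (Suc n) * nrm x"
          using x self_le_power[of D "Suc (Suc n)"] by (intro mult_right_mono) (auto simp: D_def)
        finally show ?thesis .
      next
        case False
        have "nrm (P t x) = nrm (P (t - d) (P d x))"
          using P_add[of "t - d" d x] False dC x t by (intro nrm_null) auto
        also have "\<dots> \<le> D ^ Suc n * nrm (P d x)"
          using Suc[rule_format, of "t - d" "P d x"] False dC x t by (simp add: algebra_simps)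
        also have "\<dots> \<le> D ^ Suc n * (D * nrm x)"
          using D[of d x] dC x by (intro mult_left_mono) (auto simp: D_def)
        finally show ?thesis by (simp add: ac_simps)
      qed
    qed
  qed
  moreover obtain n :: nat where "T / d < n" using reals_Archimedean2 by blast
  then have "T \<le> n * d" using dC by (simp add: field_simps)
  ultimately show ?thesis
    by (intro exI[of _ "D ^ Suc n"]) (auto simp: D_def one_le_power simp del: power_Suc)
qed

text \<open>P s and P t commute by the semigroup law and P t is bounded, so difference quotients at
  0 can be pulled through P t.\<close>

lemma P_gen:
  assumes xy: "(x, y) \<in> gen P" and t: "0 \<le> t"
  shows "(P t x, P t y) \<in> gen P"
proof (rule genI)
  note in_V = gen_in[OF xy]
  show "P t x \<in> V" "P t y \<in> V" "\<And>s. 0 \<le> s \<Longrightarrow> P s (P t x) \<in> V" using in_V t by auto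
  obtain C where C: "C \<ge> 1" "\<And>x. x \<in> V \<Longrightarrow> nrm (P t x) \<le> C * nrm x" using P_bounded_on[of t] t by auto
  fix e :: real assume e: "e > 0"
  obtain d where d: "d > 0" "\<And>s. 0 < s \<Longrightarrow> s < d \<Longrightarrow> nrm ((1 / s) *\<^sub>R (P s x - x) - y) < e / C"
    using genD[OF xy, of "e / C"] e C by auto
  have "nrm ((1 / s) *\<^sub>R (P s (P t x) - P t x) - P t y) < e" if s: "0 < s" "s < d" for s
  proof -
    let ?q = "(1 / s) *\<^sub>R (P s x - x) - y"
    have 0: "nrm (P s (P t x) - P t (P s x)) = 0"
    proof (rule nrm_null_trans)
      show "nrm (P s (P t x) - P (s + t) x) = 0"
        using P_add[of s t x] nrm_diff_commute[of "P s (P t x)" "P (s + t) x"] s t in_V by simp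
      show "nrm (P (s + t) x - P t (P s x)) = 0"
        using P_add[of t s x] s t in_V by (simp add: add.commute)
    qed (use s t in_V in simp_all)
    have "nrm ((1 / s) *\<^sub>R (P s (P t x) - P t x) - P t y) = nrm ((1 / s) *\<^sub>R (P t (P s x) - P t x) - P t y)"
    proof (rule nrm_null)
      have "(1 / s) *\<^sub>R (P s (P t x) - P t x) - P t y - ((1 / s) *\<^sub>R (P t (P s x) - P t x) - P t y) =
          (1 / s) *\<^sub>R (P s (P t x) - P t (P s x))"
        by (simp add: algebra_simps)
      then show "nrm ((1 / s) *\<^sub>R (P s (P t x) - P t x) - P t y -
          ((1 / s) *\<^sub>R (P t (P s x) - P t x) - P t y)) = 0"
        using 0 in_V s t by (simp add: nrm_scale)
    qed (use in_V s t in auto)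
    also have "\<dots> = nrm (P t ((1 / s) *\<^sub>R (P s x - x) - y))"
    proof (rule nrm_null)
      let ?a = "P t (- y + (1 / s) *\<^sub>R (P s x - x)) - (P t (- y) + (1 / s) *\<^sub>R P t (P s x - x))"
      let ?b = "P t (0 + (-1) *\<^sub>R y) - (P t 0 + (-1) *\<^sub>R P t y)"
      let ?c = "(1 / s) *\<^sub>R (P t (P s x - x) - (P t (P s x) - P t x))"
      have eq: "(1 / s) *\<^sub>R (P t (P s x) - P t x) - P t y - P t ((1 / s) *\<^sub>R (P s x - x) - y) =
          - (?a + (?b + (P t 0 + ?c)))"
        by (simp add: algebra_simps)
      have "nrm (P t 0) = 0" using C(2)[of 0] t by (simp add: antisym)
      then have "nrm (?a + (?b + (P t 0 + ?c))) \<le> 0"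
        using P_linear[of t "- y" "P s x - x" "1 / s"] P_linear[of t 0 y "-1"]
          P_diff[of t "P s x" x] in_V s t
        by (intro order_trans[OF nrm_triangle] order_trans[OF add_left_mono[OF nrm_triangle]]
            order_trans[OF add_left_mono[OF add_left_mono[OF nrm_triangle]]])
          (auto simp: nrm_scale)
      then show "nrm ((1 / s) *\<^sub>R (P t (P s x) - P t x) - P t y -
          P t ((1 / s) *\<^sub>R (P s x - x) - y)) = 0"
        unfolding eq using in_V s t by (subst nrm_minus) (auto intro: antisym)
    qed (use in_V s t in auto)
    also have "\<dots> \<le> C * nrm ?q" using in_V s t by (intro C) auto
    also have "\<dots> < C * (e / C)" using d(2)[OF s] C by (intro mult_strict_left_mono) auto
    finally show ?thesis using C by simp
  qed
  then show "\<exists>d>0. \<forall>s. 0 < s \<and> s < d \<longrightarrow> nrm ((1 / s) *\<^sub>R (P s (P t x) - P t x) - P t y) < e"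
    using d by blast
qed

text \<open>From the left, P s x - P t x = P s (x - P (t - s) x) with s varying, so this is where
  the locally uniform bound enters.\<close>

lemma P_cont_left:
  assumes x: "x \<in> V" and t: "0 < t"
  shows "((\<lambda>s. nrm (P s x - P t x)) \<longlongrightarrow> 0) (at_left t)"
proof (rule tendstoI)
  fix e :: real assume e: "e > 0"
  obtain C where C: "C \<ge> 1" "\<And>s x. 0 \<le> s \<Longrightarrow> s \<le> t \<Longrightarrow> x \<in> V \<Longrightarrow> nrm (P s x) \<le> C * nrm x"
    using P_bounded_on[of t] by auto
  have "\<forall>\<^sub>F s in at_right 0. dist (nrm (P s x - x)) 0 < e / C"
    using P_cont[OF x] e C by (intro tendstoD) auto
  then obtain d where d: "d > 0" "\<And>s. 0 < s \<Longrightarrow> s < d \<Longrightarrow> nrm (P s x - x) < e / C"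
    unfolding eventually_at_right_field by fastforce
  have "nrm (P s x - P t x) < e" if s: "max 0 (t - d) < s" "s < t" for s
  proof -
    have "nrm (P s x - P t x) = nrm (P s x - P s (P (t - s) x))"
    proof (rule nrm_null)
      have "P s x - P t x - (P s x - P s (P (t - s) x)) = - (P t x - P s (P (t - s) x))" by simp
      then show "nrm (P s x - P t x - (P s x - P s (P (t - s) x))) = 0"
        using P_add[of s "t - s" x] x s t by (simp only: nrm_minus diff_in P_in) auto
    qed (use x s t in auto)
    also have "\<dots> = nrm (P s (x - P (t - s) x))" using x s t by (intro nrm_P_diff) auto
    also have "\<dots> \<le> C * nrm (x - P (t - s) x)" using x s by (intro C) auto
    also have "\<dots> < C * (e / C)"
      using d(2)[of "t - s"] C s x by (intro mult_strict_left_mono) (auto simp: nrm_diff_commute[of x])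
    finally show ?thesis using C by simp
  qed
  then have *: "\<And>s. max 0 (t - d) < s \<Longrightarrow> s < t \<Longrightarrow> dist (nrm (P s x - P t x)) 0 < e"
    using x t by simp
  show "\<forall>\<^sub>F s in at_left t. dist (nrm (P s x - P t x)) 0 < e"
    by (rule eventually_at_leftI[of "max 0 (t - d)"], rule *) (use t d(1) in auto)
qed

text \<open>The left quotient is P s applied to the quotient of x at 0, so its limit requires the
  locally uniform bound and left continuity of the orbit of y. The terms \<open>?a\<close>,
  \<open>?b\<close>, \<open>?c\<close>, \<open>?f\<close> of the proof are null vectors that express
  linearity and the semigroup law.\<close>

lemma P_deriv_left:
  assumes xy: "(x, y) \<in> gen P" and t: "0 < t"
  shows "((\<lambda>s. nrm ((1 / (s - t)) *\<^sub>R (P s x - P t x) - P t y)) \<longlongrightarrow> 0) (at_left t)"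
proof (rule tendstoI)
  note in_V = gen_in[OF xy]
  fix e :: real assume e: "e > 0"
  obtain C where C: "C \<ge> 1" "\<And>s x. 0 \<le> s \<Longrightarrow> s \<le> t \<Longrightarrow> x \<in> V \<Longrightarrow> nrm (P s x) \<le> C * nrm x"
    using P_bounded_on[of t] by auto
  obtain d where d: "d > 0" "\<And>s. 0 < s \<Longrightarrow> s < d \<Longrightarrow> nrm ((1 / s) *\<^sub>R (P s x - x) - y) < e / (2 * C)"
    using genD[OF xy, of "e / (2 * C)"] e C by auto
  have "\<forall>\<^sub>F s in at_left t. dist (nrm (P s y - P t y)) 0 < e / 2"
    using P_cont_left[OF in_V(2) t] e by (intro tendstoD) auto
  then obtain b where b: "b < t" "\<And>s. b < s \<Longrightarrow> s < t \<Longrightarrow> nrm (P s y - P t y) < e / 2"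
    unfolding eventually_at_left_field by fastforce
  have "nrm ((1 / (s - t)) *\<^sub>R (P s x - P t x) - P t y) < e"
    if s: "max b (max 0 (t - d)) < s" "s < t" for s
  proof -
    define h where "h = t - s"
    have h: "h > 0" "h < d" "s - t = - h" "t = s + h" "0 < s" using s by (auto simp: h_def)
    let ?q = "(1 / h) *\<^sub>R (P h x - x) - y"
    let ?a = "(1 / h) *\<^sub>R (P (s + h) x - P s (P h x))"
    let ?b = "(1 / h) *\<^sub>R (P s (x + 1 *\<^sub>R (P h x - x)) - (P s x + 1 *\<^sub>R P s (P h x - x)))"
    let ?c = "P s (- y + (1 / h) *\<^sub>R (P h x - x)) - (P s (- y) + (1 / h) *\<^sub>R P s (P h x - x))"
    let ?f = "P s (0 + (-1) *\<^sub>R y) - (P s 0 + (-1) *\<^sub>R P s y)"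
    have eq: "(1 / (s - t)) *\<^sub>R (P s x - P t x) - P t y =
        ?a + (?b + (- ?c + (- ?f + (P s ?q + (- P s 0 + (P s y - P t y))))))"
      unfolding h(3) using h(4) by (simp add: algebra_simps)
    have 0: "nrm (P s 0) = 0" using C(2)[of s 0] h by (simp add: antisym)
    have a: "nrm ?a = 0" using P_add[of s h x] h(1,5) in_V by (simp add: nrm_scale)
    have "nrm (P s (x + 1 *\<^sub>R (P h x - x)) - (P s x + 1 *\<^sub>R P s (P h x - x))) = 0"
      using h(1,5) in_V by (intro P_linear) auto
    then have b': "nrm ?b = 0" using h(1,5) in_V by (subst nrm_scale) auto
    have c: "nrm (- ?c) = 0"
      using P_linear[of s "- y" "P h x - x" "1 / h"] h(1,5) in_V by (simp only: nrm_minus diff_in P_in add_in scale_in minus_in less_imp_le)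
    have f: "nrm (- ?f) = 0"
      using P_linear[of s 0 y "-1"] h(1,5) in_V by (simp only: nrm_minus diff_in P_in add_in scale_in minus_in zero_in less_imp_le)
    have "nrm ((1 / (s - t)) *\<^sub>R (P s x - P t x) - P t y) \<le>
        nrm ?a + (nrm ?b + (nrm (- ?c) + (nrm (- ?f) + (nrm (P s ?q) + (nrm (- P s 0) +
         nrm (P s y - P t y))))))"
      unfolding eq using h(1,5) t in_V
      by (intro order_trans[OF nrm_triangle] add_left_mono order_refl) auto
    also have "\<dots> = nrm (P s ?q) + nrm (P s y - P t y)"
      unfolding a b' c f using 0 h(1,5) in_V by (simp add: nrm_minus)
    also have "nrm (P s ?q) \<le> C * nrm ?q" using h(1,5) s(2) in_V by (intro C) auto
    also have "nrm (P s y - P t y) < e / 2" using b s by simp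
    also have "C * nrm ?q < C * (e / (2 * C))"
      using d(2)[of h] h C by (intro mult_strict_left_mono) auto
    finally show ?thesis using C by simp
  qed
  then have *: "\<And>s. max b (max 0 (t - d)) < s \<Longrightarrow> s < t \<Longrightarrow>
      dist (nrm ((1 / (s - t)) *\<^sub>R (P s x - P t x) - P t y)) 0 < e"
    using in_V t by simp
  show "\<forall>\<^sub>F s in at_left t. dist (nrm ((1 / (s - t)) *\<^sub>R (P s x - P t x) - P t y)) 0 < e"
    by (rule eventually_at_leftI[of "max b (max 0 (t - d))"], rule *) (use t d(1) b(1) in auto)
qed

lemma P_deriv_right:
  assumes xy: "(x, y) \<in> gen P" and t: "0 \<le> t"
  shows "((\<lambda>s. nrm ((1 / (s - t)) *\<^sub>R (P s x - P t x) - P t y)) \<longlongrightarrow> 0) (at_right t)"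
proof (rule tendstoI)
  note in_V = gen_in[OF xy]
  fix e :: real assume e: "e > 0"
  obtain d where d: "d > 0"
    "\<And>s. 0 < s \<Longrightarrow> s < d \<Longrightarrow> nrm ((1 / s) *\<^sub>R (P s (P t x) - P t x) - P t y) < e"
    using genD[OF P_gen[OF xy t] e] by auto
  have "nrm ((1 / (s - t)) *\<^sub>R (P s x - P t x) - P t y) < e" if s: "t < s" "s < t + d" for s
  proof -
    let ?r = "(1 / (s - t)) *\<^sub>R (P (s - t) (P t x) - P t x) - P t y"
    have "nrm ((1 / (s - t)) *\<^sub>R (P s x - P t x) - P t y) = nrm ?r"
    proof (rule nrm_null)
      have "(1 / (s - t)) *\<^sub>R (P s x - P t x) - P t y - ?r =
          (1 / (s - t)) *\<^sub>R (P s x - P (s - t) (P t x))"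
        by (simp add: algebra_simps)
      then show "nrm ((1 / (s - t)) *\<^sub>R (P s x - P t x) - P t y - ?r) = 0"
        using P_add[of "s - t" t x] s t in_V by (simp add: nrm_scale)
    qed (use s t in_V in simp_all)
    also have "\<dots> < e" using s d by simp
    finally show ?thesis .
  qed
  then have *: "\<And>s. t < s \<Longrightarrow> s < t + d \<Longrightarrow>
      dist (nrm ((1 / (s - t)) *\<^sub>R (P s x - P t x) - P t y)) 0 < e"
    using in_V t by simp
  show "\<forall>\<^sub>F s in at_right t. dist (nrm ((1 / (s - t)) *\<^sub>R (P s x - P t x) - P t y)) 0 < e"
    by (rule eventually_at_rightI[of _ "t + d"], rule *) (use d(1) in auto)
qed

lemma P_deriv:
  assumes xy: "(x, y) \<in> gen P" and t: "0 < t"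
  shows "((\<lambda>s. nrm ((1 / (s - t)) *\<^sub>R (P s x - P t x) - P t y)) \<longlongrightarrow> 0) (at t)"
  using P_deriv_left[OF xy t] P_deriv_right[OF xy less_imp_le[OF t]] by (rule filterlim_split_at)

end

context c0_semigroup
begin

lemma P_cont_right:
  assumes x: "x \<in> V" and t: "0 \<le> t"
  shows "((\<lambda>s. nrm (P s x - P t x)) \<longlongrightarrow> 0) (at_right t)"
proof (rule tendstoI)
  fix e :: real assume e: "e > 0"
  have "\<forall>\<^sub>F s in at_right 0. dist (nrm (P s (P t x) - P t x)) 0 < e"
    using P_cont[of "P t x"] x t e by (intro tendstoD) auto
  then obtain d where d: "d > 0" "\<And>s. 0 < s \<Longrightarrow> s < d \<Longrightarrow> nrm (P s (P t x) - P t x) < e"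
    unfolding eventually_at_right_field by fastforce
  have "nrm (P s x - P t x) < e" if s: "t < s" "s < t + d" for s
  proof -
    have "nrm (P s x - P t x) = nrm (P (s - t) (P t x) - P t x)"
      using P_add[of "s - t" t x] s t x by (intro nrm_null) auto
    also have "\<dots> < e" using d s by simp
    finally show ?thesis .
  qed
  then have *: "\<And>s. t < s \<Longrightarrow> s < t + d \<Longrightarrow> dist (nrm (P s x - P t x)) 0 < e"
    using x t by simp
  show "\<forall>\<^sub>F s in at_right t. dist (nrm (P s x - P t x)) 0 < e"
    by (rule eventually_at_rightI[of _ "t + d"], rule *) (use d(1) in auto)
qed

end

section \<open>Weak continuity and differentiability of the constructed semigroup\<close>

context monotone_op
begin

lemma S_c0: "c0_semigroup V ip S"
proof unfold_locales
  show "\<exists>C. \<forall>x\<in>V. nrm (S t x) \<le> C * nrm x" if "0 \<le> t" for t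
    using nrm_S_le that by (intro exI[of _ 1]) auto
qed (auto intro: S_linear S_zero S_add S_cont_zero)

sublocale S: c0_semigroup V ip S
  by (rule S_c0)

lemma S_deriv_ip:
  assumes xy: "(x, y) \<in> A" and h: "h \<in> V" and t: "0 < t"
  shows "((\<lambda>t. ip (S t x) h) has_real_derivative - ip (S t y) h) (at t)"
proof -
  note in_V = A_in[OF xy]
  let ?q = "\<lambda>s. (1 / (s - t)) *\<^sub>R (S \<bar>s\<bar> x - S t x)"
  have "((\<lambda>s. nrm ((1 / (s - t)) *\<^sub>R (S s x - S t x) - S t (- y))) \<longlongrightarrow> 0) (at t)"
    by (rule S.P_deriv[OF A_imp_gen[OF xy] t])
  moreover have ev: "\<forall>\<^sub>F s in at t. 0 < s" using order_tendstoD(1)[OF tendsto_ident_at t] by simp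
  ultimately have "((\<lambda>s. nrm (?q s - S t (- y))) \<longlongrightarrow> 0) (at t)"
    by (elim Lim_transform_eventually) (auto elim: eventually_mono)
  then have "((\<lambda>s. ip (?q s) h) \<longlongrightarrow> ip (S t (- y)) h) (at t)"
    using in_V h t by (intro ip_tendsto) auto
  moreover have "ip (S t (- y)) h = - ip (S t y) h"
  proof -
    have "nrm (S t (0 - y) - (S t 0 - S t y)) = 0" using in_V t by (intro S.P_diff) auto
    moreover have "nrm (S t 0 - 0) = 0"
      using S_sub[OF A_zero, of t] t by (simp add: antisym)
    then have "ip (S t 0) h = 0" using nrm_null_ip[of "S t 0" 0 h] t h by simp
    ultimately show ?thesis
      using nrm_null_ip[of "S t (0 - y)" "S t 0 - S t y" h] in_V t h by (simp add: ip_simps)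
  qed
  ultimately have "((\<lambda>s. ip (?q s) h) \<longlongrightarrow> - ip (S t y) h) (at t)" by simp
  moreover have "\<forall>\<^sub>F s in at t. ip (?q s) h = (ip (S s x) h - ip (S t x) h) / (s - t)"
    using ev by eventually_elim (use in_V h t in \<open>simp add: ip_simps\<close>)
  ultimately have "((\<lambda>s. (ip (S s x) h - ip (S t x) h) / (s - t)) \<longlongrightarrow> - ip (S t y) h) (at t)"
    by (rule Lim_transform_eventually)
  then show ?thesis by (simp add: has_field_derivative_iff)
qed

lemma S_cont_ip:
  assumes x: "x \<in> V" and h: "h \<in> V" and t: "0 < t"
  shows "isCont (\<lambda>t. ip (S t x) h) t"
proof -
  have "((\<lambda>s. nrm (S s x - S t x)) \<longlongrightarrow> 0) (at t)"
    using S.P_cont_left[OF x t] S.P_cont_right[OF x less_imp_le[OF t]] by (rule filterlim_split_at)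
  moreover have ev: "\<forall>\<^sub>F s in at t. 0 < s" using order_tendstoD(1)[OF tendsto_ident_at t] by simp
  ultimately have "((\<lambda>s. nrm (S \<bar>s\<bar> x - S t x)) \<longlongrightarrow> 0) (at t)"
    by (elim Lim_transform_eventually) (auto elim: eventually_mono)
  then have "((\<lambda>s. ip (S \<bar>s\<bar> x) h) \<longlongrightarrow> ip (S t x) h) (at t)"
    using x h t by (intro ip_tendsto) auto
  then have "((\<lambda>s. ip (S s x) h) \<longlongrightarrow> ip (S t x) h) (at t)"
    by (rule Lim_transform_eventually) (use ev in \<open>auto elim: eventually_mono\<close>)
  then show ?thesis by (simp add: isCont_def)
qed

lemma S_cont_ip_zero:
  assumes x: "x \<in> V" and h: "h \<in> V"
  shows "((\<lambda>t. ip (S t x) h) \<longlongrightarrow> ip x h) (at_right 0)"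
proof -
  have ev: "\<forall>\<^sub>F s in at_right 0. 0 < (s :: real)" by (rule eventually_at_right_less)
  have "((\<lambda>s. nrm (S \<bar>s\<bar> x - x)) \<longlongrightarrow> 0) (at_right 0)"
    by (rule Lim_transform_eventually[OF S_cont_zero[OF x]]) (use ev in \<open>auto elim: eventually_mono\<close>)
  then have "((\<lambda>s. ip (S \<bar>s\<bar> x) h) \<longlongrightarrow> ip x h) (at_right 0)"
    using x h by (intro ip_tendsto) auto
  then show ?thesis
    by (rule Lim_transform_eventually) (use ev in \<open>auto elim: eventually_mono\<close>)
qed

end

locale generated_semigroup = monotone_op V ip A + c0_semigroup V ip P
  for V :: "'v::real_vector set" and ip A P +
  assumes gen_P: "gen P = {(x, - y) |x y. (x, y) \<in> A}"
begin

lemma gen_eq: "gen P = gen S"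
  using gen_S_iff by (auto simp: gen_P) (metis minus_minus)

text \<open>Energy argument: w = P x - S x has a derivative w' such that the pair (w, w') is in the
  common generator. So the square of its norm has derivative 2 \<open>ip w' w\<close> \<le> 0, and
  it starts from 0. The product rule is done by hand because V carries only a seminorm.\<close>

lemma P_eq_S_on_dom:
  assumes x: "(x, y) \<in> gen S" and t: "0 \<le> t"
  shows "nrm (P t x - S t x) = 0"
proof -
  note in_V = gen_in[OF x]
  define w where "w t = P t x - S t x" for t
  define w' where "w' t = P t y - S t y" for t
  have w_in: "w t \<in> V" "w' t \<in> V" if "0 \<le> t" for t using in_V that by (auto simp: w_def w'_def)
  have w_gen: "(w t, w' t) \<in> gen S" if "0 \<le> t" for t
    using P_gen[of x y t] S.P_gen[of x y t] x that
    by (auto simp: w_def w'_def gen_eq intro: gen_S_diff)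
  define f where "f t = (nrm (w t))\<^sup>2" for t
  have deriv: "\<exists>d. DERIV f s :> d \<and> d \<le> 0" if s: "0 < s" for s
  proof (intro exI conjI)
    show "2 * ip (w' s) (w s) \<le> 0" using gen_dissipative[OF w_gen[of s]] s by simp
    let ?q = "\<lambda>r. (1 / (r - s)) *\<^sub>R (w r - w s)"
    have q: "((\<lambda>r. nrm (?q r - w' s)) \<longlongrightarrow> 0) (at s)"
    proof (rule Lim_null_comparison)
      have "\<forall>\<^sub>F r in at s. r > 0"
        using order_tendstoD(1)[OF tendsto_ident_at s] by simp
      then show "\<forall>\<^sub>F r in at s. norm (nrm (?q r - w' s)) \<le>
          nrm ((1 / (r - s)) *\<^sub>R (P r x - P s x) - P s y) + nrm ((1 / (r - s)) *\<^sub>R (S r x - S s x) - S s y)"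
      proof eventually_elim
        fix r :: real assume r: "0 < r"
        have "?q r - w' s = ((1 / (r - s)) *\<^sub>R (P r x - P s x) - P s y) -
            ((1 / (r - s)) *\<^sub>R (S r x - S s x) - S s y)"
          by (simp add: w_def w'_def algebra_simps)
        then show "norm (nrm (?q r - w' s)) \<le>
          nrm ((1 / (r - s)) *\<^sub>R (P r x - P s x) - P s y) + nrm ((1 / (r - s)) *\<^sub>R (S r x - S s x) - S s y)"
          using nrm_triangle_minus[of "(1 / (r - s)) *\<^sub>R (P r x - P s x) - P s y"
              "(1 / (r - s)) *\<^sub>R (S r x - S s x) - S s y"] r s in_V w_in[of r] w_in[of s] by simp
      qed
      show "((\<lambda>r. nrm ((1 / (r - s)) *\<^sub>R (P r x - P s x) - P s y) +
          nrm ((1 / (r - s)) *\<^sub>R (S r x - S s x) - S s y)) \<longlongrightarrow> 0) (at s)"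
        using tendsto_add[OF P_deriv[of x y s] S.P_deriv[of x y s]] x s gen_eq by simp
    qed
    have ws: "((\<lambda>r. nrm (w r - w s)) \<longlongrightarrow> 0) (at s)"
    proof (rule Lim_null_comparison)
      have "\<forall>\<^sub>F r in at s. r > 0" using order_tendstoD(1)[OF tendsto_ident_at s] by simp
      moreover have "\<forall>\<^sub>F r in at s. r \<noteq> s" by (simp add: eventually_at_filter)
      ultimately show "\<forall>\<^sub>F r in at s. norm (nrm (w r - w s)) \<le> \<bar>r - s\<bar> * (nrm (w' s) + nrm (?q r - w' s))"
      proof eventually_elim
        fix r :: real assume r: "0 < r" "r \<noteq> s"
        have "w r - w s = (r - s) *\<^sub>R ?q r" using r by simp
        then have "nrm (w r - w s) = \<bar>r - s\<bar> * nrm (?q r)"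
          using w_in[of r] w_in[of s] r s by (metis diff_in nrm_scale scale_in less_imp_le)
        also have "\<dots> \<le> \<bar>r - s\<bar> * (nrm (w' s) + nrm (?q r - w' s))"
          using w_in[of r] w_in[of s] r s by (intro mult_left_mono nrm_triangle_sub) auto
        finally show "norm (nrm (w r - w s)) \<le> \<bar>r - s\<bar> * (nrm (w' s) + nrm (?q r - w' s))"
          using w_in[of r] w_in[of s] r s by simp
      qed
      have "((\<lambda>r. \<bar>r - s\<bar> * (nrm (w' s) + nrm (?q r - w' s))) \<longlongrightarrow> \<bar>s - s\<bar> * (nrm (w' s) + 0)) (at s)"
        by (intro tendsto_intros q)
      then show "((\<lambda>r. \<bar>r - s\<bar> * (nrm (w' s) + nrm (?q r - w' s))) \<longlongrightarrow> 0) (at s)" by simp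
    qed
    have "((\<lambda>r. (f r - f s) / (r - s) - 2 * ip (w' s) (w s)) \<longlongrightarrow> 0) (at s)"
    proof (rule Lim_null_comparison)
      let ?B = "\<lambda>r. nrm (?q r - w' s) * (2 * nrm (w s) + nrm (w r - w s)) + nrm (w' s) * nrm (w r - w s)"
      have "\<forall>\<^sub>F r in at s. r > 0" using order_tendstoD(1)[OF tendsto_ident_at s] by simp
      moreover have "\<forall>\<^sub>F r in at s. r \<noteq> s" by (simp add: eventually_at_filter)
      ultimately show "\<forall>\<^sub>F r in at s. norm ((f r - f s) / (r - s) - 2 * ip (w' s) (w s)) \<le> ?B r"
      proof eventually_elim
        fix r :: real assume r: "0 < r" "r \<noteq> s"
        note W = w_in[of r] w_in[of s]
        have "(f r - f s) / (r - s) = ip (?q r) (w r + w s)"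
          using W r s
          by (simp add: f_def nrm_sq ip_simps ip_sym[of "w r" "w s"] add_divide_distrib[symmetric])
        also have "\<dots> - 2 * ip (w' s) (w s) = ip (?q r - w' s) (w r + w s) + ip (w' s) (w r - w s)"
          using W r s by (simp add: ip_simps algebra_simps)
        also have "norm \<dots> \<le> nrm (?q r - w' s) * nrm (w r + w s) + nrm (w' s) * nrm (w r - w s)"
        proof -
          have "\<bar>ip (?q r - w' s) (w r + w s)\<bar> \<le> nrm (?q r - w' s) * nrm (w r + w s)"
            "\<bar>ip (w' s) (w r - w s)\<bar> \<le> nrm (w' s) * nrm (w r - w s)"
            using W r s by (intro ip_cauchy_schwarz; simp)+
          then show ?thesis unfolding real_norm_def by linarith
        qed
        also have "nrm (w r + w s) \<le> 2 * nrm (w s) + nrm (w r - w s)"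
        proof -
          have "w r + w s = 2 *\<^sub>R w s + (w r - w s)" by (simp add: scaleR_2)
          also have "nrm \<dots> \<le> nrm (2 *\<^sub>R w s) + nrm (w r - w s)"
            using W r s by (intro nrm_triangle) simp_all
          finally show ?thesis using W s by (simp add: nrm_scale)
        qed
        finally show "norm ((f r - f s) / (r - s) - 2 * ip (w' s) (w s)) \<le> ?B r"
          using W r s by (simp add: mult_left_mono)
      qed
      have "(?B \<longlongrightarrow> 0 * (2 * nrm (w s) + 0) + nrm (w' s) * 0) (at s)"
        by (intro tendsto_intros q ws)
      then show "(?B \<longlongrightarrow> 0) (at s)" by simp
    qed
    then show "DERIV f s :> 2 * ip (w' s) (w s)"
      by (simp add: has_field_derivative_iff LIM_zero_iff)
  qed
  have mono: "f t \<le> f s" if "0 < s" "s \<le> t" for s t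
    using deriv that by (intro DERIV_nonpos_imp_nonincreasing[of s t f]) (meson less_le_trans)+
  \<comment> \<open>The derivative is available for positive times only, so the initial value enters
    through the limit s to 0 of a bound on the norm of w s.\<close>
  have "f t \<le> 0" if t: "0 < t" for t
  proof (rule tendsto_lowerbound)
    have "((\<lambda>s. nrm (P s x - x) + nrm (S s x - x)) \<longlongrightarrow> 0) (at_right 0)"
      using tendsto_add[OF P_cont[OF in_V(1)] S.P_cont[OF in_V(1)]] by simp
    then have "((\<lambda>s. (nrm (P s x - x) + nrm (S s x - x))\<^sup>2) \<longlongrightarrow> 0) (at_right 0)"
      using tendsto_power[of _ 0 _ 2] by fastforce
    then show "((\<lambda>s. (nrm (P s x - x) + nrm (S s x - x))\<^sup>2) \<longlongrightarrow> 0) (at_right 0)" .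
    have "f t \<le> (nrm (P s x - x) + nrm (S s x - x))\<^sup>2" if s: "0 < s" "s < t" for s
    proof -
      have "w s = (P s x - x) - (S s x - x)" by (simp add: w_def)
      then have "nrm (w s) \<le> nrm (P s x - x) + nrm (S s x - x)"
        using nrm_triangle_minus[of "P s x - x" "S s x - x"] s in_V by simp
      then have "f s \<le> (nrm (P s x - x) + nrm (S s x - x))\<^sup>2"
        using w_in[of s] s by (simp add: f_def power_mono)
      then show ?thesis using mono[of s t] s by simp
    qed
    then show "\<forall>\<^sub>F s in at_right 0. f t \<le> (nrm (P s x - x) + nrm (S s x - x))\<^sup>2"
      unfolding eventually_at_right_field using t by blast
  qed simp
  then have "nrm (w t) = 0" if "0 < t" for t using that by (simp add: f_def)
  moreover have "nrm (w 0) = 0"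
    unfolding w_def
  proof (rule nrm_null_trans)
    show "nrm (P 0 x - x) = 0" using in_V by (intro P_zero)
    show "nrm (x - S 0 x) = 0"
      using in_V S.P_zero[of x] nrm_diff_commute[of x "S 0 x"] by simp
  qed (use in_V in simp_all)
  ultimately show ?thesis using t by (cases "t = 0") (auto simp: w_def)
qed

theorem P_eq_S:
  assumes x: "x \<in> V" and t: "0 \<le> t"
  shows "nrm (P t x - S t x) = 0"
proof (rule ccontr)
  assume "nrm (P t x - S t x) \<noteq> 0"
  then have e: "nrm (P t x - S t x) > 0" (is "?e > 0")
    using x t nrm_nonneg[of "P t x - S t x"] by (simp del: nrm_nonneg)
  obtain C where C: "C \<ge> 1" "\<And>x. x \<in> V \<Longrightarrow> nrm (P t x) \<le> C * nrm x" using P_bounded_on[of t] t by auto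
  obtain u g where ug: "(u, g) \<in> A" "nrm (x - u) < ?e / (2 * C)"
    using A_dense[of x "?e / (2 * C)"] x e C by auto
  note in_V = A_in[OF ug(1)]
  have "?e \<le> nrm (P t x - P t u) + (nrm (P t u - S t u) + nrm (S t u - S t x))"
    using in_V x t
    by (intro order_trans[OF nrm_triangle_diff[of _ "P t u"]] add_left_mono nrm_triangle_diff) auto
  moreover have "nrm (P t x - P t u) \<le> C * nrm (x - u)"
    using nrm_P_diff[of t x u] C(2)[of "x - u"] x in_V t by simp
  moreover have "nrm (P t u - S t u) = 0" using A_imp_gen[OF ug(1)] t by (intro P_eq_S_on_dom)
  moreover have "nrm (S t u - S t x) \<le> nrm (x - u)"
    using S_contr[of u x t] x in_V t by (simp add: nrm_diff_commute)
  moreover have "nrm (x - u) \<le> C * nrm (x - u)"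
    using mult_right_mono[OF C(1), of "nrm (x - u)"] x in_V by simp
  moreover have "C * nrm (x - u) < ?e / 2"
    using ug(2) C e by (simp add: field_simps)
  ultimately show False by linarith
qed

end

section \<open>The space of square integrable functions\<close>

definition ip2 :: "'a measure \<Rightarrow> ('a \<Rightarrow> real) \<Rightarrow> ('a \<Rightarrow> real) \<Rightarrow> real" where
  "ip2 m f g = (\<integral>x. f x * g x \<partial>m)"

lemma scaleR_fun_apply: "(c *\<^sub>R f) x = c *\<^sub>R f x"
  by (simp add: scaleR_fun_def)

lemmas fun_ops = plus_fun_apply minus_apply uminus_apply zero_fun_apply scaleR_fun_apply

lemma L2_measurable: "f \<in> L2 m \<Longrightarrow> f \<in> borel_measurable m"
  by (simp add: L2_def)

lemma L2_integrable_sq: "f \<in> L2 m \<Longrightarrow> integrable m (\<lambda>x. (f x)\<^sup>2)"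
  by (simp add: L2_def)

lemma L2_bound:
  assumes "f \<in> borel_measurable m" "g \<in> L2 m" "AE x in m. \<bar>f x\<bar> \<le> \<bar>g x\<bar>"
  shows "f \<in> L2 m"
proof -
  have "integrable m (\<lambda>x. (f x)\<^sup>2)"
  proof (rule Bochner_Integration.integrable_bound[OF L2_integrable_sq[OF assms(2)]])
    show "AE x in m. norm ((f x)\<^sup>2) \<le> norm ((g x)\<^sup>2)"
      using assms(3) by eventually_elim (simp add: abs_le_square_iff)
  qed (use assms in measurable)
  then show ?thesis using assms by (simp add: L2_def)
qed

lemma L2_mult_integrable:
  assumes "f \<in> L2 m" "g \<in> L2 m"
  shows "integrable m (\<lambda>x. f x * g x)"
proof (rule Bochner_Integration.integrable_bound)
  show "integrable m (\<lambda>x. (f x)\<^sup>2 + (g x)\<^sup>2)"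
    using assms by (intro Bochner_Integration.integrable_add L2_integrable_sq)
  have "\<bar>f x * g x\<bar> \<le> (f x)\<^sup>2 + (g x)\<^sup>2" for x
  proof -
    have "2 * (\<bar>f x\<bar> * \<bar>g x\<bar>) \<le> \<bar>f x\<bar>\<^sup>2 + \<bar>g x\<bar>\<^sup>2"
      using zero_le_power2[of "\<bar>f x\<bar> - \<bar>g x\<bar>"] by (simp add: power2_diff algebra_simps)
    moreover have "0 \<le> \<bar>f x\<bar> * \<bar>g x\<bar>" by simp
    ultimately show ?thesis unfolding abs_mult power2_abs by linarith
  qed
  then show "AE x in m. norm (f x * g x) \<le> norm ((f x)\<^sup>2 + (g x)\<^sup>2)" by simp
qed (use assms in \<open>auto intro!: borel_measurable_times dest: L2_measurable\<close>)

lemma L2_add: "f \<in> L2 m \<Longrightarrow> g \<in> L2 m \<Longrightarrow> f + g \<in> L2 m"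
  using L2_mult_integrable[of f m g]
  by (auto simp: L2_def plus_fun_def power2_sum mult.assoc
      intro!: borel_measurable_add Bochner_Integration.integrable_add)

lemma L2_scale: "f \<in> L2 m \<Longrightarrow> c *\<^sub>R f \<in> L2 m"
  by (auto simp: L2_def scaleR_fun_def power_mult_distrib)

lemma L2_zero: "0 \<in> L2 m"
  by (simp add: L2_def zero_fun_def)

lemma L2_indicator:
  assumes "f \<in> L2 m" "A \<in> sets m"
  shows "(\<lambda>x. indicator A x * f x) \<in> L2 m"
proof (rule L2_bound[OF _ assms(1)])
  show "(\<lambda>x. indicator A x * f x) \<in> borel_measurable m"
    using L2_measurable[OF assms(1)] assms(2) by measurable
qed (simp add: indicator_def)

lemma L2_abs: "f \<in> L2 m \<Longrightarrow> (\<lambda>x. \<bar>f x\<bar>) \<in> L2 m"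
  by (rule L2_bound[of _ _ f]) (auto dest: L2_measurable)

lemma L2_max0: "f \<in> L2 m \<Longrightarrow> (\<lambda>x. max (f x) 0) \<in> L2 m"
  by (rule L2_bound[of _ _ f]) (auto dest: L2_measurable)

lemma L2_min:
  assumes "f \<in> L2 m" "g \<in> L2 m"
  shows "(\<lambda>x. min (f x) (g x)) \<in> L2 m"
proof (rule L2_bound)
  show "(\<lambda>x. \<bar>f x\<bar>) + (\<lambda>x. \<bar>g x\<bar>) \<in> L2 m" using assms by (intro L2_add L2_abs)
  show "(\<lambda>x. min (f x) (g x)) \<in> borel_measurable m"
    using L2_measurable[OF assms(1)] L2_measurable[OF assms(2)] by measurable
qed (simp add: plus_fun_apply)

lemma L2_cong_AE:
  "f \<in> L2 m \<Longrightarrow> g \<in> borel_measurable m \<Longrightarrow> AE x in m. f x = g x \<Longrightarrow> g \<in> L2 m"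
  by (rule L2_bound[of g m f]) (auto elim: AE_mp)

lemma L2_const:
  assumes "emeasure m (space m) < \<infinity>"
  shows "(\<lambda>x. c) \<in> L2 m"
proof -
  interpret finite_measure m using assms by (intro finite_measureI) simp
  show ?thesis by (simp add: L2_def)
qed

lemma semi_inner_L2: "semi_inner (L2 m) (ip2 m)"
proof
  fix x y z :: "'a \<Rightarrow> real" and c
  assume x: "x \<in> L2 m" and y: "y \<in> L2 m" and z: "z \<in> L2 m"
  show "ip2 m x y = ip2 m y x" by (simp add: ip2_def mult.commute)
  show "ip2 m (x + y) z = ip2 m x z + ip2 m y z"
    using L2_mult_integrable[OF x z] L2_mult_integrable[OF y z]
    by (simp add: ip2_def plus_fun_apply distrib_right)
  show "ip2 m (c *\<^sub>R x) z = c * ip2 m x z" by (simp add: ip2_def scaleR_fun_def mult.assoc)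
  show "0 \<le> ip2 m x x" by (simp add: ip2_def)
qed (simp_all add: L2_zero L2_add L2_scale)

lemma nrm_eq_L2norm: "semi_inner.nrm (ip2 m) = L2norm m"
  by (simp add: fun_eq_iff semi_inner.nrm_def[OF semi_inner_L2] ip2_def L2norm_def power2_eq_square)

lemma L2_nn_integral_sq:
  assumes "f \<in> L2 m"
  shows "(\<integral>\<^sup>+x. ennreal ((f x)\<^sup>2) \<partial>m) = ennreal ((L2norm m f)\<^sup>2)"
  using nn_integral_eq_integral[OF L2_integrable_sq[OF assms]]
  by (simp add: L2norm_def)

lemma L2_of_nn_integral_sq:
  assumes "f \<in> borel_measurable m" "(\<integral>\<^sup>+x. ennreal ((f x)\<^sup>2) \<partial>m) \<le> ennreal c" "0 \<le> c"
  shows "f \<in> L2 m" "(L2norm m f)\<^sup>2 \<le> c"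
proof -
  have "integrable m (\<lambda>x. (f x)\<^sup>2)"
    using assms by (intro integrableI_nonneg) (auto intro: le_less_trans)
  then show f: "f \<in> L2 m" using assms by (simp add: L2_def)
  show "(L2norm m f)\<^sup>2 \<le> c" using assms(2,3) unfolding L2_nn_integral_sq[OF f] by simp
qed

text \<open>The bounds may vary with n, so one statement gives both membership in \<open>L2\<close>
  and, with d = 0, the identification of two limits.\<close>

lemma L2_Fatou:
  assumes X: "\<And>n::nat. X n \<in> L2 m" and f: "f \<in> borel_measurable m"
    and lim: "AE x in m. (\<lambda>n. X n x) \<longlonglongrightarrow> f x"
    and b: "\<And>n. (L2norm m (X n))\<^sup>2 \<le> c n" and c: "c \<longlonglongrightarrow> d"
  shows "f \<in> L2 m" "(L2norm m f)\<^sup>2 \<le> d"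
proof -
  have c0: "0 \<le> c n" for n by (rule order_trans[OF _ b]) simp
  then have d0: "0 \<le> d" using c by (intro LIMSEQ_le_const) auto
  have "(\<integral>\<^sup>+x. ennreal ((f x)\<^sup>2) \<partial>m) = (\<integral>\<^sup>+x. liminf (\<lambda>n. ennreal ((X n x)\<^sup>2)) \<partial>m)"
  proof (rule nn_integral_cong_AE)
    show "AE x in m. ennreal ((f x)\<^sup>2) = liminf (\<lambda>n. ennreal ((X n x)\<^sup>2))"
      using lim
    proof eventually_elim
      case (elim x)
      then have "(\<lambda>n. ennreal ((X n x)\<^sup>2)) \<longlonglongrightarrow> ennreal ((f x)\<^sup>2)"
        by (intro tendsto_intros)
      from lim_imp_Liminf[OF _ this] show ?case by simp
    qed
  qed
  also have "\<dots> \<le> liminf (\<lambda>n. \<integral>\<^sup>+x. ennreal ((X n x)\<^sup>2) \<partial>m)"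
  proof (rule nn_integral_liminf)
    show "(\<lambda>x. ennreal ((X n x)\<^sup>2)) \<in> borel_measurable m" for n
      using L2_measurable[OF X] by measurable
  qed
  also have "\<dots> \<le> liminf (\<lambda>n. ennreal (c n))"
    using b c0 by (intro Liminf_mono) (auto simp: L2_nn_integral_sq[OF X] intro!: ennreal_leI)
  also have "\<dots> = ennreal d"
    using c by (intro lim_imp_Liminf tendsto_ennrealI) auto
  finally show "f \<in> L2 m" "(L2norm m f)\<^sup>2 \<le> d"
    using L2_of_nn_integral_sq[OF f _ d0] by auto
qed

lemma ennreal_le_suminf: "g n \<le> (\<Sum>n. g n)" for g :: "nat \<Rightarrow> ennreal"
  by (rule order_trans[OF _ sum_le_suminf[OF summableI, of "{n}"]]) simp_all

text \<open>Weights 4^n against the decay 8^-n leave the summable 2^-n. So for almost every x the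
  sum of 4^n times the squared increments is finite, and the increments are dominated by a geometric
  sequence of ratio 1/2.\<close>

lemma AE_convergent_of_fast:
  assumes X: "\<And>n::nat. X n \<in> L2 m"
    and b: "\<And>n. (L2norm m (X (Suc n) - X n))\<^sup>2 \<le> 1 / 8 ^ n"
  shows "AE x in m. convergent (\<lambda>n. X n x)"
proof -
  interpret semi_inner "L2 m" "ip2 m" by (rule semi_inner_L2)
  define d where "d n = X (Suc n) - X n" for n
  have d: "d n \<in> L2 m" for n using X by (auto simp: d_def)
  note [measurable] = L2_measurable[OF d]
  have "(\<integral>\<^sup>+x. (\<Sum>n. ennreal (4 ^ n * (d n x)\<^sup>2)) \<partial>m) = (\<Sum>n. \<integral>\<^sup>+x. ennreal (4 ^ n * (d n x)\<^sup>2) \<partial>m)"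
    by (intro nn_integral_suminf) measurable
  also have "\<dots> = (\<Sum>n. ennreal (4 ^ n * (L2norm m (d n))\<^sup>2))"
    using L2_nn_integral_sq[OF d] by (simp add: ennreal_mult nn_integral_cmult)
  also have "\<dots> \<le> (\<Sum>n. ennreal ((1 / 2) ^ n))"
  proof (intro suminf_le allI)
    fix n
    have "4 ^ n * (L2norm m (d n))\<^sup>2 \<le> 4 ^ n * (1 / 8 ^ n)"
      using b by (intro mult_left_mono) (auto simp: d_def)
    also have "\<dots> = (1 / 2) ^ n"
      by (simp only: times_divide_eq_right mult_1_right power_divide[symmetric]) simp
    finally show "ennreal (4 ^ n * (L2norm m (d n))\<^sup>2) \<le> ennreal ((1 / 2) ^ n)" by (rule ennreal_leI)
  qed auto
  also have "\<dots> = ennreal (\<Sum>n. (1 / 2) ^ n)"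
    by (intro suminf_ennreal2 summable_geometric) auto
  also have "\<dots> < \<infinity>" by simp
  finally have fin: "(\<integral>\<^sup>+x. (\<Sum>n. ennreal (4 ^ n * (d n x)\<^sup>2)) \<partial>m) < \<infinity>" .
  have "(\<lambda>x. \<Sum>n. ennreal (4 ^ n * (d n x)\<^sup>2)) \<in> borel_measurable m" by measurable
  from nn_integral_PInf_AE[OF this] fin
  have "AE x in m. (\<Sum>n. ennreal (4 ^ n * (d n x)\<^sup>2)) \<noteq> \<infinity>" by simp
  then show ?thesis
  proof eventually_elim
    case (elim x)
    define C where "C = enn2real (\<Sum>n. ennreal (4 ^ n * (d n x)\<^sup>2))"
    have C: "(\<Sum>n. ennreal (4 ^ n * (d n x)\<^sup>2)) = ennreal C"
      using elim by (simp add: C_def less_top)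
    have C0: "0 \<le> C" by (simp add: C_def)
    have le: "\<bar>d n x\<bar> \<le> sqrt C * (1 / 2) ^ n" for n
    proof -
      have "ennreal (4 ^ n * (d n x)\<^sup>2) \<le> (\<Sum>n. ennreal (4 ^ n * (d n x)\<^sup>2))"
        by (rule ennreal_le_suminf)
      then have "4 ^ n * (d n x)\<^sup>2 \<le> C" unfolding C using C0 by simp
      moreover have "(4::real) ^ n = (2 ^ n)\<^sup>2" by (simp add: power2_eq_square flip: power_mult_distrib)
      ultimately have "(2 ^ n * d n x)\<^sup>2 \<le> C"
        by (simp only: power_mult_distrib)
      then have "\<bar>2 ^ n * d n x\<bar> \<le> sqrt C"
        using real_sqrt_le_mono[of "(2 ^ n * d n x)\<^sup>2" C] by simp
      then show ?thesis by (simp add: abs_mult field_simps)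
    qed
    have "summable (\<lambda>n. d n x)"
      by (rule summable_comparison_test'[of "\<lambda>n. sqrt C * (1 / 2) ^ n"])
        (use le in \<open>auto intro!: summable_mult summable_geometric\<close>)
    then have "convergent (\<lambda>n. \<Sum>i<n. d i x)" by (simp add: summable_iff_convergent)
    then have "convergent (\<lambda>n. X 0 x + (\<Sum>i<n. d i x))"
      by (simp add: convergent_add_const_iff)
    moreover have "X 0 x + (\<Sum>i<n. d i x) = X n x" for n
      by (induction n) (auto simp: d_def fun_ops)
    ultimately show ?case by simp
  qed
qed

text \<open>Riesz-Fischer, for functions: a fast subsequence converges almost everywhere, and Fatou
  turns the Cauchy estimate into an estimate for the distance to the pointwise limit.\<close>

lemma semi_hilbert_L2: "semi_hilbert (L2 m) (ip2 m)"
proof -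
  interpret semi_inner "L2 m" "ip2 m" rewrites "nrm = L2norm m"
    by (rule semi_inner_L2) (rule nrm_eq_L2norm)
  show ?thesis
  proof (unfold_locales, unfold nrm_eq_L2norm)
    fix X :: "nat \<Rightarrow> 'a \<Rightarrow> real"
    assume X: "\<And>n. X n \<in> L2 m"
      and C: "\<And>e. e > 0 \<Longrightarrow> \<exists>N. \<forall>i\<ge>N. \<forall>j\<ge>N. L2norm m (X i - X j) < e"
    have "\<exists>N. \<forall>i\<ge>N. \<forall>j\<ge>N. L2norm m (X i - X j) < sqrt (1 / 8 ^ k)" for k by (intro C) simp
    then obtain M where M: "\<And>k i j. i \<ge> M k \<Longrightarrow> j \<ge> M k \<Longrightarrow> L2norm m (X i - X j) < sqrt (1 / 8 ^ k)"
      by metis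
    \<comment> \<open>Past every \<open>M i\<close> with i \<le> k, which makes the subsequence
      fast, and at least k, which makes it cofinal.\<close>
    define r where "r k = (\<Sum>i\<le>k. M i) + k" for k
    have rM: "r j \<ge> M k" if "j \<ge> k" for j k
      using member_le_sum[of k "{..j}" M] that by (simp add: r_def trans_le_add1)
    define Y where "Y k = X (r k)" for k
    have Y: "Y k \<in> L2 m" for k using X by (simp add: Y_def)
    have Y_diff: "(L2norm m (Y i - Y j))\<^sup>2 \<le> 1 / 8 ^ k" if "i \<ge> k" "j \<ge> k" for i j k
    proof -
      have "L2norm m (Y i - Y j) \<le> sqrt (1 / 8 ^ k)"
        unfolding Y_def using M[of k "r i" "r j"] rM that by (simp add: less_imp_le)
      then have "(L2norm m (Y i - Y j))\<^sup>2 \<le> (sqrt (1 / 8 ^ k))\<^sup>2"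
        using Y by (intro power_mono) auto
      then show ?thesis by simp
    qed
    have conv: "AE x in m. convergent (\<lambda>n. Y n x)"
      by (rule AE_convergent_of_fast[OF Y Y_diff]) auto
    note [measurable] = L2_measurable[OF Y]
    define f where "f x = lim (\<lambda>n. Y n x)" for x
    have f[measurable]: "f \<in> borel_measurable m" unfolding f_def by measurable
    have diff: "f - Y k \<in> L2 m \<and> (L2norm m (f - Y k))\<^sup>2 \<le> 1 / 8 ^ k" for k
    proof -
      have 1: "AE x in m. (\<lambda>n. (Y (n + k) - Y k) x) \<longlonglongrightarrow> (f - Y k) x"
        using conv
      proof eventually_elim
        case (elim x)
        then have "(\<lambda>n. Y n x) \<longlonglongrightarrow> f x" by (simp add: f_def convergent_LIMSEQ_iff)
        then have "(\<lambda>n. Y (n + k) x) \<longlonglongrightarrow> f x" by (rule LIMSEQ_ignore_initial_segment)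
        then show ?case by (auto simp: fun_ops intro!: tendsto_intros)
      qed
      have 2: "f - Y k \<in> borel_measurable m" unfolding fun_diff_def by measurable
      have 3: "Y (n + k) - Y k \<in> L2 m" for n using Y by simp
      have 4: "(L2norm m (Y (n + k) - Y k))\<^sup>2 \<le> 1 / 8 ^ k" for n by (rule Y_diff) simp_all
      show ?thesis by (intro conjI L2_Fatou[OF 3 2 1 4]) (rule tendsto_const)+
    qed
    have f_in: "f \<in> L2 m" using add_in[of "f - Y 0" "Y 0"] diff[of 0] Y by simp
    have "(\<lambda>n. L2norm m (X n - f)) \<longlonglongrightarrow> 0"
    proof (rule LIMSEQ_I)
      fix e :: real assume e: "e > 0"
      obtain N where N: "\<And>i j. i \<ge> N \<Longrightarrow> j \<ge> N \<Longrightarrow> L2norm m (X i - X j) < e / 2"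
        using C[of "e / 2"] e by auto
      have "(\<lambda>k. 1 / 8 ^ k :: real) \<longlonglongrightarrow> 0" by (rule LIMSEQ_divide_realpow_zero) simp
      then have "\<forall>\<^sub>F k in sequentially. (1 / 8 ^ k :: real) < (e / 2)\<^sup>2"
        using e by (intro order_tendstoD) auto
      then obtain k0 where k0: "\<And>k. k \<ge> k0 \<Longrightarrow> (1 / 8 ^ k :: real) < (e / 2)\<^sup>2"
        by (auto simp: eventually_sequentially)
      define k where "k = max N k0"
      have "(L2norm m (f - Y k))\<^sup>2 \<le> 1 / 8 ^ k" using diff by blast
      also have "\<dots> < (e / 2)\<^sup>2" by (intro k0) (simp add: k_def)
      finally have "(L2norm m (f - Y k))\<^sup>2 < (e / 2)\<^sup>2" .
      then have fk: "L2norm m (f - Y k) < e / 2" by (rule power2_less_imp_less) (use e in simp)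
      have "r k \<ge> N" by (simp add: r_def k_def trans_le_add2)
      show "\<exists>no. \<forall>n\<ge>no. norm (L2norm m (X n - f) - 0) < e"
      proof (intro exI allI impI)
        fix n assume "n \<ge> N"
        then have "L2norm m (X n - f) < e"
          using nrm_triangle_diff[of "X n" "Y k" f] N[of n "r k"] \<open>r k \<ge> N\<close> fk X Y f_in
            nrm_diff_commute[of f "Y k"] by (simp add: Y_def)
        then show "norm (L2norm m (X n - f) - 0) < e" using X f_in by simp
      qed
    qed
    then show "\<exists>x\<in>L2 m. (\<lambda>n. L2norm m (X n - x)) \<longlonglongrightarrow> 0" using f_in by auto
  qed
qed

interpretation L2: semi_hilbert "L2 m" "ip2 m"
  rewrites "semi_inner.nrm (ip2 m) = L2norm m" for m :: "'a measure"
  by (rule semi_hilbert_L2) (rule nrm_eq_L2norm)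

lemma L2norm_eq_0_iff:
  assumes "f \<in> L2 m"
  shows "L2norm m f = 0 \<longleftrightarrow> (AE x in m. f x = 0)"
  using integral_nonneg_eq_0_iff_AE[OF L2_integrable_sq[OF assms]]
  by (simp add: L2norm_def)

lemma L2norm_diff_eq_0_iff:
  "f \<in> L2 m \<Longrightarrow> g \<in> L2 m \<Longrightarrow> L2norm m (f - g) = 0 \<longleftrightarrow> (AE x in m. f x = g x)"
  by (simp add: L2norm_eq_0_iff fun_ops)

lemma L2norm_mono:
  assumes "f \<in> L2 m" "g \<in> L2 m" "AE x in m. \<bar>f x\<bar> \<le> \<bar>g x\<bar>"
  shows "L2norm m f \<le> L2norm m g"
  unfolding L2norm_def
proof (intro real_sqrt_le_mono integral_mono_AE L2_integrable_sq assms)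
  show "AE x in m. (f x)\<^sup>2 \<le> (g x)\<^sup>2"
    using assms(3) by eventually_elim (simp add: abs_le_square_iff)
qed

lemma ip2_mono:
  assumes "f \<in> L2 m" "g \<in> L2 m" "h \<in> L2 m" "AE x in m. f x * h x \<le> g x * h x"
  shows "ip2 m f h \<le> ip2 m g h"
  unfolding ip2_def using assms by (intro integral_mono_AE L2_mult_integrable)

lemma ip2_nonneg:
  assumes "AE x in m. 0 \<le> f x * g x"
  shows "0 \<le> ip2 m f g"
  unfolding ip2_def using assms by (rule integral_nonneg_AE)

lemma ip2_cong_AE:
  assumes "f \<in> borel_measurable m" "g \<in> borel_measurable m" "f' \<in> borel_measurable m"
    "g' \<in> borel_measurable m" "AE x in m. f x * g x = f' x * g' x"
  shows "ip2 m f g = ip2 m f' g'"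
  unfolding ip2_def using assms by (intro integral_cong_AE) auto

lemma L2_limit_AE_eq:
  assumes X: "\<And>n::nat. X n \<in> L2 m" and f: "f \<in> L2 m" and g: "g \<in> borel_measurable m"
    and lim: "(\<lambda>n. L2norm m (X n - f)) \<longlonglongrightarrow> 0" and AE: "AE x in m. (\<lambda>n. X n x) \<longlonglongrightarrow> g x"
  shows "AE x in m. f x = g x"
proof -
  have 1: "AE x in m. (\<lambda>n. (X n - f) x) \<longlonglongrightarrow> (g - f) x"
    using AE by eventually_elim (auto simp: fun_ops intro!: tendsto_intros)
  have 2: "g - f \<in> borel_measurable m"
    unfolding fun_diff_def using g L2_measurable[OF f] by measurable
  have 3: "X n - f \<in> L2 m" for n using X f by simp
  have 4: "(\<lambda>n. (L2norm m (X n - f))\<^sup>2) \<longlonglongrightarrow> 0" using tendsto_power[OF lim, of 2] by simp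
  from L2_Fatou[where f = "g - f" and X = "\<lambda>n. X n - f", OF 3 2 1 order_refl 4] have "g - f \<in> L2 m" "L2norm m (g - f) = 0" by auto
  then have "AE x in m. (g - f) x = 0" by (simp add: L2norm_eq_0_iff)
  then show ?thesis by eventually_elim (simp add: fun_ops)
qed

lemma L2_dominated_convergence:
  assumes X: "\<And>n::nat. X n \<in> borel_measurable m" and f: "f \<in> borel_measurable m"
    and w: "w \<in> L2 m" and le: "\<And>n. AE x in m. \<bar>X n x\<bar> \<le> w x"
    and lim: "AE x in m. (\<lambda>n. X n x) \<longlonglongrightarrow> f x"
  shows "f \<in> L2 m" "(\<lambda>n. L2norm m (X n - f)) \<longlonglongrightarrow> 0"
proof -
  have le': "AE x in m. \<forall>n. \<bar>X n x\<bar> \<le> w x" using le by (simp add: AE_all_countable)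
  have fw: "AE x in m. \<bar>f x\<bar> \<le> w x"
    using le' lim
  proof eventually_elim
    case (elim x)
    then show ?case using tendsto_rabs[OF elim(2)] by (intro LIMSEQ_le_const2) auto
  qed
  show "f \<in> L2 m" by (rule L2_bound[OF f w]) (use fw in eventually_elim, auto)
  have "(\<lambda>n. \<integral>x. (X n x - f x)\<^sup>2 \<partial>m) \<longlonglongrightarrow> (\<integral>x. 0 \<partial>m)"
  proof (rule integral_dominated_convergence)
    show "integrable m (\<lambda>x. 4 * (w x)\<^sup>2)" using L2_integrable_sq[OF w] by simp
    show "AE x in m. (\<lambda>n. (X n x - f x)\<^sup>2) \<longlonglongrightarrow> 0"
      using lim
    proof eventually_elim
      case (elim x)
      from tendsto_power[OF tendsto_diff[OF elim tendsto_const[of "f x"]], of 2] show ?case by simp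
    qed
    show "AE x in m. norm ((X n x - f x)\<^sup>2) \<le> 4 * (w x)\<^sup>2" for n
      using le[of n] fw
    proof eventually_elim
      case (elim x)
      then have "\<bar>X n x - f x\<bar> \<le> \<bar>2 * w x\<bar>" by linarith
      then have "(X n x - f x)\<^sup>2 \<le> (2 * w x)\<^sup>2" by (simp only: abs_le_square_iff)
      then show ?case by simp
    qed
  qed (use X f in measurable)
  then have "(\<lambda>n. sqrt (\<integral>x. (X n x - f x)\<^sup>2 \<partial>m)) \<longlonglongrightarrow> sqrt 0"
    by (intro tendsto_real_sqrt) simp
  then show "(\<lambda>n. L2norm m (X n - f)) \<longlonglongrightarrow> 0" by (simp add: L2norm_def fun_ops)
qed

text \<open>Tested with the positive part of f - g.\<close>

lemma L2_AE_le_of_ip2_le: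
  assumes f: "f \<in> L2 m" and g: "g \<in> L2 m"
    and le: "\<And>h. h \<in> L2 m \<Longrightarrow> AE x in m. 0 \<le> h x \<Longrightarrow> ip2 m f h \<le> ip2 m g h"
  shows "AE x in m. f x \<le> g x"
proof -
  define h where "h x = max ((f - g) x) 0" for x
  have h: "h \<in> L2 m" using L2_max0[of "f - g" m] f g by (simp add: h_def[abs_def])
  have "ip2 m (f - g) h \<le> 0"
    using le[OF h] f g h by (simp add: L2.ip_diff h_def)
  moreover have "ip2 m (f - g) h = ip2 m h h"
    unfolding ip2_def by (intro arg_cong[where f = "integral\<^sup>L m"]) (auto simp: h_def max_def)
  ultimately have "ip2 m h h = 0" using L2.ip_nonneg[OF h] by simp
  then have "L2norm m h = 0" using L2.nrm_sq[OF h] by simp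
  then have "AE x in m. h x = 0" by (simp add: L2norm_eq_0_iff h)
  then show ?thesis by eventually_elim (auto simp: h_def fun_ops max_def split: if_splits)
qed

lemma (in semi_inner) nrm_midpoint:
  assumes "x \<in> V" "y \<in> V" "z \<in> V"
  shows "nrm ((1 / 2) *\<^sub>R (x + y) - z) \<le> (1 / 2) * (nrm (x - z) + nrm (y - z))"
proof -
  have "(x - z) + (y - z) = (x + y) - 2 *\<^sub>R z" by (simp add: scaleR_2)
  then have "(1 / 2) *\<^sub>R ((x - z) + (y - z)) = (1 / 2) *\<^sub>R (x + y) - z"
    by (simp only: scaleR_diff_right) simp
  then have "nrm ((1 / 2) *\<^sub>R (x + y) - z) = (1 / 2) * nrm ((x - z) + (y - z))"
    using nrm_scale[of "(x - z) + (y - z)" "1 / 2"] assms by simp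
  also have "\<dots> \<le> (1 / 2) * (nrm (x - z) + nrm (y - z))"
    using assms by (intro mult_left_mono nrm_triangle) auto
  finally show ?thesis .
qed

lemma (in semi_inner) ip_parallelogram:
  assumes "x \<in> V" "y \<in> V"
  shows "ip (x - y) (x - y) =
    2 * ip x x + 2 * ip y y - 4 * ip ((1 / 2) *\<^sub>R (x + y)) ((1 / 2) *\<^sub>R (x + y))"
  using assms by (simp add: ip_simps ip_sym[of y x] algebra_simps)

section \<open>Closed forms: weak compactness by minimal norm\<close>

locale closed_form_space =
  fixes D :: "'a dirichlet"
  assumes symmetric: "symmetric_form D" and closed: "closed_form D"
begin

abbreviation "m \<equiv> msr D"
abbreviation "F \<equiv> fdom D"
abbreviation "E \<equiv> frm D"

lemma
  shows F_AE: "f \<in> F \<Longrightarrow> g \<in> borel_measurable m \<Longrightarrow> AE x in m. f x = g x \<Longrightarrow> g \<in> F"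
    and E_AE: "f \<in> F \<Longrightarrow> g \<in> F \<Longrightarrow> h \<in> F \<Longrightarrow> AE x in m. f x = g x \<Longrightarrow> E f h = E g h"
    and F_L2 [simp]: "f \<in> F \<Longrightarrow> f \<in> L2 m"
    and E_sym: "f \<in> F \<Longrightarrow> g \<in> F \<Longrightarrow> E f g = E g f"
    and E_nonneg: "f \<in> F \<Longrightarrow> 0 \<le> E f f"
  using symmetric unfolding symmetric_form_def Let_def by blast+

lemma semi_inner_E: "semi_inner F E"
proof
  show "0 \<in> F"
    using symmetric unfolding symmetric_form_def Let_def zero_fun_def by blast
  fix x y z c assume x: "x \<in> F" and y: "y \<in> F" and z: "z \<in> F"
  show "x + y \<in> F"
    using symmetric x y unfolding symmetric_form_def Let_def plus_fun_def by blast
  show "c *\<^sub>R x \<in> F"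
    using symmetric x unfolding symmetric_form_def Let_def scaleR_fun_def real_scaleR_def by blast
  show "E (x + y) z = E x z + E y z"
    using symmetric x y z unfolding symmetric_form_def Let_def plus_fun_def by blast
  show "E (c *\<^sub>R x) z = c * E x z"
    using symmetric x z unfolding symmetric_form_def Let_def scaleR_fun_def real_scaleR_def by blast
qed (rule E_sym E_nonneg; assumption)+

lemma F_measurable [measurable_dest]: "f \<in> F \<Longrightarrow> f \<in> borel_measurable m"
  by (simp add: L2_measurable)

sublocale EE: semi_inner F E
  by (rule semi_inner_E)

definition Ea :: "real \<Rightarrow> ('a \<Rightarrow> real) \<Rightarrow> ('a \<Rightarrow> real) \<Rightarrow> real" where
  "Ea a u v = E u v + a * ip2 m u v"

lemma form1_eq_Ea: "form1 D = Ea 1"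
  by (simp add: fun_eq_iff form1_def Ea_def ip2_def)

lemma norm1_complete:
  assumes "\<And>n::nat. X n \<in> F" "\<And>e. e > 0 \<Longrightarrow> \<exists>N. \<forall>i\<ge>N. \<forall>j\<ge>N. norm1 D (X i - X j) < e"
  shows "\<exists>f\<in>F. (\<lambda>n. norm1 D (X n - f)) \<longlonglongrightarrow> 0"
  using closed assms unfolding closed_form_def fun_diff_def by blast

lemma semi_inner_Ea: "0 \<le> a \<Longrightarrow> semi_inner F (Ea a)"
  by unfold_locales
    (simp_all add: Ea_def EE.ip_simps L2.ip_simps E_sym L2.ip_sym E_nonneg L2.ip_nonneg algebra_simps)

lemma norm1_eq: "semi_inner.nrm (form1 D) = norm1 D"
  using semi_inner_Ea[of 1] by (simp add: fun_eq_iff semi_inner.nrm_def norm1_def form1_eq_Ea)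

text \<open>The squared norms of \<open>Ea a\<close> and \<open>Ea 1\<close> are equivalent with
  constants max 1 (1 / a) and max 1 a, so completeness, assumed for the parameter 1, passes to every
  a > 0.\<close>

lemma semi_hilbert_Ea:
  assumes a: "0 < a"
  shows "semi_hilbert F (Ea a)"
proof -
  interpret A: semi_inner F "Ea a" using a by (intro semi_inner_Ea) simp
  interpret B: semi_inner F "Ea 1" by (intro semi_inner_Ea) simp
  have norm1: "norm1 D = B.nrm" using norm1_eq form1_eq_Ea by simp
  define c where "c = max 1 (1 / a)"
  define d where "d = max 1 a"
  have c: "c \<ge> 1" "1 \<le> c * a" using a by (auto simp: c_def max_def field_simps)
  have d: "d \<ge> 1" "a \<le> d" by (auto simp: d_def)
  have BA: "B.nrm u \<le> sqrt c * A.nrm u" if u: "u \<in> F" for u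
  proof -
    have "E u u + ip2 m u u \<le> c * E u u + (c * a) * ip2 m u u"
      using c E_nonneg[OF u] L2.ip_nonneg[of u m] u
      by (intro add_mono) (auto simp: mult_le_cancel_right1)
    then have "Ea 1 u u \<le> c * Ea a u u" by (simp add: Ea_def algebra_simps)
    then show ?thesis by (simp add: A.nrm_def B.nrm_def flip: real_sqrt_mult)
  qed
  have AB: "A.nrm u \<le> sqrt d * B.nrm u" if u: "u \<in> F" for u
  proof -
    have "E u u + a * ip2 m u u \<le> d * E u u + d * ip2 m u u"
      using d E_nonneg[OF u] L2.ip_nonneg[of u m] u
      by (intro add_mono mult_right_mono) (auto simp: mult_le_cancel_right1)
    then have "Ea a u u \<le> d * Ea 1 u u" by (simp add: Ea_def algebra_simps)
    then show ?thesis by (simp add: A.nrm_def B.nrm_def flip: real_sqrt_mult)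
  qed
  show ?thesis
  proof unfold_locales
    fix X :: "nat \<Rightarrow> 'a \<Rightarrow> real"
    assume X: "\<And>n. X n \<in> F" and C: "\<And>e. e > 0 \<Longrightarrow> \<exists>N. \<forall>i\<ge>N. \<forall>j\<ge>N. A.nrm (X i - X j) < e"
    have "\<exists>N. \<forall>i\<ge>N. \<forall>j\<ge>N. norm1 D (X i - X j) < e" if e: "e > 0" for e
    proof -
      have "e / sqrt c > 0" using e c by simp
      from C[OF this] obtain N where N: "\<And>i j. i \<ge> N \<Longrightarrow> j \<ge> N \<Longrightarrow> A.nrm (X i - X j) < e / sqrt c"
        by auto
      show ?thesis
      proof (intro exI[of _ N] allI impI)
        fix i j assume "i \<ge> N" "j \<ge> N"
        have "norm1 D (X i - X j) \<le> sqrt c * A.nrm (X i - X j)" unfolding norm1 by (intro BA EE.diff_in X)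
        also have "\<dots> < sqrt c * (e / sqrt c)"
          using c by (intro mult_strict_left_mono N \<open>i \<ge> N\<close> \<open>j \<ge> N\<close>) auto
        finally show "norm1 D (X i - X j) < e" using c by simp
      qed
    qed
    from norm1_complete[OF X this]
    obtain f where f: "f \<in> F" "(\<lambda>n. norm1 D (X n - f)) \<longlonglongrightarrow> 0" by auto
    have "(\<lambda>n. A.nrm (X n - f)) \<longlonglongrightarrow> 0"
    proof (rule Lim_null_comparison)
      show "\<forall>\<^sub>F n in sequentially. norm (A.nrm (X n - f)) \<le> sqrt d * norm1 D (X n - f)"
        using AB[of "X _ - f"] X f by (intro always_eventually) (auto simp: norm1)
      show "(\<lambda>n. sqrt d * norm1 D (X n - f)) \<longlonglongrightarrow> 0"
        using tendsto_mult_left[OF f(2), of "sqrt d"] by simp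
    qed
    then show "\<exists>x\<in>F. (\<lambda>n. A.nrm (X n - x)) \<longlonglongrightarrow> 0" using f by auto
  qed
qed

sublocale F1: semi_hilbert F "form1 D"
  rewrites "semi_inner.nrm (form1 D) = norm1 D"
  using semi_hilbert_Ea[of 1] by (simp_all add: form1_eq_Ea norm1_eq[unfolded form1_eq_Ea])

lemma form1_eq: "form1 D u v = E u v + ip2 m u v"
  by (simp add: form1_def ip2_def)

lemma norm1_sq: "u \<in> F \<Longrightarrow> (norm1 D u)\<^sup>2 = E u u + (L2norm m u)\<^sup>2"
  by (simp only: F1.nrm_sq form1_eq L2.nrm_sq F_L2)

lemma L2norm_le_norm1:
  assumes "u \<in> F"
  shows "L2norm m u \<le> norm1 D u"
proof (rule power2_le_imp_le)
  show "(L2norm m u)\<^sup>2 \<le> (norm1 D u)\<^sup>2" using norm1_sq[OF assms] E_nonneg[OF assms] by linarith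
  show "0 \<le> norm1 D u" by (rule F1.nrm_nonneg[OF assms])
qed

lemma E_bound:
  assumes u: "u \<in> F" and v: "v \<in> F"
  shows "\<bar>E u v\<bar> \<le> norm1 D u * norm1 D v"
proof -
  have le: "EE.nrm w \<le> norm1 D w" if "w \<in> F" for w
    using that E_nonneg[of w] L2.ip_nonneg[of w m]
    by (simp add: EE.nrm_def norm1_def form1_eq)
  have "\<bar>E u v\<bar> \<le> EE.nrm u * EE.nrm v" by (rule EE.ip_cauchy_schwarz[OF u v])
  also have "\<dots> \<le> norm1 D u * norm1 D v" by (intro mult_mono le u v) (use u v in auto)
  finally show ?thesis .
qed

lemma E_tendsto:
  assumes "\<And>n. X n \<in> F" "u \<in> F" "v \<in> F" "((\<lambda>n. norm1 D (X n - u)) \<longlongrightarrow> 0) G"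
  shows "((\<lambda>n. E (X n) v) \<longlongrightarrow> E u v) G"
proof -
  have "((\<lambda>n. E (X n) v - E u v) \<longlongrightarrow> 0) G"
  proof (rule Lim_null_comparison)
    show "\<forall>\<^sub>F n in G. norm (E (X n) v - E u v) \<le> norm1 D (X n - u) * norm1 D v"
      using E_bound[of "X _ - u" v] assms by (intro always_eventually) (auto simp: EE.ip_simps)
    show "((\<lambda>n. norm1 D (X n - u) * norm1 D v) \<longlongrightarrow> 0) G"
      using tendsto_mult_right[OF assms(4), of "norm1 D v"] by simp
  qed
  then show ?thesis by (simp add: LIM_zero_iff)
qed

text \<open>Instead of extracting a weakly convergent subsequence, take elements of almost minimal norm in
  the intersections of \<open>K\<close> with shrinking \<open>L\<^sup>2\<close>-balls; the parallelogram law makes them Cauchy.\<close>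

lemma weakly_closed:
  assumes KF: "K \<subseteq> F"
    and mid: "\<And>u v. u \<in> K \<Longrightarrow> v \<in> K \<Longrightarrow> (1 / 2) *\<^sub>R (u + v) \<in> K"
    and cl: "\<And>Y v. (\<And>n::nat. Y n \<in> K) \<Longrightarrow> v \<in> F \<Longrightarrow> (\<lambda>n. norm1 D (Y n - v)) \<longlonglongrightarrow> 0 \<Longrightarrow> v \<in> K"
    and X: "\<And>n::nat. X n \<in> K" and b: "\<And>n. E (X n) (X n) \<le> C"
    and u: "u \<in> L2 m" and lim: "(\<lambda>n. L2norm m (X n - u)) \<longlonglongrightarrow> 0"
  shows "\<exists>v\<in>K. AE x in m. v x = u x"
proof -
  have XF: "X n \<in> F" for n using X KF by auto
  have "(\<lambda>n. L2norm m (X n)) \<longlonglongrightarrow> L2norm m u" using XF u lim by (intro L2.nrm_tendsto) auto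
  then have "Bseq (\<lambda>n. L2norm m (X n))" by (intro convergent_imp_Bseq convergentI)
  then obtain B where B: "\<And>n. \<bar>L2norm m (X n)\<bar> \<le> B" by (auto simp: Bseq_def)
  define q where "q c = form1 D c c" for c
  define C' where "C' = C + B\<^sup>2"
  have qX: "q (X n) \<le> C'" for n
  proof -
    have "(L2norm m (X n))\<^sup>2 \<le> B\<^sup>2"
      using B[of n] XF[of n] by (intro power_mono) auto
    then show ?thesis
      using b[of n] L2.nrm_sq[of "X n" m] XF[of n] unfolding q_def form1_eq C'_def by simp
  qed
  define S where "S n = {c \<in> K. L2norm m (c - u) \<le> 1 / Suc n}" for n :: nat
  have S_F: "c \<in> F" if "c \<in> S n" for c n using that KF by (auto simp: S_def)
  have S_ne: "\<exists>j. X j \<in> S n" for n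
  proof -
    have "\<forall>\<^sub>F j in sequentially. L2norm m (X j - u) < 1 / Suc n"
      using lim by (intro order_tendstoD) auto
    then obtain j where "L2norm m (X j - u) < 1 / Suc n" by (auto simp: eventually_sequentially)
    then show ?thesis using X by (auto simp: S_def intro!: exI[of _ j])
  qed
  have S_anti: "S j \<subseteq> S i" if "i \<le> j" for i j
  proof -
    have "1 / Suc j \<le> 1 / Suc i" using that by (simp add: field_simps)
    then show ?thesis by (auto simp: S_def)
  qed
  have S_mid: "(1 / 2) *\<^sub>R (c + c') \<in> S n" if "c \<in> S n" "c' \<in> S n" for c c' n
  proof -
    note cF = S_F[OF that(1)] S_F[OF that(2)]
    have "L2norm m ((1 / 2) *\<^sub>R (c + c') - u) \<le> (1 / 2) * (L2norm m (c - u) + L2norm m (c' - u))"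
      using cF u by (intro L2.nrm_midpoint) auto
    also have "\<dots> \<le> 1 / Suc n" using that by (simp add: S_def)
    finally show ?thesis using that mid by (auto simp: S_def)
  qed
  define k where "k n = Inf (q ` S n)" for n
  have q_nonneg: "0 \<le> q c" if "c \<in> F" for c using F1.ip_nonneg[OF that] by (simp add: q_def)
  have bdd: "bdd_below (q ` S n)" for n
    by (rule bdd_belowI[of _ 0]) (auto intro: q_nonneg S_F)
  have k_le: "k n \<le> q c" if "c \<in> S n" for n c
    unfolding k_def by (rule cInf_lower[OF _ bdd]) (use that in auto)
  have kC: "k n \<le> C'" for n using S_ne[of n] k_le qX order_trans by blast
  \<comment> \<open>The infima over the shrinking balls increase towards L. Once they are close to
    L, two almost minimal elements and their midpoint have nearly the same square norm.\<close>
  define L where "L = Sup (range k)"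
  have k_bdd: "bdd_above (range k)" by (rule bdd_aboveI[of _ C']) (auto intro: kC)
  have kL: "k n \<le> L" for n unfolding L_def by (rule cSup_upper[OF _ k_bdd]) auto
  have "\<exists>c\<in>S n. q c < k n + 1 / Suc n" for n
    using cInf_lessD[of "q ` S n" "k n + 1 / Suc n"] S_ne[of n] by (force simp: k_def)
  then obtain c where c: "\<And>n. c n \<in> S n" "\<And>n. q (c n) < k n + 1 / Suc n" by metis
  have cF: "c n \<in> F" and cK: "c n \<in> K" for n using c(1)[of n] S_F by (auto simp: S_def)
  have par: "q (x - y) = 2 * q x + 2 * q y - 4 * q ((1 / 2) *\<^sub>R (x + y))" if "x \<in> F" "y \<in> F" for x y
    unfolding q_def by (rule F1.ip_parallelogram[OF that])
  have "\<exists>v\<in>F. (\<lambda>n. norm1 D (c n - v)) \<longlonglongrightarrow> 0"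
  proof (rule F1.complete[OF cF])
    fix e :: real assume e: "e > 0"
    \<comment> \<open>With slack \<open>e\<^sup>2 / 16\<close> in all three values, the
      parallelogram law bounds the square of the distance by \<open>e\<^sup>2 / 2\<close>.\<close>
    have "L - e\<^sup>2 / 16 < Sup (range k)" using e by (simp add: L_def)
    then obtain N1 where N1: "L - e\<^sup>2 / 16 < k N1"
      using less_cSupD[of "range k" "L - e\<^sup>2 / 16"] by auto
    have e16: "0 < e\<^sup>2 / 16" using e by simp
    obtain N2 :: nat where N2: "1 / Suc N2 < e\<^sup>2 / 16"
      using nat_approx_posE[OF e16] by blast
    define N where "N = max N1 N2"
    have kN: "k N1 \<le> k N"
    proof -
      have "k N1 \<le> q x" if "x \<in> S N" for x using S_anti[of N1 N] k_le that by (auto simp: N_def)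
      then show ?thesis unfolding k_def[of N] using S_ne[of N] by (intro cInf_greatest) auto
    qed
    have sN: "1 / Suc N < e\<^sup>2 / 16"
    proof -
      have "1 / Suc N \<le> 1 / Suc N2" by (simp add: N_def field_simps)
      then show ?thesis using N2 by simp
    qed
    show "\<exists>N. \<forall>i\<ge>N. \<forall>j\<ge>N. norm1 D (c i - c j) < e"
    proof (intro exI allI impI)
      fix i j assume ij: "i \<ge> N" "j \<ge> N"
      have small: "q (c l) < L + e\<^sup>2 / 16" if "l \<ge> N" for l
      proof -
        have "1 / Suc l \<le> 1 / Suc N" using that by (simp add: field_simps)
        then show ?thesis using c(2)[of l] kL[of l] sN by simp
      qed
      have "c i \<in> S N" "c j \<in> S N" using c(1) S_anti ij by blast+
      then have "k N \<le> q ((1 / 2) *\<^sub>R (c i + c j))" by (intro k_le S_mid)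
      then have "q (c i - c j) < e\<^sup>2"
        using par[OF cF cF, of i j] small[OF ij(1)] small[OF ij(2)] N1 kN e16 by linarith
      then have "(norm1 D (c i - c j))\<^sup>2 < e\<^sup>2" by (simp add: F1.nrm_sq cF q_def)
      then show "norm1 D (c i - c j) < e" by (rule power2_less_imp_less) (use e in simp)
    qed
  qed
  then obtain v where v: "v \<in> F" "(\<lambda>n. norm1 D (c n - v)) \<longlonglongrightarrow> 0" by auto
  have "v \<in> K" using cl[OF cK v] .
  moreover have "AE x in m. v x = u x"
  proof -
    have 1: "(\<lambda>n. L2norm m (c n - v)) \<longlonglongrightarrow> 0"
      by (rule Lim_null_comparison[OF _ v(2)]) (use L2norm_le_norm1 cF v in \<open>auto intro!: always_eventually\<close>)
    have 2: "(\<lambda>n. L2norm m (c n - u)) \<longlonglongrightarrow> 0"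
    proof (rule Lim_null_comparison)
      show "\<forall>\<^sub>F n in sequentially. norm (L2norm m (c n - u)) \<le> 1 / Suc n"
        using c(1) cF u by (auto simp: S_def intro!: always_eventually)
      show "(\<lambda>n. 1 / real (Suc n)) \<longlonglongrightarrow> 0" by (intro LIMSEQ_Suc lim_1_over_n)
    qed
    have "L2norm m (v - u) = 0" using L2.nrm_lim_unique[OF _ _ _ 1 2] cF v(1) u by simp
    then show ?thesis using L2norm_diff_eq_0_iff[of v m u] v(1) u by simp
  qed
  ultimately show ?thesis by auto
qed

lemma F_weakly_closed:
  assumes "\<And>n::nat. X n \<in> F" "\<And>n. E (X n) (X n) \<le> C" "u \<in> L2 m" "(\<lambda>n. L2norm m (X n - u)) \<longlonglongrightarrow> 0"
  shows "u \<in> F"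
proof -
  obtain v where "v \<in> F" "AE x in m. v x = u x"
    using weakly_closed[of F X C u] assms by auto
  then show ?thesis using F_AE[of v u] assms(3) by (simp add: L2_measurable)
qed

text \<open>If it failed, a subsequence would stay in the half-space of all c with E c v \<ge> E u v
  + e. This half-space is convex and closed in \<open>norm1\<close>, so by
  \<open>weakly_closed\<close> it would contain a version of u.\<close>

lemma weak_conv_upper:
  assumes X: "\<And>n::nat. X n \<in> F" and b: "\<And>n. E (X n) (X n) \<le> C"
    and u: "u \<in> F" and lim: "(\<lambda>n. L2norm m (X n - u)) \<longlonglongrightarrow> 0" and v: "v \<in> F" and e: "e > 0"
  shows "\<forall>\<^sub>F n in sequentially. E (X n) v < E u v + e"
proof (rule ccontr)
  assume "\<not> ?thesis"
  from not_eventually_sequentiallyD[OF this]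
  obtain r :: "nat \<Rightarrow> nat" where r: "strict_mono r" "\<And>n. E u v + e \<le> E (X (r n)) v" by (auto simp: not_less)
  have "\<exists>w\<in>{c \<in> F. E u v + e \<le> E c v}. AE x in m. w x = u x"
  proof (rule weakly_closed[where X = "\<lambda>n. X (r n)" and C = C])
    show "(1 / 2) *\<^sub>R (a + b) \<in> {c \<in> F. E u v + e \<le> E c v}"
      if "a \<in> {c \<in> F. E u v + e \<le> E c v}" "b \<in> {c \<in> F. E u v + e \<le> E c v}" for a b
      using that v by (simp add: EE.ip_simps)
    show "w \<in> {c \<in> F. E u v + e \<le> E c v}"
      if "\<And>n::nat. Y n \<in> {c \<in> F. E u v + e \<le> E c v}" "w \<in> F" "(\<lambda>n. norm1 D (Y n - w)) \<longlonglongrightarrow> 0"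
      for Y w
    proof -
      have Y: "Y n \<in> F" "E u v + e \<le> E (Y n) v" for n using that(1)[of n] by auto
      have "(\<lambda>n. E (Y n) v) \<longlonglongrightarrow> E w v" by (rule E_tendsto[OF Y(1) that(2) v that(3)])
      then have "E u v + e \<le> E w v" using Y(2) by (intro LIMSEQ_le_const) auto
      then show ?thesis using that(2) by simp
    qed
    show "(\<lambda>n. L2norm m (X (r n) - u)) \<longlonglongrightarrow> 0"
      using LIMSEQ_subseq_LIMSEQ[OF lim r(1)] by (simp add: o_def)
  qed (use X b u r in auto)
  then obtain w where "w \<in> F" "E u v + e \<le> E w v" "AE x in m. w x = u x" by auto
  then show False using E_AE[of w u v] u v e by simp
qed

text \<open>The lower estimate is the upper one for -v.\<close>

lemma weak_conv:
  assumes X: "\<And>n::nat. X n \<in> F" and b: "\<And>n. E (X n) (X n) \<le> C"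
    and u: "u \<in> F" and lim: "(\<lambda>n. L2norm m (X n - u)) \<longlonglongrightarrow> 0" and v: "v \<in> F"
  shows "(\<lambda>n. E (X n) v) \<longlonglongrightarrow> E u v"
proof (rule order_tendstoI)
  fix a assume "a < E u v"
  then have "\<forall>\<^sub>F n in sequentially. E (X n) (- v) < E u (- v) + (E u v - a)"
    using v by (intro weak_conv_upper[OF X b u lim]) auto
  then show "\<forall>\<^sub>F n in sequentially. a < E (X n) v"
    by eventually_elim (use X u v in \<open>simp add: EE.ip_simps\<close>)
next
  fix a assume "E u v < a"
  then have "\<forall>\<^sub>F n in sequentially. E (X n) v < E u v + (a - E u v)"
    using v by (intro weak_conv_upper[OF X b u lim]) auto
  then show "\<forall>\<^sub>F n in sequentially. E (X n) v < a" by simp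
qed

end

section \<open>Resolvents of Dirichlet forms\<close>

locale dirichlet_form = closed_form_space +
  assumes dense: "densely_defined_form D" and markov: "markov_form D"
begin

lemma F_dense: "f \<in> L2 m \<Longrightarrow> e > 0 \<Longrightarrow> \<exists>g\<in>F. L2norm m (f - g) < e"
  using dense unfolding densely_defined_form_def fun_diff_def by blast

lemma form_operator_iff:
  "(f, g) \<in> form_operator D \<longleftrightarrow> f \<in> F \<and> g \<in> L2 m \<and> (\<forall>v\<in>F. E f v = ip2 m g v)"
  by (simp add: form_operator_def ip2_def)

lemma exists_resolvent:
  assumes f: "f \<in> L2 m" and a: "0 < a"
  shows "\<exists>u\<in>F. \<forall>v\<in>F. E u v = a * ip2 m (f - u) v"
proof -
  interpret A: semi_hilbert F "Ea a" by (rule semi_hilbert_Ea[OF a])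
  have nrm_le: "L2norm m v \<le> (1 / sqrt a) * A.nrm v" if v: "v \<in> F" for v
  proof -
    have "a * ip2 m v v \<le> Ea a v v" using E_nonneg[OF v] by (simp add: Ea_def)
    then have "sqrt a * L2norm m v \<le> A.nrm v"
      using a by (simp add: A.nrm_def L2norm_def ip2_def power2_eq_square flip: real_sqrt_mult)
    then show ?thesis using a by (simp add: field_simps)
  qed
  have "\<exists>u\<in>F. \<forall>v\<in>F. Ea a u v = a * ip2 m f v"
  proof (rule A.riesz)
    show "\<bar>a * ip2 m f v\<bar> \<le> (a * L2norm m f * (1 / sqrt a)) * A.nrm v" if v: "v \<in> F" for v
    proof -
      have "\<bar>ip2 m f v\<bar> \<le> L2norm m f * L2norm m v" using f v by (intro L2.ip_cauchy_schwarz) auto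
      also have "\<dots> \<le> L2norm m f * ((1 / sqrt a) * A.nrm v)"
        using f by (intro mult_left_mono nrm_le v) auto
      finally have "a * \<bar>ip2 m f v\<bar> \<le> a * (L2norm m f * ((1 / sqrt a) * A.nrm v))"
        using a by (intro mult_left_mono) auto
      then show ?thesis using a by (simp add: abs_mult mult.assoc)
    qed
  qed (use f in \<open>simp_all add: L2.ip_simps algebra_simps\<close>)
  then show ?thesis
    using f by (auto simp: Ea_def L2.ip_simps algebra_simps)
qed

text \<open>An \<open>L2\<close> rate and an energy bound come at once from E (u - r) (u - r) \<ge>
  0 when the cross term is rewritten by the resolvent equation.\<close>

lemma F_approx_by_resolvent:
  assumes u: "u \<in> F" and r: "r \<in> F" and a: "0 < a"
    and eq: "\<And>v. v \<in> F \<Longrightarrow> E r v = a * ip2 m (u - r) v"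
  shows "a * (L2norm m (u - r))\<^sup>2 + E r r \<le> E u u"
proof -
  have "0 \<le> E (u - r) (u - r)" using u r by (intro E_nonneg) auto
  then have "E r r + 2 * E r (u - r) \<le> E u u"
    using u r by (simp add: EE.ip_simps E_sym[of u r] algebra_simps)
  moreover have "E r (u - r) = a * (L2norm m (u - r))\<^sup>2"
    using eq[of "u - r"] u r by (simp add: L2.nrm_sq)
  moreover have "0 \<le> a * (L2norm m (u - r))\<^sup>2" using a by simp
  ultimately show ?thesis by linarith
qed

sublocale M: monotone_op "L2 m" "ip2 m" "form_operator D"
  rewrites "semi_inner.nrm (ip2 m) = L2norm m"
proof -
  show "monotone_op (L2 m) (ip2 m) (form_operator D)"
  proof (unfold_locales, unfold nrm_eq_L2norm)
    fix x y x' y' :: "'a \<Rightarrow> real" and c :: real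
    assume xy: "(x, y) \<in> form_operator D"
    then show "x \<in> L2 m \<and> y \<in> L2 m" by (auto simp: form_operator_iff)
    show "(c *\<^sub>R x, c *\<^sub>R y) \<in> form_operator D"
      using xy by (auto simp: form_operator_iff EE.ip_simps L2.ip_simps)
    show "0 \<le> ip2 m x y"
      using xy E_nonneg[of x] L2.ip_sym[of x m y] by (auto simp: form_operator_iff)
    show "(x + x', y + y') \<in> form_operator D" if "(x', y') \<in> form_operator D"
      using xy that by (auto simp: form_operator_iff EE.ip_simps L2.ip_simps)
    show "(x', y') \<in> form_operator D"
      if x': "x' \<in> L2 m" "L2norm m (x' - x) = 0" and y': "y' \<in> L2 m" "L2norm m (y' - y) = 0"
    proof -
      have xF: "x \<in> F" and yL: "y \<in> L2 m" using xy by (auto simp: form_operator_iff)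
      have ae: "AE z in m. x' z = x z" using L2norm_diff_eq_0_iff[of x' m x] x' xF by simp
      have "AE z in m. x z = x' z" using ae by eventually_elim simp
      then have x'F: "x' \<in> F" by (rule F_AE[OF xF L2_measurable[OF x'(1)]])
      have "E x' v = ip2 m y' v" if v: "v \<in> F" for v
        using E_AE[OF x'F xF v ae] L2.nrm_null_ip[of y' m y v] xy y' yL v
        by (simp add: form_operator_iff)
      then show ?thesis using x'F y' by (simp add: form_operator_iff)
    qed
  next
    fix f :: "'a \<Rightarrow> real" and t :: real assume f: "f \<in> L2 m" and t: "0 < t"
    obtain u where u: "u \<in> F" "\<And>v. v \<in> F \<Longrightarrow> E u v = (1 / t) * ip2 m (f - u) v"
      using exists_resolvent[OF f, of "1 / t"] t by auto
    then show "\<exists>u. (u, (1 / t) *\<^sub>R (f - u)) \<in> form_operator D"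
      using f by (intro exI[of _ u]) (simp add: form_operator_iff L2.ip_scale)
  next
    fix f :: "'a \<Rightarrow> real" and e :: real assume f: "f \<in> L2 m" and e: "0 < e"
    obtain g where g: "g \<in> F" "L2norm m (f - g) < e / 2" using F_dense[OF f, of "e / 2"] e by auto
    \<comment> \<open>Chosen so that a times (e/2)^2 exceeds the energy of g. Elements of F
      approximate in \<open>L2\<close>, and resolvents approximate elements of F at this
      rate.\<close>
    define a where "a = (E g g + 1) * (4 / e\<^sup>2)"
    have a: "a > 0" using E_nonneg[OF g(1)] e by (simp add: a_def add_nonneg_pos)
    obtain u where u: "u \<in> F" "\<And>v. v \<in> F \<Longrightarrow> E u v = a * ip2 m (g - u) v"
      using exists_resolvent[of g a] a g by auto
    have "a * (L2norm m (g - u))\<^sup>2 \<le> E g g"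
      using F_approx_by_resolvent[OF g(1) u(1) a u(2)] E_nonneg[OF u(1)] by simp
    also have "\<dots> < E g g + 1" by simp
    also have "E g g + 1 = a * (e / 2)\<^sup>2" using e by (simp add: a_def power2_eq_square)
    finally have "(L2norm m (g - u))\<^sup>2 < (e / 2)\<^sup>2" using a by simp
    then have "L2norm m (g - u) < e / 2" by (rule power2_less_imp_less) (use e in simp)
    then have "L2norm m (f - u) < e"
      using L2.nrm_triangle_diff[of f m g u] f g u by simp
    moreover have "(u, a *\<^sub>R (g - u)) \<in> form_operator D"
      using u g by (simp add: form_operator_iff L2.ip_scale)
    ultimately show "\<exists>u g. (u, g) \<in> form_operator D \<and> L2norm m (f - u) < e" by blast
  qed
qed (rule nrm_eq_L2norm)

text \<open>The resolvent a (H + a)^-1, normalized to be a contraction that keeps upper bounds by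
  nonnegative constants; it is the Euler step of length 1 / a.\<close>

definition R :: "real \<Rightarrow> ('a \<Rightarrow> real) \<Rightarrow> 'a \<Rightarrow> real" where
  "R a f = M.J (1 / a) f"

lemma
  assumes "f \<in> L2 m" "0 < a"
  shows R_F [simp]: "R a f \<in> F"
    and R_eq: "v \<in> F \<Longrightarrow> E (R a f) v = a * ip2 m (f - R a f) v"
  using M.J_in_A[of f "1 / a"] assms
  by (auto simp: R_def form_operator_iff L2.ip_scale)

lemma R_unique:
  assumes "f \<in> L2 m" "0 < a" "u \<in> F" "\<And>v. v \<in> F \<Longrightarrow> E u v = a * ip2 m (f - u) v"
  shows "AE x in m. R a f x = u x"
proof -
  have "(u, a *\<^sub>R (f - u)) \<in> form_operator D"
    using assms by (simp add: form_operator_iff L2.ip_scale)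
  from M.nrm_J_diff[OF this, of f "1 / a"] have "L2norm m (R a f - u) \<le> L2norm m (f - u - (1 / a) *\<^sub>R a *\<^sub>R (f - u))"
    using assms by (simp add: R_def)
  also have "\<dots> = L2norm m 0" using assms by simp
  finally have "L2norm m (R a f - u) = 0" using assms by (simp add: antisym)
  then show ?thesis using L2norm_diff_eq_0_iff[of "R a f" m u] assms by simp
qed

lemma R_linear:
  assumes "f \<in> L2 m" "g \<in> L2 m" "0 < a"
  shows "AE x in m. R a (f + c *\<^sub>R g) x = R a f x + c * R a g x"
proof -
  have "L2norm m (R a (f + c *\<^sub>R g) - (R a f + c *\<^sub>R R a g)) = 0"
    using M.J_linear[of f g "1 / a" c] assms by (simp add: R_def)
  then have "AE x in m. R a (f + c *\<^sub>R g) x = (R a f + c *\<^sub>R R a g) x"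
    using L2norm_diff_eq_0_iff[of "R a (f + c *\<^sub>R g)" m "R a f + c *\<^sub>R R a g"] assms by simp
  then show ?thesis by (simp add: fun_ops)
qed

lemma R_diff:
  assumes "f \<in> L2 m" "g \<in> L2 m" "0 < a"
  shows "AE x in m. R a (f - g) x = R a f x - R a g x"
  using R_linear[OF assms, of "-1"] by simp

text \<open>\<open>R a f\<close> is the unique minimizer of \<open>E w w + a \<parallel>w - f\<parallel>\<^sup>2\<close>, and contracting it towards \<open>f\<close> does not
  increase this functional.\<close>

lemma R_contraction_fixed:
  assumes f: "f \<in> L2 m" and a: "0 < a"
    and T: "\<And>s t. \<bar>T s - T t\<bar> \<le> \<bar>s - t\<bar>" "T 0 = (0::real)"
    and Tf: "AE x in m. T (f x) = f x"
  shows "AE x in m. T (R a f x) = R a f x"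
proof -
  define u where "u = R a f"
  define w where "w = T \<circ> u"
  have u: "u \<in> F" and ueq: "\<And>v. v \<in> F \<Longrightarrow> E u v = a * ip2 m (f - u) v"
    using R_F R_eq f a by (auto simp: u_def)
  have w: "w \<in> F" and wu: "E w w \<le> E u u"
    using markov T u unfolding markov_form_def w_def by blast+
  have "AE x in m. \<bar>(w - f) x\<bar> \<le> \<bar>(u - f) x\<bar>"
    using Tf
  proof eventually_elim
    case (elim x)
    then show ?case using T(1)[of "u x" "f x"] by (simp add: w_def fun_ops)
  qed
  then have "L2norm m (w - f) \<le> L2norm m (u - f)"
    using u w f by (intro L2norm_mono) auto
  then have "(L2norm m (w - f))\<^sup>2 \<le> (L2norm m (u - f))\<^sup>2"
    using w f by (intro power_mono) auto
  then have "E w w + a * ip2 m (w - f) (w - f) \<le> E u u + a * ip2 m (u - f) (u - f)"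
    using wu a u w f by (simp add: L2.nrm_sq add_mono)
  \<comment> \<open>The functional is quadratic with critical point u, so its excess at w is exactly
    \<open>Ea a\<close> of w - u with itself.\<close>
  moreover have "E w w + a * ip2 m (w - f) (w - f) - (E u u + a * ip2 m (u - f) (u - f)) =
      E (w - u) (w - u) + a * ip2 m (w - u) (w - u)"
  proof -
    have 1: "E w w = E u u + 2 * E u (w - u) + E (w - u) (w - u)"
      using u w by (simp add: EE.ip_simps E_sym[of w u] algebra_simps)
    have 2: "ip2 m (w - f) (w - f) = ip2 m (u - f) (u - f) + 2 * ip2 m (u - f) (w - u) + ip2 m (w - u) (w - u)"
      using u w f by (simp add: L2.ip_simps L2.ip_sym[of w m u] L2.ip_sym[of f m u] L2.ip_sym[of f m w] algebra_simps)
    have 3: "E u (w - u) = - a * ip2 m (u - f) (w - u)"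
      using ueq[of "w - u"] u w f by (simp add: L2.ip_simps algebra_simps)
    show ?thesis unfolding 1 2 3 by (simp add: algebra_simps)
  qed
  ultimately have "a * ip2 m (w - u) (w - u) \<le> 0"
    using E_nonneg[of "w - u"] u w by simp
  then have "ip2 m (w - u) (w - u) = 0"
    using a L2.ip_nonneg[of "w - u" m] u w by (simp add: mult_le_0_iff)
  then have "L2norm m (w - u) = 0" using L2.nrm_sq[of "w - u" m] u w by simp
  then have "AE x in m. w x = u x" using L2norm_diff_eq_0_iff[of w m u] u w by simp
  then show ?thesis by (simp add: w_def u_def)
qed

lemma R_nonneg:
  assumes "f \<in> L2 m" "0 < a" "AE x in m. 0 \<le> f x"
  shows "AE x in m. 0 \<le> R a f x"
proof -
  have "AE x in m. \<bar>R a f x\<bar> = R a f x"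
  proof (rule R_contraction_fixed[OF assms(1,2), where T = abs])
    show "AE x in m. \<bar>f x\<bar> = f x" using assms(3) by eventually_elim simp
  qed auto
  then show ?thesis by eventually_elim (metis abs_ge_zero)
qed

lemma R_le_const:
  assumes "f \<in> L2 m" "0 < a" "0 \<le> c" "AE x in m. f x \<le> c"
  shows "AE x in m. R a f x \<le> c"
proof -
  have "AE x in m. min (R a f x) c = R a f x"
  proof (rule R_contraction_fixed[OF assms(1,2), where T = "\<lambda>s. min s c"])
    show "AE x in m. min (f x) c = f x" using assms(4) by eventually_elim simp
  qed (use assms in auto)
  then show ?thesis by eventually_elim (metis min.cobounded2)
qed

lemma R_mono:
  assumes "f \<in> L2 m" "g \<in> L2 m" "0 < a" "AE x in m. f x \<le> g x"
  shows "AE x in m. R a f x \<le> R a g x"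
proof -
  have "AE x in m. 0 \<le> (g - f) x" using assms(4) by eventually_elim (simp add: fun_ops)
  then have "AE x in m. 0 \<le> R a (g - f) x" using assms by (intro R_nonneg) auto
  then show ?thesis using R_diff[OF assms(2,1,3)] by eventually_elim simp
qed

lemma R_abs_le:
  assumes "f \<in> L2 m" "0 < a" "AE x in m. \<bar>f x\<bar> \<le> c"
  shows "AE x in m. \<bar>R a f x\<bar> \<le> c"
proof (cases "0 \<le> c")
  case True
  have "AE x in m. f x \<le> c" using assms(3) by eventually_elim simp
  then have 1: "AE x in m. R a f x \<le> c" using assms True by (intro R_le_const) auto
  have "AE x in m. (- f) x \<le> c" using assms(3) by eventually_elim (simp add: fun_ops)
  then have "AE x in m. R a (- f) x \<le> c" using assms True by (intro R_le_const) auto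
  moreover have "AE x in m. R a (0 - f) x = R a 0 x - R a f x" using assms by (intro R_diff) auto
  moreover have "AE x in m. R a 0 x = 0"
    using R_unique[of 0 a 0] assms by (auto simp: L2.ip_simps fun_ops)
  ultimately show ?thesis using 1 by eventually_elim (auto simp: abs_le_iff)
next
  case False
  from assms(3) show ?thesis by eventually_elim (use False in linarith)
qed

lemma R_approx:
  assumes "u \<in> F" "0 < a"
  shows "a * (L2norm m (u - R a u))\<^sup>2 + E (R a u) (R a u) \<le> E u u"
  using assms by (intro F_approx_by_resolvent) (auto simp: R_eq)

lemma R_tendsto:
  assumes u: "u \<in> F" and a: "\<And>n. 0 < a n" "filterlim a at_top sequentially"
  shows "(\<lambda>n. L2norm m (R (a n) u - u)) \<longlonglongrightarrow> 0"
proof -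
  have "(\<lambda>n. sqrt (E u u / a n)) \<longlonglongrightarrow> sqrt 0"
    by (intro tendsto_real_sqrt tendsto_divide_0[OF tendsto_const] filterlim_at_top_imp_at_infinity a)
  then have lim: "(\<lambda>n. sqrt (E u u / a n)) \<longlonglongrightarrow> 0" by simp
  show ?thesis
  proof (rule Lim_null_comparison[OF _ lim], intro always_eventually allI)
    fix n
    have "(L2norm m (R (a n) u - u))\<^sup>2 \<le> E u u / a n"
      using R_approx[OF u a(1)[of n]] E_nonneg[of "R (a n) u"] u a(1)[of n]
      by (simp add: L2.nrm_diff_commute[of u] field_simps)
    then show "norm (L2norm m (R (a n) u - u)) \<le> sqrt (E u u / a n)"
      using u a(1)[of n] by (simp add: real_le_rsqrt)
  qed
qed

text \<open>By the resolvent equation the left side is E (R u) v. The resolvents of u have energy at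
  most that of u and converge to u in \<open>L2\<close>, which is enough for
  \<open>weak_conv\<close>.\<close>

lemma E_approx_tendsto:
  assumes u: "u \<in> F" and v: "v \<in> F" and a: "\<And>n. 0 < a n" "filterlim a at_top sequentially"
  shows "(\<lambda>n. a n * ip2 m (u - R (a n) u) v) \<longlonglongrightarrow> E u v"
proof -
  have "(\<lambda>n. E (R (a n) u) v) \<longlonglongrightarrow> E u v"
  proof (rule weak_conv[OF _ _ u R_tendsto[OF u a] v])
    show "R (a n) u \<in> F" for n using u a by simp
    show "E (R (a n) u) (R (a n) u) \<le> E u u" for n
    proof -
      have "0 \<le> a n * (L2norm m (u - R (a n) u))\<^sup>2" using a(1)[of n] by simp
      then show ?thesis using R_approx[OF u a(1)[of n]] by linarith
    qed
  qed
  then show ?thesis using u v a by (simp add: R_eq)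
qed

text \<open>The approximating form splits into E (R u) (R u) and a times the squared distance of R u
  to u. A bound on it bounds the energies and also forces convergence in \<open>L2\<close>, and F is
  closed under such limits.\<close>

lemma F_of_E_approx_bounded:
  assumes u: "u \<in> L2 m" and a: "\<And>n. 0 < a n" "filterlim a at_top sequentially"
    and b: "\<And>n. a n * ip2 m (u - R (a n) u) u \<le> C"
  shows "u \<in> F"
proof -
  have key: "E (R (a n) u) (R (a n) u) + a n * (L2norm m (R (a n) u - u))\<^sup>2 \<le> C" for n
  proof -
    have r: "R (a n) u \<in> F" using u a by simp
    have 1: "ip2 m (u - R (a n) u) u =
        ip2 m (u - R (a n) u) (R (a n) u) + ip2 m (u - R (a n) u) (u - R (a n) u)"
      using u r by (simp add: L2.ip_simps algebra_simps)
    have 2: "a n * ip2 m (u - R (a n) u) (R (a n) u) = E (R (a n) u) (R (a n) u)"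
      using R_eq[OF u a(1) r] by simp
    have 3: "ip2 m (u - R (a n) u) (u - R (a n) u) = (L2norm m (R (a n) u - u))\<^sup>2"
      using u r by (simp add: L2.nrm_sq[symmetric] L2.nrm_diff_commute[of u])
    show ?thesis using b[of n] unfolding 1 distrib_left 2 3 .
  qed
  have E_le: "E (R (a n) u) (R (a n) u) \<le> C" for n
  proof -
    have "0 \<le> a n * (L2norm m (R (a n) u - u))\<^sup>2" using a(1)[of n] by simp
    then show ?thesis using key[of n] by linarith
  qed
  have "(\<lambda>n. sqrt (C / a n)) \<longlonglongrightarrow> sqrt 0"
    by (intro tendsto_real_sqrt tendsto_divide_0[OF tendsto_const] filterlim_at_top_imp_at_infinity a)
  then have lim: "(\<lambda>n. sqrt (C / a n)) \<longlonglongrightarrow> 0" by simp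
  have "(\<lambda>n. L2norm m (R (a n) u - u)) \<longlonglongrightarrow> 0"
  proof (rule Lim_null_comparison[OF _ lim], intro always_eventually allI)
    fix n
    have "(L2norm m (R (a n) u - u))\<^sup>2 \<le> C / a n"
      using key[of n] E_nonneg[of "R (a n) u"] u a(1)[of n] by (simp add: field_simps)
    then show "norm (L2norm m (R (a n) u - u)) \<le> sqrt (C / a n)"
      using u a(1)[of n] by (simp add: real_le_rsqrt)
  qed
  from F_weakly_closed[OF _ E_le u this] show ?thesis using u a by simp
qed

end

section \<open>The heat semigroup\<close>

lemma L2_limit_AE_le:
  assumes X: "\<And>n::nat. X n \<in> L2 m" and f: "f \<in> L2 m" and g: "g \<in> borel_measurable m"
    and lim: "(\<lambda>n. L2norm m (X n - f)) \<longlonglongrightarrow> 0" and le: "\<And>n. AE x in m. X n x \<le> g x"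
  shows "AE x in m. f x \<le> g x"
proof -
  define h where "h x = max (f x - g x) 0" for x
  have hm: "h \<in> borel_measurable m"
    unfolding h_def using L2_measurable[OF f] g by measurable
  have h_le: "AE x in m. \<bar>h x\<bar> \<le> \<bar>(X n - f) x\<bar>" for n
    using le[of n] by eventually_elim (auto simp: h_def fun_ops)
  have h: "h \<in> L2 m" by (rule L2_bound[of h m "X 0 - f"]) (use hm h_le[of 0] X f in auto)
  have "L2norm m h \<le> L2norm m (X n - f)" for n using h X f h_le by (intro L2norm_mono) auto
  then have "L2norm m h \<le> 0" using lim by (intro LIMSEQ_le_const) auto
  then have "L2norm m h = 0" using h by (simp add: antisym)
  then have "AE x in m. h x = 0" using L2norm_eq_0_iff[OF h] by simp
  then show ?thesis by eventually_elim (auto simp: h_def max_def split: if_splits)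
qed

lemma L2_indicator_finite:
  assumes "A \<in> sets m" "emeasure m A < \<infinity>"
  shows "(indicator A :: 'a \<Rightarrow> real) \<in> L2 m"
proof -
  have "(indicator A x)\<^sup>2 = (indicator A x :: real)" for x by (simp add: indicator_def)
  then show ?thesis using assms by (simp add: L2_def)
qed

text \<open>For \<open>g \<in> L\<^sup>2\<close> and \<open>c \<ge> 0\<close> the superlevel sets of \<open>g\<close> above \<open>c\<close> have finite measure.\<close>

lemma L2_AE_le_constI:
  assumes g: "g \<in> L2 m" and c: "0 \<le> c" and N: "N \<in> sets m"
    and le: "\<And>A. A \<in> sets m \<Longrightarrow> A \<subseteq> N \<Longrightarrow> emeasure m A < \<infinity> \<Longrightarrow> ip2 m g (indicator A) \<le> c * measure m A"
  shows "AE x in m. x \<in> N \<longrightarrow> g x \<le> c"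
proof -
  note [measurable] = L2_measurable[OF g] N
  have null: "AE x in m. x \<in> N \<longrightarrow> g x < c + 1 / Suc n" for n
  proof -
    define d where "d = 1 / real (Suc n)"
    have d: "d > 0" by (simp add: d_def)
    define A where "A = {x \<in> space m. x \<in> N \<and> c + d \<le> g x}"
    have A[measurable]: "A \<in> sets m" unfolding A_def by measurable
    have AN: "A \<subseteq> N" by (auto simp: A_def)
    have le_sq: "indicator A x \<le> ennreal ((1 / d)\<^sup>2 * (g x)\<^sup>2)" for x
    proof (cases "x \<in> A")
      case True
      then have "d \<le> g x" using c d by (simp add: A_def)
      then have "1 \<le> (1 / d) * g x" using d by simp
      then have "1 \<le> ((1 / d) * g x)\<^sup>2" by (rule one_le_power)
      then have "ennreal 1 \<le> ennreal ((1 / d)\<^sup>2 * (g x)\<^sup>2)" unfolding power_mult_distrib by (rule ennreal_leI)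
      then show ?thesis using True by simp
    qed simp
    have "emeasure m A = (\<integral>\<^sup>+x. indicator A x \<partial>m)" by simp
    also have "\<dots> \<le> (\<integral>\<^sup>+x. ennreal ((1 / d)\<^sup>2 * (g x)\<^sup>2) \<partial>m)" by (intro nn_integral_mono le_sq)
    also have "\<dots> = ennreal (\<integral>x. (1 / d)\<^sup>2 * (g x)\<^sup>2 \<partial>m)"
      using L2_integrable_sq[OF g] by (intro nn_integral_eq_integral integrable_mult_right) auto
    finally have fin: "emeasure m A < \<infinity>" by (rule le_less_trans) simp
    have iA: "(indicator A :: 'a \<Rightarrow> real) \<in> L2 m" by (rule L2_indicator_finite[OF A fin])
    have "(c + d) * measure m A = (\<integral>x. (c + d) * indicator A x \<partial>m)" using A fin by simp
    also have "\<dots> \<le> ip2 m g (indicator A)"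
      unfolding ip2_def
    proof (rule integral_mono)
      show "integrable m (\<lambda>x. g x * indicator A x)" by (intro L2_mult_integrable g iA)
      show "integrable m (\<lambda>x. (c + d) * indicator A x :: real)" using fin A by simp
      show "(c + d) * indicator A x \<le> g x * indicator A x" for x
        by (cases "x \<in> A") (auto simp: A_def)
    qed
    also have "\<dots> \<le> c * measure m A" by (rule le[OF A AN fin])
    finally have "measure m A \<le> 0" using d by (simp add: distrib_right mult_le_0_iff not_less)
    then have "measure m A = 0" by (simp add: antisym)
    then have "emeasure m A = 0" using fin by (simp add: emeasure_eq_ennreal_measure)
    then have "AE x in m. x \<notin> A" using A by (intro AE_not_in) (auto simp: null_sets_def)
    moreover have "AE x in m. x \<in> space m" by (rule AE_space)
    ultimately show ?thesis by eventually_elim (auto simp: A_def d_def)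
  qed
  then have "AE x in m. \<forall>n. x \<in> N \<longrightarrow> g x < c + 1 / Suc n" by (subst AE_all_countable) blast
  then show ?thesis
  proof eventually_elim
    case (elim x)
    show ?case
    proof
      assume "x \<in> N"
      then have lt: "g x \<le> c + 1 / Suc n" for n using elim by (simp add: less_imp_le)
      have "(\<lambda>n. c + 1 / Suc n) \<longlonglongrightarrow> c + 0" by (intro tendsto_intros LIMSEQ_Suc lim_1_over_n)
      then show "g x \<le> c" using lt by (intro LIMSEQ_le_const[of _ "c"]) auto
    qed
  qed
qed

lemma exp_set_integral:
  assumes b: "(0::real) < b"
  shows "set_integrable lborel {0<..} (\<lambda>t. exp (- b * t))"
    and "(LBINT t:{0<..}. exp (- b * t)) = 1 / b"
proof -
  have A: "(((\<lambda>t. - exp (- b * t) / b) \<circ> real_of_ereal) \<longlongrightarrow> - 1 / b) (at_right 0)"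
  proof -
    have "((\<lambda>t. - exp (- b * t) / b) \<longlongrightarrow> - exp (- b * 0) / b) (at_right 0)"
      by (intro tendsto_intros) (use b in auto)
    then show ?thesis unfolding zero_ereal_def ereal_tendsto_simps by simp
  qed
  have B: "(((\<lambda>t. - exp (- b * t) / b) \<circ> real_of_ereal) \<longlongrightarrow> 0) (at_left \<infinity>)"
  proof -
    have "((\<lambda>t. - exp (- b * t) / b) \<longlongrightarrow> - 0 / b) at_top"
    proof (intro tendsto_intros)
      have "filterlim (\<lambda>t. b * t) at_top at_top"
        by (rule filterlim_tendsto_pos_mult_at_top[OF tendsto_const b filterlim_ident])
      then have "((\<lambda>t. exp (- (b * t))) \<longlongrightarrow> 0) at_top"
        by (intro filterlim_compose[OF exp_at_bot] filterlim_compose[OF filterlim_uminus_at_bot_at_top])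
      then show "((\<lambda>t. exp (- b * t)) \<longlongrightarrow> 0) at_top" by simp
    qed (use b in auto)
    then show ?thesis unfolding ereal_tendsto_simps by simp
  qed
  have D: "DERIV (\<lambda>t. - exp (- b * t) / b) x :> exp (- b * x)" for x
    using b by (auto intro!: derivative_eq_intros)
  have e: "einterval 0 \<infinity> = {0<..}" by (auto simp: einterval_def)
  note I = interval_integral_FTC_nonneg[of 0 \<infinity> "\<lambda>t. - exp (- b * t) / b" "\<lambda>t. exp (- b * t)", OF _ D _ _ A B]
  show "set_integrable lborel {0<..} (\<lambda>t. exp (- b * t))"
    using I(1) by (simp add: e)
  show "(LBINT t:{0<..}. exp (- b * t)) = 1 / b"
    using I(2) by (simp add: interval_lebesgue_integral_def e)
qed

section \<open>Identification of \<open>heat\<close> with the constructed semigroup\<close>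

context dirichlet_form
begin

abbreviation "S \<equiv> M.S"

lemma S_AE_eq:
  assumes "f \<in> L2 m" "g \<in> L2 m" "0 \<le> t" "AE x in m. f x = g x"
  shows "AE x in m. S t f x = S t g x"
  using M.S_null[of f g t] assms L2norm_diff_eq_0_iff[of f m g] L2norm_diff_eq_0_iff[of "S t f" m "S t g"]
  by simp

lemma S_AE_linear:
  assumes "f \<in> L2 m" "g \<in> L2 m" "0 \<le> t"
  shows "AE x in m. S t (f + c *\<^sub>R g) x = S t f x + c * S t g x"
  using M.S_linear[of f g t c] assms L2norm_diff_eq_0_iff[of "S t (f + c *\<^sub>R g)" m "S t f + c *\<^sub>R S t g"]
  by (simp add: fun_ops)

lemma S_AE_diff:
  assumes "f \<in> L2 m" "g \<in> L2 m" "0 \<le> t"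
  shows "AE x in m. S t (f - g) x = S t f x - S t g x"
  using S_AE_linear[OF assms, of "-1"] by simp

lemma S_AE_add:
  assumes "f \<in> L2 m" "0 \<le> s" "0 \<le> t"
  shows "AE x in m. S (s + t) f x = S s (S t f) x"
  using M.S_add[of f s t] assms L2norm_diff_eq_0_iff[of "S (s + t) f" m "S s (S t f)"] by simp

lemma S_AE_zero: "f \<in> L2 m \<Longrightarrow> AE x in m. S 0 f x = f x"
  using M.S_zero[of f] L2norm_diff_eq_0_iff[of "S 0 f" m f] by simp

lemma generator_eq_gen: "generator m P = L2.gen m P"
proof -
  have "(\<lambda>x. (P t f x - f x) / t - g x) = (1 / t) *\<^sub>R (P t f - f) - g" for t f g
    by (simp add: fun_eq_iff fun_ops)
  then show ?thesis by (simp add: generator_def L2.gen_def)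
qed

lemma generator_S: "generator m S = {(f, \<lambda>x. - g x) |f g. (f, g) \<in> form_operator D}"
proof -
  have "(\<lambda>x. - g x) = - g" for g :: "'a \<Rightarrow> real" by (simp add: fun_eq_iff)
  then show ?thesis
    unfolding generator_eq_gen using M.gen_S_iff
    by auto (metis minus_minus)
qed

lemma C0_semigroup_S: "C0_semigroup m S"
proof -
  have add: "AE x in m. S t (\<lambda>y. f y + g y) x = S t f x + S t g x" if "0 \<le> t" "f \<in> L2 m" "g \<in> L2 m" for t f g
    using S_AE_linear[of f g t 1] that by (simp add: plus_fun_def)
  have scale: "AE x in m. S t (\<lambda>y. c * f y) x = c * S t f x" if t: "0 \<le> t" and f: "f \<in> L2 m" for t f c
  proof -
    have "AE x in m. S t 0 x = 0"
      using M.nrm_S_le[of 0 t] t L2norm_eq_0_iff[of "S t 0" m] by (simp add: antisym)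
    moreover have eq: "0 + c *\<^sub>R f = (\<lambda>y. c * f y)" by (simp add: fun_eq_iff fun_ops)
    have "AE x in m. S t (0 + c *\<^sub>R f) x = S t 0 x + c * S t f x"
      using t f by (intro S_AE_linear) auto
    ultimately show ?thesis unfolding eq by eventually_elim simp
  qed
  have cont: "((\<lambda>t. L2norm m (\<lambda>x. S t f x - f x)) \<longlongrightarrow> 0) (at_right 0)" if "f \<in> L2 m" for f
    using M.S_cont_zero[OF that] by (simp only: fun_diff_def)
  have bdd: "\<exists>C. \<forall>f\<in>L2 m. L2norm m (S t f) \<le> C * L2norm m f" if "0 \<le> t" for t
    using M.nrm_S_le that by (intro exI[of _ 1]) simp
  show ?thesis
    unfolding C0_semigroup_def
    by (intro conjI allI ballI impI) (rule M.S_in S_AE_eq add scale bdd S_AE_zero S_AE_add cont; assumption)+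
qed

lemma c0_semigroup_of_C0:
  assumes P: "C0_semigroup m P"
  shows "c0_semigroup (L2 m) (ip2 m) P"
proof -
  have P1: "P t f \<in> L2 m" if "0 \<le> t" "f \<in> L2 m" for t f using P that by (auto simp: C0_semigroup_def)
  have P3: "AE x in m. P t (f + g) x = P t f x + P t g x" if "0 \<le> t" "f \<in> L2 m" "g \<in> L2 m" for t f g
    using P that unfolding C0_semigroup_def plus_fun_def by blast
  have P4: "AE x in m. P t (c *\<^sub>R f) x = c * P t f x" if "0 \<le> t" "f \<in> L2 m" for t f c
    using P that unfolding C0_semigroup_def scaleR_fun_def real_scaleR_def by blast
  show ?thesis
  proof (unfold_locales, unfold nrm_eq_L2norm)
    fix t s c :: real and f g :: "'a \<Rightarrow> real" assume f: "f \<in> L2 m"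
    show "L2norm m (P 0 f - f) = 0"
      using P f P1[of 0 f] L2norm_diff_eq_0_iff[of "P 0 f" m f] by (simp add: C0_semigroup_def)
    show "((\<lambda>t. L2norm m (P t f - f)) \<longlongrightarrow> 0) (at_right 0)"
      using P f unfolding C0_semigroup_def fun_diff_def by blast
    assume t: "0 \<le> t"
    show "P t f \<in> L2 m" using P1 t f by simp
    show "L2norm m (P t (f + c *\<^sub>R g) - (P t f + c *\<^sub>R P t g)) = 0" if g: "g \<in> L2 m"
    proof -
      have "AE x in m. P t (f + c *\<^sub>R g) x = (P t f + c *\<^sub>R P t g) x"
        using P3[OF t f L2.scale_in[OF g], of c] P4[OF t g, of c] by eventually_elim (simp add: fun_ops)
      then show ?thesis
        using P1 t f g L2norm_diff_eq_0_iff[of "P t (f + c *\<^sub>R g)" m "P t f + c *\<^sub>R P t g"] by simp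
    qed
    assume s: "0 \<le> s"
    show "L2norm m (P (t + s) f - P t (P s f)) = 0"
      using P f s t P1 L2norm_diff_eq_0_iff[of "P (t + s) f" m "P t (P s f)"]
      by (simp add: C0_semigroup_def)
  next
    fix t :: real assume t: "0 \<le> t"
    show "\<exists>C. \<forall>f\<in>L2 m. L2norm m (P t f) \<le> C * L2norm m f"
      using P t unfolding C0_semigroup_def by blast
  qed
qed

text \<open>\<open>S\<close> has the property by which \<open>heat_L2\<close> is selected, so the
  \<open>SOME\<close> picks some semigroup with the same generator, and by uniqueness it agrees with
  \<open>S\<close>.\<close>

lemma heat_L2_AE_eq:
  assumes f: "f \<in> L2 m" and t: "0 \<le> t"
  shows "AE x in m. heat_L2 D t f x = S t f x"
proof -
  let ?Q = "\<lambda>P. C0_semigroup m P \<and> generator m P = {(f, \<lambda>x. - g x) |f g. (f, g) \<in> form_operator D}"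
  have "?Q S" using C0_semigroup_S generator_S by simp
  then have Q: "?Q (heat_L2 D)" unfolding heat_L2_def by (rule someI[of ?Q])
  interpret P: c0_semigroup "L2 m" "ip2 m" "heat_L2 D" using Q by (intro c0_semigroup_of_C0) simp
  have "(\<lambda>x. - g x) = - g" for g :: "'a \<Rightarrow> real" by (simp add: fun_eq_iff)
  then have gen: "L2.gen m (heat_L2 D) = {(x, - y) |x y. (x, y) \<in> form_operator D}"
    using Q by (simp add: generator_eq_gen)
  interpret GP: generated_semigroup "L2 m" "ip2 m" "form_operator D" "heat_L2 D"
    by unfold_locales (rule gen)
  have "L2norm m (heat_L2 D t f - S t f) = 0"
    using GP.P_eq_S[OF f t] by (simp add: nrm_eq_L2norm)
  then show ?thesis using L2norm_diff_eq_0_iff[OF P.P_in[OF t f] M.S_in[OF f t]] by blast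
qed

lemma heat_L2_in: "f \<in> L2 m \<Longrightarrow> 0 \<le> t \<Longrightarrow> heat_L2 D t f \<in> L2 m"
proof -
  assume f: "f \<in> L2 m" and t: "0 \<le> t"
  let ?Q = "\<lambda>P. C0_semigroup m P \<and> generator m P = {(f, \<lambda>x. - g x) |f g. (f, g) \<in> form_operator D}"
  have "?Q S" using C0_semigroup_S generator_S by simp
  then have "?Q (heat_L2 D)" unfolding heat_L2_def by (rule someI[of ?Q])
  then have "c0_semigroup (L2 m) (ip2 m) (heat_L2 D)" by (intro c0_semigroup_of_C0) simp
  from c0_semigroup.P_in[OF this t f] show ?thesis .
qed

text \<open>A sequence increasing to a limit in \<open>L2\<close> converges in norm by dominated
  convergence, so the images converge in norm to \<open>S t f\<close>, whichever sequence was
  chosen.\<close>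

lemma heat_pos_ext_unique:
  assumes f: "f \<in> L2 m" and t: "0 \<le> t" and g: "heat_pos_ext D t f g"
  shows "AE x in m. g x = S t f x"
proof -
  obtain u :: "nat \<Rightarrow> 'a \<Rightarrow> real" where u: "\<And>n. u n \<in> L2 m"
    and mono: "AE x in m. \<forall>n. 0 \<le> u n x \<and> u n x \<le> u (Suc n) x"
    and lim: "AE x in m. (\<lambda>n. u n x) \<longlonglongrightarrow> f x"
    and limg: "AE x in m. (\<lambda>n. heat_L2 D t (u n) x) \<longlonglongrightarrow> g x"
    and gm: "g \<in> borel_measurable m"
    using g unfolding heat_pos_ext_def by blast
  have le: "AE x in m. \<bar>u n x\<bar> \<le> \<bar>f x\<bar>" for n
    using mono lim
  proof eventually_elim
    case (elim x)
    have "incseq (\<lambda>n. u n x)" using elim(1) by (simp add: incseq_SucI)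
    then have "u n x \<le> f x" using elim(2) by (rule incseq_le)
    then show ?case using elim(1) by (smt (verit))
  qed
  have "(\<lambda>n. L2norm m (u n - f)) \<longlonglongrightarrow> 0"
    by (rule L2_dominated_convergence(2)[OF L2_measurable[OF u] L2_measurable[OF f] L2_abs[OF f] le lim])
  then have "(\<lambda>n. L2norm m (S t (u n) - S t f)) \<longlonglongrightarrow> 0"
    by (rule Lim_null_comparison[rotated]) (use M.S_contr u f t in \<open>auto intro!: always_eventually\<close>)
  moreover have "AE x in m. (\<lambda>n. S t (u n) x) \<longlonglongrightarrow> g x"
  proof -
    have "AE x in m. \<forall>n. heat_L2 D t (u n) x = S t (u n) x"
      using heat_L2_AE_eq[OF u t] by (simp add: AE_all_countable)
    then show ?thesis using limg by eventually_elim simp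
  qed
  ultimately have "AE x in m. S t f x = g x"
    using u f t gm by (intro L2_limit_AE_eq[where X = "\<lambda>n. S t (u n)"]) auto
  then show ?thesis by eventually_elim simp
qed

lemma heat_pos_ext_exists:
  assumes f: "f \<in> L2 m" and t: "0 \<le> t" and pos: "\<And>x. 0 \<le> f x"
  shows "heat_pos_ext D t f (heat_L2 D t f)"
  unfolding heat_pos_ext_def
  using f t pos heat_L2_in[OF f t] by (intro conjI exI[of _ "\<lambda>n. f"]) (auto simp: L2_measurable)

text \<open>The \<open>SOME\<close> in \<open>heat\<close> is harmless once some pair of monotone
  limits exists; for f in \<open>L2\<close> constant sequences provide one.\<close>

theorem heat_AE_eq:
  assumes f: "f \<in> L2 m" and t: "0 \<le> t"
  shows "AE x in m. heat D t f x = S t f x"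
proof -
  let ?p = "\<lambda>x. max (f x) 0" and ?q = "\<lambda>x. max (- f x) 0"
  have "- f \<in> L2 m" using f by simp
  then have pq: "?p \<in> L2 m" "?q \<in> L2 m" using L2_max0[OF f] L2_max0[of "- f" m] by (simp_all add: fun_ops)
  have ex: "\<exists>g p q. heat_pos_ext D t ?p p \<and> heat_pos_ext D t ?q q \<and> g = (\<lambda>x. p x - q x)"
    using heat_pos_ext_exists[OF pq(1) t] heat_pos_ext_exists[OF pq(2) t] by auto
  obtain p q where p: "heat_pos_ext D t ?p p" and q: "heat_pos_ext D t ?q q"
    and eq: "heat D t f = (\<lambda>x. p x - q x)"
    using someI_ex[OF ex] unfolding heat_def by blast
  have "f = ?p - ?q" by (auto simp: fun_eq_iff fun_ops max_def)
  then have "AE x in m. S t f x = S t ?p x - S t ?q x" using S_AE_diff[OF pq t] by simp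
  then show ?thesis
    using heat_pos_ext_unique[OF pq(1) t p] heat_pos_ext_unique[OF pq(2) t q]
    by eventually_elim (simp add: eq)
qed

lemma J_AE_le_const:
  assumes "f \<in> L2 m" "0 \<le> t" "0 \<le> c" "AE x in m. f x \<le> c"
  shows "AE x in m. M.J t f x \<le> c"
  using R_le_const[of f "1 / t" c] assms by (cases "t = 0") (auto simp: R_def)

lemma J_AE_mono:
  assumes "f \<in> L2 m" "g \<in> L2 m" "0 \<le> t" "AE x in m. f x \<le> g x"
  shows "AE x in m. M.J t f x \<le> M.J t g x"
  using R_mono[of f g "1 / t"] assms by (cases "t = 0") (auto simp: R_def)

text \<open>Each Euler step is a resolvent and keeps the bound, and so does the limit in
  \<open>L2\<close>.\<close>

lemma S_le_const:
  assumes f: "f \<in> L2 m" and t: "0 \<le> t" and c: "0 \<le> c" and le: "AE x in m. f x \<le> c"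
  shows "AE x in m. S t f x \<le> c"
proof (rule L2_limit_AE_le[OF _ _ _ M.S_lim[OF f t]])
  fix k
  have "AE x in m. (M.J (t / 2 ^ k) ^^ n) f x \<le> c" for n
  proof (induction n)
    case (Suc n)
    then show ?case using J_AE_le_const[of "(M.J (t / 2 ^ k) ^^ n) f" "t / 2 ^ k" c] f t c by simp
  qed (use le in simp)
  then show "AE x in m. M.eul k t f x \<le> c" by (simp add: M.eul_def)
qed (use f t in auto)

lemma S_nonneg:
  assumes f: "f \<in> L2 m" and t: "0 \<le> t" and le: "AE x in m. 0 \<le> f x"
  shows "AE x in m. 0 \<le> S t f x"
proof -
  have "AE x in m. (- f) x \<le> 0" using le by eventually_elim (simp add: fun_ops)
  then have "AE x in m. S t (- f) x \<le> 0" using f t by (intro S_le_const) auto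
  moreover have "AE x in m. S t (- f) x = S t 0 x - S t f x"
    using S_AE_diff[of 0 f t] f t by simp
  moreover have "AE x in m. S t 0 x = 0"
    using M.nrm_S_le[of 0 t] t L2norm_eq_0_iff[of "S t 0" m] by (simp add: antisym)
  ultimately show ?thesis by eventually_elim simp
qed

lemma S_mono:
  assumes "f \<in> L2 m" "g \<in> L2 m" "0 \<le> t" "AE x in m. f x \<le> g x"
  shows "AE x in m. S t f x \<le> S t g x"
proof -
  have "AE x in m. 0 \<le> (g - f) x" using assms(4) by eventually_elim (simp add: fun_ops)
  then have "AE x in m. 0 \<le> S t (g - f) x" using assms by (intro S_nonneg) auto
  then show ?thesis using S_AE_diff[OF assms(2,1,3)] by eventually_elim simp
qed

lemma S_abs_le:
  assumes f: "f \<in> L2 m" and t: "0 \<le> t" and c: "0 \<le> c" and le: "AE x in m. \<bar>f x\<bar> \<le> c"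
  shows "AE x in m. \<bar>S t f x\<bar> \<le> c"
proof -
  have "AE x in m. f x \<le> c" using le by eventually_elim simp
  then have 1: "AE x in m. S t f x \<le> c" using f t c by (intro S_le_const)
  have "AE x in m. (- f) x \<le> c" using le by eventually_elim (simp add: fun_ops)
  then have "AE x in m. S t (- f) x \<le> c" using f t c by (intro S_le_const) auto
  moreover have "AE x in m. S t (- f) x = S t 0 x - S t f x"
    using S_AE_diff[of 0 f t] f t by simp
  moreover have "AE x in m. S t 0 x = 0"
    using M.nrm_S_le[of 0 t] t L2norm_eq_0_iff[of "S t 0" m] by (simp add: antisym)
  ultimately show ?thesis using 1 by eventually_elim (simp add: abs_le_iff)
qed

end

section \<open>Laplace representation of the resolvent and its consequences\<close>

lemma ip2_indicator_le:
  assumes g: "g \<in> L2 m" and A: "A \<in> sets m" "emeasure m A < \<infinity>"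
    and le: "AE x in m. x \<in> A \<longrightarrow> g x \<le> c"
  shows "ip2 m g (indicator A) \<le> c * measure m A"
proof -
  have "ip2 m g (indicator A) \<le> (\<integral>x. c * indicator A x \<partial>m)"
    unfolding ip2_def
  proof (rule integral_mono_AE)
    show "integrable m (\<lambda>x. g x * indicator A x)" by (intro L2_mult_integrable g L2_indicator_finite A)
    show "integrable m (\<lambda>x. c * indicator A x)" using A by simp
    show "AE x in m. g x * indicator A x \<le> c * indicator A x"
      using le by eventually_elim (simp add: indicator_def)
  qed
  also have "\<dots> = c * measure m A" using A by simp
  finally show ?thesis .
qed

context dirichlet_form
begin

lemma S_ip_linear:
  assumes "f \<in> L2 m" "g \<in> L2 m" "h \<in> L2 m" "0 \<le> t"
  shows "ip2 m (S t (f + c *\<^sub>R g)) h = ip2 m (S t f) h + c * ip2 m (S t g) h"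
proof -
  have "ip2 m (S t (f + c *\<^sub>R g)) h = ip2 m (S t f + c *\<^sub>R S t g) h"
    using M.S_linear[of f g t c] assms by (intro L2.nrm_null_ip) auto
  then show ?thesis using assms by (simp add: L2.ip_simps)
qed

lemma S_ip_zero: "0 \<le> t \<Longrightarrow> h \<in> L2 m \<Longrightarrow> ip2 m (S t 0) h = 0"
proof -
  assume t: "0 \<le> t" and h: "h \<in> L2 m"
  have "L2norm m (S t 0 - 0) = 0" using M.nrm_S_le[of 0 t] t by (simp add: antisym)
  then show ?thesis using L2.nrm_null_ip[of "S t 0" m 0 h] t h by simp
qed

lemma S_ip_bound:
  assumes "f \<in> L2 m" "h \<in> L2 m" "0 \<le> t"
  shows "\<bar>ip2 m (S t f) h\<bar> \<le> L2norm m f * L2norm m h"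
proof -
  have "\<bar>ip2 m (S t f) h\<bar> \<le> L2norm m (S t f) * L2norm m h"
    using assms by (intro L2.ip_cauchy_schwarz) auto
  also have "\<dots> \<le> L2norm m f * L2norm m h"
    using assms by (intro mult_right_mono M.nrm_S_le) auto
  finally show ?thesis .
qed

lemma R_in_operator:
  assumes "f \<in> L2 m" "0 < a"
  shows "(R a f, a *\<^sub>R (f - R a f)) \<in> form_operator D"
  using M.J_in_A[of f "1 / a"] assms by (simp add: R_def)

text \<open>An antiderivative is at hand: with r = R a f the operator sends r to a (f - r), so the
  derivative of -e^(-a t) times the product of S t r with h is exactly the integrand. The limits at
  0 and at infinity leave the product of r with h.\<close>

lemma
  assumes f: "f \<in> L2 m" and h: "h \<in> L2 m" and a: "0 < a"
  shows laplace_integrable: "set_integrable lborel {0<..} (\<lambda>t. a * exp (- a * t) * ip2 m (S t f) h)"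
    and laplace: "(LBINT t:{0<..}. a * exp (- a * t) * ip2 m (S t f) h) = ip2 m (R a f) h"
proof -
  define r where "r = R a f"
  have r: "r \<in> L2 m" using f a by (simp add: r_def)
  let ?\<phi> = "\<lambda>t. a * exp (- a * t) * ip2 m (S t f) h"
  let ?F = "\<lambda>t. - exp (- a * t) * ip2 m (S t r) h"
  have cont: "isCont ?\<phi> t" if "0 < t" for t
    by (intro continuous_intros M.S_cont_ip f h that)
  have e: "einterval 0 \<infinity> = {0<..}" by (auto simp: einterval_def)
  show int: "set_integrable lborel {0<..} ?\<phi>"
  proof (rule set_integrable_bound)
    show "set_integrable lborel {0<..} (\<lambda>t. (a * (L2norm m f * L2norm m h)) * exp (- a * t))"
      by (intro set_integrable_mult_right exp_set_integral a)
    have "continuous_on {0<..} ?\<phi>"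
      using cont by (intro continuous_at_imp_continuous_on) auto
    then show "set_borel_measurable lborel {0<..} ?\<phi>"
      unfolding set_borel_measurable_def
      using borel_measurable_continuous_on_indicator[of "{0<..}" ?\<phi>] by simp
    show "AE t in lborel. t \<in> {0<..} \<longrightarrow>
        norm (?\<phi> t) \<le> norm ((a * (L2norm m f * L2norm m h)) * exp (- a * t))"
    proof (intro AE_I2 impI)
      fix t :: real assume "t \<in> {0<..}"
      then have "a * exp (- a * t) * \<bar>ip2 m (S t f) h\<bar> \<le> a * exp (- a * t) * (L2norm m f * L2norm m h)"
        using a f h by (intro mult_left_mono S_ip_bound) auto
      then show "norm (?\<phi> t) \<le> norm ((a * (L2norm m f * L2norm m h)) * exp (- a * t))"
        using a f h by (simp add: abs_mult mult_ac)
    qed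
  qed
  have D: "(?F has_vector_derivative ?\<phi> t) (at t)" if t: "0 < t" for t
  proof -
    have y: "ip2 m (S t (a *\<^sub>R (f - r))) h = a * (ip2 m (S t f) h - ip2 m (S t r) h)"
      using S_ip_linear[of 0 "f - r" h t a] S_ip_linear[of f r h t "-1"] S_ip_zero[of t h] f r h t by simp
    have d1: "((\<lambda>t. - exp (- a * t)) has_real_derivative a * exp (- a * t)) (at t)"
      by (auto intro!: derivative_eq_intros)
    have d2: "((\<lambda>t. ip2 m (S t r) h) has_real_derivative - (a * (ip2 m (S t f) h - ip2 m (S t r) h))) (at t)"
      using M.S_deriv_ip[OF R_in_operator[OF f a] h t] unfolding r_def[symmetric] y .
    have "(?F has_real_derivative ?\<phi> t) (at t)"
      by (rule DERIV_cong[OF DERIV_mult[OF d1 d2]]) (simp add: algebra_simps)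
    then show ?thesis by (simp add: has_real_derivative_iff_has_vector_derivative)
  qed
  have A: "((?F \<circ> real_of_ereal) \<longlongrightarrow> - ip2 m r h) (at_right 0)"
  proof -
    have "((\<lambda>t. - exp (- a * t)) \<longlongrightarrow> - exp (- a * 0)) (at_right 0)"
      by (intro tendsto_intros)
    from tendsto_mult[OF this M.S_cont_ip_zero[OF r h]]
    have "(?F \<longlongrightarrow> - ip2 m r h) (at_right 0)" by simp
    then show ?thesis unfolding zero_ereal_def ereal_tendsto_simps .
  qed
  have B: "((?F \<circ> real_of_ereal) \<longlongrightarrow> 0) (at_left \<infinity>)"
  proof -
    have "filterlim (\<lambda>t. a * t) at_top at_top"
      by (rule filterlim_tendsto_pos_mult_at_top[OF tendsto_const a filterlim_ident])
    then have "((\<lambda>t. exp (- (a * t))) \<longlongrightarrow> 0) at_top"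
      by (intro filterlim_compose[OF exp_at_bot] filterlim_compose[OF filterlim_uminus_at_bot_at_top])
    then have lim: "((\<lambda>t. exp (- (a * t)) * (L2norm m r * L2norm m h)) \<longlongrightarrow> 0) at_top"
      by (rule tendsto_mult_left_zero)
    have "(?F \<longlongrightarrow> 0) at_top"
    proof (rule Lim_null_comparison[OF _ lim])
      have "\<forall>\<^sub>F t :: real in at_top. 0 \<le> t" by (rule eventually_ge_at_top)
      then show "\<forall>\<^sub>F t in at_top. norm (?F t) \<le> exp (- (a * t)) * (L2norm m r * L2norm m h)"
        by eventually_elim (use S_ip_bound r h in \<open>simp add: abs_mult\<close>)
    qed
    then show ?thesis unfolding ereal_tendsto_simps .
  qed
  have "(LBINT x=0..\<infinity>. ?\<phi> x) = 0 - (- ip2 m r h)"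
  proof (rule interval_integral_FTC_integrable[OF _ _ _ _ A B])
    show "set_integrable lborel (einterval 0 \<infinity>) ?\<phi>" unfolding e by (rule int)
  qed (use D cont in auto)
  then show "(LBINT t:{0<..}. ?\<phi> t) = ip2 m (R a f) h"
    by (simp add: interval_lebesgue_integral_def e r_def)
qed

lemma laplace_le:
  assumes f: "f \<in> L2 m" and h: "h \<in> L2 m" and a: "0 < a"
    and k: "set_integrable lborel {0<..} (\<lambda>t. a * exp (- a * t) * k t)"
    and le: "\<And>t. 0 < t \<Longrightarrow> ip2 m (S t f) h \<le> k t"
  shows "ip2 m (R a f) h \<le> (LBINT t:{0<..}. a * exp (- a * t) * k t)"
  unfolding laplace[OF f h a, symmetric]
  using a le by (intro set_integral_mono laplace_integrable f h k) (auto intro!: mult_left_mono)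

lemma laplace_ge:
  assumes f: "f \<in> L2 m" and h: "h \<in> L2 m" and a: "0 < a"
    and k: "set_integrable lborel {0<..} (\<lambda>t. a * exp (- a * t) * k t)"
    and le: "\<And>t. 0 < t \<Longrightarrow> k t \<le> ip2 m (S t f) h"
  shows "(LBINT t:{0<..}. a * exp (- a * t) * k t) \<le> ip2 m (R a f) h"
  unfolding laplace[OF f h a, symmetric]
  using a le by (intro set_integral_mono laplace_integrable f h k) (auto intro!: mult_left_mono)

text \<open>Integrating e^(\<lambda> t) v \<le> S t v against a e^(-a t), both sides tested with h
  \<ge> 0, produces the factor a / (a - \<lambda>).\<close>

lemma R_ge_of_S_ge:
  assumes v: "v \<in> L2 m" and lam: "0 \<le> lam" "lam < a"
    and le: "\<And>t. 0 < t \<Longrightarrow> AE x in m. v x \<le> exp (- t * lam) * S t v x"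
  shows "AE x in m. a / (a - lam) * v x \<le> R a v x"
proof -
  have a: "0 < a" using lam by simp
  have "AE x in m. ((a / (a - lam)) *\<^sub>R v) x \<le> R a v x"
  proof (rule L2_AE_le_of_ip2_le)
    fix h assume h: "h \<in> L2 m" "AE x in m. 0 \<le> h x"
    have eq: "a * exp (- a * t) * (exp (t * lam) * ip2 m v h) = (a * ip2 m v h) * exp (- (a - lam) * t)" for t
    proof -
      have "exp (- a * t) * exp (t * lam) = exp (- (a - lam) * t)"
        unfolding exp_add[symmetric] by (simp add: algebra_simps)
      then show ?thesis by (simp add: ac_simps)
    qed
    have "(LBINT t:{0<..}. a * exp (- a * t) * (exp (t * lam) * ip2 m v h)) \<le> ip2 m (R a v) h"
    proof (rule laplace_ge[OF v h(1) a])
      show "set_integrable lborel {0<..} (\<lambda>t. a * exp (- a * t) * (exp (t * lam) * ip2 m v h))"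
        unfolding eq using lam by (intro set_integrable_mult_right exp_set_integral) auto
      fix t :: real assume t: "0 < t"
      have "exp (t * lam) * ip2 m v h = ip2 m (exp (t * lam) *\<^sub>R v) h" using v h by (simp add: L2.ip_scale)
      also have "\<dots> \<le> ip2 m (S t v) h"
      proof (rule ip2_mono)
        show "AE x in m. (exp (t * lam) *\<^sub>R v) x * h x \<le> S t v x * h x"
          using le[OF t] h(2)
        proof eventually_elim
          case (elim x)
          have "exp (t * lam) * v x \<le> exp (t * lam) * (exp (- t * lam) * S t v x)"
            using elim by (intro mult_left_mono) auto
          also have "\<dots> = S t v x" by (simp add: exp_minus)
          finally show ?case using elim by (simp add: fun_ops mult_right_mono)
        qed
      qed (use v h t in auto)
      finally show "exp (t * lam) * ip2 m v h \<le> ip2 m (S t v) h" .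
    qed
    also have "(LBINT t:{0<..}. a * exp (- a * t) * (exp (t * lam) * ip2 m v h)) = a * ip2 m v h * (1 / (a - lam))"
    proof -
      have b: "0 < a - lam" using lam by simp
      show ?thesis unfolding eq set_integral_mult_right exp_set_integral(2)[OF b] ..
    qed
    finally show "ip2 m ((a / (a - lam)) *\<^sub>R v) h \<le> ip2 m (R a v) h"
      using v h by (simp add: L2.ip_scale)
  qed (use v a in auto)
  then show ?thesis by (simp add: fun_ops)
qed

text \<open>With a = 1 / r the hypothesis bounds one Euler step of length r by the factor 1 / (1 -
  \<lambda> r). Iterated 2^k times with r = t / 2^k, the factors converge to e^(\<lambda>
  t).\<close>

lemma S_le_of_R_le:
  assumes s: "s \<in> L2 m" and lam: "0 \<le> lam" and t: "0 \<le> t"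
    and le: "\<And>a. lam < a \<Longrightarrow> AE x in m. R a s x \<le> a / (a - lam) * s x"
  shows "AE x in m. S t s x \<le> exp (t * lam) * s x"
proof -
  have J_le: "AE x in m. M.J r s x \<le> 1 / (1 - lam * r) * s x" if r: "0 \<le> r" "lam * r < 1" for r
  proof (cases "r = 0")
    case False
    have "lam < 1 / r" using r False by (simp add: field_simps)
    then have "AE x in m. R (1 / r) s x \<le> (1 / r) / (1 / r - lam) * s x" by (rule le)
    moreover have "(1 / r) / (1 / r - lam) = 1 / (1 - lam * r)" using r False by (simp add: field_simps)
    ultimately show ?thesis by (simp add: R_def)
  qed simp
  have J_pow_le: "AE x in m. (M.J r ^^ n) s x \<le> (1 / (1 - lam * r)) ^ n * s x"
    if r: "0 \<le> r" "lam * r < 1" for r n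
  proof (induction n)
    case (Suc n)
    let ?c = "1 / (1 - lam * r)"
    have c: "?c > 0" using r by simp
    have "AE x in m. M.J r ((M.J r ^^ n) s) x \<le> M.J r (?c ^ n *\<^sub>R s) x"
      using Suc s r by (intro J_AE_mono) (auto simp: fun_ops)
    moreover have "L2norm m (M.J r (0 + ?c ^ n *\<^sub>R s) - (M.J r 0 + ?c ^ n *\<^sub>R M.J r s)) = 0"
      using s r by (intro M.J_linear) auto
    then have "AE x in m. M.J r (?c ^ n *\<^sub>R s) x = (M.J r 0 + ?c ^ n *\<^sub>R M.J r s) x"
      using L2norm_diff_eq_0_iff[of "M.J r (?c ^ n *\<^sub>R s)" m "M.J r 0 + ?c ^ n *\<^sub>R M.J r s"] s r by simp
    moreover have "L2norm m (M.J r 0) = 0" using M.nrm_J_le[of 0 r] r by (simp add: antisym)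
    then have "AE x in m. M.J r 0 x = 0" using L2norm_eq_0_iff[of "M.J r 0" m] r by simp
    ultimately have "AE x in m. M.J r ((M.J r ^^ n) s) x \<le> ?c ^ n * (?c * s x)"
      using J_le[OF r]
    proof eventually_elim
      case (elim x)
      have "?c ^ n * M.J r s x \<le> ?c ^ n * (?c * s x)" using elim c by (intro mult_left_mono) auto
      then show ?case using elim by (simp add: fun_ops)
    qed
    then show ?case by eventually_elim (simp add: mult.assoc)
  qed simp
  have "AE x in m. S t s x \<le> (exp (t * lam) *\<^sub>R s) x"
  proof (rule L2_AE_le_of_ip2_le)
    fix h assume h: "h \<in> L2 m" "AE x in m. 0 \<le> h x"
    define c where "c k = (1 / (1 - lam * t / 2 ^ k)) ^ 2 ^ k" for k :: nat
    have c_lim: "c \<longlonglongrightarrow> exp (t * lam)"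
    proof -
      have "(\<lambda>n. (1 + (- (lam * t)) / real n) ^ n) \<longlonglongrightarrow> exp (- (lam * t))"
        by (rule tendsto_exp_limit_sequentially)
      from LIMSEQ_subseq_LIMSEQ[OF this, of "\<lambda>k. 2 ^ k"]
      have "(\<lambda>k. (1 - lam * t / 2 ^ k) ^ 2 ^ k) \<longlonglongrightarrow> exp (- (lam * t))"
        by (simp add: o_def strict_mono_def)
      from tendsto_inverse[OF this] show ?thesis
        by (simp add: c_def[abs_def] exp_minus power_inverse inverse_eq_divide mult.commute power_one_over)
    qed
    have "(\<lambda>k. lam * t / 2 ^ k) \<longlonglongrightarrow> 0" by (rule LIMSEQ_divide_realpow_zero) simp
    then have "\<forall>\<^sub>F k in sequentially. lam * t / 2 ^ k < 1" by (intro order_tendstoD) auto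
    then have ev: "\<forall>\<^sub>F k in sequentially. ip2 m (M.eul k t s) h \<le> c k * ip2 m s h"
    proof eventually_elim
      case (elim k)
      have "AE x in m. M.eul k t s x \<le> (c k *\<^sub>R s) x"
        using J_pow_le[of "t / 2 ^ k" "2 ^ k"] elim t by (simp add: M.eul_def c_def fun_ops)
      then have "ip2 m (M.eul k t s) h \<le> ip2 m (c k *\<^sub>R s) h"
        using h s t by (intro ip2_mono) (auto intro: mult_right_mono elim: eventually_elim2)
      then show ?case using s h by (simp add: L2.ip_scale)
    qed
    have "(\<lambda>k. ip2 m (M.eul k t s) h) \<longlonglongrightarrow> ip2 m (S t s) h"
      using M.S_lim[OF s t] s t h by (intro L2.ip_tendsto) auto
    moreover have "(\<lambda>k. c k * ip2 m s h) \<longlonglongrightarrow> exp (t * lam) * ip2 m s h"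
      by (intro tendsto_intros c_lim)
    ultimately have "ip2 m (S t s) h \<le> exp (t * lam) * ip2 m s h"
      using ev by (intro tendsto_le[of sequentially]) auto
    then show "ip2 m (S t s) h \<le> ip2 m (exp (t * lam) *\<^sub>R s) h" using s h by (simp add: L2.ip_scale)
  qed (use s t in auto)
  then show ?thesis by (simp add: fun_ops)
qed

text \<open>For t > T the crude bound is multiplied by e^(a (t - T) / 2) \<ge> 1. This makes the
  majorant a sum of exponentials on the whole half-line, so the integral need not be split at T.
  Since a e^(-a t) e^(a t / 2) has integral 2, the late times cost 2 B e^(-a T / 2).\<close>

lemma R_le_of_S_le:
  assumes f: "f \<in> L2 m" and w: "w \<in> L2 m" and N: "N \<in> sets m" and a: "0 < a"
    and e: "0 \<le> e" and B: "0 \<le> B" and T: "0 \<le> T"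
    and le1: "\<And>t. 0 < t \<Longrightarrow> t \<le> T \<Longrightarrow> AE x in m. x \<in> N \<longrightarrow> S t f x \<le> w x + e"
    and le2: "\<And>t. 0 < t \<Longrightarrow> AE x in m. x \<in> N \<longrightarrow> S t f x \<le> w x + B"
  shows "AE x in m. x \<in> N \<longrightarrow> R a f x \<le> w x + (e + 2 * B * exp (- a * T / 2))"
proof -
  have "AE x in m. x \<in> N \<longrightarrow> (R a f - w) x \<le> e + 2 * B * exp (- a * T / 2)"
  proof (rule L2_AE_le_constI[where g = "R a f - w", OF _ _ N])
    fix A assume A: "A \<in> sets m" "A \<subseteq> N" "emeasure m A < \<infinity>"
    note iA = L2_indicator_finite[OF A(1,3)]
    define c where "c = ip2 m w (indicator A)"
    define M where "M = measure m A"
    let ?k = "\<lambda>t. c + e * M + (B * M * exp (- a * T / 2)) * exp (a * t / 2)"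
    have eq: "a * exp (- a * t) * ?k t = (a * (c + e * M)) * exp (- a * t) +
        (a * (B * M * exp (- a * T / 2))) * exp (- (a / 2) * t)" for t
    proof -
      have "exp (- a * t) * exp (a * t / 2) = exp (- (a / 2) * t)"
        unfolding exp_add[symmetric] by (simp add: field_simps)
      then show ?thesis by (simp add: algebra_simps)
    qed
    have i1: "set_integrable lborel {0<..} (\<lambda>t. (a * (c + e * M)) * exp (- a * t))"
      using a by (intro set_integrable_mult_right exp_set_integral)
    have i2: "set_integrable lborel {0<..} (\<lambda>t. (a * (B * M * exp (- a * T / 2))) * exp (- (a / 2) * t))"
      using a by (intro set_integrable_mult_right exp_set_integral) simp
    have "ip2 m (R a f) (indicator A) \<le> (LBINT t:{0<..}. a * exp (- a * t) * ?k t)"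
    proof (rule laplace_le[OF f iA a])
      show "set_integrable lborel {0<..} (\<lambda>t. a * exp (- a * t) * ?k t)"
        unfolding eq by (intro set_integral_add i1 i2)
      fix t :: real assume t: "0 < t"
      have dec: "ip2 m (S t f) (indicator A) = c + ip2 m (S t f - w) (indicator A)"
        using f w t iA by (simp add: L2.ip_simps c_def)
      show "ip2 m (S t f) (indicator A) \<le> ?k t"
      proof (cases "t \<le> T")
        case True
        have "AE x in m. x \<in> A \<longrightarrow> (S t f - w) x \<le> e"
          using le1[OF t True] by eventually_elim (use A(2) in \<open>auto simp: fun_ops\<close>)
        then have "ip2 m (S t f - w) (indicator A) \<le> e * M"
          unfolding M_def using f w t by (intro ip2_indicator_le A) auto
        moreover have "0 \<le> (B * M * exp (- a * T / 2)) * exp (a * t / 2)" using B by (simp add: M_def)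
        ultimately show ?thesis unfolding dec by linarith
      next
        case False
        have "AE x in m. x \<in> A \<longrightarrow> (S t f - w) x \<le> B"
          using le2[OF t] by eventually_elim (use A(2) in \<open>auto simp: fun_ops\<close>)
        then have "ip2 m (S t f - w) (indicator A) \<le> B * M"
          unfolding M_def using f w t by (intro ip2_indicator_le A) auto
        also have "\<dots> \<le> (B * M) * (exp (- a * T / 2) * exp (a * t / 2))"
        proof -
          have "0 \<le> - a * T / 2 + a * t / 2" using False a by (simp add: field_simps)
          then have "1 \<le> exp (- a * T / 2) * exp (a * t / 2)"
            unfolding exp_add[symmetric] by (simp only: one_le_exp_iff)
          then show ?thesis using mult_left_mono[of 1 _ "B * M"] B by (simp add: M_def)
        qed
        also have "\<dots> = (B * M * exp (- a * T / 2)) * exp (a * t / 2)" by (simp only: mult.assoc)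
        finally have "ip2 m (S t f - w) (indicator A) \<le> (B * M * exp (- a * T / 2)) * exp (a * t / 2)" .
        moreover have "0 \<le> e * M" using e by (simp add: M_def)
        ultimately show ?thesis unfolding dec by linarith
      qed
    qed
    also have "\<dots> = c + (e + 2 * B * exp (- a * T / 2)) * M"
      unfolding eq set_integral_add(2)[OF i1 i2] set_integral_mult_right
      using exp_set_integral(2)[OF a] exp_set_integral(2)[of "a / 2"] a
      by (simp add: algebra_simps)
    finally show "ip2 m (R a f - w) (indicator A) \<le> (e + 2 * B * exp (- a * T / 2)) * measure m A"
      using f w a iA by (simp add: L2.ip_simps c_def M_def)
  qed (use f w a e B in auto)
  then show ?thesis by eventually_elim (auto simp: fun_ops)
qed

text \<open>The operator sends R a f to a (f - R a f), which is bounded by 2 a B, and the semigroup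
  preserves this bound. The mean value theorem is applied to integrals over sets of finite measure,
  which makes the estimate pointwise.\<close>

lemma S_sub_R:
  assumes f: "f \<in> L2 m" and fB: "AE x in m. \<bar>f x\<bar> \<le> B" and B: "0 \<le> B" and a: "0 < a" and t: "0 \<le> t"
  shows "AE x in m. \<bar>S t (R a f) x - R a f x\<bar> \<le> 2 * a * B * t"
proof (cases "t = 0")
  case True
  have "AE x in m. S 0 (R a f) x = R a f x" using f a by (intro S_AE_zero) simp
  then show ?thesis unfolding True by eventually_elim simp
next
  case False
  then have t: "0 < t" using t by simp
  define r where "r = R a f"
  define y where "y = a *\<^sub>R (f - r)"
  have r: "r \<in> L2 m" and y: "y \<in> L2 m" using f a by (auto simp: r_def y_def)
  have "AE x in m. \<bar>r x\<bar> \<le> B" unfolding r_def by (rule R_abs_le[OF f a fB])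
  then have yB: "AE x in m. \<bar>y x\<bar> \<le> 2 * a * B"
    using fB
  proof eventually_elim
    case (elim x)
    then have "\<bar>f x - r x\<bar> \<le> 2 * B" by linarith
    then have "a * \<bar>f x - r x\<bar> \<le> a * (2 * B)" using a by (intro mult_left_mono) auto
    then show ?case using a by (simp add: y_def fun_ops abs_mult)
  qed
  have key: "\<bar>ip2 m (S t r - r) (indicator A)\<bar> \<le> 2 * a * B * t * measure m A"
    if A: "A \<in> sets m" "emeasure m A < \<infinity>" for A
  proof -
    define h where "h = (indicator A :: 'a \<Rightarrow> real)"
    have h: "h \<in> L2 m" using L2_indicator_finite[OF A] by (simp add: h_def)
    define K where "K = 2 * a * B * measure m A"
    have yh: "\<bar>ip2 m (S s y) h\<bar> \<le> K" if s: "0 < s" for s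
    proof -
      have ae: "AE x in m. \<bar>S s y x\<bar> \<le> 2 * a * B"
        using y s yB a B by (intro S_abs_le) auto
      have "AE x in m. x \<in> A \<longrightarrow> S s y x \<le> 2 * a * B" using ae by eventually_elim auto
      then have 1: "ip2 m (S s y) h \<le> K"
        unfolding h_def K_def using y s by (intro ip2_indicator_le A) auto
      have "AE x in m. x \<in> A \<longrightarrow> (- S s y) x \<le> 2 * a * B"
        using ae by eventually_elim (auto simp: fun_ops)
      then have "ip2 m (- S s y) h \<le> K"
        unfolding h_def K_def using y s by (intro ip2_indicator_le A) auto
      then show ?thesis using 1 y s h by (simp add: L2.ip_simps abs_le_iff)
    qed
    have D: "((\<lambda>s. ip2 m (S s r) h) has_real_derivative - ip2 m (S s y) h) (at s)" if "0 < s" for s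
      using M.S_deriv_ip[OF R_in_operator[OF f a] h that] by (simp add: r_def y_def)
    \<comment> \<open>Differentiability is known for positive times only, so the increment is taken
      from s > 0, and s tends to 0 afterwards.\<close>
    have step: "\<bar>ip2 m (S t r) h - ip2 m (S s r) h\<bar> \<le> K * t" if s: "0 < s" "s < t" for s
    proof -
      obtain z where z: "s < z" "z < t"
        "ip2 m (S t r) h - ip2 m (S s r) h = (t - s) * - ip2 m (S z y) h"
        using MVT2[of s t "\<lambda>s. ip2 m (S s r) h" "\<lambda>s. - ip2 m (S s y) h"] D s by auto
      have "\<bar>ip2 m (S t r) h - ip2 m (S s r) h\<bar> = (t - s) * \<bar>ip2 m (S z y) h\<bar>"
        unfolding z(3) using s by (simp add: abs_mult)
      also have "\<dots> \<le> t * K"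
        using s z yh[of z] by (intro mult_mono) auto
      finally show ?thesis by (simp add: mult.commute)
    qed
    have "((\<lambda>s. \<bar>ip2 m (S t r) h - ip2 m (S s r) h\<bar>) \<longlongrightarrow> \<bar>ip2 m (S t r) h - ip2 m r h\<bar>) (at_right 0)"
      by (intro tendsto_intros M.S_cont_ip_zero r h)
    then have "\<bar>ip2 m (S t r) h - ip2 m r h\<bar> \<le> K * t"
      by (rule tendsto_upperbound) (use step t in \<open>auto simp: eventually_at_right_field\<close>)
    then show ?thesis using r t h by (simp add: L2.ip_simps K_def h_def mult_ac)
  qed
  have c: "0 \<le> 2 * a * B * t" using a B t by simp
  have "AE x in m. x \<in> space m \<longrightarrow> (S t r - r) x \<le> 2 * a * B * t"
  proof (rule L2_AE_le_constI[where g = "S t r - r", OF _ c])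
    show "ip2 m (S t r - r) (indicator A) \<le> 2 * a * B * t * measure m A"
      if "A \<in> sets m" "emeasure m A < \<infinity>" for A
      using key[OF that] by linarith
  qed (use r t in auto)
  moreover have "AE x in m. x \<in> space m \<longrightarrow> (r - S t r) x \<le> 2 * a * B * t"
  proof (rule L2_AE_le_constI[where g = "r - S t r", OF _ c])
    fix A assume A: "A \<in> sets m" "emeasure m A < \<infinity>"
    have "ip2 m (r - S t r) (indicator A) = - ip2 m (S t r - r) (indicator A)"
      using r t L2_indicator_finite[OF A] by (simp add: L2.ip_simps)
    then show "ip2 m (r - S t r) (indicator A) \<le> 2 * a * B * t * measure m A"
      using key[OF A] by (simp add: abs_le_iff)
  qed (use r t in auto)
  moreover have "AE x in m. x \<in> space m" by (rule AE_space)
  ultimately show ?thesis by eventually_elim (auto simp: fun_ops r_def abs_le_iff)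
qed

end

section \<open>Topology and measure of the underlying space\<close>

lemma separable_metrizable_imp_second_countable:
  assumes "metrizable_space X" "separable_space X"
  shows "second_countable X"
proof -
  obtain M d where Md: "Metric_space M d" and X: "X = Metric_space.mtopology M d"
    using assms(1) unfolding metrizable_space_def by auto
  interpret Metric_space M d by (rule Md)
  obtain C where C: "countable C" "C \<subseteq> M" "mtopology closure_of C = M"
    using assms(2) unfolding separable_space_def X by auto
  define B where "B = (\<lambda>(c, n). mball c (1 / Suc n)) ` (C \<times> UNIV)"
  have base: "\<exists>V\<in>B. x \<in> V \<and> V \<subseteq> U" if U: "openin mtopology U" "x \<in> U" for U x
  proof -
    obtain r where r: "r > 0" "mball x r \<subseteq> U" and x: "x \<in> M"
      using U openin_mtopology by blast
    have r2: "0 < r / 2" using r by simp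
    obtain n :: nat where n: "1 / Suc n < r / 2" using nat_approx_posE[OF r2] by blast
    have "x \<in> mtopology closure_of C" using C x by simp
    then have "\<forall>r>0. \<exists>y\<in>C. y \<in> mball x r" unfolding metric_closure_of by simp
    moreover have "(0::real) < 1 / Suc n" by simp
    ultimately obtain c where c: "c \<in> C" "c \<in> mball x (1 / Suc n)" by blast
    have "x \<in> mball c (1 / Suc n)" using c x by (simp add: commute)
    moreover have "mball c (1 / Suc n) \<subseteq> mball x r"
    proof
      fix y assume "y \<in> mball c (1 / Suc n)"
      then show "y \<in> mball x r" using c n triangle[of x c y] by auto
    qed
    ultimately show ?thesis using r c by (force simp: B_def)
  qed
  have "countable B" using C by (auto simp: B_def)
  moreover have "\<forall>V\<in>B. openin mtopology V" by (auto simp: B_def)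
  ultimately show ?thesis
    unfolding second_countable_def X using base by (intro exI[of _ B]) blast
qed

locale dirichlet_space =
  fixes D :: "'a dirichlet"
  assumes space: "strongly_local_dirichlet_space D"
begin

abbreviation "X \<equiv> top_of D"

sublocale dirichlet_form D
  using space unfolding strongly_local_dirichlet_space_def by unfold_locales auto

lemma
  shows locally_compact_X: "locally_compact_space X"
    and metrizable_X: "metrizable_space X"
    and radon: "radon_measure X m"
    and full_support: "openin X U \<Longrightarrow> U \<noteq> {} \<Longrightarrow> emeasure m U > 0"
    and regular: "regular_form D"
    and strongly_local: "strongly_local_form D"
  using space unfolding strongly_local_dirichlet_space_def by auto

lemma second_countable_X: "second_countable X"
  using space unfolding strongly_local_dirichlet_space_def
  by (intro separable_metrizable_imp_second_countable) auto

lemma Hausdorff_X: "Hausdorff_space X"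
  by (intro metrizable_imp_Hausdorff_space metrizable_X)

lemma space_m: "space m = topspace X"
  using radon by (simp add: radon_measure_def)

lemma open_sets: "openin X U \<Longrightarrow> U \<in> sets m"
  using radon by (auto simp: radon_measure_def)

lemma closed_sets: "closedin X C \<Longrightarrow> C \<in> sets m"
proof -
  assume C: "closedin X C"
  then have "topspace X - C \<in> sets m" by (intro open_sets) auto
  then have "space m - (topspace X - C) \<in> sets m" by (rule sets.compl_sets)
  moreover have "space m - (topspace X - C) = C" using closedin_subset[OF C] by (auto simp: space_m)
  ultimately show ?thesis by simp
qed

lemma compact_closed: "compactin X K \<Longrightarrow> closedin X K"
  by (rule compactin_imp_closedin[OF Hausdorff_X])

lemma compact_sets: "compactin X K \<Longrightarrow> K \<in> sets m"
  by (intro closed_sets compact_closed)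

lemma compact_finite: "compactin X K \<Longrightarrow> emeasure m K < \<infinity>"
  using radon by (auto simp: radon_measure_def)

lemma inner_regular: "A \<in> sets m \<Longrightarrow> emeasure m A = (SUP K\<in>{K. compactin X K \<and> K \<subseteq> A}. emeasure m K)"
  using radon by (auto simp: radon_measure_def)

text \<open>The null neighbourhoods may be uncountably many; inner regularity reduces to compact
  subsets of A, which finitely many of them cover.\<close>

lemma null_of_locally_null:
  assumes A: "A \<in> sets m"
    and loc: "\<And>x. x \<in> A \<Longrightarrow> \<exists>V. openin X V \<and> x \<in> V \<and> (AE y in m. y \<in> V \<longrightarrow> y \<notin> A)"
  shows "AE x in m. x \<notin> A"
proof -
  have "emeasure m K = 0" if K: "compactin X K" "K \<subseteq> A" for K
  proof -
    let ?U = "{V. openin X V \<and> (AE y in m. y \<in> V \<longrightarrow> y \<notin> A)}"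
    have "K \<subseteq> \<Union>?U" using loc K by blast
    then obtain G where G: "finite G" "G \<subseteq> ?U" "K \<subseteq> \<Union>G"
      using compactinD[OF K(1), of ?U] by blast
    have "AE y in m. \<forall>V\<in>G. y \<in> V \<longrightarrow> y \<notin> A" using G by (intro AE_finite_allI) auto
    then have "AE y in m. y \<notin> K" by eventually_elim (use G K in auto)
    then have "K \<in> null_sets m" using AE_iff_null_sets[OF compact_sets[OF K(1)]] by blast
    then show ?thesis by (rule null_setsD1)
  qed
  then have "emeasure m A = 0" unfolding inner_regular[OF A] by (auto intro!: SUP_eqI)
  then show ?thesis using A by (intro AE_not_in) (auto simp: null_sets_def)
qed

lemma compact_nbhd:
  assumes K: "compactin X K" and U: "openin X U" and KU: "K \<subseteq> U"
  shows "\<exists>V. openin X V \<and> K \<subseteq> V \<and> compactin X (X closure_of V) \<and> X closure_of V \<subseteq> U"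
proof -
  have "locally_compact_space (subtopology X U)"
    using Hausdorff_X locally_compact_X U by (intro locally_compact_space_open_subset) auto
  moreover have "Hausdorff_space (subtopology X U)" by (intro Hausdorff_space_subtopology Hausdorff_X)
  moreover have "compactin (subtopology X U) K" using K KU by (simp add: compactin_subtopology)
  ultimately have "\<exists>V L. openin (subtopology X U) V \<and> compactin (subtopology X U) L \<and>
      closedin (subtopology X U) L \<and> K \<subseteq> V \<and> V \<subseteq> L"
    by (simp add: locally_compact_space_compact_closed_compact)
  then obtain V L where VL: "openin (subtopology X U) V" "compactin (subtopology X U) L" "K \<subseteq> V" "V \<subseteq> L"
    by blast
  have V: "openin X V" using VL U by (simp add: openin_open_subtopology)
  have L: "compactin X L" "L \<subseteq> U" using VL by (auto simp: compactin_subtopology)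
  have "X closure_of V \<subseteq> L" using VL compact_closed[OF L(1)] by (intro closure_of_minimal)
  then show ?thesis
    using V VL L by (intro exI[of _ V]) (auto intro: closed_compactin[OF L(1)])
qed

text \<open>The function is 1 on a neighbourhood of K and not only on K, so that it can stand for
  the constant 1 in \<open>form_loc\<close>, which asks for equality near a support. The bounds 0
  and 1 hold everywhere, also off the space.\<close>

definition cutoff :: "('a \<Rightarrow> real) \<Rightarrow> 'a set \<Rightarrow> 'a set \<Rightarrow> bool" where
  "cutoff f K U \<longleftrightarrow> f \<in> F \<inter> Cc X \<and> (\<forall>x. 0 \<le> f x \<and> f x \<le> 1) \<and> csupport X f \<subseteq> U \<and>
     (\<exists>W. openin X W \<and> K \<subseteq> W \<and> (\<forall>x\<in>W. f x = 1))"

lemma cutoff_exists: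
  assumes K: "compactin X K" and U: "openin X U" and KU: "K \<subseteq> U"
  shows "\<exists>f. cutoff f K U"
proof -
  obtain V where V: "openin X V" "K \<subseteq> V" "compactin X (X closure_of V)" "X closure_of V \<subseteq> U"
    using compact_nbhd[OF assms] by auto
  have "normal_space X" by (intro metrizable_imp_normal_space metrizable_X)
  moreover have "closedin X K" by (rule compact_closed[OF K])
  moreover have "closedin X (topspace X - V)" using V by auto
  moreover have "disjnt K (topspace X - V)" using V by (auto simp: disjnt_def)
  \<comment> \<open>The value 2 leaves room for the uniform error 1/4 of the approximation from F.
    The truncation \<open>T\<close> below is 0 up to 1/2 and 1 from 3/2 on, so the result vanishes
    where f = 0 and is 1 on the open set where f > 7/4.\<close>
  ultimately obtain f where f: "continuous_map X euclideanreal f" "f ` K \<subseteq> {2}" "f ` (topspace X - V) \<subseteq> {0}"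
    using Urysohn_lemma_alt[of X K "topspace X - V" 2 0] by blast
  have csub: "csupport X g \<subseteq> X closure_of V" if "\<And>x. x \<in> topspace X - V \<Longrightarrow> g x = 0" for g :: "'a \<Rightarrow> real"
    unfolding csupport_def using that by (intro closure_of_mono) auto
  have ccomp: "compactin X (csupport X g)" if "\<And>x. x \<in> topspace X - V \<Longrightarrow> g x = 0" for g :: "'a \<Rightarrow> real"
    using csub[OF that] V by (intro closed_compactin[OF V(3)]) (auto simp: csupport_def)
  have "f \<in> Cc X" using f ccomp[of f] by (auto simp: Cc_def Cont_def)
  from bspec[OF conjunct1[OF regular[unfolded regular_form_def]] this]
  have "\<forall>e>0. \<exists>g\<in>F \<inter> Cc X. \<forall>x\<in>topspace X. \<bar>f x - g x\<bar> < e" .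
  from this[rule_format, of "1 / 4"] obtain g where g: "g \<in> F \<inter> Cc X" "\<And>x. x \<in> topspace X \<Longrightarrow> \<bar>f x - g x\<bar> < 1 / 4" by auto
  define T where "T s = min (max (s - 1 / 2) 0) 1" for s :: real
  have T: "\<bar>T s - T t\<bar> \<le> \<bar>s - t\<bar>" "T 0 = 0" "0 \<le> T s" "T s \<le> 1" for s t
    by (auto simp: T_def min_def max_def)
  define h where "h = T \<circ> g"
  have hF: "h \<in> F" using markov T g unfolding markov_form_def h_def by blast
  have gc: "continuous_map X euclideanreal g" using g by (auto simp: Cc_def Cont_def)
  have "continuous_map X euclideanreal h"
    unfolding h_def T_def o_def
    by (intro continuous_map_real_min continuous_map_real_max continuous_map_diff gc) auto
  moreover have h0: "h x = 0" if "x \<in> topspace X - V" for x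
    using f(3) g(2)[of x] that by (auto simp: h_def T_def)
  ultimately have hC: "h \<in> Cc X" using ccomp[of h] by (auto simp: Cc_def Cont_def)
  have "csupport X h \<subseteq> U" using csub[of h] h0 V by auto
  moreover have "\<exists>W. openin X W \<and> K \<subseteq> W \<and> (\<forall>x\<in>W. h x = 1)"
  proof (intro exI conjI ballI)
    let ?W = "{x \<in> topspace X. f x \<in> {7 / 4<..}}"
    show "openin X ?W" using f(1) by (intro openin_continuous_map_preimage[of X euclideanreal]) auto
    show "K \<subseteq> ?W" using f(2) compactin_subset_topspace[OF K] by auto
    fix x assume "x \<in> ?W"
    then have "f x > 7 / 4" "\<bar>f x - g x\<bar> < 1 / 4" using g(2)[of x] by auto
    then have "g x > 3 / 2" by linarith
    then show "h x = 1" by (simp add: h_def T_def)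
  qed
  moreover have "0 \<le> h x \<and> h x \<le> 1" for x using T(3,4) by (simp add: h_def)
  ultimately show ?thesis using hF hC unfolding cutoff_def by blast
qed

lemma cutoffD:
  assumes "cutoff f K U"
  shows "f \<in> F" "f \<in> Cc X" "0 \<le> f x" "f x \<le> 1" "csupport X f \<subseteq> U" "x \<in> K \<Longrightarrow> f x = 1"
  using assms by (auto simp: cutoff_def)

lemma csupport_zero: "x \<in> topspace X \<Longrightarrow> x \<notin> csupport X f \<Longrightarrow> f x = 0"
  unfolding csupport_def using closure_of_subset[of "{x \<in> topspace X. f x \<noteq> 0}" X] by auto

lemma closedin_msupport: "closedin X (msupport X m f)"
  unfolding msupport_def by (intro closedin_diff openin_Union) auto

lemma msupport_AE_zero:
  assumes "f \<in> borel_measurable m"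
  shows "AE x in m. x \<notin> msupport X m f \<longrightarrow> f x = 0"
proof -
  let ?A = "{x \<in> space m. x \<notin> msupport X m f \<and> f x \<noteq> 0}"
  note [measurable] = assms closed_sets[OF closedin_msupport[of f]]
  have A: "?A \<in> sets m" by measurable
  have "AE x in m. x \<notin> ?A"
  proof (rule null_of_locally_null[OF A])
    fix x assume "x \<in> ?A"
    then obtain V where "openin X V" "x \<in> V" "AE y in m. y \<in> V \<longrightarrow> f y = 0"
      by (auto simp: msupport_def space_m)
    then show "\<exists>V. openin X V \<and> x \<in> V \<and> (AE y in m. y \<in> V \<longrightarrow> y \<notin> ?A)"
      by (intro exI[of _ V]) (auto elim: eventually_mono)
  qed
  moreover have "AE x in m. x \<in> space m" by (rule AE_space)
  ultimately show ?thesis by eventually_elim auto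
qed

lemma msupport_subset:
  assumes "closedin X C" "AE x in m. x \<notin> C \<longrightarrow> f x = 0"
  shows "msupport X m f \<subseteq> C"
proof -
  have "AE x in m. x \<in> topspace X - C \<longrightarrow> f x = 0" using assms(2) by eventually_elim auto
  moreover have "openin X (topspace X - C)" using assms(1) by auto
  ultimately have "topspace X - C \<subseteq> \<Union>{V. openin X V \<and> (AE x in m. x \<in> V \<longrightarrow> f x = 0)}" by blast
  then show ?thesis by (auto simp: msupport_def)
qed

lemma msupport_csupport:
  "msupport X m f \<subseteq> csupport X f"
proof (rule msupport_subset)
  have "AE x in m. x \<in> space m" by (rule AE_space)
  then show "AE x in m. x \<notin> csupport X f \<longrightarrow> f x = 0"
    by eventually_elim (auto simp: space_m csupport_zero)
qed (simp add: csupport_def)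

lemma E_local_const:
  assumes "u \<in> F" "v \<in> F" "AE x in m. x \<in> msupport X m v \<longrightarrow> u x = c"
  shows "E u v = 0"
  using strongly_local assms unfolding strongly_local_form_def by blast

lemma E_local_eq:
  assumes "u \<in> F" "u' \<in> F" "v \<in> F" "AE x in m. x \<in> msupport X m v \<longrightarrow> u x = u' x"
  shows "E u v = E u' v"
proof -
  have "E (u - u') v = 0"
  proof (rule E_local_const)
    show "AE x in m. x \<in> msupport X m v \<longrightarrow> (u - u') x = 0"
      using assms(4) by eventually_elim (simp add: fun_ops)
  qed (use assms in auto)
  then show ?thesis using assms by (simp add: EE.ip_simps)
qed

lemma F_contraction:
  assumes "u \<in> F" "\<And>s t. \<bar>T s - T t\<bar> \<le> \<bar>s - t\<bar>" "T 0 = (0::real)"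
  shows "(\<lambda>x. T (u x)) \<in> F" "E (\<lambda>x. T (u x)) (\<lambda>x. T (u x)) \<le> E u u"
  using markov assms unfolding markov_form_def o_def by blast+

lemma F_abs: "u \<in> F \<Longrightarrow> (\<lambda>x. \<bar>u x\<bar>) \<in> F" "u \<in> F \<Longrightarrow> E (\<lambda>x. \<bar>u x\<bar>) (\<lambda>x. \<bar>u x\<bar>) \<le> E u u"
  using F_contraction[of u abs] by auto

lemma F_pos: "u \<in> F \<Longrightarrow> (\<lambda>x. max (u x) 0) \<in> F"
  using F_contraction(1)[of u "\<lambda>s. max s 0"] by auto

text \<open>The minimum is half of u + v - |u - v|. The energy bound is crude, but boundedness is
  all that the weak limits ask for.\<close>

lemma
  assumes u: "u \<in> F" and v: "v \<in> F"
  shows F_min: "(\<lambda>x. min (u x) (v x)) \<in> F"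
    and E_min_le: "EE.nrm (\<lambda>x. min (u x) (v x)) \<le> EE.nrm u + EE.nrm v"
proof -
  let ?a = "\<lambda>x. \<bar>(u - v) x\<bar>"
  have a: "?a \<in> F" "E ?a ?a \<le> E (u - v) (u - v)" using F_abs[of "u - v"] u v by auto
  have eq: "(\<lambda>x. min (u x) (v x)) = (1 / 2) *\<^sub>R (u + v - ?a)"
    by (auto simp: fun_eq_iff fun_ops min_def)
  show "(\<lambda>x. min (u x) (v x)) \<in> F" unfolding eq using u v a by (intro EE.scale_in EE.diff_in EE.add_in)
  have "EE.nrm ?a \<le> EE.nrm (u - v)" using a by (simp add: EE.nrm_def)
  also have "\<dots> \<le> EE.nrm u + EE.nrm v" using u v by (intro EE.nrm_triangle_minus)
  finally have "EE.nrm ?a \<le> EE.nrm u + EE.nrm v" .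
  moreover have "EE.nrm (u + v - ?a) \<le> EE.nrm u + EE.nrm v + EE.nrm ?a"
    using u v a EE.nrm_triangle_minus[of "u + v" ?a] EE.nrm_triangle[of u v] by simp
  ultimately show "EE.nrm (\<lambda>x. min (u x) (v x)) \<le> EE.nrm u + EE.nrm v"
    unfolding eq using u v a by (simp add: EE.nrm_scale)
qed

text \<open>|u| is twice the positive part minus u; expand E |u| |u| \<le> E u u.\<close>

lemma E_pos_part:
  assumes u: "u \<in> F"
  shows "E (\<lambda>x. max (u x) 0) (\<lambda>x. max (u x) 0) \<le> E u (\<lambda>x. max (u x) 0)"
proof -
  let ?p = "\<lambda>x. max (u x) 0" and ?a = "\<lambda>x. \<bar>u x\<bar>"
  have a: "?a \<in> F" "E ?a ?a \<le> E u u" and p: "?p \<in> F" using F_abs[OF u] F_pos[OF u] by auto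
  have eq: "?a = 2 *\<^sub>R ?p - u" by (auto simp: fun_eq_iff fun_ops max_def)
  have "E ?a ?a = 4 * E ?p ?p - 4 * E u ?p + E u u"
    unfolding eq using u p by (simp add: EE.ip_simps E_sym[of ?p u])
  then show ?thesis using a by simp
qed

end

section \<open>The form on open subsets\<close>

lemma abs_min_diff_le:
  fixes a b u w :: real
  assumes "0 \<le> u" "0 \<le> w"
  shows "\<bar>min \<bar>a\<bar> \<bar>b\<bar> - min u w\<bar> \<le> \<bar>a - u\<bar> + \<bar>b - w\<bar>"
proof -
  have "\<bar>min p q - min u w\<bar> \<le> \<bar>p - u\<bar> + \<bar>q - w\<bar>" for p q :: real
    by (cases "p \<le> q"; cases "u \<le> w"; simp add: min_def)
  from this[of "\<bar>a\<bar>" "\<bar>b\<bar>"] show ?thesis using assms by linarith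
qed

context dirichlet_space
begin

abbreviation "FU \<equiv> fdom_open D"

lemma FU_F: "f \<in> FU U \<Longrightarrow> f \<in> F"
  by (simp add: fdom_open_def)

lemma FU_approx:
  assumes "f \<in> FU U"
  shows "\<exists>g :: nat \<Rightarrow> 'a \<Rightarrow> real. (\<forall>n. g n \<in> F \<inter> Cc X \<and> csupport X (g n) \<subseteq> U) \<and>
    (\<lambda>n. norm1 D (g n - f)) \<longlonglongrightarrow> 0"
proof -
  have "\<exists>g\<in>F \<inter> Cc X. csupport X g \<subseteq> U \<and> norm1 D (f - g) < 1 / Suc n" for n
    using assms unfolding fdom_open_def fun_diff_def by (auto dest: spec[of _ "1 / Suc n"])
  then obtain g where g: "\<And>n. g n \<in> F \<inter> Cc X" "\<And>n. csupport X (g n) \<subseteq> U" "\<And>n. norm1 D (f - g n) < 1 / Suc n"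
    by metis
  have "(\<lambda>n. norm1 D (g n - f)) \<longlonglongrightarrow> 0"
  proof (rule Lim_null_comparison)
    show "\<forall>\<^sub>F n in sequentially. norm (norm1 D (g n - f)) \<le> 1 / Suc n"
      using g FU_F[OF assms]
      by (intro always_eventually) (auto simp: F1.nrm_diff_commute[of _ f] intro: less_imp_le)
    show "(\<lambda>n. 1 / real (Suc n)) \<longlonglongrightarrow> 0" by (intro LIMSEQ_Suc lim_1_over_n)
  qed
  then show ?thesis using g by blast
qed

lemma FU_I:
  assumes "f \<in> F" "\<And>e. e > 0 \<Longrightarrow> \<exists>g\<in>F \<inter> Cc X. csupport X g \<subseteq> U \<and> norm1 D (f - g) < e"
  shows "f \<in> FU U"
  using assms unfolding fdom_open_def fun_diff_def by blast

lemma FU_core: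
  assumes "g \<in> F" "g \<in> Cc X" "csupport X g \<subseteq> U"
  shows "g \<in> FU U"
  using assms by (intro FU_I) (auto intro!: bexI[of _ g])

lemma FU_closed:
  assumes Y: "\<And>n::nat. Y n \<in> FU U" and v: "v \<in> F" and lim: "(\<lambda>n. norm1 D (Y n - v)) \<longlonglongrightarrow> 0"
  shows "v \<in> FU U"
proof (rule FU_I[OF v])
  fix e :: real assume e: "e > 0"
  have "\<forall>\<^sub>F n in sequentially. norm1 D (Y n - v) < e / 2" using lim e by (intro order_tendstoD) auto
  then obtain n where n: "norm1 D (Y n - v) < e / 2" by (auto simp: eventually_sequentially)
  have "0 < e / 2" using e by simp
  then obtain g where g: "g \<in> F \<inter> Cc X" "csupport X g \<subseteq> U" "norm1 D (Y n - g) < e / 2"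
    using Y[of n] unfolding fdom_open_def fun_diff_def by blast
  have "norm1 D (v - g) < e"
    using F1.nrm_triangle_diff[of v "Y n" g] F1.nrm_diff_commute[of v "Y n"] n g FU_F[OF Y, of n] v by simp
  then show "\<exists>g\<in>F \<inter> Cc X. csupport X g \<subseteq> U \<and> norm1 D (v - g) < e" using g by blast
qed

lemma Cc_linear:
  assumes "f \<in> Cc X" "g \<in> Cc X" "csupport X f \<subseteq> U" "csupport X g \<subseteq> U"
  shows "f + c *\<^sub>R g \<in> Cc X" "csupport X (f + c *\<^sub>R g) \<subseteq> U"
proof -
  have sub: "csupport X (f + c *\<^sub>R g) \<subseteq> csupport X f \<union> csupport X g"
  proof -
    have "{x \<in> topspace X. (f + c *\<^sub>R g) x \<noteq> 0} \<subseteq> {x \<in> topspace X. f x \<noteq> 0} \<union> {x \<in> topspace X. g x \<noteq> 0}"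
      by (auto simp: plus_fun_apply scaleR_fun_apply)
    from closure_of_mono[OF this] show ?thesis unfolding csupport_def closure_of_Un .
  qed
  then show "csupport X (f + c *\<^sub>R g) \<subseteq> U" using assms by blast
  have "compactin X (csupport X f \<union> csupport X g)" using assms by (intro compactin_Un) (auto simp: Cc_def)
  then have "compactin X (csupport X (f + c *\<^sub>R g))"
    by (rule closed_compactin[OF _ sub]) (simp add: csupport_def)
  moreover have "continuous_map X euclideanreal (f + c *\<^sub>R g)"
    using assms unfolding plus_fun_def scaleR_fun_def real_scaleR_def
    by (intro continuous_map_add continuous_map_real_mult) (auto simp: Cc_def Cont_def)
  ultimately show "f + c *\<^sub>R g \<in> Cc X" by (simp add: Cc_def Cont_def)
qed

lemma FU_linear:
  assumes f: "f \<in> FU U" and g: "g \<in> FU U"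
  shows "f + c *\<^sub>R g \<in> FU U"
proof -
  obtain a where a: "\<And>n::nat. a n \<in> F \<inter> Cc X" "\<And>n. csupport X (a n) \<subseteq> U" "(\<lambda>n. norm1 D (a n - f)) \<longlonglongrightarrow> 0"
    using FU_approx[OF f] by blast
  obtain b where b: "\<And>n::nat. b n \<in> F \<inter> Cc X" "\<And>n. csupport X (b n) \<subseteq> U" "(\<lambda>n. norm1 D (b n - g)) \<longlonglongrightarrow> 0"
    using FU_approx[OF g] by blast
  have aF: "a n \<in> F" and bF: "b n \<in> F" for n using a b by auto
  have fF: "f \<in> F" and gF: "g \<in> F" using FU_F f g by auto
  have lim: "(\<lambda>n. norm1 D ((a n + c *\<^sub>R b n) - (f + c *\<^sub>R g))) \<longlonglongrightarrow> 0"
  proof (rule Lim_null_comparison)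
    have "norm1 D ((a n + c *\<^sub>R b n) - (f + c *\<^sub>R g)) \<le> norm1 D (a n - f) + \<bar>c\<bar> * norm1 D (b n - g)" for n
    proof -
      have eq: "(a n + c *\<^sub>R b n) - (f + c *\<^sub>R g) = (a n - f) + c *\<^sub>R (b n - g)"
        by (simp add: algebra_simps)
      show ?thesis
        unfolding eq using F1.nrm_triangle[of "a n - f" "c *\<^sub>R (b n - g)"] F1.nrm_scale[of "b n - g" c] aF bF fF gF by simp
    qed
    then show "\<forall>\<^sub>F n in sequentially. norm (norm1 D ((a n + c *\<^sub>R b n) - (f + c *\<^sub>R g)))
        \<le> norm1 D (a n - f) + \<bar>c\<bar> * norm1 D (b n - g)"
      using aF bF fF gF by (intro always_eventually) auto
    show "(\<lambda>n. norm1 D (a n - f) + \<bar>c\<bar> * norm1 D (b n - g)) \<longlonglongrightarrow> 0"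
      using tendsto_add[OF a(3) tendsto_mult_right_zero[OF b(3), of "\<bar>c\<bar>"]] by simp
  qed
  have mem: "a n + c *\<^sub>R b n \<in> FU U" for n
    using a(1,2)[of n] b(1,2)[of n]
    by (intro FU_core Cc_linear[where U = U] EE.add_in EE.scale_in) simp_all
  show ?thesis by (rule FU_closed[OF mem _ lim]) (use fF gF in simp)
qed

lemma FU_zero: "0 \<in> FU U"
proof -
  have "csupport X 0 = {}" by (simp add: csupport_def fun_ops)
  moreover have "continuous_map X euclideanreal (0 :: 'a \<Rightarrow> real)"
    unfolding zero_fun_def by simp
  ultimately show ?thesis by (intro FU_core) (auto simp: Cc_def Cont_def)
qed

lemma FU_scale: "f \<in> FU U \<Longrightarrow> c *\<^sub>R f \<in> FU U"
  using FU_linear[where f = 0 and g = f and c = c, OF FU_zero] by simp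

lemma FU_add: "f \<in> FU U \<Longrightarrow> g \<in> FU U \<Longrightarrow> f + g \<in> FU U"
  using FU_linear[where f = f and g = g and c = 1] by simp

lemma FU_diff: "f \<in> FU U \<Longrightarrow> g \<in> FU U \<Longrightarrow> f - g \<in> FU U"
  using FU_linear[where f = f and g = g and c = "-1"] by simp

lemma norm1_AE_zero:
  assumes "u \<in> F" "AE x in m. u x = 0"
  shows "norm1 D u = 0"
proof -
  have "E u u = E 0 u" using assms by (intro E_AE) (auto simp: fun_ops)
  then have "(norm1 D u)\<^sup>2 = 0"
    using norm1_sq[OF assms(1)] L2norm_eq_0_iff[of u m] assms by simp
  then show ?thesis by simp
qed

lemma FU_AE:
  assumes f: "f \<in> FU U" and g: "g \<in> borel_measurable m" and eq: "AE x in m. f x = g x"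
  shows "g \<in> FU U"
proof -
  have fF: "f \<in> F" by (rule FU_F[OF f])
  have gF: "g \<in> F" by (rule F_AE[OF fF g eq])
  have "AE x in m. (f - g) x = 0" using eq by eventually_elim (simp add: fun_ops)
  then have "norm1 D (f - g) = 0" using fF gF by (intro norm1_AE_zero) auto
  then show ?thesis by (intro FU_closed[OF f gF]) simp
qed

lemma FU_weakly_closed:
  assumes X: "\<And>n::nat. Y n \<in> FU U" and b: "\<And>n. E (Y n) (Y n) \<le> C"
    and u: "u \<in> L2 m" and lim: "(\<lambda>n. L2norm m (Y n - u)) \<longlonglongrightarrow> 0"
  shows "u \<in> FU U"
proof -
  have "\<exists>v\<in>FU U. AE x in m. v x = u x"
  proof (rule weakly_closed[OF _ _ _ X b u lim])
    show "FU U \<subseteq> F" by (auto simp: fdom_open_def)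
    show "(1 / 2) *\<^sub>R (f + g) \<in> FU U" if "f \<in> FU U" "g \<in> FU U" for f g
      using that by (intro FU_scale FU_add)
    show "v \<in> FU U" if "\<And>n::nat. Z n \<in> FU U" "v \<in> F" "(\<lambda>n. norm1 D (Z n - v)) \<longlonglongrightarrow> 0" for Z v
      by (rule FU_closed[OF that])
  qed
  then obtain v where v: "v \<in> FU U" "AE x in m. v x = u x" by blast
  show ?thesis by (rule FU_AE[OF v(1) L2_measurable[OF u] v(2)])
qed

lemma norm1_bounded:
  assumes "\<And>n::nat. g n \<in> F" "f \<in> F" "(\<lambda>n. norm1 D (g n - f)) \<longlonglongrightarrow> 0"
  shows "\<exists>B\<ge>0. \<forall>n. norm1 D (g n) \<le> B"
proof -
  have "(\<lambda>n. norm1 D (g n)) \<longlonglongrightarrow> norm1 D f" by (rule F1.nrm_tendsto[OF assms])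
  then have "Bseq (\<lambda>n. norm1 D (g n))" by (intro convergent_imp_Bseq convergentI)
  then obtain B where B: "B > 0" "\<And>n. norm (norm1 D (g n)) \<le> B" by (auto elim: BseqE)
  then have "norm1 D (g n) \<le> B" for n using B(2)[of n] by (simp add: abs_le_iff)
  then show ?thesis using B(1) by (intro exI[of _ B]) simp
qed

lemma EE_nrm_le_norm1: "u \<in> F \<Longrightarrow> EE.nrm u \<le> norm1 D u"
  using L2.ip_nonneg[of u m] by (simp add: EE.nrm_def norm1_def form1_eq)

lemma L2_tendsto_of_norm1:
  assumes "\<And>n::nat. g n \<in> F" "f \<in> F" "(\<lambda>n. norm1 D (g n - f)) \<longlonglongrightarrow> 0"
  shows "(\<lambda>n. L2norm m (g n - f)) \<longlonglongrightarrow> 0"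
  by (rule Lim_null_comparison[OF _ assms(3)])
    (use assms L2norm_le_norm1 in \<open>auto intro!: always_eventually\<close>)

lemma F_approx:
  assumes "f \<in> F"
  shows "\<exists>g :: nat \<Rightarrow> 'a \<Rightarrow> real. (\<forall>n. g n \<in> F \<inter> Cc X) \<and> (\<lambda>n. norm1 D (g n - f)) \<longlonglongrightarrow> 0"
proof -
  have "f \<in> FU (topspace X)"
  proof (rule FU_I[OF assms])
    fix e :: real assume "e > 0"
    then obtain g where "g \<in> F \<inter> Cc X" "norm1 D (f - g) < e"
      using regular assms unfolding regular_form_def fun_diff_def by blast
    then show "\<exists>g\<in>F \<inter> Cc X. csupport X g \<subseteq> topspace X \<and> norm1 D (f - g) < e"
      by (intro bexI[of _ g]) (auto simp: csupport_def closure_of_subset_topspace[THEN subsetD])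
  qed
  from FU_approx[OF this] show ?thesis by blast
qed

text \<open>Minima of core functions are core functions, since their support lies in that of the
  second one. Convergence in \<open>norm1\<close> is not claimed for them, but their energies are
  bounded and they converge in \<open>L2\<close>, so \<open>FU_weakly_closed\<close>
  applies.\<close>

lemma FU_ideal:
  assumes u: "u \<in> F" and w: "w \<in> FU U" and u0: "AE x in m. 0 \<le> u x" and w0: "AE x in m. 0 \<le> w x"
  shows "(\<lambda>x. min (u x) (w x)) \<in> FU U"
proof -
  obtain a where a: "\<And>n::nat. a n \<in> F \<inter> Cc X" "(\<lambda>n. norm1 D (a n - u)) \<longlonglongrightarrow> 0"
    using F_approx[OF u] by blast
  obtain b where b: "\<And>n::nat. b n \<in> F \<inter> Cc X" "\<And>n. csupport X (b n) \<subseteq> U" "(\<lambda>n. norm1 D (b n - w)) \<longlonglongrightarrow> 0"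
    using FU_approx[OF w] by blast
  have aF: "a n \<in> F" and bF: "b n \<in> F" and wF: "w \<in> F" for n using a b FU_F[OF w] by auto
  let ?c = "\<lambda>n x. min \<bar>a n x\<bar> \<bar>b n x\<bar>" and ?d = "\<lambda>x. min (u x) (w x)"
  have cF: "?c n \<in> F" for n using F_min[OF F_abs(1)[OF aF] F_abs(1)[OF bF], of n n] .
  have dF: "?d \<in> F" using F_min[OF u wF] .
  have cC: "?c n \<in> FU U" for n
  proof (rule FU_core[OF cF])
    have sub: "csupport X (?c n) \<subseteq> csupport X (b n)"
      unfolding csupport_def by (intro closure_of_mono) auto
    then show "csupport X (?c n) \<subseteq> U" using b(2)[of n] by blast
    have "compactin X (csupport X (b n))" using b(1)[of n] by (simp add: Cc_def)
    then have "compactin X (csupport X (?c n))"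
      using sub by (rule closed_compactin) (simp add: csupport_def)
    moreover have "continuous_map X euclideanreal (?c n)"
      using a(1)[of n] b(1)[of n]
      by (intro continuous_map_real_min continuous_map_real_abs) (auto simp: Cc_def Cont_def)
    ultimately show "?c n \<in> Cc X" by (simp add: Cc_def Cont_def)
  qed
  obtain A where A: "A \<ge> 0" "\<And>n. norm1 D (a n) \<le> A" using norm1_bounded[OF aF u a(2)] by auto
  obtain B where B: "B \<ge> 0" "\<And>n. norm1 D (b n) \<le> B" using norm1_bounded[OF bF wF b(3)] by auto
  have "E (?c n) (?c n) \<le> (A + B)\<^sup>2" for n
  proof -
    have "EE.nrm (?c n) \<le> EE.nrm (\<lambda>x. \<bar>a n x\<bar>) + EE.nrm (\<lambda>x. \<bar>b n x\<bar>)"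
      by (intro E_min_le F_abs aF bF)
    also have "\<dots> \<le> EE.nrm (a n) + EE.nrm (b n)"
      using F_abs(2)[OF aF, of n] F_abs(2)[OF bF, of n]
      by (intro add_mono) (simp_all add: EE.nrm_def)
    also have "\<dots> \<le> A + B"
      using EE_nrm_le_norm1[OF aF, of n] EE_nrm_le_norm1[OF bF, of n] A(2)[of n] B(2)[of n] by linarith
    finally have "(EE.nrm (?c n))\<^sup>2 \<le> (A + B)\<^sup>2" using cF by (intro power_mono) auto
    then show ?thesis using EE.nrm_sq[OF cF] by simp
  qed
  moreover have "(\<lambda>n. L2norm m (?c n - ?d)) \<longlonglongrightarrow> 0"
  proof (rule Lim_null_comparison)
    have la: "(\<lambda>n. L2norm m (a n - u)) \<longlonglongrightarrow> 0" by (rule L2_tendsto_of_norm1[OF aF u a(2)])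
    have lb: "(\<lambda>n. L2norm m (b n - w)) \<longlonglongrightarrow> 0" by (rule L2_tendsto_of_norm1[OF bF wF b(3)])
    show "(\<lambda>n. L2norm m (a n - u) + L2norm m (b n - w)) \<longlonglongrightarrow> 0" using tendsto_add[OF la lb] by simp
    have "L2norm m (?c n - ?d) \<le> L2norm m (a n - u) + L2norm m (b n - w)" for n
    proof -
      let ?A = "\<lambda>x. \<bar>(a n - u) x\<bar>" and ?B = "\<lambda>x. \<bar>(b n - w) x\<bar>"
      have AB: "?A \<in> L2 m" "?B \<in> L2 m"
        using L2_abs[of "a n - u" m] L2_abs[of "b n - w" m] aF bF u wF by simp_all
      have "AE x in m. \<bar>(?c n - ?d) x\<bar> \<le> \<bar>(?A + ?B) x\<bar>"
        using u0 w0
      proof eventually_elim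
        case (elim x)
        then show ?case
          using abs_min_diff_le[of "u x" "w x" "a n x" "b n x"] by (simp add: fun_ops)
      qed
      then have "L2norm m (?c n - ?d) \<le> L2norm m (?A + ?B)"
        using cF dF AB by (intro L2norm_mono) auto
      also have "\<dots> \<le> L2norm m ?A + L2norm m ?B" using AB by (intro L2.nrm_triangle)
      also have "\<dots> = L2norm m (a n - u) + L2norm m (b n - w)" by (simp add: L2norm_def)
      finally show ?thesis .
    qed
    then show "\<forall>\<^sub>F n in sequentially. norm (L2norm m (?c n - ?d)) \<le> L2norm m (a n - u) + L2norm m (b n - w)"
      using cF dF by (intro always_eventually) auto
  qed
  ultimately show ?thesis using dF by (intro FU_weakly_closed[OF cC]) auto
qed

text \<open>Same device as for the ideal property: a contraction maps core functions to core
  functions, with bounded energies and convergence in \<open>L2\<close>.\<close>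

lemma FU_contraction:
  assumes f: "f \<in> FU U" and T: "\<And>s t. \<bar>T s - T t\<bar> \<le> \<bar>s - t\<bar>" "T 0 = (0::real)"
  shows "(\<lambda>x. T (f x)) \<in> FU U"
proof -
  obtain b where b: "\<And>n::nat. b n \<in> F \<inter> Cc X" "\<And>n. csupport X (b n) \<subseteq> U" "(\<lambda>n. norm1 D (b n - f)) \<longlonglongrightarrow> 0"
    using FU_approx[OF f] by blast
  have bF: "b n \<in> F" and fF: "f \<in> F" for n using b FU_F[OF f] by auto
  let ?c = "\<lambda>n x. T (b n x)" and ?d = "\<lambda>x. T (f x)"
  have cF: "?c n \<in> F" for n by (rule F_contraction(1)[OF bF T])
  have dF: "?d \<in> F" by (rule F_contraction(1)[OF fF T])
  have Tcont: "continuous_on UNIV T"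
  proof (rule continuous_onI)
    fix x e :: real assume "e > 0"
    then show "\<exists>d>0. \<forall>x'\<in>UNIV. dist x' x < d \<longrightarrow> dist (T x') (T x) \<le> e"
      using order_trans[OF T(1)] by (intro exI[of _ e]) (auto simp: dist_real_def)
  qed
  have cC: "?c n \<in> FU U" for n
  proof (rule FU_core[OF cF])
    have sub: "csupport X (?c n) \<subseteq> csupport X (b n)"
      unfolding csupport_def by (intro closure_of_mono) (auto simp: T(2))
    then show "csupport X (?c n) \<subseteq> U" using b(2)[of n] by blast
    have "compactin X (csupport X (b n))" using b(1)[of n] by (simp add: Cc_def)
    then have "compactin X (csupport X (?c n))"
      using sub by (rule closed_compactin) (simp add: csupport_def)
    moreover have "continuous_map X euclideanreal (T \<circ> b n)"
      using b(1)[of n] Tcont by (intro continuous_map_compose[of X euclideanreal]) (auto simp: Cc_def Cont_def)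
    ultimately show "?c n \<in> Cc X" by (simp add: Cc_def Cont_def o_def)
  qed
  obtain B where B: "B \<ge> 0" "\<And>n. norm1 D (b n) \<le> B" using norm1_bounded[OF bF fF b(3)] by auto
  have "E (?c n) (?c n) \<le> B\<^sup>2" for n
  proof -
    have "E (?c n) (?c n) \<le> (EE.nrm (b n))\<^sup>2"
      using F_contraction(2)[OF bF T, of n] EE.nrm_sq[OF bF, of n] by simp
    also have "\<dots> \<le> B\<^sup>2"
      using EE_nrm_le_norm1[OF bF, of n] B(2)[of n] bF by (intro power_mono) auto
    finally show ?thesis .
  qed
  moreover have "(\<lambda>n. L2norm m (?c n - ?d)) \<longlonglongrightarrow> 0"
  proof (rule Lim_null_comparison)
    show "(\<lambda>n. L2norm m (b n - f)) \<longlonglongrightarrow> 0" by (rule L2_tendsto_of_norm1[OF bF fF b(3)])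
    have "L2norm m (?c n - ?d) \<le> L2norm m (b n - f)" for n
      using cF dF bF fF T(1) by (intro L2norm_mono) (auto simp: fun_ops)
    then show "\<forall>\<^sub>F n in sequentially. norm (L2norm m (?c n - ?d)) \<le> L2norm m (b n - f)"
      using cF dF by (intro always_eventually) auto
  qed
  ultimately show ?thesis using dF by (intro FU_weakly_closed[OF cC]) auto
qed

text \<open>The approximants vanish off U, so the part of f off U is dominated by the approximation
  error.\<close>

lemma FU_zero_outside:
  assumes f: "f \<in> FU U" and U: "openin X U"
  shows "AE x in m. x \<notin> U \<longrightarrow> f x = 0"
proof -
  obtain b where b: "\<And>n::nat. b n \<in> F \<inter> Cc X" "\<And>n. csupport X (b n) \<subseteq> U" "(\<lambda>n. norm1 D (b n - f)) \<longlonglongrightarrow> 0"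
    using FU_approx[OF f] by blast
  have bF: "b n \<in> F" and fF: "f \<in> F" for n using b FU_F[OF f] by auto
  let ?V = "space m - U"
  have V: "?V \<in> sets m" using open_sets[OF U] by auto
  let ?g = "\<lambda>x. indicator ?V x * f x"
  have g: "?g \<in> L2 m" using fF V by (intro L2_indicator) auto
  have "L2norm m ?g \<le> L2norm m (b n - f)" for n
  proof (rule L2norm_mono[OF g])
    have le: "\<bar>?g x\<bar> \<le> \<bar>(b n - f) x\<bar>" if "x \<in> space m" for x
    proof (cases "x \<in> U")
      case False
      then have "b n x = 0" using csupport_zero[of x "b n"] b(2)[of n] that by (auto simp: space_m)
      then show ?thesis using that False by (simp add: fun_ops)
    qed (simp add: indicator_def)
    show "AE x in m. \<bar>?g x\<bar> \<le> \<bar>(b n - f) x\<bar>" by (rule AE_I2) (rule le)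
  qed (use bF fF in simp)
  then have "L2norm m ?g \<le> 0"
    using L2_tendsto_of_norm1[OF bF fF b(3)] by (intro LIMSEQ_le_const) auto
  then have "L2norm m ?g = 0" using g by (simp add: antisym)
  then have "AE x in m. ?g x = 0" using L2norm_eq_0_iff[OF g] by simp
  moreover have "AE x in m. x \<in> space m" by (rule AE_space)
  ultimately show ?thesis by eventually_elim (auto simp: indicator_def split: if_splits)
qed

text \<open>Locality is applied to approximants with support inside U, because the support of f
  itself may meet the boundary of U, where nothing is known about y.\<close>

lemma FU_local:
  assumes y: "y \<in> F" and y0: "AE x in m. x \<in> U \<longrightarrow> y x = 0" and f: "f \<in> FU U"
  shows "E y f = 0"
proof -
  obtain b where b: "\<And>n::nat. b n \<in> F \<inter> Cc X" "\<And>n. csupport X (b n) \<subseteq> U" "(\<lambda>n. norm1 D (b n - f)) \<longlonglongrightarrow> 0"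
    using FU_approx[OF f] by blast
  have bF: "b n \<in> F" for n using b by auto
  have "E (b n) y = 0" for n
  proof -
    have "AE x in m. x \<in> msupport X m (b n) \<longrightarrow> y x = 0"
      using y0 by eventually_elim (use msupport_csupport[of "b n"] b(2)[of n] in auto)
    then show ?thesis using E_local_const[OF y bF] E_sym[OF y bF, of n] by simp
  qed
  moreover have "(\<lambda>n. E (b n) y) \<longlonglongrightarrow> E f y" by (rule E_tendsto[OF bF FU_F[OF f] y b(3)])
  ultimately have "E f y = 0" by (simp add: LIMSEQ_const_iff)
  then show ?thesis using E_sym[OF y FU_F[OF f]] by simp
qed

lemma FU_local_eq:
  assumes "u \<in> F" "v \<in> F" "AE x in m. x \<in> U \<longrightarrow> u x = v x" "f \<in> FU U"
  shows "E u f = E v f"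
proof -
  have "AE x in m. x \<in> U \<longrightarrow> (u - v) x = 0"
    using assms(3) by eventually_elim (simp add: fun_ops)
  then have "E (u - v) f = 0" using assms by (intro FU_local) auto
  then show ?thesis using assms FU_F[OF assms(4)] by (simp add: EE.ip_simps)
qed

lemma cutoff_FU: "cutoff f K U \<Longrightarrow> f \<in> FU U"
  by (auto simp: cutoff_def intro: FU_core)

text \<open>f may be unbounded, so a cutoff c yields only min f (n c). On the support of f this is
  min f n, a contraction of f and hence of bounded energy; n tends to infinity.\<close>

lemma FU_of_compact:
  assumes f: "f \<in> F" and f0: "AE x in m. 0 \<le> f x"
    and K: "compactin X (msupport X m f)" and U: "openin X U" and KU: "msupport X m f \<subseteq> U"
  shows "f \<in> FU U"
proof -
  obtain c where c: "cutoff c (msupport X m f) U" using cutoff_exists[OF K U KU] by auto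
  have cU: "c \<in> FU U" by (rule cutoff_FU[OF c])
  let ?g = "\<lambda>n x. min (f x) ((real n *\<^sub>R c) x)"
  let ?T = "\<lambda>n s. max (min s (real n)) 0"
  have g: "?g n \<in> FU U" for n
    using cutoffD(3)[OF c] by (intro FU_ideal f f0 FU_scale cU) (simp add: fun_ops)
  have T: "(\<lambda>x. ?T n (f x)) \<in> F" "E (\<lambda>x. ?T n (f x)) (\<lambda>x. ?T n (f x)) \<le> E f f" for n
    by (rule F_contraction[OF f]; auto simp: max_def min_def)+
  have eq: "AE x in m. ?g n x = ?T n (f x)" for n
    using f0 msupport_AE_zero[OF F_measurable[OF f]]
  proof eventually_elim
    case (elim x)
    then show ?case
      using cutoffD(6)[OF c, of x] cutoffD(3)[OF c, of x] by (cases "x \<in> msupport X m f") (auto simp: fun_ops)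
  qed
  have E_le: "E (?g n) (?g n) \<le> E f f" for n
  proof -
    have gF: "?g n \<in> F" using g by (rule FU_F)
    have "E (?g n) (?g n) = E (\<lambda>x. ?T n (f x)) (?g n)" by (rule E_AE[OF gF T(1) gF eq])
    also have "\<dots> = E (?g n) (\<lambda>x. ?T n (f x))" by (rule E_sym[OF T(1) gF])
    also have "\<dots> = E (\<lambda>x. ?T n (f x)) (\<lambda>x. ?T n (f x))" by (rule E_AE[OF gF T(1) T(1) eq])
    finally show ?thesis using T(2)[of n] by simp
  qed
  have lim: "(\<lambda>n. L2norm m (?g n - f)) \<longlonglongrightarrow> 0"
  proof (rule L2_dominated_convergence(2))
    show "?g n \<in> borel_measurable m" for n using F_measurable[OF FU_F[OF g]] .
    show "f \<in> borel_measurable m" using F_measurable[OF f] .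
    show "(\<lambda>x. \<bar>f x\<bar>) \<in> L2 m" using f by (intro L2_abs) auto
    show "AE x in m. \<bar>?g n x\<bar> \<le> \<bar>f x\<bar>" for n
      using f0 by eventually_elim (use cutoffD(3)[OF c] in \<open>auto simp: fun_ops min_def\<close>)
    have "AE x in m. \<forall>n. ?g n x = ?T n (f x)" by (subst AE_all_countable) (use eq in blast)
    then show "AE x in m. (\<lambda>n. ?g n x) \<longlonglongrightarrow> f x"
      using f0
    proof eventually_elim
      case (elim x)
      obtain N :: nat where "f x \<le> real N" using real_arch_simple by blast
      then have "\<forall>n\<ge>N. ?g n x = f x" using elim by (auto simp: min_def max_def)
      then show ?case by (intro tendsto_eventually) (auto simp: eventually_sequentially)
    qed
  qed
  show ?thesis by (rule FU_weakly_closed[OF g E_le _ lim]) (use f in simp)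
qed

lemma FU_max:
  assumes "f \<in> FU U" "g \<in> FU U" "AE x in m. 0 \<le> f x" "AE x in m. 0 \<le> g x"
  shows "(\<lambda>x. max (f x) (g x)) \<in> FU U"
proof -
  have eq: "(\<lambda>x. max (f x) (g x)) = f + g - (\<lambda>x. min (f x) (g x))"
    by (auto simp: fun_eq_iff fun_ops max_def min_def)
  show ?thesis unfolding eq by (intro FU_diff FU_add FU_ideal assms FU_F[OF assms(1)])
qed

text \<open>By the Lindelof property countably many cutoffs of single points suffice, and c n is the
  maximum of the first n + 1 of them.\<close>

lemma exhaustion:
  assumes U: "openin X U"
  shows "\<exists>c :: nat \<Rightarrow> 'a \<Rightarrow> real. (\<forall>n. c n \<in> FU U \<and> (\<forall>x. 0 \<le> c n x \<and> c n x \<le> 1)) \<and>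
    (\<forall>x\<in>U. \<exists>N. \<forall>n\<ge>N. c n x = 1)"
proof (cases "U = {}")
  case True
  then show ?thesis by (intro exI[of _ "\<lambda>n. 0"]) (auto simp: FU_zero fun_ops)
next
  case False
  have "\<exists>f W. cutoff f {x} U \<and> openin X W \<and> x \<in> W \<and> W \<subseteq> U \<and> (\<forall>y\<in>W. f y = 1)" if x: "x \<in> U" for x
  proof -
    have "compactin X {x}" using x openin_subset[OF U] by auto
    then obtain f where f: "cutoff f {x} U" using cutoff_exists[OF _ U] x by blast
    then obtain W where W: "openin X W" "x \<in> W" "\<And>y. y \<in> W \<Longrightarrow> f y = 1" by (auto simp: cutoff_def)
    then show ?thesis using f x U by (intro exI[of _ f] exI[of _ "W \<inter> U"]) auto
  qed
  then obtain f W where fW: "\<And>x. x \<in> U \<Longrightarrow> cutoff (f x) {x} U" "\<And>x. x \<in> U \<Longrightarrow> openin X (W x)"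
    "\<And>x. x \<in> U \<Longrightarrow> x \<in> W x" "\<And>x. x \<in> U \<Longrightarrow> W x \<subseteq> U" "\<And>x y. x \<in> U \<Longrightarrow> y \<in> W x \<Longrightarrow> f x y = 1"
    by metis
  have "Lindelof_space (subtopology X U)"
    by (intro second_countable_imp_Lindelof_space second_countable_subtopology second_countable_X)
  moreover have "topspace (subtopology X U) = U" using openin_subset[OF U] by auto
  moreover have "\<forall>V\<in>W ` U. openin (subtopology X U) V" using fW U by (auto simp: openin_open_subtopology)
  moreover have "\<Union>(W ` U) = U" using fW by blast
  ultimately obtain G where G: "countable G" "G \<subseteq> W ` U" "\<Union>G = U"
    unfolding Lindelof_space_def by metis
  then obtain C where C: "countable C" "C \<subseteq> U" "G = W ` C" by (metis countable_subset_image)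
  have "C \<noteq> {}" using G C False by auto
  define e where "e = from_nat_into C"
  have e: "e n \<in> C" for n using \<open>C \<noteq> {}\<close> by (simp add: e_def from_nat_into)
  have e_surj: "\<exists>n. e n = x" if "x \<in> C" for x
    using from_nat_into_surj[OF C(1) that] by (auto simp: e_def)
  define c where "c = rec_nat (f (e 0)) (\<lambda>n g x. max (g x) (f (e (Suc n)) x))"
  have c_0: "c 0 = f (e 0)" and c_Suc: "c (Suc n) = (\<lambda>x. max (c n x) (f (e (Suc n)) x))" for n
    by (simp_all add: c_def)
  have eU: "e n \<in> U" for n using e C by auto
  have cut: "0 \<le> f (e n) x" "f (e n) x \<le> 1" "f (e n) \<in> FU U" for n x
    using cutoffD(3,4)[OF fW(1)[OF eU]] cutoff_FU[OF fW(1)[OF eU]] by auto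
  have c: "c n \<in> FU U \<and> (\<forall>x. 0 \<le> c n x \<and> c n x \<le> 1)" for n
  proof (induction n)
    case (Suc n)
    then show ?case using cut by (auto simp: c_Suc le_max_iff_disj intro!: FU_max)
  qed (use cut in \<open>simp add: c_0\<close>)
  have c_ge: "f (e k) x \<le> c n x" if "k \<le> n" for k n x
    using that
  proof (induction n)
    case (Suc n)
    then show ?case by (cases "k = Suc n") (auto simp: c_Suc)
  qed (simp add: c_0)
  have "\<exists>N. \<forall>n\<ge>N. c n x = 1" if x: "x \<in> U" for x
  proof -
    obtain z where "z \<in> C" "x \<in> W z" using x G C by blast
    then obtain k where k: "x \<in> W (e k)" using e_surj by blast
    then have "f (e k) x = 1" using fW(5)[OF eU] by blast
    then have "c n x = 1" if "n \<ge> k" for n using c_ge[OF that, of x] c[of n] by (metis antisym)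
    then show ?thesis by blast
  qed
  then show ?thesis using c by blast
qed

text \<open>The functions min u (n c_n) are in F(U) by the ideal property and agree with u at each
  point of U for large n; the factor n takes care of unbounded u.\<close>

lemma FU_dense_pos:
  assumes u: "u \<in> F" and u0: "\<And>x. 0 \<le> u x" and U: "openin X U" and e: "e > 0"
  shows "\<exists>g\<in>FU U. L2norm m ((\<lambda>x. indicator U x * u x) - g) < e"
proof -
  obtain c :: "nat \<Rightarrow> 'a \<Rightarrow> real" where c: "\<And>n. c n \<in> FU U" "\<And>n x. 0 \<le> c n x" "\<And>n x. c n x \<le> 1"
    "\<And>x. x \<in> U \<Longrightarrow> \<exists>N. \<forall>n\<ge>N. c n x = 1"
    using exhaustion[OF U] by blast
  let ?g = "\<lambda>n x. min (u x) ((real n *\<^sub>R c n) x)" and ?v = "\<lambda>x. indicator U x * u x"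
  have g: "?g n \<in> FU U" for n
    using u0 c by (intro FU_ideal u FU_scale) (auto simp: fun_ops)
  have v: "?v \<in> L2 m" using u open_sets[OF U] by (intro L2_indicator) auto
  have "(\<lambda>n. L2norm m (?g n - ?v)) \<longlonglongrightarrow> 0"
  proof (rule L2_dominated_convergence(2))
    show "?g n \<in> borel_measurable m" for n using F_measurable[OF FU_F[OF g]] .
    show "?v \<in> borel_measurable m" using L2_measurable[OF v] .
    show "u \<in> L2 m" using u by simp
    show "AE x in m. \<bar>?g n x\<bar> \<le> u x" for n using u0 c by (auto simp: fun_ops min_def)
    have "AE x in m. \<forall>n. x \<notin> U \<longrightarrow> ?g n x = 0"
      by (subst AE_all_countable) (use FU_zero_outside[OF g U] in blast)
    then show "AE x in m. (\<lambda>n. ?g n x) \<longlonglongrightarrow> ?v x"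
    proof eventually_elim
      case (elim x)
      show ?case
      proof (cases "x \<in> U")
        case True
        obtain N where N: "\<And>n. n \<ge> N \<Longrightarrow> c n x = 1" using c(4)[OF True] by auto
        obtain N' :: nat where N': "u x \<le> real N'" using real_arch_simple by blast
        have "?g n x = ?v x" if "n \<ge> max N N'" for n
        proof -
          have "u x \<le> real n" using that N' by (meson le_trans max.bounded_iff of_nat_mono order_trans)
          then show ?thesis using N[of n] that True by (simp add: fun_ops)
        qed
        then have "\<forall>n\<ge>max N N'. ?g n x = ?v x" by blast
        then show ?thesis by (intro tendsto_eventually) (simp only: eventually_sequentially, blast)
      qed (use elim in simp)
    qed
  qed
  then have "\<forall>\<^sub>F n in sequentially. L2norm m (?g n - ?v) < e" using e by (intro order_tendstoD) auto
  then obtain n where "L2norm m (?g n - ?v) < e" by (auto simp: eventually_sequentially)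
  then have "L2norm m (?v - ?g n) < e"
    using L2.nrm_diff_commute[of ?v m "?g n"] v FU_F[OF g, of n] by simp
  then show ?thesis using g by blast
qed

lemma FU_dense:
  assumes f: "f \<in> L2 m" and U: "openin X U" and f0: "AE x in m. x \<notin> U \<longrightarrow> f x = 0" and e: "e > 0"
  shows "\<exists>g\<in>FU U. L2norm m (f - g) < e"
proof -
  obtain u where u: "u \<in> F" "L2norm m (f - u) < e / 3" using F_dense[OF f, of "e / 3"] e by auto
  let ?p = "\<lambda>x. max (u x) 0" and ?q = "\<lambda>x. max ((- u) x) 0"
  have pq: "?p \<in> F" "?q \<in> F" using F_pos[of u] F_pos[of "- u"] u by auto
  let ?ext = "\<lambda>f x. indicator U x * f x"
  have e3: "e / 3 > 0" using e by simp
  obtain g where g: "g \<in> FU U" "L2norm m (?ext ?p - g) < e / 3"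
    using FU_dense_pos[OF pq(1) _ U e3] by auto
  obtain h where h: "h \<in> FU U" "L2norm m (?ext ?q - h) < e / 3"
    using FU_dense_pos[OF pq(2) _ U e3] by auto
  have L: "?ext ?p \<in> L2 m" "?ext ?q \<in> L2 m" "?ext u \<in> L2 m"
    using pq u open_sets[OF U] by (auto intro!: L2_indicator)
  have gh: "g \<in> F" "h \<in> F" using FU_F g h by auto
  have 1: "L2norm m (f - ?ext u) \<le> L2norm m (f - u)"
  proof (rule L2norm_mono)
    show "AE x in m. \<bar>(f - ?ext u) x\<bar> \<le> \<bar>(f - u) x\<bar>"
      using f0 by eventually_elim (auto simp: fun_ops indicator_def)
  qed (use f L u in auto)
  have eq: "?ext u = ?ext ?p - ?ext ?q" by (auto simp: fun_eq_iff fun_ops max_def indicator_def)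
  have 2: "?ext u - (g - h) = (?ext ?p - g) - (?ext ?q - h)" unfolding eq by simp
  have 3: "L2norm m (?ext u - (g - h)) \<le> L2norm m (?ext ?p - g) + L2norm m (?ext ?q - h)"
    unfolding 2 using L gh by (intro L2.nrm_triangle_minus) auto
  have "L2norm m (f - (g - h)) \<le> L2norm m (f - ?ext u) + L2norm m (?ext u - (g - h))"
    using f L gh by (intro L2.nrm_triangle_diff) auto
  then have "L2norm m (f - (g - h)) < e" using 1 3 u g h by linarith
  then show ?thesis using FU_diff[OF g(1) h(1)] by blast
qed

end

section \<open>Restriction to open subsets\<close>

locale open_subset = dirichlet_space +
  fixes U :: "'a set"
  assumes U: "openin X U"
begin

abbreviation "DU \<equiv> restrict_dirichlet D U"
abbreviation "mU \<equiv> restrict_space m U"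

definition zext :: "('a \<Rightarrow> real) \<Rightarrow> 'a \<Rightarrow> real" where
  "zext f = (\<lambda>x. indicator U x * f x)"

lemma zext_apply: "zext f x = indicator U x * f x"
  by (simp add: zext_def)

lemma zext_in [simp]: "x \<in> U \<Longrightarrow> zext f x = f x"
  by (simp add: zext_def)

lemma zext_out: "x \<notin> U \<Longrightarrow> zext f x = 0"
  by (simp add: zext_def)

lemma zext_simps: "zext (f + g) = zext f + zext g" "zext (f - g) = zext f - zext g"
  "zext (c *\<^sub>R f) = c *\<^sub>R zext f" "zext 0 = 0" "zext (zext f) = zext f"
  by (auto simp: fun_eq_iff fun_ops zext_apply algebra_simps indicator_def)

lemma zext_compose: "T 0 = 0 \<Longrightarrow> zext (\<lambda>x. T (f x)) = (\<lambda>x. T (zext f x))"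
  by (auto simp: fun_eq_iff zext_apply indicator_def)

lemma DU_simps: "top_of DU = subtopology X U" "msr DU = mU" "frm DU f g = E (zext f) (zext g)"
  "f \<in> fdom DU \<longleftrightarrow> zext f \<in> FU U"
  by (simp_all add: restrict_dirichlet_def zext_def)

lemma U_sets: "U \<in> sets m" "U \<inter> space m \<in> sets m"
  using open_sets[OF U] by auto

lemma U_top: "U \<subseteq> topspace X"
  using openin_subset[OF U] .

lemma AE_U: "(AE x in mU. P x) \<longleftrightarrow> (AE x in m. x \<in> U \<longrightarrow> P x)"
  by (rule AE_restrict_space_iff[OF U_sets(2)])

lemma AE_DU: "(AE x in msr DU. P x) \<longleftrightarrow> (AE x in m. x \<in> U \<longrightarrow> P x)"
  by (simp only: DU_simps AE_U)

lemma measurable_U: "f \<in> borel_measurable mU \<longleftrightarrow> zext f \<in> borel_measurable m"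
  by (simp add: borel_measurable_restrict_space_iff[OF U_sets(2)] zext_def)

lemma L2_U: "f \<in> L2 mU \<longleftrightarrow> zext f \<in> L2 m"
proof -
  have "(\<lambda>x. (zext f x)\<^sup>2) = (\<lambda>x. indicator U x *\<^sub>R (f x)\<^sup>2)"
    by (auto simp: fun_eq_iff zext_apply indicator_def)
  then show ?thesis by (simp add: L2_def measurable_U integrable_restrict_space[OF U_sets(2)])
qed

lemma ip2_U: "ip2 mU f g = ip2 m (zext f) (zext g)"
  unfolding ip2_def integral_restrict_space[OF U_sets(2)]
  by (rule Bochner_Integration.integral_cong) (auto simp: zext_apply indicator_def)

lemma L2norm_U: "L2norm mU f = L2norm m (zext f)"
  using ip2_U[of f f] by (simp add: L2norm_def ip2_def power2_eq_square)

lemma norm1_U: "norm1 DU f = norm1 D (zext f)"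
  using ip2_U[of f f] by (simp add: norm1_def form1_def DU_simps ip2_def)

lemma zext_L2 [simp]: "f \<in> L2 m \<Longrightarrow> zext f \<in> L2 m"
  using L2_indicator[OF _ U_sets(1)] by (simp add: zext_def)

lemma zext_measurable: "f \<in> borel_measurable m \<Longrightarrow> zext f \<in> borel_measurable m"
  using U_sets(1) by (simp add: zext_def)

lemma zext_FU: "f \<in> FU U \<Longrightarrow> AE x in m. zext f x = f x"
  using FU_zero_outside[OF _ U, of f] by (auto simp: zext_apply indicator_def elim!: eventually_mono)

lemma zext_mem_FU: "f \<in> FU U \<Longrightarrow> zext f \<in> FU U"
  using zext_FU[of f] FU_AE[of f U "zext f"] zext_measurable[OF F_measurable[OF FU_F[of f U]]]
  by (simp add: eq_commute)

lemma E_zext: "f \<in> FU U \<Longrightarrow> g \<in> F \<Longrightarrow> E (zext f) g = E f g"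
  using zext_FU FU_F zext_mem_FU by (intro E_AE) blast+

lemma symmetric_U: "symmetric_form DU"
proof -
  have F1: "zext g \<in> FU U" if "zext f \<in> FU U" "g \<in> borel_measurable mU" "AE x in mU. f x = g x" for f g
  proof (rule FU_AE[OF that(1)])
    show "zext g \<in> borel_measurable m" using that measurable_U by blast
    show "AE x in m. zext f x = zext g x"
      using that(3) unfolding AE_U by eventually_elim (auto simp: zext_apply indicator_def)
  qed
  have F2: "E (zext f) (zext h) = E (zext g) (zext h)"
    if "zext f \<in> FU U" "zext g \<in> FU U" "zext h \<in> FU U" "AE x in mU. f x = g x" for f g h
  proof (rule E_AE)
    show "AE x in m. zext f x = zext g x"
      using that(4) unfolding AE_U by eventually_elim (auto simp: zext_apply indicator_def)
  qed (use that FU_F in blast)+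
  have F3: "f \<in> L2 mU" if "zext f \<in> FU U" for f
    using that FU_F by (auto simp: L2_U)
  have p: "(\<lambda>x. f x + g x) = f + g" "(\<lambda>x. c * f x) = c *\<^sub>R f" "(\<lambda>x. 0) = (0 :: 'a \<Rightarrow> real)" for f g :: "'a \<Rightarrow> real" and c
    by (auto simp: fun_eq_iff fun_ops)
  show ?thesis
    unfolding symmetric_form_def Let_def p
  proof (intro conjI ballI impI allI subsetI, unfold DU_simps)
    fix f g h :: "'a \<Rightarrow> real" and c :: real
    assume f: "zext f \<in> FU U"
    note fF = FU_F[OF f]
    show "f \<in> L2 mU" by (rule F3[OF f])
    show "zext (c *\<^sub>R f) \<in> FU U" using f by (simp add: zext_simps FU_scale)
    show "0 \<le> E (zext f) (zext f)" using fF by (rule E_nonneg)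
    show "zext g \<in> FU U" if "g \<in> borel_measurable mU" "AE x in mU. f x = g x" by (rule F1[OF f that])
    assume g: "zext g \<in> FU U"
    note gF = FU_F[OF g]
    show "E (zext f) (zext g) = E (zext g) (zext f)" by (rule E_sym[OF fF gF])
    show "zext (f + g) \<in> FU U" using f g by (simp add: zext_simps FU_add)
    show "E (zext (c *\<^sub>R f)) (zext g) = c * E (zext f) (zext g)"
      using fF gF by (simp add: zext_simps EE.ip_simps)
    assume h: "zext h \<in> FU U"
    show "E (zext (f + g)) (zext h) = E (zext f) (zext h) + E (zext g) (zext h)"
      using fF gF FU_F[OF h] by (simp add: zext_simps EE.ip_simps)
    show "E (zext f) (zext h) = E (zext g) (zext h)" if "AE x in mU. f x = g x"
      by (rule F2[OF f g h that])
  qed (simp add: zext_simps FU_zero)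
qed

lemma closed_U: "closed_form DU"
  unfolding closed_form_def
proof (intro allI impI, elim conjE)
  fix u :: "nat \<Rightarrow> 'a \<Rightarrow> real"
  assume u: "\<forall>n. u n \<in> fdom DU" and c: "\<forall>e>0. \<exists>N. \<forall>i\<ge>N. \<forall>j\<ge>N. norm1 DU (\<lambda>x. u i x - u j x) < e"
  have zu: "zext (u n) \<in> FU U" for n using u by (simp add: DU_simps)
  have nd: "norm1 DU (\<lambda>x. u n x - f x) = norm1 D (zext (u n) - zext f)" for n f
  proof -
    have "(\<lambda>x. u n x - f x) = u n - f" by (simp add: fun_eq_iff fun_ops)
    then show ?thesis by (simp add: norm1_U zext_simps)
  qed
  have "\<exists>f\<in>F. (\<lambda>n. norm1 D (zext (u n) - f)) \<longlonglongrightarrow> 0"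
    using c unfolding nd by (intro norm1_complete FU_F[OF zu]) blast
  then obtain f where f: "f \<in> F" "(\<lambda>n. norm1 D (zext (u n) - f)) \<longlonglongrightarrow> 0" by blast
  have fU: "f \<in> FU U" by (rule FU_closed[OF zu f])
  have "norm1 D (zext (u n) - zext f) = norm1 D (zext (u n) - f)" for n
  proof -
    have F: "zext f \<in> F" "zext (u n) \<in> F" using zext_mem_FU[OF fU] zu FU_F by blast+
    have "norm1 D (zext f - f) = 0"
      using zext_FU[OF fU] F f(1) by (intro norm1_AE_zero) (auto simp: fun_ops)
    then show ?thesis
      using F1.nrm_triangle_diff[of "zext (u n)" "zext f" f] F1.nrm_triangle_diff[of "zext (u n)" f "zext f"]
        F1.nrm_diff_commute[of f "zext f"] F f(1) by simp
  qed
  then show "\<exists>f\<in>fdom DU. (\<lambda>n. norm1 DU (\<lambda>x. u n x - f x)) \<longlonglongrightarrow> 0"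
    unfolding nd using f fU zext_mem_FU[OF fU] by (intro bexI[of _ f]) (auto simp: DU_simps)
qed

lemma markov_U: "markov_form DU"
  unfolding markov_form_def
proof (intro allI impI ballI, elim conjE)
  fix T :: "real \<Rightarrow> real" and f
  assume T: "\<forall>s t. \<bar>T s - T t\<bar> \<le> \<bar>s - t\<bar>" "T 0 = 0" and f: "f \<in> fdom DU"
  have eq: "zext (T \<circ> f) = (\<lambda>x. T (zext f x))" using zext_compose[of T f] T(2) by (simp add: comp_def)
  have "zext f \<in> FU U" using f by (simp add: DU_simps)
  then show "T \<circ> f \<in> fdom DU \<and> frm DU (T \<circ> f) (T \<circ> f) \<le> frm DU f f"
    using FU_contraction[of "zext f" U T] F_contraction(2)[of "zext f" T] T FU_F
    unfolding DU_simps eq by blast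
qed

lemma dense_U: "densely_defined_form DU"
  unfolding densely_defined_form_def
proof (intro ballI allI impI)
  fix f and e :: real assume f: "f \<in> L2 (msr DU)" and e: "e > 0"
  then have zf: "zext f \<in> L2 m" by (simp add: DU_simps L2_U)
  obtain g where g: "g \<in> FU U" "L2norm m (zext f - g) < e"
    using FU_dense[OF zf U _ e] by (auto simp: zext_out)
  have "L2norm m (zext f - zext g) \<le> L2norm m (zext f - g)"
    using zext_FU[OF g(1)] zf FU_F[OF g(1)] FU_F[OF zext_mem_FU[OF g(1)]]
    by (intro L2norm_mono) (auto simp: fun_ops elim!: eventually_mono)
  moreover have "(\<lambda>x. f x - g x) = f - g" by (simp add: fun_eq_iff fun_ops)
  ultimately show "\<exists>g\<in>fdom DU. L2norm (msr DU) (\<lambda>x. f x - g x) < e"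
    using g zext_mem_FU[OF g(1)]
    by (intro bexI[of _ g]) (auto simp: DU_simps L2norm_U zext_simps)
qed

sublocale DU: dirichlet_form DU
  by unfold_locales (fact symmetric_U closed_U dense_U markov_U)+

text \<open>The resolvent of the part on U as a function on all of X, so that it can be compared
  with elements of F.\<close>

definition RU :: "real \<Rightarrow> ('a \<Rightarrow> real) \<Rightarrow> 'a \<Rightarrow> real" where
  "RU a f = zext (DU.R a f)"

text \<open>A function in F(U) differs from its \<open>zext\<close> only on a null set, so the
  equation on U may be tested directly with elements of F(U).\<close>

lemma
  assumes f: "zext f \<in> L2 m" and a: "0 < a"
  shows RU_FU: "RU a f \<in> FU U"
    and RU_eq: "v \<in> FU U \<Longrightarrow> E (RU a f) v = a * ip2 m (zext f - RU a f) v"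
proof -
  have fU: "f \<in> L2 (msr DU)" using f by (simp add: DU_simps L2_U)
  show R: "RU a f \<in> FU U" using DU.R_F[OF fU a] by (simp add: DU_simps RU_def)
  assume v: "v \<in> FU U"
  have "zext v \<in> FU U" by (rule zext_mem_FU[OF v])
  then have "E (RU a f) (zext v) = a * ip2 m (zext f - RU a f) (zext v)"
    using DU.R_eq[OF fU a, of v] by (simp add: DU_simps ip2_U zext_simps RU_def)
  moreover have "E (RU a f) (zext v) = E (RU a f) v"
    using E_sym[OF FU_F[OF R]] E_zext[OF v FU_F[OF R]] FU_F[OF v] FU_F[OF zext_mem_FU[OF v]] by simp
  moreover have "ip2 m (zext f - RU a f) (zext v) = ip2 m (zext f - RU a f) v"
    using zext_FU[OF v] f FU_F[OF R] FU_F[OF v] FU_F[OF zext_mem_FU[OF v]]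
    by (intro ip2_cong_AE) (auto simp: L2_measurable elim!: eventually_mono)
  ultimately show "E (RU a f) v = a * ip2 m (zext f - RU a f) v" by simp
qed

end

section \<open>Local extension of the form, on X and on U\<close>

context dirichlet_space
begin

text \<open>The \<open>THE\<close> is resolved by strong locality: any two local representatives
  agree on the support of \<phi>.\<close>

lemma form_loc_eq:
  assumes "\<phi> \<in> F" "h \<in> F" "openin X V" "msupport X m \<phi> \<subseteq> V" "AE x in m. x \<in> V \<longrightarrow> f x = h x"
  shows "form_loc D f \<phi> = E h \<phi>"
  unfolding form_loc_def
proof (rule the_equality)
  show "\<exists>h'\<in>F. \<exists>V. openin X V \<and> msupport X m \<phi> \<subseteq> V \<and> (AE x in m. x \<in> V \<longrightarrow> f x = h' x) \<and> E h \<phi> = E h' \<phi>"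
    using assms by blast
  fix r assume "\<exists>h\<in>F. \<exists>V. openin X V \<and> msupport X m \<phi> \<subseteq> V \<and> (AE x in m. x \<in> V \<longrightarrow> f x = h x) \<and> r = E h \<phi>"
  then obtain h' V' where *: "h' \<in> F" "msupport X m \<phi> \<subseteq> V'" "AE x in m. x \<in> V' \<longrightarrow> f x = h' x" "r = E h' \<phi>" by blast
  have "E h' \<phi> = E h \<phi>"
  proof (rule E_local_eq[OF *(1) assms(2,1)])
    show "AE x in m. x \<in> msupport X m \<phi> \<longrightarrow> h' x = h x"
      using *(3) assms(5) by eventually_elim (use *(2) assms(4) in auto)
  qed
  then show "r = E h \<phi>" using * by simp
qed

lemma Floc_local:
  assumes f: "f \<in> Floc D" and K: "compactin X K" and W: "openin X W" "K \<subseteq> W"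
  shows "\<exists>h\<in>F. \<exists>V. rel_compact_open X V \<and> K \<subseteq> V \<and> X closure_of V \<subseteq> W \<and> (AE x in m. x \<in> V \<longrightarrow> f x = h x)"
proof -
  obtain V where V: "openin X V" "K \<subseteq> V" "compactin X (X closure_of V)" "X closure_of V \<subseteq> W"
    using compact_nbhd[OF K W] by blast
  then have "rel_compact_open X V" by (simp add: rel_compact_open_def)
  then show ?thesis using f V unfolding Floc_def by blast
qed

end

context open_subset
begin

lemma set_eq_of_subsets: "U \<inter> A \<subseteq> B \<Longrightarrow> B \<subseteq> A \<Longrightarrow> U \<subseteq> T \<Longrightarrow> U - B = U \<inter> (T - A)"
  by blast

lemma msupport_U: "msupport (top_of DU) (msr DU) \<phi> = U \<inter> msupport X m (zext \<phi>)"
proof -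
  have eq: "(AE x in m. x \<in> U \<longrightarrow> x \<in> V \<longrightarrow> \<phi> x = 0) \<longleftrightarrow> (AE x in m. x \<in> V \<longrightarrow> zext \<phi> x = 0)" for V
    by (rule AE_cong) (auto simp: zext_apply indicator_def)
  have "openin (subtopology X U) V \<longleftrightarrow> openin X V \<and> V \<subseteq> U" for V
    using openin_open_subtopology[OF U] by blast
  then have *: "msupport (top_of DU) (msr DU) \<phi> =
      U - \<Union>{V. openin X V \<and> V \<subseteq> U \<and> (AE x in m. x \<in> V \<longrightarrow> zext \<phi> x = 0)}"
    using U_top unfolding msupport_def DU_simps AE_U eq by auto
  have "\<exists>W. openin X W \<and> W \<subseteq> U \<and> (AE x in m. x \<in> W \<longrightarrow> zext \<phi> x = 0) \<and> x \<in> W"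
    if "openin X V" "AE x in m. x \<in> V \<longrightarrow> zext \<phi> x = 0" "x \<in> V" "x \<in> U" for V x
  proof (intro exI[of _ "V \<inter> U"] conjI)
    show "AE y in m. y \<in> V \<inter> U \<longrightarrow> zext \<phi> y = 0" using that(2) by eventually_elim blast
  qed (use that U in auto)
  then have "U \<inter> \<Union>{V. openin X V \<and> (AE x in m. x \<in> V \<longrightarrow> zext \<phi> x = 0)} \<subseteq>
      \<Union>{V. openin X V \<and> V \<subseteq> U \<and> (AE x in m. x \<in> V \<longrightarrow> zext \<phi> x = 0)}"
    by auto
  moreover have "\<Union>{V. openin X V \<and> V \<subseteq> U \<and> (AE x in m. x \<in> V \<longrightarrow> zext \<phi> x = 0)} \<subseteq>
      \<Union>{V. openin X V \<and> (AE x in m. x \<in> V \<longrightarrow> zext \<phi> x = 0)}"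
    by (rule Union_mono) auto
  ultimately show ?thesis
    unfolding * using U_top by (subst msupport_def) (rule set_eq_of_subsets)
qed

lemma Fcomp_U:
  assumes "\<phi> \<in> Fcomp DU"
  shows "zext \<phi> \<in> FU U" "compactin X (msupport X m (zext \<phi>))"
    "msupport (top_of DU) (msr DU) \<phi> = msupport X m (zext \<phi>)" "msupport X m (zext \<phi>) \<subseteq> U"
proof -
  let ?K = "msupport (top_of DU) (msr DU) \<phi>"
  show 1: "zext \<phi> \<in> FU U" using assms by (simp add: Fcomp_def DU_simps)
  have K: "compactin X ?K" "?K \<subseteq> U"
    using assms by (auto simp: Fcomp_def DU_simps compactin_subtopology)
  have "AE x in m. x \<notin> ?K \<longrightarrow> zext \<phi> x = 0"
    using msupport_AE_zero[OF F_measurable[OF FU_F[OF 1]]]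
    by eventually_elim (auto simp: msupport_U zext_out)
  then have "msupport X m (zext \<phi>) \<subseteq> ?K" by (rule msupport_subset[OF compact_closed[OF K(1)]])
  then show "?K = msupport X m (zext \<phi>)" unfolding msupport_U by blast
  then show "compactin X (msupport X m (zext \<phi>))" "msupport X m (zext \<phi>) \<subseteq> U" using K by simp_all
qed

lemma Fcomp_U_I:
  assumes \<phi>: "\<phi> \<in> Fcomp D" "AE x in m. 0 \<le> \<phi> x" and sub: "msupport X m \<phi> \<subseteq> U"
  shows "\<phi> \<in> FU U" "\<phi> \<in> Fcomp DU" "msupport X m (zext \<phi>) = msupport X m \<phi>"
proof -
  have F: "\<phi> \<in> F" and K: "compactin X (msupport X m \<phi>)" using \<phi> by (auto simp: Fcomp_def)
  show FU: "\<phi> \<in> FU U" by (rule FU_of_compact[OF F \<phi>(2) K U sub])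
  have "AE x in m. (x \<in> V \<longrightarrow> zext \<phi> x = 0) = (x \<in> V \<longrightarrow> \<phi> x = 0)" for V
    using zext_FU[OF FU] by eventually_elim simp
  then have "(AE x in m. x \<in> V \<longrightarrow> zext \<phi> x = 0) \<longleftrightarrow> (AE x in m. x \<in> V \<longrightarrow> \<phi> x = 0)" for V
    by (rule eventually_subst)
  then show eq: "msupport X m (zext \<phi>) = msupport X m \<phi>" unfolding msupport_def by simp
  show "\<phi> \<in> Fcomp DU"
    using zext_mem_FU[OF FU] K sub unfolding Fcomp_def mem_Collect_eq msupport_U eq
    by (simp add: DU_simps compactin_subtopology Int_absorb1)
qed

lemma form_loc_U:
  assumes \<phi>: "\<phi> \<in> Fcomp DU" and h: "zext h \<in> FU U" and V: "openin X V" "msupport X m (zext \<phi>) \<subseteq> V"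
    and eq: "AE x in m. x \<in> V \<inter> U \<longrightarrow> f x = h x"
  shows "form_loc DU f \<phi> = E (zext h) (zext \<phi>)"
  unfolding form_loc_def
proof (rule the_equality)
  note c = Fcomp_U[OF \<phi>]
  show "\<exists>h'\<in>fdom DU. \<exists>V. openin (top_of DU) V \<and> msupport (top_of DU) (msr DU) \<phi> \<subseteq> V \<and>
      (AE x in msr DU. x \<in> V \<longrightarrow> f x = h' x) \<and> E (zext h) (zext \<phi>) = frm DU h' \<phi>"
    unfolding c(3) using h V eq c(4) U
    by (intro bexI[of _ h] exI[of _ "V \<inter> U"])
      (auto simp: AE_DU DU_simps openin_open_subtopology elim!: eventually_mono)
  fix r assume "\<exists>h\<in>fdom DU. \<exists>V. openin (top_of DU) V \<and> msupport (top_of DU) (msr DU) \<phi> \<subseteq> V \<and>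
      (AE x in msr DU. x \<in> V \<longrightarrow> f x = h x) \<and> r = frm DU h \<phi>"
  then obtain h' V' where *: "zext h' \<in> FU U" "msupport X m (zext \<phi>) \<subseteq> V'"
      "AE x in m. x \<in> U \<longrightarrow> x \<in> V' \<longrightarrow> f x = h' x" "r = E (zext h') (zext \<phi>)"
    unfolding c(3) by (auto simp: AE_DU DU_simps)
  have "E (zext h') (zext \<phi>) = E (zext h) (zext \<phi>)"
  proof (rule E_local_eq)
    show "AE x in m. x \<in> msupport X m (zext \<phi>) \<longrightarrow> zext h' x = zext h x"
      using *(3) eq by eventually_elim (use *(2) V c(4) in auto)
  qed (use * h c(1) FU_F in blast)+
  then show "r = E (zext h) (zext \<phi>)" using * by simp
qed

text \<open>The inequalities for g and for -g, tested with the same \<phi>, combine to an equation;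
  near the compact support of \<phi> the function g is represented by an element of F(U).\<close>

lemma weakly_harmonic_U:
  assumes g: "weakly_harmonic lam DU g"
    and \<phi>: "\<phi> \<in> Fcomp D" "AE x in m. 0 \<le> \<phi> x" and sub: "msupport X m \<phi> \<subseteq> U"
  shows "\<exists>h\<in>FU U. \<exists>V. openin X V \<and> msupport X m \<phi> \<subseteq> V \<and> V \<subseteq> U \<and>
    (AE x in m. x \<in> V \<longrightarrow> g x = h x) \<and> E h \<phi> + lam * ip2 m (zext g) \<phi> = 0"
proof -
  note c = Fcomp_U_I[OF \<phi> sub]
  have K: "compactin X (msupport X m \<phi>)" using \<phi> by (simp add: Fcomp_def)
  obtain V where V: "openin X V" "msupport X m \<phi> \<subseteq> V" "compactin X (X closure_of V)" "X closure_of V \<subseteq> U"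
    using compact_nbhd[OF K U sub] by blast
  have VU: "V \<subseteq> U" using V closure_of_subset[of V X] openin_subset[OF V(1)] by blast
  have "U \<inter> (X closure_of (U \<inter> V)) = X closure_of V" using V VU by (auto simp: Int_absorb1)
  then have "rel_compact_open (top_of DU) V"
    using V VU by (simp add: rel_compact_open_def DU_simps openin_open_subtopology[OF U]
      closure_of_subtopology compactin_subtopology)
  moreover have "g \<in> Floc DU" using g by (simp add: weakly_harmonic_def weakly_subharmonic_def)
  ultimately obtain h where h: "zext h \<in> FU U" "AE x in m. x \<in> U \<longrightarrow> x \<in> V \<longrightarrow> g x = h x"
    unfolding Floc_def by (auto simp: AE_DU DU_simps)
  have eq1: "form_loc DU g \<phi> = E (zext h) (zext \<phi>)"
    by (rule form_loc_U[OF c(2) h(1) V(1)]) (use V h in \<open>auto simp: c(3) elim: eventually_mono\<close>)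
  have eq2: "form_loc DU (\<lambda>x. - g x) \<phi> = E (zext (- h)) (zext \<phi>)"
  proof (rule form_loc_U[OF c(2) _ V(1)])
    show "zext (- h) \<in> FU U" using FU_scale[OF h(1), of "- 1"] zext_simps(3)[of "- 1" h] by simp
  qed (use V h in \<open>auto simp: c(3) fun_ops elim: eventually_mono\<close>)
  have neg: "zext (- h) = - zext h" using zext_simps(3)[of "- 1" h] by simp
  have pos: "AE x in msr DU. 0 \<le> \<phi> x" unfolding AE_DU using \<phi>(2) by eventually_elim simp
  have hF: "zext h \<in> F" and \<phi>F: "\<phi> \<in> F" "zext \<phi> \<in> F" using h c FU_F zext_mem_FU by blast+
  have i: "(\<integral>x. g x * \<phi> x \<partial>mU) = ip2 m (zext g) (zext \<phi>)" using ip2_U[of g \<phi>] by (simp add: ip2_def)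
  have "E (zext h) (zext \<phi>) + lam * ip2 m (zext g) (zext \<phi>) = 0"
    using g c(2) pos hF \<phi>F unfolding weakly_harmonic_def weakly_subharmonic_def
    by (fastforce simp: eq1 eq2 neg EE.ip_simps DU_simps i)
  moreover have "E (zext h) (zext \<phi>) = E (zext h) \<phi>"
    using E_zext[OF c(1) hF] E_sym hF \<phi>F by simp
  moreover have "ip2 m (zext g) (zext \<phi>) = ip2 m (zext g) \<phi>"
    by (simp add: ip2_def zext_apply) (rule Bochner_Integration.integral_cong; auto simp: indicator_def)
  moreover have "AE x in m. x \<in> V \<longrightarrow> g x = zext h x" using h(2) by eventually_elim (use VU in auto)
  ultimately show ?thesis using h V VU by (intro bexI[OF _ h(1)] exI[of _ V]) auto
qed

end

section \<open>Shift defective functions are subharmonic\<close>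

context dirichlet_form
begin

text \<open>For a_n = \<lambda> + n + 1 the coefficient a \<lambda> / (a - \<lambda>) has a closed
  form from which both its bound \<lambda> (1 + \<lambda>) and its limit \<lambda> can be read
  off.\<close>

lemma shift_sequence:
  fixes lam :: real
  assumes "0 \<le> lam"
  obtains a :: "nat \<Rightarrow> real" where "\<And>n. 0 < a n" "\<And>n. lam < a n"
    "\<And>n. a n * (lam / (a n - lam)) = lam * (1 + lam * inverse (real (Suc n)))"
    "filterlim a at_top sequentially"
proof
  let ?a = "\<lambda>n. lam + real (Suc n)"
  fix n
  show "0 < ?a n" "lam < ?a n" using assms by auto
  have "?a n * (lam / real (Suc n)) = lam * (1 + lam * inverse (real (Suc n)))"
    by (subst distrib_right) (simp add: divide_inverse algebra_simps del: of_nat_Suc)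
  then show "?a n * (lam / (?a n - lam)) = lam * (1 + lam * inverse (real (Suc n)))" by simp
next
  have "filterlim (\<lambda>n. real (Suc n)) at_top sequentially"
    using filterlim_real_sequentially by (subst filterlim_sequentially_Suc)
  then show "filterlim (\<lambda>n. lam + real (Suc n)) at_top sequentially"
    by (intro filterlim_tendsto_add_at_top[OF tendsto_const])
qed

text \<open>Let q be the minimum. Then p - q vanishes unless s < p, and there q = s, so q - R q
  \<ge> s - R s. Testing q - R q with p - q therefore bounds the approximating form of q by E (R q)
  p + c; its energy part is absorbed, since E (R q) (R q) is at most the approximating form
  itself.\<close>

lemma truncated_supersolution_domain:
  assumes s: "s \<in> L2 m" and s0: "AE x in m. 0 \<le> s x" and v: "v \<in> L2 m"
    and p: "p \<in> F" and p0: "AE x in m. 0 \<le> p x" and lam: "0 \<le> lam"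
    and le: "\<And>a. lam < a \<Longrightarrow> AE x in m. lam / (a - lam) * v x \<le> s x - R a s x"
  shows "(\<lambda>x. min (s x) (p x)) \<in> F"
proof -
  let ?q = "\<lambda>x. min (s x) (p x)"
  obtain a :: "nat \<Rightarrow> real" where a: "\<And>n. 0 < a n" "\<And>n. lam < a n"
    "\<And>n. a n * (lam / (a n - lam)) = lam * (1 + lam * inverse (real (Suc n)))"
    "filterlim a at_top sequentially"
    using shift_sequence[OF lam] by blast
  have q: "?q \<in> L2 m" using s p by (intro L2_min) auto
  \<comment> \<open>\<lambda> (1 + \<lambda>) bounds a \<lambda> / (a - \<lambda>) along the whole
    sequence; v has no sign, hence the absolute value.\<close>
  define c where "c = lam * (1 + lam) * ip2 m (\<lambda>x. \<bar>v x\<bar>) p"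
  have "a n * ip2 m (?q - R (a n) ?q) ?q \<le> E p p + 2 * c" for n
  proof -
    let ?r = "R (a n) ?q"
    have r: "?r \<in> F" using q a by simp
    have coef: "a n * (lam / (a n - lam)) \<le> lam * (1 + lam)"
      unfolding a(3) using lam by (intro mult_left_mono add_left_mono) (auto simp: field_simps)
    have "AE x in m. ?r x \<le> R (a n) s x" by (rule R_mono[OF q s a(1)]) simp
    then have "AE x in m. - (lam * (1 + lam)) * (\<bar>v x\<bar> * p x) \<le> a n * ((?q - ?r) x * (p - ?q) x)"
      using le[OF a(2), of n] s0 p0
    proof eventually_elim
      case (elim x)
      show ?case
      proof (cases "p x \<le> s x")
        case True
        have "0 \<le> lam * (1 + lam) * (\<bar>v x\<bar> * p x)" using lam elim by (intro mult_nonneg_nonneg) auto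
        then show ?thesis using True by (simp add: fun_ops)
      next
        case False
        let ?k = "lam / (a n - lam)"
        have k0: "0 \<le> ?k" using lam a(2)[of n] by simp
        have "- (?k * \<bar>v x\<bar>) \<le> ?k * v x"
          using mult_left_mono[OF abs_ge_minus_self[of "v x"] k0] by simp
        then have "- (?k * \<bar>v x\<bar>) \<le> (?q - ?r) x" using False elim by (simp add: fun_ops)
        then have "a n * (- (?k * \<bar>v x\<bar>) * (p - ?q) x) \<le> a n * ((?q - ?r) x * (p - ?q) x)"
          using False a(1)[of n] by (intro mult_left_mono mult_right_mono) (auto simp: fun_ops)
        moreover have "(a n * ?k) * (\<bar>v x\<bar> * (p - ?q) x) \<le> lam * (1 + lam) * (\<bar>v x\<bar> * p x)"
        proof (rule mult_mono[OF coef])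
          show "\<bar>v x\<bar> * (p - ?q) x \<le> \<bar>v x\<bar> * p x"
            using elim False by (intro mult_left_mono) (auto simp: fun_ops)
        qed (use lam False in \<open>auto simp: fun_ops\<close>)
        moreover have "a n * (- (?k * \<bar>v x\<bar>) * (p - ?q) x) = - ((a n * ?k) * (\<bar>v x\<bar> * (p - ?q) x))"
          by (simp only: mult_minus_left mult_minus_right mult.assoc)
        moreover have "- (lam * (1 + lam)) * (\<bar>v x\<bar> * p x) = - (lam * (1 + lam) * (\<bar>v x\<bar> * p x))"
          by (rule mult_minus_left)
        ultimately show ?thesis by linarith
      qed
    qed
    then have "(\<integral>x. - (lam * (1 + lam)) * (\<bar>v x\<bar> * p x) \<partial>m) \<le> (\<integral>x. a n * ((?q - ?r) x * (p - ?q) x) \<partial>m)"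
    proof (rule integral_mono_AE[rotated 2])
      have "?q - ?r \<in> L2 m" "p - ?q \<in> L2 m" using q r p by simp_all
      then show "integrable m (\<lambda>x. a n * ((?q - ?r) x * (p - ?q) x))"
        by (intro integrable_mult_right L2_mult_integrable)
      show "integrable m (\<lambda>x. - (lam * (1 + lam)) * (\<bar>v x\<bar> * p x))"
        using L2_abs[OF v] p by (intro integrable_mult_right L2_mult_integrable) auto
    qed
    then have "- c \<le> a n * ip2 m (?q - ?r) (p - ?q)"
      by (simp add: c_def ip2_def)
    then have 1: "a n * ip2 m (?q - ?r) ?q \<le> E ?r p + c"
      using R_eq[OF q a(1) p, of n] p q r by (simp add: L2.ip_simps algebra_simps)
    have 2: "2 * E ?r p \<le> E ?r ?r + E p p"
      using E_nonneg[of "?r - p"] r p E_sym[OF r p] by (simp add: EE.ip_simps)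
    have "E ?r ?r = a n * ip2 m (?q - ?r) ?q - a n * ip2 m (?q - ?r) (?q - ?r)"
      using R_eq[OF q a(1) r, of n] q r by (simp add: L2.ip_simps algebra_simps)
    then have 3: "E ?r ?r \<le> a n * ip2 m (?q - ?r) ?q"
      using a(1)[of n] L2.ip_nonneg[of "?q - ?r" m] q r by simp
    show ?thesis using 1 2 3 by linarith
  qed
  then show ?thesis using F_of_E_approx_bounded[OF q a(1,4)] by blast
qed

text \<open>Where \<phi> is nonzero, q = min s k. If s \<le> k, then q - R q \<ge> s - R s; if s >
  k, then q = k \<ge> R q while v \<le> 0. In both cases \<lambda> / (a - \<lambda>) v is a lower
  bound of q - R q. Multiply by a and let a tend to infinity.\<close>

lemma truncated_supersolution:
  assumes s: "s \<in> L2 m" and s0: "AE x in m. 0 \<le> s x" and v: "v \<in> L2 m"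
    and p: "p \<in> F" and p0: "AE x in m. 0 \<le> p x" and lam: "0 \<le> lam"
    and le: "\<And>a. lam < a \<Longrightarrow> AE x in m. lam / (a - lam) * v x \<le> s x - R a s x"
    and k: "0 \<le> k" "AE x in m. p x \<le> k" and \<phi>: "\<phi> \<in> F" "AE x in m. 0 \<le> \<phi> x"
    and pk: "AE x in m. \<phi> x \<noteq> 0 \<longrightarrow> p x = k" and vk: "AE x in m. k < s x \<longrightarrow> v x \<le> 0"
  shows "lam * ip2 m v \<phi> \<le> E (\<lambda>x. min (s x) (p x)) \<phi>"
proof -
  let ?q = "\<lambda>x. min (s x) (p x)"
  obtain a :: "nat \<Rightarrow> real" where a: "\<And>n. 0 < a n" "\<And>n. lam < a n"
    "\<And>n. a n * (lam / (a n - lam)) = lam * (1 + lam * inverse (real (Suc n)))"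
    "filterlim a at_top sequentially"
    using shift_sequence[OF lam] by blast
  have qF: "?q \<in> F" by (rule truncated_supersolution_domain[OF s s0 v p p0 lam le])
  have q: "?q \<in> L2 m" using qF by simp
  have "lam * (1 + lam * inverse (real (Suc n))) * ip2 m v \<phi> \<le> a n * ip2 m (?q - R (a n) ?q) \<phi>" for n
  proof -
    let ?r = "R (a n) ?q"
    have r: "?r \<in> F" using q a by simp
    have qk: "AE x in m. ?q x \<le> k" using k(2) by eventually_elim simp
    have "AE x in m. ?r x \<le> R (a n) s x" by (rule R_mono[OF q s a(1)]) simp
    then have "AE x in m. lam / (a n - lam) * (v x * \<phi> x) \<le> (?q - ?r) x * \<phi> x"
      using le[OF a(2), of n] R_le_const[OF q a(1) k(1) qk, of n] \<phi>(2) pk vk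
    proof eventually_elim
      case (elim x)
      have "lam / (a n - lam) * v x \<le> (?q - ?r) x" if "\<phi> x \<noteq> 0"
      proof (cases "s x \<le> k")
        case False
        then have "lam / (a n - lam) * v x \<le> 0"
          using elim(6) lam a(2)[of n] by (intro mult_nonneg_nonpos) auto
        then show ?thesis using elim that False by (simp add: fun_ops)
      qed (use elim that in \<open>simp add: fun_ops\<close>)
      from mult_right_mono[OF this elim(4)] show ?case
        by (cases "\<phi> x = 0") (simp_all add: mult.assoc)
    qed
    then have "(\<integral>x. lam / (a n - lam) * (v x * \<phi> x) \<partial>m) \<le> (\<integral>x. (?q - ?r) x * \<phi> x \<partial>m)"
    proof (rule integral_mono_AE[rotated 2])
      have "?q - ?r \<in> L2 m" using q r by simp
      then show "integrable m (\<lambda>x. (?q - ?r) x * \<phi> x)" by (rule L2_mult_integrable) (use \<phi> in simp)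
      show "integrable m (\<lambda>x. lam / (a n - lam) * (v x * \<phi> x))"
        using v \<phi> by (intro integrable_mult_right L2_mult_integrable) auto
    qed
    then have "lam / (a n - lam) * ip2 m v \<phi> \<le> ip2 m (?q - ?r) \<phi>" by (simp add: ip2_def)
    then have "a n * (lam / (a n - lam) * ip2 m v \<phi>) \<le> a n * ip2 m (?q - ?r) \<phi>"
      by (rule mult_left_mono) (use a(1)[of n] in simp)
    then show ?thesis by (simp only: mult.assoc[symmetric] a(3))
  qed
  moreover have "(\<lambda>n. a n * ip2 m (?q - R (a n) ?q) \<phi>) \<longlonglongrightarrow> E ?q \<phi>"
    by (rule E_approx_tendsto[OF qF \<phi>(1) a(1,4)])
  moreover have "(\<lambda>n. lam * (1 + lam * inverse (real (Suc n))) * ip2 m v \<phi>) \<longlonglongrightarrow> lam * (1 + lam * 0) * ip2 m v \<phi>"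
    by (intro tendsto_intros LIMSEQ_inverse_real_of_nat)
  ultimately show ?thesis using LIMSEQ_le[of _ "lam * (1 + lam * 0) * ip2 m v \<phi>" _ "E ?q \<phi>"] by auto
qed

end

context dirichlet_space
begin

lemma rel_compact_finite:
  assumes "rel_compact_open X U"
  shows "emeasure m U < \<infinity>"
proof -
  have "U \<subseteq> X closure_of U" "compactin X (X closure_of U)"
    using assms closure_of_subset[of U X] openin_subset[of X U] by (auto simp: rel_compact_open_def)
  then have "emeasure m U \<le> emeasure m (X closure_of U)"
    by (intro emeasure_mono compact_sets)
  then show ?thesis using compact_finite[OF \<open>compactin X (X closure_of U)\<close>] by (rule le_less_trans)
qed

end

context open_subset
begin

lemma continuous_measurable_U:
  assumes "continuous_map (subtopology X U) euclideanreal g"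
  shows "g \<in> borel_measurable mU"
proof (rule borel_measurableI)
  fix S :: "real set" assume "open S"
  then have "openin (subtopology X U) {x \<in> topspace (subtopology X U). g x \<in> S}"
    using openin_continuous_map_preimage[OF assms] by simp
  moreover have "{x \<in> topspace (subtopology X U). g x \<in> S} = g -` S \<inter> space mU"
    using U_top by (auto simp: space_restrict_space space_m)
  ultimately have o: "openin X (g -` S \<inter> space mU)" and "g -` S \<inter> space mU \<subseteq> U"
    by (auto simp: openin_open_subtopology[OF U])
  then show "g -` S \<inter> space mU \<in> sets mU"
    using open_sets[OF o] by (subst sets_restrict_space_iff[OF U_sets(2)]) blast
qed

lemma bounded_L2_U:
  assumes fin: "emeasure m U < \<infinity>" and g: "g \<in> borel_measurable mU" and B: "AE x in m. x \<in> U \<longrightarrow> \<bar>g x\<bar> \<le> B"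
  shows "zext g \<in> L2 m"
proof (rule L2_bound)
  have "(indicator U :: 'a \<Rightarrow> real) \<in> L2 m" by (rule L2_indicator_finite[OF U_sets(1) fin])
  then show "B *\<^sub>R indicator U \<in> L2 m" by simp
  show "zext g \<in> borel_measurable m" using g by (simp add: measurable_U)
  show "AE x in m. \<bar>zext g x\<bar> \<le> \<bar>(B *\<^sub>R indicator U) x\<bar>"
    using B by eventually_elim (auto simp: zext_apply fun_ops indicator_def)
qed

lemma Cb_L2_U:
  assumes fin: "emeasure m U < \<infinity>" and g: "g \<in> Cb (subtopology X U)"
  shows "zext g \<in> L2 m" "g \<in> borel_measurable mU" "\<exists>B\<ge>0. \<forall>x\<in>U. \<bar>g x\<bar> \<le> B"
proof -
  have tU: "topspace (subtopology X U) = U" using U_top by auto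
  show 1: "g \<in> borel_measurable mU" using g by (intro continuous_measurable_U) (simp add: Cb_def Cont_def)
  obtain B where B: "\<forall>x\<in>U. \<bar>g x\<bar> \<le> B" using g tU by (auto simp: Cb_def)
  then show "zext g \<in> L2 m" by (intro bounded_L2_U[OF fin 1, of B]) auto
  show "\<exists>B\<ge>0. \<forall>x\<in>U. \<bar>g x\<bar> \<le> B" using B by (intro exI[of _ "max B 0"]) (auto simp: le_max_iff_disj)
qed

lemma integrable_U_of_L2:
  assumes fin: "emeasure m U < \<infinity>" and f: "zext f \<in> L2 m"
  shows "integrable mU f"
proof -
  have "integrable m (\<lambda>x. zext f x * indicator U x)"
    by (rule L2_mult_integrable[OF f L2_indicator_finite[OF U_sets(1) fin]])
  moreover have "(\<lambda>x. zext f x * indicator U x) = (\<lambda>x. indicator U x *\<^sub>R f x)"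
    by (auto simp: fun_eq_iff zext_apply indicator_def)
  ultimately show ?thesis by (simp add: integrable_restrict_space[OF U_sets(2)])
qed

text \<open>U has finite measure, so v is integrable, and ultracontractivity bounds its image at
  time 1, which dominates v up to a factor at most 1.\<close>

lemma shift_defective_upper_bound:
  assumes fin: "emeasure m U < \<infinity>" and uc: "ultracontractive DU" and lam: "0 \<le> lam"
    and v: "zext v \<in> L2 m"
    and shift: "\<And>t. 0 < t \<Longrightarrow> AE x in mU. v x \<le> exp (- t * lam) * heat DU t v x"
  shows "\<exists>C\<ge>0. AE x in mU. v x \<le> C"
proof -
  have "heat DU 1 v \<in> Linf mU"
    using uc integrable_U_of_L2[OF fin v] by (simp add: ultracontractive_def L1_def DU_simps)
  then obtain C where C: "AE x in mU. \<bar>heat DU 1 v x\<bar> \<le> C" by (auto simp: Linf_def)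
  have "AE x in mU. v x \<le> max C 0"
    using shift[OF zero_less_one] C
  proof eventually_elim
    case (elim x)
    have "exp (- 1 * lam) * heat DU 1 v x \<le> exp (- 1 * lam) * max C 0"
      using elim(2) by (intro mult_left_mono) auto
    also have "\<dots> \<le> 1 * max C 0" using lam by (intro mult_right_mono) auto
    finally show ?case using elim by simp
  qed
  then show ?thesis by (intro exI[of _ "max C 0"]) auto
qed

text \<open>From a / (a - \<lambda>) v \<le> R v and R C \<le> C it follows that s = C - v satisfies
  s - R s \<ge> \<lambda> / (a - \<lambda>) v. So \<open>truncated_supersolution\<close> applies
  with p = k \<eta>; the condition C \<le> k makes v negative where s exceeds k.\<close>

lemma shift_defective_truncation:
  assumes fin: "emeasure m U < \<infinity>" and lam: "0 \<le> lam" and v: "zext v \<in> L2 m"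
    and C: "0 \<le> C" "AE x in mU. v x \<le> C"
    and shift: "\<And>t. 0 < t \<Longrightarrow> AE x in mU. v x \<le> exp (- t * lam) * heat DU t v x"
    and \<eta>: "cutoff \<eta> K U" and k: "C \<le> k"
  defines "q \<equiv> zext (\<lambda>x. min (C - v x) (k * \<eta> x))"
  shows "q \<in> FU U"
    and "\<lbrakk>\<phi> \<in> FU U; AE x in m. 0 \<le> \<phi> x; AE x in m. x \<notin> K \<longrightarrow> \<phi> x = 0\<rbrakk> \<Longrightarrow> lam * ip2 m (zext v) \<phi> \<le> E q \<phi>"
proof -
  have vU: "v \<in> L2 (msr DU)" using v by (simp add: L2_U DU_simps)
  have "emeasure mU (space mU) < \<infinity>"
    using fin openin_subset[OF U] by (simp add: emeasure_restrict_space[OF U_sets(2)] space_restrict_space space_m Int_absorb2)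
  then have cU: "(\<lambda>x. C) \<in> L2 (msr DU)" unfolding DU_simps by (rule L2_const)
  let ?s = "\<lambda>x. C - v x"
  have s_eq: "?s = (\<lambda>x. C) - v" by (simp add: fun_eq_iff fun_ops)
  have sU: "?s \<in> L2 (msr DU)" unfolding s_eq using cU vU by simp
  have s0: "AE x in msr DU. 0 \<le> ?s x" using C(2) unfolding DU_simps by simp
  have le: "AE x in msr DU. lam / (a - lam) * v x \<le> ?s x - DU.R a ?s x" if a: "lam < a" for a
  proof -
    have a0: "0 < a" using lam a by simp
    have "AE x in msr DU. v x \<le> exp (- t * lam) * DU.S t v x" if "0 < t" for t
      using shift[OF that, folded DU_simps(2)] DU.heat_AE_eq[OF vU, of t] that by auto
    from DU.R_ge_of_S_ge[OF vU lam a this]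
    have 1: "AE x in msr DU. a / (a - lam) * v x \<le> DU.R a v x" by blast
    have 2: "AE x in msr DU. DU.R a (\<lambda>x. C) x \<le> C" by (rule DU.R_le_const[OF cU a0 C(1)]) simp
    have 3: "AE x in msr DU. DU.R a ?s x = DU.R a (\<lambda>x. C) x - DU.R a v x"
      unfolding s_eq by (rule DU.R_diff[OF cU vU a0])
    have eq: "a / (a - lam) * r = r + lam / (a - lam) * r" for r using a by (simp add: field_simps)
    show ?thesis using 1 2 3 by eventually_elim (simp only: eq; linarith)
  qed
  let ?p = "k *\<^sub>R \<eta>"
  have \<eta>U: "\<eta> \<in> FU U" by (rule cutoff_FU[OF \<eta>])
  have pU: "?p \<in> fdom DU" by (simp add: DU_simps zext_simps FU_scale zext_mem_FU[OF \<eta>U])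
  have k0: "0 \<le> k" using k C by simp
  have p0: "AE x in msr DU. 0 \<le> ?p x" using cutoffD(3)[OF \<eta>] k0 by (simp add: fun_ops)
  have q: "(\<lambda>x. min (?s x) (?p x)) \<in> fdom DU"
    by (rule DU.truncated_supersolution_domain[OF sU s0 vU pU p0 lam le])
  then show "q \<in> FU U" unfolding q_def by (simp add: DU_simps fun_ops)
  assume \<phi>: "\<phi> \<in> FU U" "AE x in m. 0 \<le> \<phi> x" "AE x in m. x \<notin> K \<longrightarrow> \<phi> x = 0"
  have \<phi>U: "\<phi> \<in> fdom DU" using zext_mem_FU[OF \<phi>(1)] by (simp add: DU_simps)
  have "lam * ip2 (msr DU) v \<phi> \<le> frm DU (\<lambda>x. min (?s x) (?p x)) \<phi>"
  proof (rule DU.truncated_supersolution[OF sU s0 vU pU p0 lam le k0 _ \<phi>U])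
    show "AE x in msr DU. ?p x \<le> k" using cutoffD(4)[OF \<eta>] k0 by (simp add: fun_ops mult_left_le)
    show "AE x in msr DU. 0 \<le> \<phi> x" unfolding AE_DU using \<phi>(2) by eventually_elim simp
    show "AE x in msr DU. \<phi> x \<noteq> 0 \<longrightarrow> ?p x = k" unfolding AE_DU using \<phi>(3)
      by eventually_elim (use cutoffD(6)[OF \<eta>] in \<open>auto simp: fun_ops\<close>)
    show "AE x in msr DU. k < ?s x \<longrightarrow> v x \<le> 0" using k by simp
  qed
  moreover have "ip2 m (zext v) (zext \<phi>) = ip2 m (zext v) \<phi>"
    by (simp add: ip2_def zext_apply) (rule Bochner_Integration.integral_cong; auto simp: indicator_def)
  moreover have "E q (zext \<phi>) = E q \<phi>"
    using \<open>q \<in> FU U\<close> E_zext[OF \<phi>(1), of q] FU_F \<phi>(1) zext_mem_FU[OF \<phi>(1)] E_sym by metis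
  ultimately show "lam * ip2 m (zext v) \<phi> \<le> E q \<phi>"
    unfolding q_def by (simp add: DU_simps ip2_U fun_ops)
qed

end

context dirichlet_space
begin

lemma rel_compact_nbhd:
  assumes "compactin X K"
  obtains U where "rel_compact_open X U" "K \<subseteq> U" "openin X U"
  using compact_nbhd[OF assms openin_topspace compactin_subset_topspace[OF assms]]
  by (auto simp: rel_compact_open_def)

lemma shift_defective_cases:
  assumes ls: "locally_smoothing D" and lam: "0 \<le> lam" and f: "locally_shift_defective lam D f"
    and U: "rel_compact_open X U" and fL2: "(\<lambda>x. indicator U x * f x) \<in> L2 m"
  obtains g C where "open_subset D U" "weakly_harmonic lam (restrict_dirichlet D U) g"
    "g \<in> Cb (subtopology X U)" "0 \<le> C" "AE x in restrict_space m U. f x - g x \<le> C"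
    "\<And>t. 0 < t \<Longrightarrow> AE x in restrict_space m U.
      f x - g x \<le> exp (- t * lam) * heat (restrict_dirichlet D U) t (\<lambda>x. f x - g x) x"
proof -
  interpret O: open_subset D U by unfold_locales (use U in \<open>simp add: rel_compact_open_def\<close>)
  obtain g where g: "g \<in> Cb (subtopology X U)" "weakly_harmonic lam O.DU g"
    and shift: "\<And>t. 0 < t \<Longrightarrow> AE x in O.mU. f x - g x \<le> exp (- t * lam) * heat O.DU t (\<lambda>x. f x - g x) x"
    using f U unfolding locally_shift_defective_def by blast
  have eq: "(\<lambda>x. f x - g x) = f - g" by (simp add: fun_eq_iff fun_ops)
  have fL2': "O.zext f \<in> L2 m" using fL2 by (simp add: O.zext_def)
  have fin: "emeasure m U < \<infinity>" by (rule rel_compact_finite[OF U])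
  have vL2: "O.zext (\<lambda>x. f x - g x) \<in> L2 m"
    unfolding eq O.zext_simps using fL2' O.Cb_L2_U(1)[OF fin g(1)] by (rule L2.diff_in)
  have uc: "ultracontractive O.DU" using ls U by (simp add: locally_smoothing_def)
  obtain C where "0 \<le> C" "AE x in O.mU. f x - g x \<le> C"
    using O.shift_defective_upper_bound[OF fin uc lam vL2 shift] by blast
  then show ?thesis using that O.open_subset_axioms g shift by blast
qed

text \<open>Let y represent v = f - g near the support of \<phi>. There \<open>q n\<close> is min (C
  - v) (C + n), and its sum with \<open>Y n\<close> = max v (-n) is the constant C, so E (Y n)
  \<phi> = - E (q n) \<phi>. The limit is taken in \<open>Y n\<close>, whose energies are bounded by
  that of y. The equation for g then turns the inequality for y into the one for f.\<close>

lemma subharmonic_of_shift_defective: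
  assumes ls: "locally_smoothing D" and lam: "0 \<le> lam" and f: "locally_shift_defective lam D f"
    and fl: "f \<in> Floc D"
  shows "weakly_subharmonic lam D f"
  unfolding weakly_subharmonic_def
proof (intro conjI ballI impI fl)
  fix \<phi> assume \<phi>: "\<phi> \<in> Fcomp D" "AE x in m. 0 \<le> \<phi> x"
  have \<phi>F: "\<phi> \<in> F" and K: "compactin X (msupport X m \<phi>)" using \<phi> by (auto simp: Fcomp_def)
  let ?K = "msupport X m \<phi>"
  obtain U where U: "rel_compact_open X U" "?K \<subseteq> U" "openin X U" using rel_compact_nbhd[OF K] by blast
  obtain h where h: "h \<in> F" "AE x in m. x \<in> U \<longrightarrow> f x = h x" using fl U unfolding Floc_def by blast
  have fm: "f \<in> borel_measurable m" using fl by (simp add: Floc_def L2loc_def)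
  have "(\<lambda>x. indicator U x * h x) \<in> L2 m" using h open_sets[OF U(3)] by (intro L2_indicator) auto
  then have fL2: "(\<lambda>x. indicator U x * f x) \<in> L2 m"
  proof (rule L2_cong_AE)
    show "AE x in m. indicator U x * h x = indicator U x * f x"
      using h(2) by eventually_elim (auto simp: indicator_def)
  qed (use fm open_sets[OF U(3)] in simp)
  obtain g C where O: "open_subset D U" and g: "weakly_harmonic lam (restrict_dirichlet D U) g"
    "g \<in> Cb (subtopology X U)" and C: "0 \<le> C" "AE x in restrict_space m U. f x - g x \<le> C"
    and shift: "\<And>t. 0 < t \<Longrightarrow> AE x in restrict_space m U.
      f x - g x \<le> exp (- t * lam) * heat (restrict_dirichlet D U) t (\<lambda>x. f x - g x) x"
    by (rule shift_defective_cases[OF ls lam f U(1) fL2]) blast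
  interpret O: open_subset D U by (rule O)
  have fin: "emeasure m U < \<infinity>" by (rule rel_compact_finite[OF U(1)])
  have zf: "O.zext f \<in> L2 m" using fL2 by (simp add: O.zext_def)
  have zg: "O.zext g \<in> L2 m" by (rule O.Cb_L2_U(1)[OF fin g(2)])
  let ?v = "\<lambda>x. f x - g x"
  have v_eq: "O.zext ?v = O.zext f - O.zext g"
    by (auto simp: fun_eq_iff fun_ops O.zext_apply algebra_simps)
  have zv: "O.zext ?v \<in> L2 m" unfolding v_eq using zf zg by simp
  obtain hg V where hg: "hg \<in> FU U" and V: "openin X V" "?K \<subseteq> V" "V \<subseteq> U" "AE x in m. x \<in> V \<longrightarrow> g x = hg x"
    and g_harm: "E hg \<phi> + lam * ip2 m (O.zext g) \<phi> = 0"
    using O.weakly_harmonic_U[OF g(1) \<phi> U(2)] by blast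
  have hgF: "hg \<in> F" by (rule FU_F[OF hg])
  define y where "y = h - hg"
  have yF: "y \<in> F" using h hgF by (simp add: y_def)
  have \<phi>U: "\<phi> \<in> FU U" by (rule O.Fcomp_U_I(1)[OF \<phi> U(2)])
  have \<phi>0: "AE x in m. x \<notin> ?K \<longrightarrow> \<phi> x = 0" by (rule msupport_AE_zero[OF F_measurable[OF \<phi>F]])
  obtain \<eta> where \<eta>: "cutoff \<eta> ?K U" using cutoff_exists[OF K U(3,2)] by blast
  define q where "q = (\<lambda>n::nat. O.zext (\<lambda>x. min (C - ?v x) ((C + real n) * \<eta> x)))"
  define Y where "Y = (\<lambda>(n::nat) x. max (y x) (- real n))"
  have Y: "Y n \<in> F" "E (Y n) (Y n) \<le> E y y" for n
    unfolding Y_def by (rule F_contraction[OF yF]; auto simp: max_def)+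
  have le: "E (Y n) \<phi> \<le> - (lam * ip2 m (O.zext ?v) \<phi>)" for n
  proof -
    have qU: "q n \<in> FU U" and Eq: "lam * ip2 m (O.zext ?v) \<phi> \<le> E (q n) \<phi>"
      using O.shift_defective_truncation[OF fin lam zv C shift \<eta>, of "C + real n"] \<phi>U \<phi>(2) \<phi>0
      unfolding q_def by auto
    have "AE x in m. x \<in> ?K \<longrightarrow> (q n + Y n) x = C"
      using h(2) V(4)
    proof eventually_elim
      case (elim x)
      show ?case
        using elim V U(2) cutoffD(6)[OF \<eta>, of x]
        by (auto simp: q_def Y_def y_def fun_ops min_def max_def)
    qed
    then have "E (q n + Y n) \<phi> = 0" using FU_F[OF qU] Y(1) \<phi>F by (intro E_local_const) auto
    then show ?thesis using Eq FU_F[OF qU] Y(1) \<phi>F by (simp add: EE.ip_simps)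
  qed
  have "(\<lambda>n. L2norm m (Y n - y)) \<longlonglongrightarrow> 0"
  proof (rule L2_dominated_convergence(2))
    show "(\<lambda>x. \<bar>y x\<bar>) \<in> L2 m" using yF by (intro L2_abs) simp
    show "AE x in m. \<bar>Y n x\<bar> \<le> \<bar>y x\<bar>" for n by (auto simp: Y_def)
    show "AE x in m. (\<lambda>n. Y n x) \<longlonglongrightarrow> y x"
    proof (rule AE_I2)
      fix x
      obtain N :: nat where N: "- y x \<le> real N" using real_arch_simple by blast
      have "Y n x = y x" if "n \<ge> N" for n
      proof -
        have "real N \<le> real n" using that by simp
        then show ?thesis using N by (simp add: Y_def)
      qed
      then show "(\<lambda>n. Y n x) \<longlonglongrightarrow> y x" by (intro tendsto_eventually) (auto simp: eventually_sequentially)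
    qed
  qed (use Y yF F_measurable in auto)
  then have "(\<lambda>n. E (Y n) \<phi>) \<longlonglongrightarrow> E y \<phi>" by (rule weak_conv[OF Y yF _ \<phi>F])
  then have "E y \<phi> \<le> - (lam * ip2 m (O.zext ?v) \<phi>)"
    using le by (intro LIMSEQ_le_const2) auto
  then have "E h \<phi> + lam * ip2 m (O.zext f) \<phi> \<le> 0"
    using g_harm h hgF \<phi>F zf zg unfolding y_def v_eq
    by (simp add: EE.ip_simps L2.ip_simps algebra_simps)
  moreover have "form_loc D f \<phi> = E h \<phi>" by (rule form_loc_eq[OF \<phi>F h(1) U(3,2) h(2)])
  moreover have "ip2 m (O.zext f) \<phi> = (\<integral>x. f x * \<phi> x \<partial>m)"
    unfolding ip2_def
  proof (rule integral_cong_AE)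
    show "AE x in m. O.zext f x * \<phi> x = f x * \<phi> x"
      using \<phi>0 by eventually_elim (use U(2) in \<open>auto simp: O.zext_apply indicator_def\<close>)
  qed (use fm F_measurable[OF \<phi>F] O.zext_measurable[OF fm] in auto)
  ultimately show "form_loc D f \<phi> + lam * (\<integral>x. f x * \<phi> x \<partial>m) \<le> 0" by simp
qed

lemma Linfloc_L2loc:
  assumes "f \<in> Linfloc X m"
  shows "f \<in> L2loc X m"
proof -
  have f: "f \<in> borel_measurable m" using assms by (simp add: Linfloc_def)
  have "set_integrable m K (\<lambda>x. (f x)\<^sup>2)" if K: "compactin X K" for K
  proof -
    obtain C where C: "AE x in m. x \<in> K \<longrightarrow> \<bar>f x\<bar> \<le> C" using assms K by (auto simp: Linfloc_def)
    have "(\<lambda>x. indicator K x * f x) \<in> L2 m"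
    proof (rule L2_bound)
      show "\<bar>C\<bar> *\<^sub>R indicator K \<in> L2 m"
        using L2_indicator_finite[OF compact_sets[OF K] compact_finite[OF K]] by simp
      show "AE x in m. \<bar>indicator K x * f x\<bar> \<le> \<bar>(\<bar>C\<bar> *\<^sub>R indicator K) x\<bar>"
        using C by eventually_elim (auto simp: indicator_def fun_ops)
    qed (use f compact_sets[OF K] in simp)
    then have "integrable m (\<lambda>x. (indicator K x * f x)\<^sup>2)" by (rule L2_integrable_sq)
    moreover have "(\<lambda>x. (indicator K x * f x)\<^sup>2) = (\<lambda>x. indicator K x *\<^sub>R (f x)\<^sup>2)"
      by (auto simp: fun_eq_iff indicator_def)
    ultimately show ?thesis by (simp add: set_integrable_def)
  qed
  then show ?thesis using f by (simp add: L2loc_def)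
qed

text \<open>Here f is bounded on U, so one finite k leaves the truncation inactive on W. There f = C
  \<eta> - q + h, with h a local representative of g.\<close>

lemma Floc_of_shift_defective:
  assumes ls: "locally_smoothing D" and lam: "0 \<le> lam" and f: "locally_shift_defective lam D f"
    and fb: "f \<in> Linfloc X m"
  shows "f \<in> Floc D"
  unfolding Floc_def
proof (intro CollectI conjI allI impI)
  show f2: "f \<in> L2loc X m" by (rule Linfloc_L2loc[OF fb])
  fix W assume W: "rel_compact_open X W"
  let ?K = "X closure_of W"
  have K: "compactin X ?K" and WK: "W \<subseteq> ?K" and Wo: "openin X W"
    using W closure_of_subset[of W X] openin_subset[of X W] by (auto simp: rel_compact_open_def)
  obtain U where U: "rel_compact_open X U" "?K \<subseteq> U" "openin X U" using rel_compact_nbhd[OF K] by blast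
  interpret O: open_subset D U by unfold_locales (rule U)
  have fin: "emeasure m U < \<infinity>" by (rule rel_compact_finite[OF U(1)])
  have fm: "f \<in> borel_measurable m" using fb by (simp add: Linfloc_def)
  have "compactin X (X closure_of U)" using U by (simp add: rel_compact_open_def)
  then obtain B where "AE x in m. x \<in> X closure_of U \<longrightarrow> \<bar>f x\<bar> \<le> B" using fb by (auto simp: Linfloc_def)
  then have B: "AE x in m. x \<in> U \<longrightarrow> \<bar>f x\<bar> \<le> B"
    by eventually_elim (use closure_of_subset[OF openin_subset[OF U(3)]] in auto)
  have fU: "f \<in> borel_measurable O.mU" using O.zext_measurable[OF fm] by (simp add: O.measurable_U)
  have zf: "O.zext f \<in> L2 m" by (rule O.bounded_L2_U[OF fin fU B])
  obtain g C where g: "weakly_harmonic lam (restrict_dirichlet D U) g"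
    "g \<in> Cb (subtopology X U)" and C: "0 \<le> C" "AE x in restrict_space m U. f x - g x \<le> C"
    and shift: "\<And>t. 0 < t \<Longrightarrow> AE x in restrict_space m U.
      f x - g x \<le> exp (- t * lam) * heat (restrict_dirichlet D U) t (\<lambda>x. f x - g x) x"
    by (rule shift_defective_cases[OF ls lam f U(1) zf[unfolded O.zext_def]]) blast
  obtain G where G: "0 \<le> G" "\<And>x. x \<in> U \<Longrightarrow> \<bar>g x\<bar> \<le> G" using O.Cb_L2_U(3)[OF fin g(2)] by blast
  have zv: "O.zext (\<lambda>x. f x - g x) \<in> L2 m"
    using L2.diff_in[OF zf O.Cb_L2_U(1)[OF fin g(2)]]
    unfolding O.zext_simps(2)[symmetric] by (simp add: fun_diff_def)
  obtain \<eta> where \<eta>: "cutoff \<eta> ?K U" using cutoff_exists[OF K U(3,2)] by blast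
  define k where "k = C + \<bar>B\<bar> + G"
  define q where "q = O.zext (\<lambda>x. min (C - (f x - g x)) (k * \<eta> x))"
  have q: "q \<in> FU U"
    unfolding q_def using G by (intro O.shift_defective_truncation(1)[OF fin lam zv C shift \<eta>]) (auto simp: k_def)
  have "g \<in> Floc O.DU" using g by (simp add: weakly_harmonic_def weakly_subharmonic_def)
  moreover have "U \<inter> (X closure_of (U \<inter> W)) = ?K" using U WK by (auto simp: Int_absorb1)
  then have "rel_compact_open (top_of O.DU) W"
    using K U WK Wo by (simp add: rel_compact_open_def O.DU_simps openin_open_subtopology[OF U(3)]
      closure_of_subtopology compactin_subtopology)
  ultimately obtain h where h: "O.zext h \<in> FU U" "AE x in m. x \<in> U \<longrightarrow> x \<in> W \<longrightarrow> g x = h x"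
    unfolding Floc_def by (auto simp: O.AE_DU O.DU_simps)
  have "C *\<^sub>R \<eta> - q + O.zext h \<in> F" using FU_F[OF q] FU_F[OF h(1)] cutoffD(1)[OF \<eta>] by simp
  moreover have "AE x in m. x \<in> W \<longrightarrow> f x = (C *\<^sub>R \<eta> - q + O.zext h) x"
    using h(2) B
  proof eventually_elim
    case (elim x)
    show ?case
    proof
      assume x: "x \<in> W"
      then have xU: "x \<in> U" and \<eta>x: "\<eta> x = 1" using U WK cutoffD(6)[OF \<eta>] by auto
      have "C - (f x - g x) \<le> k" using elim xU G(2)[OF xU] by (auto simp: k_def abs_le_iff)
      then show "f x = (C *\<^sub>R \<eta> - q + O.zext h) x"
        using elim x xU \<eta>x by (simp add: q_def fun_ops)
    qed
  qed
  ultimately show "\<exists>h\<in>F. AE x in m. x \<in> W \<longrightarrow> f x = h x" by blast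
qed

end

section \<open>Bounded subharmonic functions are shift defective\<close>

context dirichlet_space
begin

lemma compact_finite_cover:
  assumes K: "compactin X K" and V: "\<And>x. x \<in> K \<Longrightarrow> openin X (V x)" "\<And>x. x \<in> K \<Longrightarrow> x \<in> V x"
  obtains A where "finite A" "A \<subseteq> K" "K \<subseteq> \<Union>(V ` A)"
proof -
  have "\<And>W. W \<in> V ` K \<Longrightarrow> openin X W" "K \<subseteq> \<Union>(V ` K)" using V by auto
  from compactinD[OF K this] show ?thesis using that by (metis finite_subset_image)
qed

lemma locally_bounded_above_nbhd:
  assumes f: "locally_bounded_above X m f" and K: "compactin X K"
  obtains W M where "openin X W" "K \<subseteq> W" "0 \<le> M" "AE x in m. x \<in> W \<longrightarrow> f x \<le> M"
proof -
  have "\<forall>x\<in>K. \<exists>V C. openin X V \<and> x \<in> V \<and> (AE y in m. y \<in> V \<longrightarrow> f y \<le> C)"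
    using f compactin_subset_topspace[OF K] by (auto simp: locally_bounded_above_def)
  then obtain V C where V: "\<And>x. x \<in> K \<Longrightarrow> openin X (V x)" "\<And>x. x \<in> K \<Longrightarrow> x \<in> V x"
    "\<And>x. x \<in> K \<Longrightarrow> AE y in m. y \<in> V x \<longrightarrow> f y \<le> C x" by metis
  obtain A where A: "finite A" "A \<subseteq> K" "K \<subseteq> \<Union>(V ` A)"
    using compact_finite_cover[OF K V(1,2)] by blast
  \<comment> \<open>A common and nonnegative bound, whatever the signs of the finitely many
    \<open>C x\<close>.\<close>
  let ?M = "\<Sum>x\<in>A. \<bar>C x\<bar>"
  have "AE y in m. \<forall>x\<in>A. y \<in> V x \<longrightarrow> f y \<le> C x"
    using A V by (intro AE_finite_allI) auto
  then have "AE y in m. y \<in> \<Union>(V ` A) \<longrightarrow> f y \<le> ?M"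
  proof eventually_elim
    case (elim y)
    show ?case
    proof
      assume "y \<in> \<Union>(V ` A)"
      then obtain x where x: "x \<in> A" "y \<in> V x" by blast
      then have "f y \<le> \<bar>C x\<bar>" using elim by fastforce
      also have "\<dots> \<le> ?M" using A x by (intro member_le_sum) auto
      finally show "f y \<le> ?M" .
    qed
  qed
  moreover have "openin X (\<Union>(V ` A))" using A V by (intro openin_Union) auto
  ultimately show ?thesis using A by (intro that[of "\<Union>(V ` A)" ?M]) (auto intro: sum_nonneg)
qed

text \<open>u need not be in F(U), but on U it is dominated by r, which is. So the positive part of
  min u r, which agrees with \<psi> almost everywhere, is an admissible test function, and locality
  lets u replace min u r in the form.\<close>

lemma FU_comparison:
  assumes u: "u \<in> F" and r: "r \<in> FU U" "AE x in m. 0 \<le> r x" and le: "AE x in m. x \<in> U \<longrightarrow> u x \<le> r x"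
    and \<psi>_def: "\<psi> = (\<lambda>x. min (max (u x) 0) (r x))"
  shows "\<psi> \<in> FU U" "AE x in m. 0 \<le> \<psi> x" "E \<psi> \<psi> \<le> E u \<psi>" "AE x in m. x \<in> U \<longrightarrow> \<psi> x = max (u x) 0"
proof -
  show \<psi>: "\<psi> \<in> FU U" unfolding \<psi>_def by (rule FU_ideal[OF F_pos[OF u] r(1) _ r(2)]) simp
  show "AE x in m. 0 \<le> \<psi> x" using r(2) unfolding \<psi>_def by eventually_elim simp
  show "AE x in m. x \<in> U \<longrightarrow> \<psi> x = max (u x) 0" using le r(2) unfolding \<psi>_def by eventually_elim auto
  let ?u = "\<lambda>x. min (u x) (r x)" and ?p = "\<lambda>x. max (min (u x) (r x)) 0"
  have uF: "?u \<in> F" by (rule F_min[OF u FU_F[OF r(1)]])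
  have pF: "?p \<in> F" by (rule F_pos[OF uF])
  have \<psi>F: "\<psi> \<in> F" by (rule FU_F[OF \<psi>])
  have eq: "AE x in m. ?p x = \<psi> x" using r(2) unfolding \<psi>_def by eventually_elim (auto simp: min_def max_def)
  have "E u \<psi> = E ?u \<psi>"
    by (rule FU_local_eq[OF u uF _ \<psi>]) (use le in \<open>auto elim: eventually_mono\<close>)
  moreover have "E ?u \<psi> = E ?u ?p" using E_AE[OF pF \<psi>F uF eq] E_sym uF pF \<psi>F by metis
  moreover have "E ?p ?p = E \<psi> \<psi>" using E_AE[OF pF \<psi>F pF eq] E_AE[OF pF \<psi>F \<psi>F eq] E_sym[OF pF \<psi>F] by simp
  ultimately show "E \<psi> \<psi> \<le> E u \<psi>" using E_pos_part[OF uF] by simp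
qed

text \<open>Weak maximum principle. The boundary condition u \<le> 0 is expressed by domination by
  an element of F(U), so no boundary values occur. Since E u \<psi> \<ge> E \<psi> \<psi> \<ge> 0,
  testing with \<psi> leaves a times the squared norm of \<psi> nonpositive.\<close>

lemma FU_comparison_zero:
  assumes u: "u \<in> F" and r: "r \<in> FU U" "AE x in m. 0 \<le> r x" and le: "AE x in m. x \<in> U \<longrightarrow> u x \<le> r x"
    and a: "0 < a" and U: "openin X U"
    and test: "\<And>\<psi>. \<psi> \<in> FU U \<Longrightarrow> AE x in m. 0 \<le> \<psi> x \<Longrightarrow> E u \<psi> + a * ip2 m u \<psi> \<le> 0"
  shows "AE x in m. x \<in> U \<longrightarrow> u x \<le> 0"
proof -
  define \<psi> where "\<psi> = (\<lambda>x. min (max (u x) 0) (r x))"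
  note c = FU_comparison[OF u r le \<psi>_def]
  have \<psi>F: "\<psi> \<in> F" by (rule FU_F[OF c(1)])
  have "ip2 m u \<psi> = ip2 m \<psi> \<psi>"
  proof (rule ip2_cong_AE)
    show "AE x in m. u x * \<psi> x = \<psi> x * \<psi> x"
      using c(4) FU_zero_outside[OF c(1) U] by eventually_elim (auto simp: max_def split: if_splits)
  qed (use u \<psi>F F_measurable in auto)
  then have "E u \<psi> + a * ip2 m \<psi> \<psi> \<le> 0" using test[OF c(1,2)] by simp
  then have "a * ip2 m \<psi> \<psi> \<le> 0" using c(3) E_nonneg[OF \<psi>F] by linarith
  then have "ip2 m \<psi> \<psi> \<le> 0" using a by (simp add: mult_le_0_iff)
  then have "(L2norm m \<psi>)\<^sup>2 \<le> 0" using \<psi>F by (simp add: L2.nrm_sq)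
  then have "L2norm m \<psi> = 0" by simp
  then have "AE x in m. \<psi> x = 0" using L2norm_eq_0_iff[of \<psi> m] \<psi>F by simp
  then show ?thesis using c(4) by eventually_elim (auto simp: max_def split: if_splits)
qed

end

section \<open>The harmonic function built from the potential\<close>

context open_subset
begin

text \<open>For \<open>\<lambda> > 0\<close>, \<open>w\<close> is \<open>\<lambda>\<close> times the \<open>\<lambda>\<close>-potential of \<open>1\<close>, so that \<open>1 - w\<close> is \<open>\<lambda>\<close>-harmonic; for \<open>\<lambda> = 0\<close> it is \<open>0\<close>.\<close>

definition potential_of_one :: "real \<Rightarrow> ('a \<Rightarrow> real) \<Rightarrow> bool" where
  "potential_of_one lam w \<longleftrightarrow> w \<in> FU U \<and> (AE x in m. 0 \<le> w x \<and> w x \<le> 1) \<and>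
     (\<forall>v\<in>FU U. E w v = lam * ip2 m (indicator U - w) v) \<and> (lam = 0 \<longrightarrow> w = 0)"

lemma indicator_U_L2: "emeasure m U < \<infinity> \<Longrightarrow> indicator U \<in> L2 m"
  by (rule L2_indicator_finite[OF U_sets(1)])

lemma potential_of_one_exists:
  assumes fin: "emeasure m U < \<infinity>" and lam: "0 \<le> lam"
  shows "\<exists>w. potential_of_one lam w"
proof (cases "lam = 0")
  case True
  then show ?thesis by (intro exI[of _ 0]) (auto simp: potential_of_one_def FU_zero fun_ops FU_F)
next
  case False
  let ?w = "RU lam (\<lambda>x. 1)"
  have z1: "zext (\<lambda>x. 1) = indicator U" by (simp add: fun_eq_iff zext_apply)
  have L2: "zext (\<lambda>x. 1) \<in> L2 m" unfolding z1 by (rule indicator_U_L2[OF fin])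
  then have 1: "(\<lambda>x. 1) \<in> L2 (msr DU)" by (simp add: L2_U DU_simps)
  have lam0: "0 < lam" using lam False by simp
  have "AE x in msr DU. 0 \<le> DU.R lam (\<lambda>x. 1) x" by (rule DU.R_nonneg[OF 1 lam0]) simp
  moreover have "AE x in msr DU. DU.R lam (\<lambda>x. 1) x \<le> 1" by (rule DU.R_le_const[OF 1 lam0]) auto
  ultimately have "AE x in m. 0 \<le> ?w x \<and> ?w x \<le> 1"
    unfolding AE_DU RU_def by eventually_elim (auto simp: zext_apply indicator_def)
  moreover have "?w \<in> FU U" by (rule RU_FU[OF L2 lam0])
  moreover have "E ?w v = lam * ip2 m (indicator U - ?w) v" if "v \<in> FU U" for v
    using RU_eq[OF L2 lam0 that] unfolding z1 .
  ultimately show ?thesis using False by (intro exI[of _ ?w]) (auto simp: potential_of_one_def)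
qed

lemma potential_of_oneD:
  assumes "potential_of_one lam w"
  shows "w \<in> FU U" "AE x in m. 0 \<le> w x" "AE x in m. w x \<le> 1"
    "v \<in> FU U \<Longrightarrow> E w v = lam * ip2 m (indicator U - w) v" "lam = 0 \<Longrightarrow> w = 0"
  using assms unfolding potential_of_one_def by auto

text \<open>The constant 1 need not be in F(U); near the support of a test function a cutoff
  \<theta> stands for it, and the form of \<theta> with the test function vanishes by locality. The
  sign of M is free, so that harmonicity follows by using -M as well.\<close>

lemma weakly_subharmonic_potential:
  assumes fin: "emeasure m U < \<infinity>" and w: "potential_of_one lam w"
    and g: "g \<in> borel_measurable mU" and eq: "AE x in m. x \<in> U \<longrightarrow> g x = M * (1 - w x)"
  shows "weakly_subharmonic lam DU g"
proof -
  note w = potential_of_oneD[OF w]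
  note wF = FU_F[OF w(1)]
  have local: "\<exists>\<theta> V. cutoff \<theta> K U \<and> openin X V \<and> K \<subseteq> V \<and>
      (AE x in m. x \<in> V \<inter> U \<longrightarrow> g x = (M *\<^sub>R (\<theta> - w)) x)"
    if K: "compactin X K" "K \<subseteq> U" for K
  proof -
    obtain \<theta> where \<theta>: "cutoff \<theta> K U" using cutoff_exists[OF K(1) U K(2)] by blast
    obtain V where V: "openin X V" "K \<subseteq> V" "\<And>x. x \<in> V \<Longrightarrow> \<theta> x = 1" using \<theta> by (auto simp: cutoff_def)
    have "AE x in m. x \<in> V \<inter> U \<longrightarrow> g x = (M *\<^sub>R (\<theta> - w)) x"
      using eq by eventually_elim (use V(3) in \<open>simp add: fun_ops\<close>)
    then show ?thesis using \<theta> V by blast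
  qed
  have hU: "zext (M *\<^sub>R (\<theta> - w)) \<in> FU U" if "cutoff \<theta> K U" for \<theta> K
    by (intro zext_mem_FU FU_scale FU_diff cutoff_FU[OF that] w(1))
  have gL2: "zext g \<in> L2 m"
  proof (rule bounded_L2_U[OF fin g])
    show "AE x in m. x \<in> U \<longrightarrow> \<bar>g x\<bar> \<le> \<bar>M\<bar>"
      using eq w(2,3)
    proof eventually_elim
      case (elim x)
      have "\<bar>M * (1 - w x)\<bar> \<le> \<bar>M\<bar>" using elim by (simp add: abs_mult mult_left_le)
      then show ?case using elim by simp
    qed
  qed
  have Floc: "g \<in> Floc DU"
    unfolding Floc_def L2loc_def
  proof (intro CollectI conjI allI impI)
    show "g \<in> borel_measurable (msr DU)" using g by (simp add: DU_simps)
    fix K assume "compactin (top_of DU) K"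
    then have K: "compactin X K" "K \<subseteq> U" by (auto simp: DU_simps compactin_subtopology)
    have "integrable m (\<lambda>x. (indicator K x * zext g x)\<^sup>2)"
      by (intro L2_integrable_sq L2_indicator gL2 compact_sets K)
    moreover have "(\<lambda>x. (indicator K x * zext g x)\<^sup>2) = (\<lambda>x. indicator U x *\<^sub>R indicator K x *\<^sub>R (g x)\<^sup>2)"
      by (auto simp: fun_eq_iff zext_apply indicator_def)
    ultimately show "set_integrable (msr DU) K (\<lambda>x. (g x)\<^sup>2)"
      unfolding set_integrable_def DU_simps by (simp add: integrable_restrict_space[OF U_sets(2)])
  next
    fix V assume "rel_compact_open (top_of DU) V"
    then have V: "openin X V" "V \<subseteq> U" "compactin X (U \<inter> X closure_of V)"
      by (auto simp: rel_compact_open_def DU_simps openin_open_subtopology[OF U] closure_of_subtopology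
        compactin_subtopology Int_absorb1)
    \<comment> \<open>The closure of V within U; it is compact because V is relatively compact in
      the subspace.\<close>
    let ?K = "U \<inter> X closure_of V"
    have VK: "V \<subseteq> ?K" using V closure_of_subset[OF openin_subset[OF V(1)]] by blast
    obtain \<theta> W where \<theta>: "cutoff \<theta> ?K U" and W: "?K \<subseteq> W" "AE x in m. x \<in> W \<inter> U \<longrightarrow> g x = (M *\<^sub>R (\<theta> - w)) x"
      using local[OF V(3)] by auto
    have "AE x in m. x \<in> U \<longrightarrow> x \<in> V \<longrightarrow> g x = (M *\<^sub>R (\<theta> - w)) x"
      using W(2) by eventually_elim (use W(1) VK in auto)
    then show "\<exists>h\<in>fdom DU. AE x in msr DU. x \<in> V \<longrightarrow> g x = h x"
      using hU[OF \<theta>] unfolding AE_DU by (intro bexI[of _ "M *\<^sub>R (\<theta> - w)"]) (auto simp: DU_simps)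
  qed
  moreover have "form_loc DU g \<phi> + lam * (\<integral>x. g x * \<phi> x \<partial>msr DU) = 0" if \<phi>: "\<phi> \<in> Fcomp DU" for \<phi>
  proof -
    note c = Fcomp_U[OF \<phi>]
    note \<phi>F = FU_F[OF c(1)]
    obtain \<theta> V where \<theta>: "cutoff \<theta> (msupport X m (zext \<phi>)) U" and V: "openin X V" "msupport X m (zext \<phi>) \<subseteq> V"
      "AE x in m. x \<in> V \<inter> U \<longrightarrow> g x = (M *\<^sub>R (\<theta> - w)) x"
      using local[OF c(2,4)] by blast
    let ?h = "M *\<^sub>R (\<theta> - w)"
    have hF: "?h \<in> FU U" by (intro FU_scale FU_diff cutoff_FU[OF \<theta>] w(1))
    have "form_loc DU g \<phi> = E (zext ?h) (zext \<phi>)" by (rule form_loc_U[OF \<phi> hU[OF \<theta>] V])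
    also have "\<dots> = E ?h (zext \<phi>)" by (rule E_zext[OF hF \<phi>F])
    also have "\<dots> = M * (E \<theta> (zext \<phi>) - E w (zext \<phi>))"
      using cutoffD(1)[OF \<theta>] wF \<phi>F by (simp add: EE.ip_simps)
    also have "E \<theta> (zext \<phi>) = 0"
      using cutoffD(1,6)[OF \<theta>] \<phi>F by (intro E_local_const[where c = 1]) auto
    also have "E w (zext \<phi>) = lam * ip2 m (indicator U - w) (zext \<phi>)" by (rule w(4)[OF c(1)])
    finally have "form_loc DU g \<phi> = - (lam * (M * ip2 m (indicator U - w) (zext \<phi>)))" by simp
    moreover have "(\<integral>x. g x * \<phi> x \<partial>msr DU) = ip2 m (zext g) (zext \<phi>)"
      using ip2_U[of g \<phi>] by (simp add: ip2_def DU_simps)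
    moreover have "ip2 m (zext g) (zext \<phi>) = ip2 m (M *\<^sub>R (indicator U - w)) (zext \<phi>)"
    proof (rule ip2_cong_AE)
      show "AE x in m. zext g x * zext \<phi> x = (M *\<^sub>R (indicator U - w)) x * zext \<phi> x"
        using eq by eventually_elim (auto simp: zext_apply indicator_def fun_ops)
      show "M *\<^sub>R (indicator U - w) \<in> borel_measurable m"
        using indicator_U_L2[OF fin] wF by (intro L2_measurable) simp
    qed (use gL2 \<phi>F in \<open>auto intro: L2_measurable F_measurable\<close>)
    ultimately show ?thesis using indicator_U_L2[OF fin] wF \<phi>F by (simp add: L2.ip_simps)
  qed
  ultimately show ?thesis unfolding weakly_subharmonic_def by simp
qed

lemma weakly_harmonic_potential:
  assumes fin: "emeasure m U < \<infinity>" and w: "potential_of_one lam w"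
    and g: "g \<in> borel_measurable mU" and eq: "AE x in m. x \<in> U \<longrightarrow> g x = M * (1 - w x)"
  shows "weakly_harmonic lam DU g"
proof -
  have "weakly_subharmonic lam DU (\<lambda>x. - g x)"
    by (rule weakly_subharmonic_potential[OF fin w, of _ "- M"]) (use g eq in \<open>auto elim: eventually_mono\<close>)
  then show ?thesis using weakly_subharmonic_potential[OF fin w g eq] by (simp add: weakly_harmonic_def)
qed

end

section \<open>From subharmonicity to the shift inequality\<close>

context dirichlet_space
begin

text \<open>The maximum principle is used twice. With dominating element M w it gives f \<le> g on
  U. With s = g - f \<ge> 0 and b = a / (a - \<lambda>) it applies to R a s - b s, which is
  dominated by R a s itself, and gives R a s \<le> b s; \<open>S_le_of_R_le\<close> returns to the
  semigroup.\<close>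

lemma subharmonic_shift_inequality:
  assumes lam: "0 \<le> lam" and f: "weakly_subharmonic lam D f"
    and U: "rel_compact_open X U" and W: "openin X W" "X closure_of U \<subseteq> W"
    and h: "h \<in> F" "AE x in m. x \<in> W \<longrightarrow> f x = h x" and M: "0 \<le> M" "AE x in m. x \<in> U \<longrightarrow> f x \<le> M"
    and w: "open_subset.potential_of_one D U lam w"
    and g: "g \<in> Cb (subtopology X U)" "AE x in m. x \<in> U \<longrightarrow> g x = M * (1 - w x)" and t: "0 < t"
  shows "AE x in restrict_space m U. f x - g x \<le> exp (- t * lam) * heat (restrict_dirichlet D U) t (\<lambda>x. f x - g x) x"
proof -
  have Uo: "openin X U" and K: "compactin X (X closure_of U)" using U by (auto simp: rel_compact_open_def)
  interpret O: open_subset D U by unfold_locales (rule Uo)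
  note w = O.potential_of_oneD[OF w]
  note wF = FU_F[OF w(1)]
  have UK: "U \<subseteq> X closure_of U" by (rule closure_of_subset[OF openin_subset[OF Uo]])
  then have UW: "U \<subseteq> W" using W by blast
  have fin: "emeasure m U < \<infinity>" by (rule rel_compact_finite[OF U])
  obtain \<xi> where \<xi>: "cutoff \<xi> (X closure_of U) W" using cutoff_exists[OF K W] by blast
  note \<xi>F = cutoffD(1)[OF \<xi>]
  \<comment> \<open>G represents g on U by an element of F, since \<xi> is 1 there; accordingly h -
    G represents f - g.\<close>
  define G where "G = M *\<^sub>R (\<xi> - w)"
  have GF: "G \<in> F" using \<xi>F wF by (simp add: G_def)
  have GU: "AE x in m. x \<in> U \<longrightarrow> g x = G x"
    using g(2) by eventually_elim (use cutoffD(6)[OF \<xi>] UK in \<open>auto simp: G_def fun_ops\<close>)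
  have EG: "E G \<psi> + lam * ip2 m G \<psi> = 0" if \<psi>: "\<psi> \<in> FU U" for \<psi>
  proof -
    note \<psi>F = FU_F[OF \<psi>]
    have "E \<xi> \<psi> = E 0 \<psi>"
    proof -
      have "AE x in m. x \<notin> X closure_of U \<longrightarrow> \<psi> x = 0"
        using FU_zero_outside[OF \<psi> Uo] by eventually_elim (use UK in auto)
      then have "msupport X m \<psi> \<subseteq> X closure_of U" by (intro msupport_subset) simp_all
      then show ?thesis using cutoffD(6)[OF \<xi>] \<xi>F \<psi>F
        by (simp, intro E_local_const[where c = 1]) auto
    qed
    moreover have "ip2 m (indicator U - w) \<psi> = ip2 m (\<xi> - w) \<psi>"
    proof (rule ip2_cong_AE)
      show "AE x in m. (indicator U - w) x * \<psi> x = (\<xi> - w) x * \<psi> x"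
        using FU_zero_outside[OF \<psi> Uo] by eventually_elim (use cutoffD(6)[OF \<xi>] UK in \<open>auto simp: fun_ops indicator_def\<close>)
      show "indicator U - w \<in> borel_measurable m" using O.indicator_U_L2[OF fin] wF by (intro L2_measurable) simp
      show "\<xi> - w \<in> borel_measurable m" using \<xi>F wF by (intro F_measurable) simp
    qed (use \<psi>F F_measurable in auto)
    moreover have "E G \<psi> + lam * ip2 m G \<psi> = M * (E \<xi> \<psi> - E w \<psi> + lam * ip2 m (\<xi> - w) \<psi>)"
      using \<xi>F wF \<psi>F by (simp add: G_def EE.ip_simps L2.ip_simps algebra_simps)
    ultimately show ?thesis using w(4)[OF \<psi>] \<psi>F by simp
  qed
  have Eh: "E h \<psi> + lam * ip2 m h \<psi> \<le> 0" if \<psi>: "\<psi> \<in> FU U" "AE x in m. 0 \<le> \<psi> x" for \<psi>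
  proof -
    note \<psi>F = FU_F[OF \<psi>(1)]
    have \<psi>0: "AE x in m. x \<notin> X closure_of U \<longrightarrow> \<psi> x = 0"
      using FU_zero_outside[OF \<psi>(1) Uo] by eventually_elim (use UK in auto)
    then have sub: "msupport X m \<psi> \<subseteq> X closure_of U" by (intro msupport_subset) simp_all
    then have "compactin X (msupport X m \<psi>)" using closed_compactin[OF K _ closedin_msupport] by blast
    then have "\<psi> \<in> Fcomp D" using \<psi>F by (simp add: Fcomp_def)
    then have "form_loc D f \<psi> + lam * (\<integral>x. f x * \<psi> x \<partial>m) \<le> 0"
      using f \<psi>(2) by (simp add: weakly_subharmonic_def)
    moreover have "form_loc D f \<psi> = E h \<psi>"
      using sub W by (intro form_loc_eq[OF \<psi>F h(1) W(1) _ h(2)]) blast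
    moreover have "(\<integral>x. f x * \<psi> x \<partial>m) = ip2 m h \<psi>"
      unfolding ip2_def
    proof (rule integral_cong_AE)
      show "AE x in m. f x * \<psi> x = h x * \<psi> x"
        using \<psi>0 h(2) by eventually_elim (use W in auto)
      have "f \<in> borel_measurable m" using f by (simp add: weakly_subharmonic_def Floc_def L2loc_def)
      then show "(\<lambda>x. f x * \<psi> x) \<in> borel_measurable m" using F_measurable[OF \<psi>F] by simp
    qed (use F_measurable \<psi>F h in auto)
    ultimately show ?thesis by simp
  qed
  have le_g: "AE x in m. x \<in> U \<longrightarrow> (h - G) x \<le> 0"
  \<comment> \<open>\<open>FU_comparison_zero\<close> asks for a positive constant, so \<lambda> = 0
    is separate; then w = 0, and on U the function g is the bound M of f.\<close>
  proof (cases "lam = 0")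
    case True
    then have w0: "w = 0" by (rule w(5))
    show ?thesis using M(2) h(2)
      by eventually_elim (use cutoffD(6)[OF \<xi>] UK UW in \<open>auto simp: G_def fun_ops w0\<close>)
  next
    case False
    show ?thesis
    proof (rule FU_comparison_zero[where r = "M *\<^sub>R w" and a = lam])
      show "AE x in m. 0 \<le> (M *\<^sub>R w) x" using w(2) by eventually_elim (use M(1) in \<open>simp add: fun_ops\<close>)
      show "AE x in m. x \<in> U \<longrightarrow> (h - G) x \<le> (M *\<^sub>R w) x"
        using M(2) h(2) by eventually_elim (use cutoffD(6)[OF \<xi>] UK UW in \<open>auto simp: G_def fun_ops algebra_simps\<close>)
      show "E (h - G) \<psi> + lam * ip2 m (h - G) \<psi> \<le> 0" if "\<psi> \<in> FU U" "AE x in m. 0 \<le> \<psi> x" for \<psi>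
        using EG[OF that(1)] Eh[OF that] h(1) GF FU_F[OF that(1)]
        by (simp add: EE.ip_simps L2.ip_simps algebra_simps)
      show "h - G \<in> F" using h GF by simp
    qed (use w(1) False lam Uo in \<open>auto intro: FU_scale\<close>)
  qed
  define s where "s = (\<lambda>x. g x - f x)"
  have sU: "AE x in m. x \<in> U \<longrightarrow> s x = (G - h) x"
    using GU h(2) by eventually_elim (use UW in \<open>auto simp: s_def fun_ops\<close>)
  have fm: "f \<in> borel_measurable m" using f by (simp add: weakly_subharmonic_def Floc_def L2loc_def)
  have zs_eq: "O.zext s = O.zext g - O.zext f"
    by (auto simp: fun_eq_iff fun_ops O.zext_apply algebra_simps s_def)
  have zsm: "O.zext s \<in> borel_measurable m"
    unfolding zs_eq using L2_measurable[OF O.Cb_L2_U(1)[OF fin g(1)]] O.zext_measurable[OF fm]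
    by (simp add: fun_diff_def)
  have ae_zs: "AE x in m. O.zext (G - h) x = O.zext s x"
    using sU by eventually_elim (auto simp: O.zext_apply indicator_def)
  have zs: "O.zext s \<in> L2 m" by (rule L2_cong_AE[OF _ zsm ae_zs]) (use GF h in simp)
  then have s2: "s \<in> L2 (msr O.DU)" by (simp add: O.L2_U O.DU_simps)
  have s0: "AE x in m. x \<in> U \<longrightarrow> 0 \<le> s x"
    using sU le_g by eventually_elim (simp add: fun_ops)
  have R_le: "AE x in msr O.DU. O.DU.R a s x \<le> a / (a - lam) * s x" if a: "lam < a" for a
  proof -
    have a0: "0 < a" using lam a by simp
    define b where "b = a / (a - lam)"
    \<comment> \<open>This identity is b (a - \<lambda>) = a. It splits b (E + a) (G - h) into a (G
      - h), which cancels the source of R a s, and b (E + \<lambda>) (G - h), which is nonnegative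
      on test functions \<psi> \<ge> 0.\<close>
    have b: "0 \<le> b" "a + b * lam = a * b" using a a0 by (auto simp: b_def field_simps)
    define r where "r = O.RU a s"
    have r: "r \<in> FU U" unfolding r_def by (rule O.RU_FU[OF zs a0])
    have "AE x in msr O.DU. 0 \<le> O.DU.R a s x"
      using s0 by (intro O.DU.R_nonneg[OF s2 a0]) (simp add: O.AE_DU)
    then have r0: "AE x in m. 0 \<le> r x"
      unfolding O.AE_DU r_def O.RU_def by eventually_elim (auto simp: O.zext_apply indicator_def)
    have "AE x in m. x \<in> U \<longrightarrow> (r - b *\<^sub>R (G - h)) x \<le> 0"
    proof (rule FU_comparison_zero[where r = r and a = a, OF _ r r0 _ a0 Uo])
      show "r - b *\<^sub>R (G - h) \<in> F" using FU_F[OF r] GF h by simp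
      show "AE x in m. x \<in> U \<longrightarrow> (r - b *\<^sub>R (G - h)) x \<le> r x"
        using le_g by eventually_elim (use b in \<open>auto simp: fun_ops intro: mult_nonneg_nonneg\<close>)
      fix \<psi> assume \<psi>: "\<psi> \<in> FU U" "AE x in m. 0 \<le> \<psi> x"
      note \<psi>F = FU_F[OF \<psi>(1)]
      have "ip2 m (O.zext s) \<psi> = ip2 m (G - h) \<psi>"
      proof (rule ip2_cong_AE)
        show "AE x in m. O.zext s x * \<psi> x = (G - h) x * \<psi> x"
          using FU_zero_outside[OF \<psi>(1) Uo] sU by eventually_elim (auto simp: O.zext_apply indicator_def)
        show "G - h \<in> borel_measurable m" using GF h(1) by (intro F_measurable EE.diff_in)
      qed (use zsm \<psi>F F_measurable in auto)
      then have "E r \<psi> = a * ip2 m (G - h) \<psi> - a * ip2 m r \<psi>"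
        using O.RU_eq[OF zs a0 \<psi>(1)] zs FU_F[OF r] \<psi>F by (simp add: r_def L2.ip_simps algebra_simps)
      moreover have "b * (E h \<psi> + lam * ip2 m h \<psi>) \<le> 0" by (rule mult_nonneg_nonpos[OF b(1) Eh[OF \<psi>]])
      moreover have "b * (E G \<psi> + lam * ip2 m G \<psi>) = 0" using EG[OF \<psi>(1)] by simp
      moreover have "a * ip2 m (G - h) \<psi> + b * lam * ip2 m (G - h) \<psi> = a * (b * ip2 m (G - h) \<psi>)"
        using b(2) by (simp add: distrib_right[symmetric] mult.assoc[symmetric])
      ultimately show "E (r - b *\<^sub>R (G - h)) \<psi> + a * ip2 m (r - b *\<^sub>R (G - h)) \<psi> \<le> 0"
        using FU_F[OF r] \<psi>F GF h by (simp add: EE.ip_simps L2.ip_simps algebra_simps)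
    qed
    then show ?thesis
      unfolding O.AE_DU using sU
      by eventually_elim (auto simp: r_def O.RU_def fun_ops b_def)
  qed
  have S_le: "AE x in msr O.DU. O.DU.S t s x \<le> exp (t * lam) * s x"
    using O.DU.S_le_of_R_le[OF s2 lam _ R_le] t by simp
  have v_eq: "(\<lambda>x. f x - g x) = (-1) *\<^sub>R s" by (simp add: fun_eq_iff fun_ops s_def)
  have "AE x in msr O.DU. O.DU.S t (0 + (-1) *\<^sub>R s) x = O.DU.S t 0 x + (-1) * O.DU.S t s x"
    using s2 t by (intro O.DU.S_AE_linear) auto
  moreover have "AE x in msr O.DU. O.DU.S t (0 + 0 *\<^sub>R 0) x = O.DU.S t 0 x + 0 * O.DU.S t 0 x"
    using t by (intro O.DU.S_AE_linear) auto
  moreover have "AE x in msr O.DU. heat O.DU t (\<lambda>x. f x - g x) x = O.DU.S t (\<lambda>x. f x - g x) x"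
    unfolding v_eq using s2 t by (intro O.DU.heat_AE_eq) auto
  moreover have "AE x in msr O.DU. O.DU.S t 0 x = 0"
    using O.DU.S_le_const[of 0 t 0] O.DU.S_nonneg[of 0 t] t
    by (auto simp: fun_ops elim: eventually_elim2)
  ultimately have "AE x in msr O.DU. f x - g x \<le> exp (- t * lam) * heat O.DU t (\<lambda>x. f x - g x) x"
    using S_le
  proof eventually_elim
    case (elim x)
    have "exp (- t * lam) * O.DU.S t s x \<le> exp (- t * lam) * (exp (t * lam) * s x)"
      using elim by (intro mult_left_mono) auto
    also have "\<dots> = s x" by (simp add: mult.assoc[symmetric] flip: exp_add)
    finally show ?case using elim by (simp add: v_eq s_def)
  qed
  then show ?thesis by (simp only: O.DU_simps)
qed

lemma L2loc_L1loc:
  assumes "f \<in> L2loc X m"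
  shows "f \<in> L1loc X m"
proof -
  have f: "f \<in> borel_measurable m" using assms by (simp add: L2loc_def)
  have "set_integrable m K f" if K: "compactin X K" for K
  proof -
    have "integrable m (\<lambda>x. indicator K x *\<^sub>R (f x)\<^sup>2)"
      using assms K by (simp add: L2loc_def set_integrable_def)
    moreover have "(\<lambda>x. indicator K x *\<^sub>R (f x)\<^sup>2) = (\<lambda>x. (indicator K x * f x)\<^sup>2)"
      by (auto simp: fun_eq_iff indicator_def)
    ultimately have "(\<lambda>x. indicator K x * f x) \<in> L2 m" using f compact_sets[OF K] by (simp add: L2_def)
    then have "integrable m (\<lambda>x. indicator K x * f x * indicator K x)"
      using L2_indicator_finite[OF compact_sets[OF K] compact_finite[OF K]] by (rule L2_mult_integrable)
    moreover have "(\<lambda>x. indicator K x * f x * indicator K x) = (\<lambda>x. indicator K x *\<^sub>R f x)"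
      by (auto simp: fun_eq_iff indicator_def)
    ultimately show ?thesis by (simp add: set_integrable_def)
  qed
  then show ?thesis using f by (simp add: L1loc_def)
qed

text \<open>The continuous version of the potential is a hypothesis here, to be supplied by the
  Feller property. The bound M and the representative h are taken on neighbourhoods of the closure
  of U, so that they hold up to its boundary.\<close>

lemma shift_defective_of_subharmonic:
  assumes lam: "0 \<le> lam" and f: "weakly_subharmonic lam D f" and fb: "locally_bounded_above X m f"
    and cont: "\<And>U w. rel_compact_open X U \<Longrightarrow> open_subset.potential_of_one D U lam w \<Longrightarrow>
      \<exists>c\<in>Cb (subtopology X U). AE x in m. x \<in> U \<longrightarrow> w x = c x"
  shows "locally_shift_defective lam D f"
  unfolding locally_shift_defective_def
proof (intro conjI allI impI)
  have fl: "f \<in> Floc D" using f by (simp add: weakly_subharmonic_def)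
  then show "f \<in> L1loc X m" using L2loc_L1loc by (simp add: Floc_def)
  fix U assume U: "rel_compact_open X U"
  then have Uo: "openin X U" and K: "compactin X (X closure_of U)" by (auto simp: rel_compact_open_def)
  interpret O: open_subset D U by unfold_locales (rule Uo)
  have fin: "emeasure m U < \<infinity>" by (rule rel_compact_finite[OF U])
  obtain W0 M where W0: "openin X W0" "X closure_of U \<subseteq> W0" and M: "0 \<le> M" "AE x in m. x \<in> W0 \<longrightarrow> f x \<le> M"
    using locally_bounded_above_nbhd[OF fb K] by blast
  have UW0: "U \<subseteq> W0" using W0 closure_of_subset[OF openin_subset[OF Uo]] by blast
  obtain h W where h: "h \<in> F" "AE x in m. x \<in> W \<longrightarrow> f x = h x" and W: "rel_compact_open X W" "X closure_of U \<subseteq> W"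
    using Floc_local[OF fl K W0] by blast
  have Wo: "openin X W" using W by (simp add: rel_compact_open_def)
  obtain w where w: "O.potential_of_one lam w" using O.potential_of_one_exists[OF fin lam] by blast
  obtain c where c: "c \<in> Cb (subtopology X U)" "AE x in m. x \<in> U \<longrightarrow> w x = c x" using cont[OF U w] by blast
  define g where "g = (\<lambda>x. M * (1 - c x))"
  have g: "g \<in> Cb (subtopology X U)"
  proof -
    obtain B where B: "\<And>x. x \<in> topspace (subtopology X U) \<Longrightarrow> \<bar>c x\<bar> \<le> B" using c(1) by (auto simp: Cb_def)
    have "\<bar>g x\<bar> \<le> \<bar>M\<bar> * (1 + B)" if "x \<in> topspace (subtopology X U)" for x
    proof -
      have "\<bar>1 - c x\<bar> \<le> 1 + B" using B[OF that] by linarith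
      then show ?thesis unfolding g_def abs_mult by (intro mult_left_mono) auto
    qed
    moreover have "continuous_map (subtopology X U) euclideanreal g"
      using c(1) unfolding g_def Cb_def Cont_def
      by (intro continuous_map_real_mult continuous_map_diff) auto
    ultimately show ?thesis unfolding Cb_def Cont_def by blast
  qed
  have gw: "AE x in m. x \<in> U \<longrightarrow> g x = M * (1 - w x)"
    using c(2) by eventually_elim (simp add: g_def)
  have MU: "AE x in m. x \<in> U \<longrightarrow> f x \<le> M" using M(2) by eventually_elim (use UW0 in auto)
  show "\<exists>g\<in>Cb (subtopology X U). weakly_harmonic lam (restrict_dirichlet D U) g \<and>
      (\<forall>t>0. AE x in restrict_space m U.
        f x - g x \<le> exp (- t * lam) * heat (restrict_dirichlet D U) t (\<lambda>y. f y - g y) x)"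
    using subharmonic_shift_inequality[OF lam f U Wo W(2) h M(1) MU w g gw]
      O.weakly_harmonic_potential[OF fin w O.Cb_L2_U(2)[OF fin g] gw] g by blast
qed

end

section \<open>Continuous representatives\<close>

context dirichlet_space
begin

text \<open>By full support a nonempty open set is not null; this is how almost everywhere
  information reaches points.\<close>

lemma AE_point:
  assumes V: "openin X V" "x \<in> V" and P: "AE y in m. y \<in> V \<longrightarrow> P y"
  shows "\<exists>y\<in>V. P y"
proof (rule ccontr)
  assume "\<not> (\<exists>y\<in>V. P y)"
  from P have "AE y in m. y \<notin> V" by eventually_elim (use \<open>\<not> (\<exists>y\<in>V. P y)\<close> in blast)
  then have "emeasure m V = 0" using open_sets[OF V(1)] by (simp add: AE_iff_null_sets null_setsD1)
  then show False using full_support[OF V(1)] V(2) by auto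
qed

end

context open_subset
begin

lemma topspace_U: "topspace (subtopology X U) = U"
  using U_top by auto

lemma continuous_nbhd:
  assumes c: "continuous_map (subtopology X U) euclideanreal c" and z: "z \<in> U" and e: "e > 0"
  shows "\<exists>N. openin X N \<and> z \<in> N \<and> N \<subseteq> U \<and> (\<forall>y\<in>N. \<bar>c y - c z\<bar> < e)"
proof -
  let ?N = "{y \<in> U. c y \<in> ball (c z) e}"
  have "openin (subtopology X U) ?N"
    using openin_continuous_map_preimage[OF c, of "ball (c z) e"] by (simp only: topspace_U) simp
  then have "openin X ?N" "?N \<subseteq> U" by (auto simp: openin_open_subtopology[OF U])
  then show ?thesis using z e by (intro exI[of _ ?N]) (auto simp: dist_real_def)
qed

lemma continuous_U_I:
  assumes "\<And>z e. z \<in> U \<Longrightarrow> e > 0 \<Longrightarrow> \<exists>N. openin X N \<and> z \<in> N \<and> (\<forall>y\<in>N \<inter> U. \<bar>c y - c z\<bar> < e)"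
  shows "continuous_map (subtopology X U) euclideanreal c"
  unfolding continuous_map_def
proof (intro conjI allI impI)
  fix W :: "real set" assume W: "openin euclideanreal W"
  let ?V = "{x \<in> topspace (subtopology X U). c x \<in> W}"
  have "\<exists>T. openin (subtopology X U) T \<and> x \<in> T \<and> T \<subseteq> ?V" if x: "x \<in> ?V" for x
  proof -
    have "c x \<in> W" "x \<in> U" "open W" using x W by auto
    then obtain e where e: "e > 0" "\<And>r. \<bar>r - c x\<bar> < e \<Longrightarrow> r \<in> W"
      unfolding open_dist by (auto simp: dist_real_def)
    obtain N where "openin X N" "x \<in> N" "\<forall>y\<in>N \<inter> U. \<bar>c y - c x\<bar> < e" using assms[OF \<open>x \<in> U\<close> e(1)] by blast
    then show ?thesis
      using e \<open>x \<in> U\<close> U U_top by (intro exI[of _ "N \<inter> U"]) (auto simp: openin_open_subtopology[OF U])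
  qed
  then show "openin (subtopology X U) ?V" by (subst openin_subopen) blast
qed simp

lemma continuous_le_of_AE:
  assumes c: "continuous_map (subtopology X U) euclideanreal c" and le: "AE x in m. x \<in> U \<longrightarrow> c x \<le> B" and z: "z \<in> U"
  shows "c z \<le> B"
proof (rule ccontr)
  assume "\<not> c z \<le> B"
  then obtain N where N: "openin X N" "z \<in> N" "N \<subseteq> U" "\<forall>y\<in>N. \<bar>c y - c z\<bar> < c z - B"
    using continuous_nbhd[OF c z, of "c z - B"] by auto
  have "AE x in m. x \<in> N \<longrightarrow> c x \<le> B" using le by eventually_elim (use N in auto)
  from AE_point[OF N(1,2) this] obtain y where y: "y \<in> N" "c y \<le> B" by blast
  then have "\<bar>c y - c z\<bar> < c z - B" using N by blast
  then show False using y by linarith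
qed

text \<open>Every admissible triple (N, r, e) with z in N constrains the value at z by |c z - r|
  \<le> e. Two constraints never differ by more than e + e', because overlapping open sets share a
  point where both estimates hold. So the centres for e = 1/(n+1) are Cauchy, and their limit
  satisfies every constraint at z.\<close>

lemma continuous_representative:
  assumes f: "zext f \<in> borel_measurable m"
    and osc: "\<And>z e. z \<in> U \<Longrightarrow> e > 0 \<Longrightarrow>
      \<exists>N r. openin X N \<and> z \<in> N \<and> (AE y in m. y \<in> N \<longrightarrow> \<bar>f y - r\<bar> \<le> e)"
  obtains c where "continuous_map (subtopology X U) euclideanreal c" "AE x in m. x \<in> U \<longrightarrow> f x = c x"
proof -
  define V where "V = (\<lambda>N r e. openin X N \<and> (AE y in m. y \<in> N \<longrightarrow> \<bar>f y - r\<bar> \<le> e))"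
  have overlap: "\<bar>r - r'\<bar> \<le> e + e'" if "V N r e" "V N' r' e'" "z \<in> N" "z \<in> N'" for N N' r r' e e' z
  proof -
    have "AE y in m. y \<in> N \<inter> N' \<longrightarrow> \<bar>f y - r\<bar> \<le> e \<and> \<bar>f y - r'\<bar> \<le> e'"
    proof -
      have "AE y in m. y \<in> N \<longrightarrow> \<bar>f y - r\<bar> \<le> e" "AE y in m. y \<in> N' \<longrightarrow> \<bar>f y - r'\<bar> \<le> e'"
        using that(1,2) unfolding V_def by blast+
      then show ?thesis by eventually_elim blast
    qed
    note both = this
    have "openin X (N \<inter> N')" "z \<in> N \<inter> N'" using that unfolding V_def by auto
    from AE_point[OF this both] obtain y where "\<bar>f y - r\<bar> \<le> e" "\<bar>f y - r'\<bar> \<le> e'" by blast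
    then show ?thesis by linarith
  qed
  have "\<forall>z\<in>U. \<forall>n::nat. \<exists>N r. V N r (inverse (Suc n)) \<and> z \<in> N"
  proof (intro ballI allI)
    fix z and n :: nat assume "z \<in> U"
    moreover have "0 < inverse (real (Suc n))" by simp
    ultimately show "\<exists>N r. V N r (inverse (Suc n)) \<and> z \<in> N" using osc unfolding V_def by blast
  qed
  then obtain N r where Nr: "\<And>z n. z \<in> U \<Longrightarrow> V (N z n) (r z n) (inverse (Suc n))" "\<And>z n. z \<in> U \<Longrightarrow> z \<in> N z n"
    by metis
  have "\<exists>c. \<forall>N r e. V N r e \<and> z \<in> N \<longrightarrow> \<bar>c - r\<bar> \<le> e" if z: "z \<in> U" for z
  proof -
    have "Cauchy (r z)"
    proof (rule CauchyI')
      fix e :: real assume e: "e > 0"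
      then obtain k where k: "inverse (real (Suc k)) < e / 2" using reals_Archimedean[of "e / 2"] by auto
      have "dist (r z i) (r z j) < e" if "i \<ge> k" "j > i" for i j
      proof -
        have "inverse (real (Suc i)) \<le> inverse (real (Suc k))" "inverse (real (Suc j)) \<le> inverse (real (Suc k))"
          using that by (auto intro!: le_imp_inverse_le)
        then show ?thesis using overlap[OF Nr(1)[OF z] Nr(1)[OF z] Nr(2)[OF z] Nr(2)[OF z], of i j] k
          unfolding dist_real_def by linarith
      qed
      then show "\<exists>M. \<forall>m\<ge>M. \<forall>n>m. dist (r z m) (r z n) < e" by blast
    qed
    then obtain c where c: "r z \<longlonglongrightarrow> c" using real_Cauchy_convergent convergent_def by blast
    have "\<bar>c - s\<bar> \<le> e" if "V W s e" "z \<in> W" for W s e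
    proof (rule LIMSEQ_le)
      show "(\<lambda>n. \<bar>r z n - s\<bar>) \<longlonglongrightarrow> \<bar>c - s\<bar>" by (intro tendsto_intros c)
      show "(\<lambda>n. inverse (real (Suc n)) + e) \<longlonglongrightarrow> e"
        using tendsto_add[OF LIMSEQ_inverse_real_of_nat tendsto_const[of e]] by simp
      show "\<exists>N. \<forall>n\<ge>N. \<bar>r z n - s\<bar> \<le> inverse (real (Suc n)) + e"
        using overlap[OF Nr(1)[OF z] that(1) Nr(2)[OF z] that(2)] by blast
    qed
    then show ?thesis by blast
  qed
  then obtain c where c: "\<And>z N r e. z \<in> U \<Longrightarrow> V N r e \<Longrightarrow> z \<in> N \<Longrightarrow> \<bar>c z - r\<bar> \<le> e" by metis
  have cont: "continuous_map (subtopology X U) euclideanreal c"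
  proof (rule continuous_U_I)
    fix z and e :: real assume z: "z \<in> U" and e: "e > 0"
    obtain W s where W: "V W s (e / 3)" "z \<in> W" using osc[OF z, of "e / 3"] e unfolding V_def by auto
    have "\<bar>c y - c z\<bar> < e" if "y \<in> W \<inter> U" for y
    proof -
      have "\<bar>c y - s\<bar> \<le> e / 3" "\<bar>c z - s\<bar> \<le> e / 3" using c[OF z W] c[OF _ W(1), of y] that by auto
      then show ?thesis using e by linarith
    qed
    then show "\<exists>N. openin X N \<and> z \<in> N \<and> (\<forall>y\<in>N \<inter> U. \<bar>c y - c z\<bar> < e)" using W unfolding V_def by blast
  qed
  have cm: "zext c \<in> borel_measurable m" using continuous_measurable_U[OF cont] by (simp add: measurable_U)
  \<comment> \<open>The exceptional null set depends on the neighbourhood, of which there may be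
    uncountably many; \<open>null_of_locally_null\<close> deals with that.\<close>
  have "AE x in m. \<bar>zext f x - zext c x\<bar> \<le> 2 * inverse (real (Suc n))" for n
  proof -
    let ?A = "{x \<in> space m. \<not> \<bar>zext f x - zext c x\<bar> \<le> 2 * inverse (real (Suc n))}"
    have "AE x in m. x \<notin> ?A"
    proof (rule null_of_locally_null)
      show "?A \<in> sets m" using f cm by measurable
      fix z assume "z \<in> ?A"
      then have "\<not> \<bar>zext f z - zext c z\<bar> \<le> 2 * inverse (real (Suc n))" by blast
      then have z: "z \<in> U" by (cases "z \<in> U") (simp_all add: zext_out del: of_nat_Suc)
      have "AE y in m. y \<in> N z n \<longrightarrow> \<bar>f y - r z n\<bar> \<le> inverse (Suc n)" using Nr(1)[OF z] unfolding V_def by blast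
      then have "AE y in m. y \<in> N z n \<longrightarrow> y \<notin> ?A"
      proof eventually_elim
        case (elim y)
        have "\<bar>zext f y - zext c y\<bar> \<le> 2 * inverse (Suc n)" if y: "y \<in> N z n"
        proof (cases "y \<in> U")
          case True
          have "\<bar>f y - r z n\<bar> \<le> inverse (Suc n)" "\<bar>c y - r z n\<bar> \<le> inverse (Suc n)"
            using elim y c[OF True Nr(1)[OF z] y] by auto
          then show ?thesis unfolding zext_in[OF True] by linarith
        qed (simp add: zext_out)
        then show ?case by auto
      qed
      then show "\<exists>V. openin X V \<and> z \<in> V \<and> (AE y in m. y \<in> V \<longrightarrow> y \<notin> ?A)"
        using Nr[OF z, of n] unfolding V_def by blast
    qed
    then show ?thesis using AE_space by eventually_elim auto
  qed
  then have "AE x in m. \<forall>n. \<bar>zext f x - zext c x\<bar> \<le> 2 * inverse (real (Suc n))"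
    by (subst AE_all_countable) blast
  then have "AE x in m. x \<in> U \<longrightarrow> f x = c x"
  proof eventually_elim
    case (elim x)
    have "(\<lambda>n. 2 * inverse (real (Suc n))) \<longlonglongrightarrow> 2 * 0"
      by (intro tendsto_intros LIMSEQ_inverse_real_of_nat)
    then have "\<bar>zext f x - zext c x\<bar> \<le> 2 * 0" by (rule LIMSEQ_le_const) (use elim in blast)
    then show ?case by auto
  qed
  then show ?thesis using that[OF cont] by blast
qed

text \<open>Metrizability supplies a sequence, as dominated convergence wants; intersecting with a
  relatively compact W makes the indicators square integrable.\<close>

lemma nbhd_sequence:
  assumes z: "z \<in> U"
  obtains N :: "nat \<Rightarrow> 'a set" where "\<And>n. openin X (N n)" "\<And>n. z \<in> N n" "\<And>n. N n \<subseteq> U" "\<And>n. emeasure m (N n) < \<infinity>"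
    "\<And>V. openin X V \<Longrightarrow> z \<in> V \<Longrightarrow> \<forall>\<^sub>F n in sequentially. N n \<subseteq> V"
proof -
  obtain M d where Md: "Metric_space M d" and X_eq: "X = Metric_space.mtopology M d"
    using metrizable_X unfolding metrizable_space_def by blast
  interpret Md: Metric_space M d by (rule Md)
  have zM: "z \<in> M" using z U_top X_eq by auto
  have "compactin X {z}" using z U_top by auto
  then obtain W where W: "openin X W" "{z} \<subseteq> W" "compactin X (X closure_of W)" "X closure_of W \<subseteq> U"
    using compact_nbhd[OF _ U] z by blast
  have WU: "W \<subseteq> U" using W closure_of_subset[OF openin_subset[OF W(1)]] by blast
  have finW: "emeasure m W < \<infinity>" by (rule rel_compact_finite) (use W in \<open>simp add: rel_compact_open_def\<close>)
  let ?N = "\<lambda>n::nat. Md.mball z (inverse (Suc n)) \<inter> W"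
  show ?thesis
  proof (rule that[of ?N])
    show "openin X (?N n)" for n using W(1) X_eq by (intro openin_Int) auto
    show "z \<in> ?N n" for n using zM W by simp
    show "?N n \<subseteq> U" for n using WU by blast
    show "emeasure m (?N n) < \<infinity>" for n
      using emeasure_mono[of "?N n" W m] open_sets[OF W(1)] finW by (auto intro: le_less_trans)
    fix V assume V: "openin X V" "z \<in> V"
    then have "openin Md.mtopology V" by (simp only: X_eq)
    then obtain r where r: "r > 0" "Md.mball z r \<subseteq> V" using V(2) unfolding Md.openin_mtopology by blast
    obtain k where k: "inverse (real (Suc k)) < r" using reals_Archimedean[OF r(1)] by auto
    have "?N n \<subseteq> V" if "n \<ge> k" for n
    proof -
      have "inverse (real (Suc n)) \<le> inverse (real (Suc k))" using that by (auto intro!: le_imp_inverse_le)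
      then have "Md.mball z (inverse (real (Suc n))) \<subseteq> Md.mball z r" using k by (intro Md.mball_subset_concentric) linarith
      then show ?thesis using r by blast
    qed
    then show "\<forall>\<^sub>F n in sequentially. ?N n \<subseteq> V" by (auto simp: eventually_sequentially)
  qed
qed

end

lemma average_bound:
  assumes f: "f \<in> L2 m" and A: "A \<in> sets m" "emeasure m A < \<infinity>" "0 < measure m A"
    and le: "AE x in m. x \<in> A \<longrightarrow> \<bar>f x - r\<bar> \<le> e"
  shows "\<bar>ip2 m f (indicator A) / measure m A - r\<bar> \<le> e"
proof -
  have "AE x in m. x \<in> A \<longrightarrow> f x \<le> r + e" using le by eventually_elim auto
  then have 1: "ip2 m f (indicator A) \<le> (r + e) * measure m A" by (rule ip2_indicator_le[OF f A(1,2)])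
  have "AE x in m. x \<in> A \<longrightarrow> (- f) x \<le> e - r" using le by eventually_elim (auto simp: fun_ops)
  then have "ip2 m (- f) (indicator A) \<le> (e - r) * measure m A" using f by (intro ip2_indicator_le[OF _ A(1,2)]) simp_all
  then have 2: "- ip2 m f (indicator A) \<le> (e - r) * measure m A"
    using f L2_indicator_finite[OF A(1,2)] by (simp add: L2.ip_simps)
  have "ip2 m f (indicator A) / measure m A \<le> r + e" using 1 A(3) by (simp add: field_simps)
  moreover have "r - e \<le> ip2 m f (indicator A) / measure m A" using 2 A(3) by (simp add: field_simps)
  ultimately show ?thesis by (simp add: abs_le_iff)
qed

section \<open>Barriers from the Feller property\<close>

text \<open>The threshold is where B < e (1 + a T / 2) is guaranteed; then 1 + x \<le> e^x.\<close>

lemma exp_decay_small: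
  fixes T :: real
  assumes "0 < T" "0 \<le> B" "0 < e"
  shows "\<exists>a0>0. \<forall>a\<ge>a0. B * exp (- a * T / 2) < e"
proof (intro exI[of _ "(2 * B / e + 1) / T"] conjI allI impI)
  show "0 < (2 * B / e + 1) / T" using assms by (intro divide_pos_pos add_nonneg_pos) auto
  fix a assume "(2 * B / e + 1) / T \<le> a"
  then have "2 * B / e + 1 \<le> a * T" using assms(1) by (simp add: field_simps)
  then have "2 * B / e < 2 * (1 + a * T / 2)" by simp
  then have "B < e * (1 + a * T / 2)" using assms(3) by (simp add: field_simps)
  also have "\<dots> \<le> e * exp (a * T / 2)" using assms(3) exp_ge_add_one_self[of "a * T / 2"] by (intro mult_left_mono) auto
  finally have "B * exp (- (a * T / 2)) < e * exp (a * T / 2) * exp (- (a * T / 2))" by simp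
  then show "B * exp (- a * T / 2) < e" by (simp add: mult.assoc flip: exp_add)
qed

locale feller_subset = open_subset +
  assumes feller: "doubly_feller DU"
begin

abbreviation "TU \<equiv> subtopology X U"

lemma measurable_DU: "f \<in> L2 DU.m \<Longrightarrow> zext f \<in> borel_measurable m"
  using L2_measurable[of f DU.m] by (simp add: DU_simps measurable_U)

lemma S_continuous:
  assumes f: "f \<in> L2 DU.m" and B: "AE x in DU.m. \<bar>f x\<bar> \<le> B" and t: "0 < t"
  obtains c where "continuous_map TU euclideanreal c" "AE x in DU.m. DU.S t f x = c x"
proof -
  have "f \<in> Linf DU.m" using L2_measurable[OF f] B by (auto simp: Linf_def)
  then obtain c where c: "c \<in> Cont (top_of DU)" "AE x in DU.m. heat DU t f x = c x"
    using feller t unfolding doubly_feller_def by blast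
  have "AE x in DU.m. heat DU t f x = DU.S t f x" using f t by (intro DU.heat_AE_eq) auto
  with c(2) have "AE x in DU.m. DU.S t f x = c x" by eventually_elim simp
  then show ?thesis using c(1) by (intro that) (auto simp: Cont_def DU_simps)
qed

text \<open>S t (R a f) is continuous by the second Feller property and differs from R a f by at
  most 2 a B t, uniformly; so R a f has arbitrarily small oscillation near each point.\<close>

lemma R_continuous:
  assumes f: "f \<in> L2 DU.m" and B: "AE x in DU.m. \<bar>f x\<bar> \<le> B" "0 \<le> B" and a: "0 < a"
  obtains c where "continuous_map TU euclideanreal c" "AE x in DU.m. DU.R a f x = c x"
proof -
  have RL2: "DU.R a f \<in> L2 DU.m" using DU.R_F[OF f a] by simp
  have RB: "AE x in DU.m. \<bar>DU.R a f x\<bar> \<le> B" by (rule DU.R_abs_le[OF f a B(1)])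
  have osc: "\<exists>N r. openin X N \<and> z \<in> N \<and> (AE y in m. y \<in> N \<longrightarrow> \<bar>DU.R a f y - r\<bar> \<le> e)"
    if z: "z \<in> U" and e: "e > 0" for z e
  proof -
    \<comment> \<open>Makes 2 a B t \<le> e / 2, with B + 1 in the denominator in case B =
      0.\<close>
    define t where "t = e / (4 * a * (B + 1))"
    have t: "0 < t" using a B(2) e by (auto simp: t_def intro!: divide_pos_pos mult_pos_pos)
    have "2 * a * B * t = e / 2 * (B / (B + 1))"
    proof -
      have "2 * a * B * (e / (4 * a * b)) = e / 2 * (B / b)" if "0 < b" for b using a that by (simp add: field_simps)
      from this[of "B + 1"] show ?thesis using B(2) by (simp add: t_def)
    qed
    also have "\<dots> \<le> e / 2 * 1" using e B(2) by (intro mult_left_mono) auto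
    finally have tB: "2 * a * B * t \<le> e / 2" by simp
    obtain c where c: "continuous_map TU euclideanreal c" "AE x in DU.m. DU.S t (DU.R a f) x = c x"
      using S_continuous[OF RL2 RB t] by blast
    obtain N where N: "openin X N" "z \<in> N" "N \<subseteq> U" "\<forall>y\<in>N. \<bar>c y - c z\<bar> < e / 2"
      using continuous_nbhd[OF c(1) z, of "e / 2"] e by auto
    have "AE x in DU.m. \<bar>DU.S t (DU.R a f) x - DU.R a f x\<bar> \<le> 2 * a * B * t"
      using t by (intro DU.S_sub_R[OF f B a]) simp
    then have "AE y in m. y \<in> N \<longrightarrow> \<bar>DU.R a f y - c z\<bar> \<le> e"
      using c(2) unfolding AE_DU
    proof eventually_elim
      case (elim y)
      show ?case
      proof
        assume y: "y \<in> N"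
        then have "\<bar>c y - c z\<bar> < e / 2" "\<bar>c y - DU.R a f y\<bar> \<le> 2 * a * B * t" using elim N by auto
        then show "\<bar>DU.R a f y - c z\<bar> \<le> e" using tB by linarith
      qed
    qed
    then show ?thesis using N by blast
  qed
  show ?thesis
    using continuous_representative[OF measurable_DU[OF RL2] osc] that unfolding AE_DU by blast
qed

lemma C0_I:
  assumes "continuous_map TU euclideanreal f" "compactin X K" "K \<subseteq> U" "\<And>x. x \<in> U - K \<Longrightarrow> f x = 0"
  shows "f \<in> C0 (top_of DU)"
proof -
  have "compactin TU K" using assms by (simp add: compactin_subtopology)
  then have "\<exists>K. compactin TU K \<and> (\<forall>x\<in>U - K. \<bar>f x\<bar> < e)" if "e > 0" for e
    using assms(4) that by (intro exI[of _ K]) auto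
  then show ?thesis using assms(1) unfolding C0_def Cont_def DU_simps topspace_U by blast
qed

lemma S_feller:
  assumes f: "f \<in> C0 (top_of DU)" "f \<in> L2 DU.m"
  obtains u where "\<And>t. 0 \<le> t \<Longrightarrow> continuous_map TU euclideanreal (u t)"
    "\<And>t. 0 \<le> t \<Longrightarrow> AE x in DU.m. DU.S t f x = u t x" "\<And>z. z \<in> U \<Longrightarrow> ((\<lambda>t. u t z) \<longlongrightarrow> f z) (at_right 0)"
proof -
  obtain u where u: "\<And>t. 0 \<le> t \<Longrightarrow> u t \<in> C0 (top_of DU)" "\<And>t. 0 \<le> t \<Longrightarrow> AE x in DU.m. heat DU t f x = u t x"
    "\<And>z. z \<in> topspace (top_of DU) \<Longrightarrow> ((\<lambda>t. u t z) \<longlongrightarrow> f z) (at_right 0)"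
    using feller f(1) unfolding doubly_feller_def by blast
  show ?thesis
  proof (rule that)
    show "continuous_map TU euclideanreal (u t)" if "0 \<le> t" for t
      using u(1)[OF that] by (simp add: C0_def Cont_def DU_simps)
    show "AE x in DU.m. DU.S t f x = u t x" if "0 \<le> t" for t
      using u(2)[OF that] DU.heat_AE_eq[OF f(2) that] by eventually_elim simp
    show "((\<lambda>t. u t z) \<longlongrightarrow> f z) (at_right 0)" if "z \<in> U" for z
      using u(3)[of z] that by (simp only: DU_simps topspace_U)
  qed
qed

text \<open>
  The semigroup is continuous at \<open>z\<close> only for each fixed function; averaging over shrinking
  neighbourhoods of \<open>z\<close> turns the weak Laplace representation of the resolvent into a pointwise one.
\<close>

lemma R_at_point:
  assumes f: "f \<in> C0 (top_of DU)" "f \<in> L2 DU.m" and B: "\<And>x. x \<in> U \<Longrightarrow> \<bar>f x\<bar> \<le> B" "0 \<le> B"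
    and z: "z \<in> U" and e: "0 < e"
  obtains a0 where "0 < a0" "\<And>a c. a0 \<le> a \<Longrightarrow> continuous_map TU euclideanreal c \<Longrightarrow>
    AE x in DU.m. DU.R a f x = c x \<Longrightarrow> \<bar>c z - f z\<bar> < e"
proof -
  obtain u where u: "\<And>t. 0 \<le> t \<Longrightarrow> continuous_map TU euclideanreal (u t)"
    "\<And>t. 0 \<le> t \<Longrightarrow> AE x in DU.m. DU.S t f x = u t x" "\<And>z. z \<in> U \<Longrightarrow> ((\<lambda>t. u t z) \<longlongrightarrow> f z) (at_right 0)"
    using S_feller[OF f] by blast
  obtain N where N: "\<And>n. openin X (N n)" "\<And>n. z \<in> N n" "\<And>n. N n \<subseteq> U" "\<And>n. emeasure m (N n) < \<infinity>"
    "\<And>V. openin X V \<Longrightarrow> z \<in> V \<Longrightarrow> \<forall>\<^sub>F n in sequentially. N n \<subseteq> V"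
    using nbhd_sequence[OF z] by blast
  have Nm: "N n \<in> sets DU.m" "emeasure DU.m (N n) < \<infinity>" "0 < measure DU.m (N n)" for n
  proof -
    have s: "N n \<in> sets m" by (rule open_sets[OF N(1)])
    then show "N n \<in> sets DU.m"
      using N(3)[of n] unfolding DU_simps by (subst sets_restrict_space_iff[OF U_sets(2)]) blast
    have eq: "emeasure DU.m (N n) = emeasure m (N n)"
      unfolding DU_simps by (rule emeasure_restrict_space[OF U_sets(2) N(3)])
    then show fin: "emeasure DU.m (N n) < \<infinity>" using N(4) by simp
    have "0 < emeasure m (N n)" using full_support[OF N(1)] N(2) by blast
    then show "0 < measure DU.m (N n)" using eq fin by (simp add: measure_def enn2real_positive_iff)
  qed
  define h where "h = (\<lambda>n. (1 / measure DU.m (N n)) *\<^sub>R (indicator (N n) :: 'a \<Rightarrow> real))"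
  have hL2: "h n \<in> L2 DU.m" for n unfolding h_def using L2_indicator_finite[OF Nm(1,2)] by simp
  have avg: "ip2 DU.m g (h n) = ip2 DU.m g (indicator (N n)) / measure DU.m (N n)" if "g \<in> L2 DU.m" for g n
    unfolding h_def using L2_indicator_finite[OF Nm(1,2)] that by (simp add: L2.ip_simps)
  have avg_tendsto: "(\<lambda>n. ip2 DU.m g (h n)) \<longlonglongrightarrow> c z"
    if g: "g \<in> L2 DU.m" and c: "continuous_map TU euclideanreal c" "AE x in DU.m. g x = c x" for g c
  proof (rule tendstoI)
    fix \<epsilon> :: real assume \<epsilon>: "0 < \<epsilon>"
    obtain V where V: "openin X V" "z \<in> V" "V \<subseteq> U" "\<forall>y\<in>V. \<bar>c y - c z\<bar> < \<epsilon> / 2"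
      using continuous_nbhd[OF c(1) z, of "\<epsilon> / 2"] \<epsilon> by auto
    show "\<forall>\<^sub>F n in sequentially. dist (ip2 DU.m g (h n)) (c z) < \<epsilon>"
      using N(5)[OF V(1,2)]
    proof eventually_elim
      case (elim n)
      have "AE x in DU.m. x \<in> N n \<longrightarrow> \<bar>g x - c z\<bar> \<le> \<epsilon> / 2"
        using c(2) by eventually_elim (use elim V(4) in force)
      from average_bound[OF g Nm this] show ?case unfolding avg[OF g] using \<epsilon> by (simp add: dist_real_def)
    qed
  qed
  have fB: "AE x in DU.m. \<bar>f x\<bar> \<le> B" unfolding AE_DU using B by simp
  have SL2: "DU.S t f \<in> L2 DU.m" if "0 \<le> t" for t using f(2) that by simp
  have hB: "\<bar>ip2 DU.m (DU.S t f) (h n)\<bar> \<le> B" if t: "0 \<le> t" for t n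
  proof -
    have "AE x in DU.m. x \<in> N n \<longrightarrow> \<bar>DU.S t f x - 0\<bar> \<le> B"
      using DU.S_abs_le[OF f(2) t B(2) fB] by eventually_elim simp
    from average_bound[OF SL2[OF t] Nm this] show ?thesis unfolding avg[OF SL2[OF t]] by simp
  qed
  have uB: "\<bar>u t z\<bar> \<le> B" if t: "0 \<le> t" for t
    using avg_tendsto[OF SL2[OF t] u(1,2)[OF t]] hB[OF t]
    by (intro LIMSEQ_le_const2[OF tendsto_rabs]) auto
  have "\<forall>\<^sub>F t in at_right 0. dist (u t z) (f z) < e / 2" using u(3)[OF z] e by (intro tendstoD) auto
  then obtain T where T: "0 < T" "\<And>t. 0 < t \<Longrightarrow> t < T \<Longrightarrow> \<bar>u t z - f z\<bar> < e / 2"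
    unfolding eventually_at_right_field dist_real_def by auto
  \<comment> \<open>After time T only |u t z - f z| \<le> 2 B is known; as in
    \<open>R_le_of_S_le\<close> this costs twice 2 B e^(-a T / 2).\<close>
  obtain a0 where a0: "a0 > 0" "\<And>a. a \<ge> a0 \<Longrightarrow> 4 * B * exp (- a * T / 2) < e / 2"
    using exp_decay_small[OF T(1), of "4 * B" "e / 2"] B e by auto
  show ?thesis
  proof (rule that[OF a0(1)])
    fix a c assume a: "a0 \<le> a" and c: "continuous_map TU euclideanreal c" "AE x in DU.m. DU.R a f x = c x"
    have apos: "0 < a" using a a0 by simp
    let ?I = "indicator {0<..} :: real \<Rightarrow> real"
    define A where "A = (\<lambda>n t. ?I t * (a * exp (- a * t) * ip2 DU.m (DU.S t f) (h n)))"
    define L where "L = (\<lambda>t. ?I t * (a * exp (- a * t) * u t z))"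
    have A_int: "integrable lborel (A n)" for n
      using DU.laplace_integrable[OF f(2) hL2 apos, of n] unfolding A_def set_integrable_def by simp
    have exp_int: "integrable lborel (\<lambda>t. ?I t * (r * exp (- b * t)))"
        "(\<integral>t. ?I t * (r * exp (- b * t)) \<partial>lborel) = r / b" if "0 < b" for r b
    proof -
      have i: "integrable lborel (\<lambda>t. ?I t * exp (- b * t))" and v: "(\<integral>t. ?I t * exp (- b * t) \<partial>lborel) = 1 / b"
        using exp_set_integral[OF that] by (simp_all add: set_integrable_def set_lebesgue_integral_def)
      have eq: "(\<lambda>t. ?I t * (r * exp (- b * t))) = (\<lambda>t. r * (?I t * exp (- b * t)))" by (simp add: ac_simps)
      show "integrable lborel (\<lambda>t. ?I t * (r * exp (- b * t)))" unfolding eq using i by (rule integrable_mult_right)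
      show "(\<integral>t. ?I t * (r * exp (- b * t)) \<partial>lborel) = r / b" unfolding eq using v by simp
    qed
    have A_lim: "(\<lambda>n. A n t) \<longlonglongrightarrow> L t" for t
    proof (cases "0 < t")
      case True
      then show ?thesis unfolding A_def L_def
        using avg_tendsto[OF SL2 u(1,2), of t] by (intro tendsto_intros) auto
    qed (simp add: A_def L_def)
    \<comment> \<open>No continuity of u t z in t is known for positive t; measurability is
      inherited from the averages that converge to it.\<close>
    have L_meas: "L \<in> borel_measurable lborel"
      by (rule borel_measurable_LIMSEQ_real[of _ A]) (use A_lim A_int in auto)
    have dom: "\<bar>A n t\<bar> \<le> ?I t * (a * B * exp (- a * t))" for n t
    proof (cases "0 < t")
      case True
      then have "a * exp (- a * t) * \<bar>ip2 DU.m (DU.S t f) (h n)\<bar> \<le> a * exp (- a * t) * B"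
        using apos hB[of t n] by (intro mult_left_mono) auto
      then show ?thesis using True apos by (simp add: A_def abs_mult ac_simps)
    qed (simp add: A_def)
    have lim: "(\<lambda>n. \<integral>t. A n t \<partial>lborel) \<longlonglongrightarrow> (\<integral>t. L t \<partial>lborel)"
      and L_int: "integrable lborel L"
    proof -
      note dct = L_meas borel_measurable_integrable[OF A_int] exp_int(1)[OF apos, of "a * B"]
      have b: "AE t in lborel. norm (A n t) \<le> ?I t * (a * B * exp (- a * t))" for n using dom by simp
      have l: "AE t in lborel. (\<lambda>n. A n t) \<longlonglongrightarrow> L t" using A_lim by simp
      show "(\<lambda>n. \<integral>t. A n t \<partial>lborel) \<longlonglongrightarrow> (\<integral>t. L t \<partial>lborel)" by (rule integral_dominated_convergence[OF dct l b])
      show "integrable lborel L" by (rule integrable_dominated_convergence[OF dct l b])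
    qed
    have RL2: "DU.R a f \<in> L2 DU.m" using f(2) apos by simp
    have "(\<integral>t. A n t \<partial>lborel) = ip2 DU.m (DU.R a f) (h n)" for n
      using DU.laplace[OF f(2) hL2 apos, of n] unfolding A_def set_lebesgue_integral_def by simp
    then have cz: "c z = (\<integral>t. L t \<partial>lborel)"
      using lim by (simp add: LIMSEQ_unique[OF avg_tendsto[OF RL2 c]])
    define G where "G = (\<lambda>t. ?I t * (a * f z * exp (- a * t)))"
    have fz: "f z = (\<integral>t. G t \<partial>lborel)" and G_int: "integrable lborel G"
      unfolding G_def using exp_int[OF apos, of "a * f z"] apos by simp_all
    define k where "k = (\<lambda>t. ?I t * (a * (e / 2) * exp (- a * t)) + ?I t * (2 * a * B * exp (- a * T / 2) * exp (- (a / 2) * t)))"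
    have k_int: "integrable lborel k" and k_val: "(\<integral>t. k t \<partial>lborel) = e / 2 + 4 * B * exp (- a * T / 2)"
    proof -
      note i = exp_int(1)[OF apos, of "a * (e / 2)"] exp_int(1)[of "a / 2" "2 * a * B * exp (- a * T / 2)"]
      show "integrable lborel k" unfolding k_def using i apos by (intro Bochner_Integration.integrable_add) auto
      show "(\<integral>t. k t \<partial>lborel) = e / 2 + 4 * B * exp (- a * T / 2)"
        unfolding k_def using i apos exp_int(2)[OF apos, of "a * (e / 2)"] exp_int(2)[of "a / 2" "2 * a * B * exp (- a * T / 2)"]
        by (subst Bochner_Integration.integral_add) auto
    qed
    have bound: "\<bar>L t - G t\<bar> \<le> k t" for t
    proof (cases "0 < t")
      case t: True
      have "L t - G t = a * exp (- a * t) * (u t z - f z)"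
        using t by (simp add: L_def G_def algebra_simps)
      then have "\<bar>L t - G t\<bar> = a * exp (- a * t) * \<bar>u t z - f z\<bar>"
        using apos by (simp add: abs_mult)
      also have "\<dots> \<le> a * exp (- a * t) * (e / 2 + 2 * B * exp (a * (t - T) / 2))"
      proof (intro mult_left_mono)
        show "\<bar>u t z - f z\<bar> \<le> e / 2 + 2 * B * exp (a * (t - T) / 2)"
        proof (cases "t < T")
          case True
          have "0 \<le> 2 * B * exp (a * (t - T) / 2)" using B(2) by simp
          then show ?thesis using T(2)[OF t True] by linarith
        next
          case False
          have "2 * B * 1 \<le> 2 * B * exp (a * (t - T) / 2)"
            using B(2) False apos by (intro mult_left_mono) auto
          then show ?thesis using uB[of t] B(1)[OF z] t e by linarith
        qed
      qed (use apos in simp)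
      also have "\<dots> = k t"
      proof -
        have "exp (- a * t) * exp (a * (t - T) / 2) = exp (- a * T / 2) * exp (- (a / 2) * t)"
          unfolding exp_add[symmetric] by (simp add: field_simps)
        then show ?thesis using t by (simp add: k_def algebra_simps)
      qed
      finally show ?thesis .
    qed (simp add: L_def G_def k_def)
    have "c z - f z = (\<integral>t. L t - G t \<partial>lborel)"
      using cz fz L_int G_int by simp
    also have "\<bar>\<dots>\<bar> \<le> (\<integral>t. k t \<partial>lborel)"
      by (rule integral_abs_bound_integral[OF _ k_int bound]) (use L_int G_int in simp)
    finally
    show "\<bar>c z - f z\<bar> < e" using a0(2)[OF a] k_val by linarith
  qed
qed

end

lemma (in dirichlet_form)
  shows S_neg: "f \<in> L2 m \<Longrightarrow> 0 \<le> t \<Longrightarrow> AE x in m. S t (- f) x = - S t f x"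
    and S_zero: "0 \<le> t \<Longrightarrow> AE x in m. S t 0 x = 0"
    and R_neg: "f \<in> L2 m \<Longrightarrow> 0 < a \<Longrightarrow> AE x in m. R a (- f) x = - R a f x"
proof -
  have S0: "AE x in m. S t 0 x = 0" if "0 \<le> t" for t using S_AE_linear[of 0 0 t 1] that by simp
  then show "0 \<le> t \<Longrightarrow> AE x in m. S t 0 x = 0" .
  show "AE x in m. S t (- f) x = - S t f x" if "f \<in> L2 m" "0 \<le> t"
    using S_AE_diff[OF L2.zero_in that] S0[OF that(2)] by eventually_elim simp
  show "AE x in m. R a (- f) x = - R a f x" if "f \<in> L2 m" "0 < a"
    using R_diff[OF L2.zero_in that] R_linear[OF L2.zero_in L2.zero_in that(2), of 1]
    by eventually_elim simp
qed

section \<open>Construction of barriers\<close>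

context feller_subset
begin

text \<open>A barrier at x0 in the sense of potential theory, phrased without pointwise values. The
  third clause says that under the semigroup \<rho> loses at most a multiple of t; the fourth, that
  its orbit over short times is small on one neighbourhood of x0. Positivity away from x0 is stated
  separately, as it is wanted only on a given compact set.\<close>

definition barrier :: "'a \<Rightarrow> ('a \<Rightarrow> real) \<Rightarrow> bool" where
  "barrier x0 \<rho> \<longleftrightarrow> \<rho> \<in> L2 DU.m \<and> (\<exists>B\<ge>0. AE x in DU.m. 0 \<le> \<rho> x \<and> \<rho> x \<le> B) \<and>
     (\<exists>K\<ge>0. \<forall>t\<ge>0. AE x in DU.m. \<rho> x \<le> DU.S t \<rho> x + K * t) \<and>
     (\<forall>e>0. \<exists>N T. openin X N \<and> x0 \<in> N \<and> N \<subseteq> U \<and> 0 < T \<and>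
        (\<forall>t. 0 < t \<longrightarrow> t \<le> T \<longrightarrow> (AE x in DU.m. x \<in> N \<longrightarrow> DU.S t \<rho> x \<le> e)))"

lemma
  assumes "barrier x0 \<rho>"
  shows barrier_L2: "\<rho> \<in> L2 DU.m"
    and barrier_bound: "\<exists>B\<ge>0. AE x in DU.m. 0 \<le> \<rho> x \<and> \<rho> x \<le> B"
    and barrier_lower: "\<exists>K\<ge>0. \<forall>t\<ge>0. AE x in DU.m. \<rho> x \<le> DU.S t \<rho> x + K * t"
    and barrier_small: "0 < e \<Longrightarrow> \<exists>N T. openin X N \<and> x0 \<in> N \<and> N \<subseteq> U \<and> 0 < T \<and>
        (\<forall>t. 0 < t \<longrightarrow> t \<le> T \<longrightarrow> (AE x in DU.m. x \<in> N \<longrightarrow> DU.S t \<rho> x \<le> e))"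
  using assms unfolding barrier_def by (simp_all only:)

lemma barrier_zero: "x0 \<in> U \<Longrightarrow> barrier x0 0"
  unfolding barrier_def
proof (intro conjI allI impI)
  assume x0: "x0 \<in> U"
  show "\<exists>B\<ge>0. AE x in DU.m. 0 \<le> (0 :: 'a \<Rightarrow> real) x \<and> (0 :: 'a \<Rightarrow> real) x \<le> B" by (intro exI[of _ 0]) (simp add: fun_ops)
  show "\<exists>K\<ge>0. \<forall>t\<ge>0. AE x in DU.m. (0 :: 'a \<Rightarrow> real) x \<le> DU.S t 0 x + K * t"
  proof (intro exI[of _ 0] conjI allI impI)
    show "AE x in DU.m. (0 :: 'a \<Rightarrow> real) x \<le> DU.S t 0 x + 0 * t" if "0 \<le> t" for t
      using DU.S_zero[OF that] by eventually_elim (simp add: fun_ops)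
  qed simp
  fix e :: real assume e: "0 < e"
  have "AE x in DU.m. x \<in> U \<longrightarrow> DU.S t 0 x \<le> e" if "0 < t" for t
    using DU.S_zero[OF less_imp_le[OF that]] by eventually_elim (use e in simp)
  then show "\<exists>N T. openin X N \<and> x0 \<in> N \<and> N \<subseteq> U \<and> 0 < T \<and>
      (\<forall>t. 0 < t \<longrightarrow> t \<le> T \<longrightarrow> (AE x in DU.m. x \<in> N \<longrightarrow> DU.S t 0 x \<le> e))"
    using x0 U by (intro exI[of _ U] exI[of _ 1]) auto
qed simp

lemma barrier_add:
  assumes "barrier x0 \<rho>" "barrier x0 \<sigma>"
  shows "barrier x0 (\<rho> + \<sigma>)"
proof -
  have L2: "\<rho> \<in> L2 DU.m" "\<sigma> \<in> L2 DU.m" using assms by (auto simp: barrier_def)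
  have S: "AE x in DU.m. DU.S t (\<rho> + \<sigma>) x = DU.S t \<rho> x + DU.S t \<sigma> x" if "0 \<le> t" for t
    using DU.S_AE_linear[OF L2 that, of 1] by simp
  obtain B B' where B: "0 \<le> B" "AE x in DU.m. 0 \<le> \<rho> x \<and> \<rho> x \<le> B" "0 \<le> B'" "AE x in DU.m. 0 \<le> \<sigma> x \<and> \<sigma> x \<le> B'"
    using barrier_bound[OF assms(1)] barrier_bound[OF assms(2)] by (elim exE conjE) simp
  obtain K K' where K: "0 \<le> K" "\<And>t. 0 \<le> t \<Longrightarrow> AE x in DU.m. \<rho> x \<le> DU.S t \<rho> x + K * t"
    "0 \<le> K'" "\<And>t. 0 \<le> t \<Longrightarrow> AE x in DU.m. \<sigma> x \<le> DU.S t \<sigma> x + K' * t"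
    using barrier_lower[OF assms(1)] barrier_lower[OF assms(2)] by (elim exE conjE) simp
  show ?thesis
    unfolding barrier_def
  proof (intro conjI allI impI)
    show "\<rho> + \<sigma> \<in> L2 DU.m" using L2 by simp
    show "\<exists>B\<ge>0. AE x in DU.m. 0 \<le> (\<rho> + \<sigma>) x \<and> (\<rho> + \<sigma>) x \<le> B"
      using B by (intro exI[of _ "B + B'"]) (auto simp: fun_ops elim: eventually_elim2)
    have "AE x in DU.m. (\<rho> + \<sigma>) x \<le> DU.S t (\<rho> + \<sigma>) x + (K + K') * t" if t: "0 \<le> t" for t
      using S[OF t] K(2,4)[OF t] by eventually_elim (simp add: fun_ops algebra_simps)
    then show "\<exists>K\<ge>0. \<forall>t\<ge>0. AE x in DU.m. (\<rho> + \<sigma>) x \<le> DU.S t (\<rho> + \<sigma>) x + K * t"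
      using K by (intro exI[of _ "K + K'"]) auto
    fix e :: real assume "0 < e"
    then have e: "0 < e / 2" by simp
    obtain N T where N: "openin X N" "x0 \<in> N" "N \<subseteq> U" "0 < T"
      "\<And>t. 0 < t \<Longrightarrow> t \<le> T \<Longrightarrow> AE x in DU.m. x \<in> N \<longrightarrow> DU.S t \<rho> x \<le> e / 2"
      using barrier_small[OF assms(1) e] by (elim exE conjE) simp
    obtain N' T' where N': "openin X N'" "x0 \<in> N'" "N' \<subseteq> U" "0 < T'"
      "\<And>t. 0 < t \<Longrightarrow> t \<le> T' \<Longrightarrow> AE x in DU.m. x \<in> N' \<longrightarrow> DU.S t \<sigma> x \<le> e / 2"
      using barrier_small[OF assms(2) e] by (elim exE conjE) simp
    have "AE x in DU.m. x \<in> N \<inter> N' \<longrightarrow> DU.S t (\<rho> + \<sigma>) x \<le> e" if t: "0 < t" "t \<le> min T T'" for t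
    proof -
      have t0: "0 \<le> t" "t \<le> T" "t \<le> T'" using t by auto
      show ?thesis using S[OF t0(1)] N(5)[OF t(1) t0(2)] N'(5)[OF t(1) t0(3)] by eventually_elim auto
    qed
    then show "\<exists>N T. openin X N \<and> x0 \<in> N \<and> N \<subseteq> U \<and> 0 < T \<and>
        (\<forall>t. 0 < t \<longrightarrow> t \<le> T \<longrightarrow> (AE x in DU.m. x \<in> N \<longrightarrow> DU.S t (\<rho> + \<sigma>) x \<le> e))"
      using N N' by (intro exI[of _ "N \<inter> N'"] exI[of _ "min T T'"]) auto
  qed
qed

lemma cutoff_C0:
  assumes "cutoff f K U"
  shows "f \<in> C0 (top_of DU)" "f \<in> L2 DU.m" "continuous_map TU euclideanreal f"
proof -
  show c: "continuous_map TU euclideanreal f"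
    using cutoffD(2)[OF assms] by (intro continuous_map_from_subtopology) (simp add: Cc_def Cont_def)
  show "f \<in> L2 DU.m" using cutoffD(1)[OF assms] by (simp add: DU_simps L2_U)
  show "f \<in> C0 (top_of DU)"
  proof (rule C0_I[OF c])
    show "compactin X (csupport X f)" using cutoffD(2)[OF assms] by (simp add: Cc_def)
    show "csupport X f \<subseteq> U" by (rule cutoffD(5)[OF assms])
    show "f x = 0" if "x \<in> U - csupport X f" for x using that U_top by (intro csupport_zero) auto
  qed
qed

text \<open>For large a the value of R a f at a point is close to that of f. Here f1 is 1 at y and 0
  at x0, and f2 is 1 at both. Errors of 1/16 in the four values leave c1 - c2 / 2 negative at x0 and
  above 1/4 at y. Subtracting half of f2 is what makes the positive part of the difference vanish
  near x0.\<close>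

lemma separating_potentials:
  assumes x0: "x0 \<in> U" and y: "y \<in> U" and ne: "y \<noteq> x0"
  obtains a f1 f2 c1 c2 where "0 < a" "f1 \<in> L2 DU.m" "f2 \<in> L2 DU.m"
    "\<And>x. 0 \<le> f1 x \<and> f1 x \<le> 1" "\<And>x. 0 \<le> f2 x \<and> f2 x \<le> 1"
    "continuous_map TU euclideanreal c1" "AE x in DU.m. DU.R a f1 x = c1 x"
    "continuous_map TU euclideanreal c2" "AE x in DU.m. DU.R a f2 x = c2 x"
    "c1 x0 < 1 / 2 * c2 x0" "1 / 2 * c2 y + 1 / 4 < c1 y"
proof -
  have top: "x0 \<in> topspace X" "y \<in> topspace X" using x0 y U_top by auto
  have "closedin X {x0}" using Hausdorff_X top by (intro closedin_Hausdorff_singleton)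
  then have "openin X (U - {x0})" using U by (rule openin_diff[rotated])
  moreover have "compactin X {y}" using top by simp
  ultimately obtain f1 where f1': "cutoff f1 {y} (U - {x0})" using cutoff_exists y ne by blast
  then have f1: "cutoff f1 {y} U" by (auto simp: cutoff_def)
  have "compactin X {x0, y}" by (rule finite_imp_compactin) (use top in auto)
  then obtain f2 where f2: "cutoff f2 {x0, y} U" using cutoff_exists[OF _ U] x0 y by blast
  have b: "\<bar>f1 x\<bar> \<le> 1" "\<bar>f2 x\<bar> \<le> 1" for x
    using cutoffD(3,4)[OF f1, of x] cutoffD(3,4)[OF f2, of x] by auto
  have vals: "f1 y = 1" "f1 x0 = 0" "f2 y = 1" "f2 x0 = 1"
    using cutoffD(6)[OF f1] cutoffD(6)[OF f2] csupport_zero[OF top(1), of f1] cutoffD(5)[OF f1'] by auto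
  have R: "\<exists>a0>0. \<forall>a c. a0 \<le> a \<longrightarrow> continuous_map TU euclideanreal c \<longrightarrow>
      (AE x in DU.m. DU.R a f x = c x) \<longrightarrow> \<bar>c z - f z\<bar> < 1 / 16"
    if "cutoff f K U" "\<And>x. \<bar>f x\<bar> \<le> 1" "z \<in> U" for f K z
  proof (rule R_at_point[OF cutoff_C0(1,2)[OF that(1)] that(2) zero_le_one that(3)])
    show "(0 :: real) < 1 / 16" by simp
  qed (use that in blast)
  obtain a1 where a1: "a1 > 0" "\<And>a c. a1 \<le> a \<Longrightarrow> continuous_map TU euclideanreal c \<Longrightarrow>
      AE x in DU.m. DU.R a f1 x = c x \<Longrightarrow> \<bar>c y - f1 y\<bar> < 1 / 16" using R[OF f1 b(1) y] by blast
  obtain a2 where a2: "\<And>a c. a2 \<le> a \<Longrightarrow> continuous_map TU euclideanreal c \<Longrightarrow>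
      AE x in DU.m. DU.R a f1 x = c x \<Longrightarrow> \<bar>c x0 - f1 x0\<bar> < 1 / 16" using R[OF f1 b(1) x0] by blast
  obtain a3 where a3: "\<And>a c. a3 \<le> a \<Longrightarrow> continuous_map TU euclideanreal c \<Longrightarrow>
      AE x in DU.m. DU.R a f2 x = c x \<Longrightarrow> \<bar>c y - f2 y\<bar> < 1 / 16" using R[OF f2 b(2) y] by blast
  obtain a4 where a4: "\<And>a c. a4 \<le> a \<Longrightarrow> continuous_map TU euclideanreal c \<Longrightarrow>
      AE x in DU.m. DU.R a f2 x = c x \<Longrightarrow> \<bar>c x0 - f2 x0\<bar> < 1 / 16" using R[OF f2 b(2) x0] by blast
  define a where "a = max (max a1 a2) (max a3 a4)"
  have a: "0 < a" "a1 \<le> a" "a2 \<le> a" "a3 \<le> a" "a4 \<le> a" using a1(1) by (auto simp: a_def)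
  have bA: "AE x in DU.m. \<bar>f1 x\<bar> \<le> 1" "AE x in DU.m. \<bar>f2 x\<bar> \<le> 1" using b by auto
  obtain c1 where c1: "continuous_map TU euclideanreal c1" "AE x in DU.m. DU.R a f1 x = c1 x"
    using R_continuous[OF cutoff_C0(2)[OF f1] bA(1) zero_le_one a(1)] by blast
  obtain c2 where c2: "continuous_map TU euclideanreal c2" "AE x in DU.m. DU.R a f2 x = c2 x"
    using R_continuous[OF cutoff_C0(2)[OF f2] bA(2) zero_le_one a(1)] by blast
  show ?thesis
  proof (rule that[OF a(1) cutoff_C0(2)[OF f1] cutoff_C0(2)[OF f2] _ _ c1 c2])
    show "c1 x0 < 1 / 2 * c2 x0" using a2[OF a(3) c1] a4[OF a(5) c2] vals by linarith
    show "1 / 2 * c2 y + 1 / 4 < c1 y" using a1(2)[OF a(2) c1] a3[OF a(4) c2] vals by linarith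
  qed (use cutoffD(3,4) f1 f2 in blast)+
qed

text \<open>\<rho> is the positive part of d = R a (f1 - f2 / 2). The semigroup moves d by at most 2
  a t, and positivity carries this over as a lower bound for S t \<rho>. For the smallness, \<rho>
  is c1 - min c1 (c2 / 2) almost everywhere: S t hardly changes c1, and the subtrahend, after a
  cutoff, is in \<open>C0\<close> and equals c1 at x0, so the Feller limit applies.\<close>

lemma barrier_at_point:
  assumes x0: "x0 \<in> U" and y: "y \<in> U" and ne: "y \<noteq> x0"
  obtains \<rho> V where "barrier x0 \<rho>" "openin X V" "y \<in> V" "AE x in DU.m. x \<in> V \<longrightarrow> 1 / 4 \<le> \<rho> x"
proof -
  obtain a f1 f2 c1 c2 where a: "0 < a" and f: "f1 \<in> L2 DU.m" "f2 \<in> L2 DU.m"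
    and f1b: "\<And>x. 0 \<le> f1 x \<and> f1 x \<le> 1" and f2b: "\<And>x. 0 \<le> f2 x \<and> f2 x \<le> 1"
    and c1: "continuous_map TU euclideanreal c1" "AE x in DU.m. DU.R a f1 x = c1 x"
    and c2: "continuous_map TU euclideanreal c2" "AE x in DU.m. DU.R a f2 x = c2 x"
    and sep: "c1 x0 < 1 / 2 * c2 x0" "1 / 2 * c2 y + 1 / 4 < c1 y"
    by (rule separating_potentials[OF assms]) blast
  have c0: "0 \<le> c1 x \<and> 0 \<le> c2 x" if x: "x \<in> U" for x
  proof -
    have "AE x in DU.m. 0 \<le> DU.R a f1 x" "AE x in DU.m. 0 \<le> DU.R a f2 x"
      using f a f1b f2b by (intro DU.R_nonneg; simp)+
    then have "AE x in DU.m. - c1 x \<le> 0" "AE x in DU.m. - c2 x \<le> 0"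
      using c1(2) c2(2) by (auto elim: eventually_elim2)
    moreover have "continuous_map TU euclideanreal (\<lambda>x. - c1 x)" "continuous_map TU euclideanreal (\<lambda>x. - c2 x)"
      using c1(1) c2(1) by (intro continuous_map_minus; simp)+
    ultimately show ?thesis using continuous_le_of_AE[OF _ _ x, of "\<lambda>x. - c1 x" 0] continuous_le_of_AE[OF _ _ x, of "\<lambda>x. - c2 x" 0]
      unfolding AE_DU by simp
  qed
  have c1_le: "c1 x \<le> 1" if x: "x \<in> U" for x
  proof (rule continuous_le_of_AE[OF c1(1) _ x])
    have "AE x in DU.m. DU.R a f1 x \<le> 1" using f a f1b by (intro DU.R_le_const) auto
    then show "AE x in m. x \<in> U \<longrightarrow> c1 x \<le> 1" using c1(2) unfolding AE_DU by eventually_elim auto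
  qed
  define d where "d = DU.R a (f1 + (- 1 / 2) *\<^sub>R f2)"
  define \<rho> where "\<rho> = (\<lambda>x. max (d x) 0)"
  have fL2: "f1 + (- 1 / 2) *\<^sub>R f2 \<in> L2 DU.m" using f by simp
  have dL2: "d \<in> L2 DU.m" unfolding d_def using DU.R_F[OF fL2 a] by simp
  then have \<rho>L2: "\<rho> \<in> L2 DU.m" unfolding \<rho>_def by (rule L2_max0)
  have d_eq: "AE x in DU.m. d x = c1 x - 1 / 2 * c2 x"
    using DU.R_linear[OF f a, of "- 1 / 2"] c1(2) c2(2) unfolding d_def by eventually_elim simp
  have fb: "AE x in DU.m. \<bar>(f1 + (- 1 / 2) *\<^sub>R f2) x\<bar> \<le> 1"
  proof (rule AE_I2)
    fix x show "\<bar>(f1 + (- 1 / 2) *\<^sub>R f2) x\<bar> \<le> 1" using f1b[of x] f2b[of x] by (simp add: fun_ops abs_le_iff)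
  qed
  have \<rho>B: "AE x in DU.m. 0 \<le> \<rho> x \<and> \<rho> x \<le> 1"
  proof -
    have "AE x in DU.m. \<bar>d x\<bar> \<le> 1" unfolding d_def by (rule DU.R_abs_le[OF fL2 a fb])
    then show ?thesis by eventually_elim (auto simp: \<rho>_def)
  qed
  have \<rho>S: "AE x in DU.m. \<rho> x \<le> DU.S t \<rho> x + 2 * a * t" if t: "0 \<le> t" for t
  proof -
    have 1: "AE x in DU.m. \<bar>DU.S t d x - d x\<bar> \<le> 2 * a * 1 * t"
      unfolding d_def by (rule DU.S_sub_R[OF fL2 fb zero_le_one a t])
    have 2: "AE x in DU.m. DU.S t d x \<le> DU.S t \<rho> x"
      by (rule DU.S_mono[OF dL2 \<rho>L2 t]) (simp add: \<rho>_def)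
    have 3: "AE x in DU.m. 0 \<le> DU.S t \<rho> x"
      by (rule DU.S_nonneg[OF \<rho>L2 t]) (simp add: \<rho>_def)
    have "0 \<le> a * t" using a t by simp
    with t a show ?thesis using 1 2 3 by - (elim eventually_rev_mp, intro always_eventually, auto simp: \<rho>_def max_def)
  qed
  have small: "\<exists>N T. openin X N \<and> x0 \<in> N \<and> N \<subseteq> U \<and> 0 < T \<and>
      (\<forall>t. 0 < t \<longrightarrow> t \<le> T \<longrightarrow> (AE x in DU.m. x \<in> N \<longrightarrow> DU.S t \<rho> x \<le> e))" if e: "e > 0" for e
  proof -
    have "compactin X {x0}" using x0 U_top by auto
    then obtain \<theta> where \<theta>: "cutoff \<theta> {x0} U" using cutoff_exists[OF _ U] x0 by blast
    \<comment> \<open>\<open>C0\<close> requires vanishing at infinity, which is not known of the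
      minimum. Multiplying by \<theta> only decreases it, so \<rho> \<le> c1 - \<xi> persists, and
      the value at x0 is unchanged.\<close>
    define \<xi> where "\<xi> = (\<lambda>x. \<theta> x * min (c1 x) (1 / 2 * c2 x))"
    have \<xi>c: "continuous_map TU euclideanreal \<xi>"
      unfolding \<xi>_def using cutoff_C0(3)[OF \<theta>] c1(1) c2(1)
      by (intro continuous_map_real_mult continuous_map_real_min) auto
    have \<xi>C0: "\<xi> \<in> C0 (top_of DU)"
    proof (rule C0_I[OF \<xi>c])
      show "compactin X (csupport X \<theta>)" using cutoffD(2)[OF \<theta>] by (simp add: Cc_def)
      show "csupport X \<theta> \<subseteq> U" by (rule cutoffD(5)[OF \<theta>])
      show "\<xi> x = 0" if "x \<in> U - csupport X \<theta>" for x
        using that U_top csupport_zero[of x \<theta>] by (auto simp: \<xi>_def)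
    qed
    have \<theta>F: "\<theta> \<in> F" by (rule cutoffD(1)[OF \<theta>])
    have \<xi>L2: "\<xi> \<in> L2 DU.m"
      unfolding DU_simps L2_U
    proof (rule L2_bound)
      show "zext \<xi> \<in> borel_measurable m" using continuous_measurable_U[OF \<xi>c] by (simp add: measurable_U)
      show "\<theta> \<in> L2 m" using \<theta>F by simp
      have "\<bar>zext \<xi> x\<bar> \<le> \<bar>\<theta> x\<bar>" for x
      proof (cases "x \<in> U")
        case True
        have "\<bar>\<theta> x\<bar> * \<bar>min (c1 x) (1 / 2 * c2 x)\<bar> \<le> \<bar>\<theta> x\<bar> * 1"
          using c0[OF True] c1_le[OF True] by (intro mult_left_mono) (auto simp: min_def)
        then show ?thesis using True by (simp add: \<xi>_def abs_mult)
      qed (simp add: zext_out)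
      then show "AE x in m. \<bar>zext \<xi> x\<bar> \<le> \<bar>\<theta> x\<bar>" by simp
    qed
    have \<xi>x0: "\<xi> x0 = c1 x0" using cutoffD(6)[OF \<theta>] sep by (simp add: \<xi>_def)
    obtain u where u: "\<And>t. 0 \<le> t \<Longrightarrow> continuous_map TU euclideanreal (u t)"
      "\<And>t. 0 \<le> t \<Longrightarrow> AE x in DU.m. DU.S t \<xi> x = u t x" "((\<lambda>t. u t x0) \<longlongrightarrow> \<xi> x0) (at_right 0)"
      by (rule S_feller[OF \<xi>C0 \<xi>L2]) (use x0 in blast)
    let ?g = "DU.R a f1"
    have gL2: "?g \<in> L2 DU.m" using f a by simp
    have \<rho>_le: "AE x in DU.m. \<rho> x \<le> (?g - \<xi>) x"
      using d_eq c1(2) unfolding AE_DU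
    proof eventually_elim
      case (elim x)
      show ?case
      proof
        assume x: "x \<in> U"
        have "\<theta> x * min (c1 x) (1 / 2 * c2 x) \<le> 1 * min (c1 x) (1 / 2 * c2 x)"
          using c0[OF x] cutoffD(4)[OF \<theta>, of x] by (intro mult_right_mono) auto
        then show "\<rho> x \<le> (?g - \<xi>) x" using elim x by (auto simp: \<rho>_def \<xi>_def fun_ops)
      qed
    qed
    have f1A: "AE x in DU.m. \<bar>f1 x\<bar> \<le> 1" by (rule AE_I2) (use f1b in simp)
    have S_le: "AE x in DU.m. DU.S t \<rho> x \<le> c1 x - u t x + 2 * a * t" if t: "0 \<le> t" for t
    proof -
      have 1: "AE x in DU.m. DU.S t \<rho> x \<le> DU.S t (?g - \<xi>) x"
        by (rule DU.S_mono[OF \<rho>L2 L2.diff_in[OF gL2 \<xi>L2] t \<rho>_le])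
      have 2: "AE x in DU.m. \<bar>DU.S t ?g x - ?g x\<bar> \<le> 2 * a * 1 * t"
        by (rule DU.S_sub_R[OF f(1) f1A zero_le_one a t])
      show ?thesis using 1 2 DU.S_AE_diff[OF gL2 \<xi>L2 t] u(2)[OF t] c1(2) by eventually_elim auto
    qed
    have "\<forall>\<^sub>F t in at_right 0. dist (u t x0) (\<xi> x0) < e / 8" using u(3) e by (intro tendstoD) auto
    then obtain T' where T': "0 < T'" "\<And>t. 0 < t \<Longrightarrow> t < T' \<Longrightarrow> \<bar>u t x0 - c1 x0\<bar> < e / 8"
      unfolding eventually_at_right_field dist_real_def \<xi>x0 by auto
    define T where "T = min (T' / 2) (e / (8 * a))"
    have T: "0 < T" "T < T'" "2 * a * T \<le> e / 4"
    proof -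
      show "0 < T" "T < T'" using T'(1) e a by (auto simp: T_def)
      have "2 * a * T \<le> 2 * a * (e / (8 * a))" using a by (intro mult_left_mono) (auto simp: T_def)
      then show "2 * a * T \<le> e / 4" using a by simp
    qed
    have T0: "0 \<le> T" using T by simp
    have "continuous_map TU euclideanreal (\<lambda>x. c1 x - u T x)"
      using c1(1) u(1)[OF T0] by (intro continuous_map_diff) auto
    from continuous_nbhd[OF this x0, of "e / 8"] e
    obtain N where N: "openin X N" "x0 \<in> N" "N \<subseteq> U" "\<And>y. y \<in> N \<Longrightarrow> \<bar>(c1 y - u T y) - (c1 x0 - u T x0)\<bar> < e / 8" by auto
    have "AE x in DU.m. x \<in> N \<longrightarrow> DU.S t \<rho> x \<le> e" if t: "0 < t" "t \<le> T" for t
    proof -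
      \<comment> \<open>Continuity in x is used at the single time T. Earlier times follow by
        applying S t to \<rho> \<le> S (T - t) \<rho> + 2 a (T - t), which is why one neighbourhood
        serves all t \<le> T.\<close>
      let ?s = "T - t"
      have ts: "0 \<le> t" "0 \<le> ?s" "t + ?s = T" using t by auto
      have SL2: "DU.S ?s \<rho> \<in> L2 DU.m" using \<rho>L2 ts by simp
      have diff: "AE x in DU.m. (\<rho> - DU.S ?s \<rho>) x \<le> 2 * a * ?s"
        using \<rho>S[OF ts(2)] by eventually_elim (simp add: fun_ops)
      have 1: "AE x in DU.m. DU.S t (\<rho> - DU.S ?s \<rho>) x \<le> 2 * a * ?s"
        by (rule DU.S_le_const[OF L2.diff_in[OF \<rho>L2 SL2] ts(1) _ diff]) (use a ts in simp)
      have "2 * a * ?s \<le> 2 * a * T" using a t by (intro mult_left_mono) auto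
      then have sT: "2 * a * ?s \<le> e / 4" using T by simp
      have "\<bar>u T x0 - c1 x0\<bar> < e / 8" using T'(2) T by blast
      then have near: "c1 x - u T x \<le> e / 4" if "x \<in> N" for x using N(4)[OF that] by linarith
      show ?thesis
        using 1 DU.S_AE_diff[OF \<rho>L2 SL2 ts(1)] DU.S_AE_add[OF \<rho>L2 ts(1,2)] S_le[OF T0]
      proof eventually_elim
        case (elim x)
        show ?case
        proof
          assume x: "x \<in> N"
          have "DU.S T \<rho> x = DU.S t (DU.S ?s \<rho>) x" using elim(3) ts(3) by simp
          then show "DU.S t \<rho> x \<le> e" using elim near[OF x] sT T(3) e by linarith
        qed
      qed
    qed
    then show ?thesis using N T by blast
  qed
  have b: "barrier x0 \<rho>"
    unfolding barrier_def
  proof (intro conjI allI impI \<rho>L2)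
    show "\<exists>B\<ge>0. AE x in DU.m. 0 \<le> \<rho> x \<and> \<rho> x \<le> B" using \<rho>B by (intro exI[of _ 1]) auto
    show "\<exists>K\<ge>0. \<forall>t\<ge>0. AE x in DU.m. \<rho> x \<le> DU.S t \<rho> x + K * t"
      using \<rho>S a by (intro exI[of _ "2 * a"]) auto
  qed (rule small)
  have "continuous_map TU euclideanreal (\<lambda>x. c1 x - 1 / 2 * c2 x)"
    using c1(1) c2(1) by (intro continuous_map_diff continuous_map_real_mult) auto
  from continuous_nbhd[OF this y, of "c1 y - 1 / 2 * c2 y - 1 / 4"] sep(2)
  obtain V where V: "openin X V" "y \<in> V"
    "\<And>z. z \<in> V \<Longrightarrow> \<bar>(c1 z - 1 / 2 * c2 z) - (c1 y - 1 / 2 * c2 y)\<bar> < c1 y - 1 / 2 * c2 y - 1 / 4"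
    by auto
  have "AE x in DU.m. x \<in> V \<longrightarrow> 1 / 4 \<le> \<rho> x"
    using d_eq
  proof eventually_elim
    case (elim x)
    show ?case
    proof
      assume "x \<in> V"
      from V(3)[OF this] have "1 / 4 < d x" unfolding elim by linarith
      then show "1 / 4 \<le> \<rho> x" by (simp add: \<rho>_def)
    qed
  qed
  then show ?thesis using that[OF b V(1,2)] by blast
qed

text \<open>Finitely many barriers, each at least 1/4 near one point of K, are added; as all are
  nonnegative, the lower bounds survive.\<close>

lemma barrier_exists:
  assumes x0: "x0 \<in> U" and K: "compactin X K" "K \<subseteq> U" "x0 \<notin> K"
  obtains \<rho> where "barrier x0 \<rho>" "AE x in DU.m. x \<in> K \<longrightarrow> 1 / 4 \<le> \<rho> x"
proof -
  define Q where "Q = (\<lambda>y \<rho> V. barrier x0 \<rho> \<and> openin X V \<and> y \<in> V \<and> (AE x in DU.m. x \<in> V \<longrightarrow> 1 / 4 \<le> \<rho> x))"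
  have "\<forall>y\<in>K. \<exists>\<rho> V. Q y \<rho> V"
  proof
    fix y assume "y \<in> K"
    then have "y \<in> U" "y \<noteq> x0" using K by auto
    from barrier_at_point[OF x0 this] show "\<exists>\<rho> V. Q y \<rho> V" unfolding Q_def by blast
  qed
  then obtain \<rho> V where "\<And>y. y \<in> K \<Longrightarrow> Q y (\<rho> y) (V y)" by metis
  then have V: "\<And>y. y \<in> K \<Longrightarrow> barrier x0 (\<rho> y)" "\<And>y. y \<in> K \<Longrightarrow> openin X (V y)"
    "\<And>y. y \<in> K \<Longrightarrow> y \<in> V y" "\<And>y. y \<in> K \<Longrightarrow> AE x in DU.m. x \<in> V y \<longrightarrow> 1 / 4 \<le> \<rho> y x"
    unfolding Q_def by simp_all
  obtain A where A: "finite A" "A \<subseteq> K" "K \<subseteq> \<Union>(V ` A)"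
    using compact_finite_cover[OF K(1) V(2,3)] by blast
  have "finite A \<Longrightarrow> A \<subseteq> K \<Longrightarrow> \<exists>\<sigma>. barrier x0 \<sigma> \<and> (AE x in DU.m. \<forall>y\<in>A. x \<in> V y \<longrightarrow> 1 / 4 \<le> \<sigma> x)" for A
  proof (induction rule: finite_induct)
    case empty
    then show ?case using barrier_zero[OF x0] by auto
  next
    case (insert y A)
    then obtain \<sigma> where \<sigma>: "barrier x0 \<sigma>" "AE x in DU.m. \<forall>y\<in>A. x \<in> V y \<longrightarrow> 1 / 4 \<le> \<sigma> x" by auto
    have y: "y \<in> K" using insert by simp
    have "AE x in DU.m. 0 \<le> \<sigma> x" "AE x in DU.m. 0 \<le> \<rho> y x"
      using \<sigma>(1) V(1)[OF y] unfolding barrier_def by (auto elim: eventually_mono)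
    then have "AE x in DU.m. \<forall>z\<in>insert y A. x \<in> V z \<longrightarrow> 1 / 4 \<le> (\<sigma> + \<rho> y) x"
      using \<sigma>(2) V(4)[OF y] by eventually_elim (auto simp: fun_ops)
    then show ?case using barrier_add[OF \<sigma>(1) V(1)[OF y]] by blast
  qed
  from this[OF A(1,2)] obtain \<sigma> where \<sigma>: "barrier x0 \<sigma>" "AE x in DU.m. \<forall>y\<in>A. x \<in> V y \<longrightarrow> 1 / 4 \<le> \<sigma> x" by blast
  have "AE x in DU.m. x \<in> K \<longrightarrow> 1 / 4 \<le> \<sigma> x" using \<sigma>(2) by eventually_elim (use A(3) in blast)
  then show ?thesis using that \<sigma>(1) by blast
qed

text \<open>Both bounds are instances of \<open>R_le_of_S_le\<close>: for -\<rho> on the whole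
  space, using the linear loss, and for \<rho> near x0 with comparison function 0. In the former, K
  T \<le> 1/16 and a late-time term below 1/16 make up the 1/8.\<close>

lemma barrier_resolvent:
  assumes b: "barrier x0 \<rho>"
  obtains a0 where "0 < a0" "\<And>a. a0 \<le> a \<Longrightarrow> AE x in DU.m. \<rho> x - 1 / 8 \<le> DU.R a \<rho> x"
    and "\<And>e. 0 < e \<Longrightarrow> \<exists>N a1. openin X N \<and> x0 \<in> N \<and> N \<subseteq> U \<and>
      (\<forall>a\<ge>a1. 0 < a \<longrightarrow> (AE x in DU.m. x \<in> N \<longrightarrow> DU.R a \<rho> x \<le> e))"
proof -
  have L2: "\<rho> \<in> L2 DU.m" using b by (simp add: barrier_def)
  obtain B where B: "0 \<le> B" "AE x in DU.m. 0 \<le> \<rho> x \<and> \<rho> x \<le> B" using b by (auto simp: barrier_def)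
  obtain K where K: "0 \<le> K" "\<And>t. 0 \<le> t \<Longrightarrow> AE x in DU.m. \<rho> x \<le> DU.S t \<rho> x + K * t"
    using b by (auto simp: barrier_def)
  have B1: "AE x in DU.m. 0 \<le> \<rho> x" "AE x in DU.m. \<rho> x \<le> B" using B(2) by (auto elim: eventually_mono)
  define T where "T = 1 / (16 * (K + 1))"
  have T: "0 < T" "K * T \<le> 1 / 16" using K(1) by (auto simp: T_def field_simps)
  obtain a0 where a0: "a0 > 0" "\<And>a. a0 \<le> a \<Longrightarrow> 2 * B * exp (- a * T / 2) < 1 / 16"
    using exp_decay_small[OF T(1), of "2 * B" "1 / 16"] B(1) by auto
  have lower: "AE x in DU.m. \<rho> x - 1 / 8 \<le> DU.R a \<rho> x" if a: "a0 \<le> a" for a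
  proof -
    have apos: "0 < a" using a a0 by simp
    have "AE x in DU.m. x \<in> space DU.m \<longrightarrow> DU.R a (- \<rho>) x \<le> (- \<rho>) x + (K * T + 2 * B * exp (- a * T / 2))"
    proof (rule DU.R_le_of_S_le[OF L2.minus_in[OF L2] L2.minus_in[OF L2] sets.top apos _ B(1)])
      fix t :: real assume t: "0 < t"
      show "AE x in DU.m. x \<in> space DU.m \<longrightarrow> DU.S t (- \<rho>) x \<le> (- \<rho>) x + K * T" if "t \<le> T"
      proof -
        have "K * t \<le> K * T" using that K(1) by (rule mult_left_mono)
        then show ?thesis using DU.S_neg[OF L2, of t] K(2)[of t] t
          by (simp add: fun_ops) (elim eventually_rev_mp, auto)
      qed
      have "AE x in DU.m. 0 \<le> DU.S t \<rho> x" by (rule DU.S_nonneg[OF L2 _ B1(1)]) (use t in simp)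
      then show "AE x in DU.m. x \<in> space DU.m \<longrightarrow> DU.S t (- \<rho>) x \<le> (- \<rho>) x + B"
        using DU.S_neg[OF L2 less_imp_le[OF t]] B1(2) by eventually_elim (simp add: fun_ops)
    qed (use K T in simp_all)
    then show ?thesis
      using DU.R_neg[OF L2 apos] AE_space
      by eventually_elim (use a0(2)[OF a] T in \<open>auto simp: fun_ops\<close>)
  qed
  have upper: "\<exists>N a1. openin X N \<and> x0 \<in> N \<and> N \<subseteq> U \<and>
      (\<forall>a\<ge>a1. 0 < a \<longrightarrow> (AE x in DU.m. x \<in> N \<longrightarrow> DU.R a \<rho> x \<le> e))" if e: "0 < e" for e
  proof -
    have e2: "0 < e / 2" using e by simp
    obtain N T where N: "openin X N" "x0 \<in> N" "N \<subseteq> U" "0 < T"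
      "\<And>t. 0 < t \<Longrightarrow> t \<le> T \<Longrightarrow> AE x in DU.m. x \<in> N \<longrightarrow> DU.S t \<rho> x \<le> e / 2"
      using barrier_small[OF b e2] by (elim exE conjE) simp
    obtain a1 where a1: "\<And>a. a1 \<le> a \<Longrightarrow> 2 * B * exp (- a * T / 2) < e / 2"
      using exp_decay_small[OF N(4), of "2 * B" "e / 2"] B(1) e by auto
    have Ns: "N \<in> sets DU.m"
      using open_sets[OF N(1)] N(3) unfolding DU_simps by (subst sets_restrict_space_iff[OF U_sets(2)]) blast
    have "AE x in DU.m. x \<in> N \<longrightarrow> DU.R a \<rho> x \<le> e" if a: "a1 \<le> a" "0 < a" for a
    proof -
      have "AE x in DU.m. x \<in> N \<longrightarrow> DU.R a \<rho> x \<le> 0 x + (e / 2 + 2 * B * exp (- a * T / 2))"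
      proof (rule DU.R_le_of_S_le[OF L2 L2.zero_in Ns a(2) _ B(1)])
        show "AE x in DU.m. x \<in> N \<longrightarrow> DU.S t \<rho> x \<le> 0 x + e / 2" if "0 < t" "t \<le> T" for t
          using N(5)[OF that] by (simp add: fun_ops)
        show "AE x in DU.m. x \<in> N \<longrightarrow> DU.S t \<rho> x \<le> 0 x + B" if "0 < t" for t
          using DU.S_le_const[OF L2 _ B(1) B1(2), of t] that by (auto simp: fun_ops elim: eventually_mono)
      qed (use N e in simp_all)
      then show ?thesis by eventually_elim (use a1[OF a(1)] in \<open>auto simp: fun_ops\<close>)
    qed
    then show ?thesis using N by blast
  qed
  show ?thesis by (rule that[OF a0(1) lower upper])
qed

end

section \<open>Continuity of the potential\<close>

context dirichlet_space
begin

lemma FU_mono: "U \<subseteq> U' \<Longrightarrow> FU U \<subseteq> FU U'"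
  unfolding fdom_open_def by blast

end

context open_subset
begin

lemma ip2_zext:
  assumes f: "f \<in> L2 m" and v: "v \<in> FU U"
  shows "ip2 m (zext f) v = ip2 m f v"
proof (rule ip2_cong_AE)
  show "AE x in m. zext f x * v x = f x * v x"
    using FU_zero_outside[OF v U] by eventually_elim (auto simp: zext_apply indicator_def)
qed (use L2_measurable[OF f] F_measurable[OF FU_F[OF v]] zext_measurable in auto)

end

context feller_subset
begin

text \<open>
  On a small neighbourhood of \<open>z\<close> the difference of \<open>w\<close> and a resolvent of a bounded function
  solves \<open>(H + a) d = 0\<close>, and is therefore dominated there by a multiple of the resolvent of a
  barrier, which is small near \<open>z\<close> for large \<open>a\<close>.
\<close>

lemma barrier_comparison:
  assumes W: "openin X W" "W \<subseteq> U" "openin X N" "compactin X (X closure_of N)" "X closure_of N \<subseteq> W"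
    and \<rho>: "\<rho> \<in> L2 DU.m" "AE x in DU.m. 0 \<le> \<rho> x" "AE x in DU.m. x \<in> W - N \<longrightarrow> 1 / 8 \<le> DU.R a \<rho> x"
    and a: "0 < a" and B: "0 \<le> B" and d: "d \<in> F" "AE x in m. d x \<le> B"
    and eq: "\<And>v. v \<in> FU W \<Longrightarrow> E d v + a * ip2 m d v = 0"
  shows "AE x in m. x \<in> W \<longrightarrow> d x \<le> 8 * B * DU.R a \<rho> x"
proof -
  have z\<rho>: "zext \<rho> \<in> L2 m" using \<rho>(1) by (simp add: DU_simps L2_U)
  let ?r = "RU a \<rho>"
  have r: "?r \<in> FU U" by (rule RU_FU[OF z\<rho> a])
  have rF: "?r \<in> F" by (rule FU_F[OF r])
  have r0: "AE x in m. 0 \<le> ?r x"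
    using DU.R_nonneg[OF \<rho>(1) a \<rho>(2)] unfolding AE_DU RU_def
    by eventually_elim (auto simp: zext_apply indicator_def)
  obtain \<theta> where \<theta>: "cutoff \<theta> (X closure_of N) W" using cutoff_exists[OF W(4,1,5)] by blast
  have NN: "N \<subseteq> X closure_of N" by (rule closure_of_subset[OF openin_subset[OF W(3)]])
  have "AE x in m. x \<in> W \<longrightarrow> (d - (8 * B) *\<^sub>R ?r) x \<le> 0"
  \<comment> \<open>The dominating element B \<theta> has to work on N only, where it is the bound B
    of d; off N the barrier term 8 B R a \<rho> is already at least B.\<close>
  proof (rule FU_comparison_zero[where r = "B *\<^sub>R \<theta>" and a = a, OF _ _ _ _ a W(1)])
    show "d - (8 * B) *\<^sub>R ?r \<in> F" using d rF by simp
    show "B *\<^sub>R \<theta> \<in> FU W" by (intro FU_scale cutoff_FU[OF \<theta>])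
    show "AE x in m. 0 \<le> (B *\<^sub>R \<theta>) x" using cutoffD(3)[OF \<theta>] B by (simp add: fun_ops)
    show "AE x in m. x \<in> W \<longrightarrow> (d - (8 * B) *\<^sub>R ?r) x \<le> (B *\<^sub>R \<theta>) x"
      using d(2) r0 \<rho>(3) unfolding AE_DU
    proof eventually_elim
      case (elim x)
      show ?case
      proof
        assume x: "x \<in> W"
        show "(d - (8 * B) *\<^sub>R ?r) x \<le> (B *\<^sub>R \<theta>) x"
        proof (cases "x \<in> N")
          case True
          then have "\<theta> x = 1" using cutoffD(6)[OF \<theta>] NN by blast
          moreover have "0 \<le> 8 * B * ?r x" using B elim by simp
          ultimately show ?thesis using elim by (simp add: fun_ops)
        next
          case False
          then have "1 / 8 \<le> ?r x" using elim x W(2) by (auto simp: RU_def)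
          then have "8 * B * (1 / 8) \<le> 8 * B * ?r x" using B by (intro mult_left_mono) auto
          moreover have "0 \<le> B * \<theta> x" using B cutoffD(3)[OF \<theta>] by simp
          ultimately show ?thesis using elim by (simp add: fun_ops)
        qed
      qed
    qed
    fix \<psi> assume \<psi>: "\<psi> \<in> FU W" "AE x in m. 0 \<le> \<psi> x"
    have \<psi>U: "\<psi> \<in> FU U" using FU_mono[OF W(2)] \<psi>(1) by blast
    note \<psi>F = FU_F[OF \<psi>U]
    have "0 \<le> ip2 m (zext \<rho>) \<psi>"
    proof (rule ip2_nonneg)
      show "AE x in m. 0 \<le> zext \<rho> x * \<psi> x"
        using \<rho>(2) \<psi>(2) unfolding AE_DU by eventually_elim (auto simp: zext_apply indicator_def)
    qed
    then have "0 \<le> (8 * B) * (E ?r \<psi> + a * ip2 m ?r \<psi>)"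
      using RU_eq[OF z\<rho> a \<psi>U] z\<rho> rF \<psi>F a B by (simp add: L2.ip_simps algebra_simps)
    then show "E (d - (8 * B) *\<^sub>R ?r) \<psi> + a * ip2 m (d - (8 * B) *\<^sub>R ?r) \<psi> \<le> 0"
    proof -
      have "E (d - (8 * B) *\<^sub>R ?r) \<psi> + a * ip2 m (d - (8 * B) *\<^sub>R ?r) \<psi> =
          (E d \<psi> + a * ip2 m d \<psi>) - (8 * B) * (E ?r \<psi> + a * ip2 m ?r \<psi>)"
        using d(1) rF \<psi>F by (simp add: EE.ip_simps L2.ip_simps algebra_simps)
      then show ?thesis using eq[OF \<psi>(1)] \<open>0 \<le> (8 * B) * (E ?r \<psi> + a * ip2 m ?r \<psi>)\<close> by linarith
    qed
  qed
  then show ?thesis by eventually_elim (use W(2) in \<open>auto simp: RU_def fun_ops\<close>)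
qed

end

context dirichlet_space
begin

text \<open>On U the function w solves the resolvent equation with parameter a and source f = w +
  (\<lambda> / a) (1 - w), which is bounded. The resolvent u of f on U' is continuous and solves the
  same equation on W, so both u - w and w - u satisfy the hypotheses of
  \<open>barrier_comparison\<close>.\<close>

lemma potential_oscillation:
  assumes lam: "0 \<le> lam" and U: "openin X U" "emeasure m U < \<infinity>"
    and U': "feller_subset D U'" "U \<subseteq> U'"
    and w: "open_subset.potential_of_one D U lam w" and z: "z \<in> U" and e: "0 < e"
  shows "\<exists>N r. openin X N \<and> z \<in> N \<and> (AE y in m. y \<in> N \<longrightarrow> \<bar>w y - r\<bar> \<le> e)"
proof -
  interpret O: open_subset D U by unfold_locales (rule U)
  interpret V: feller_subset D U' by (rule U')
  note w = O.potential_of_oneD[OF w]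
  note wF = FU_F[OF w(1)]
  have "compactin X {z}" using z O.U_top by auto
  then obtain W where W: "openin X W" "{z} \<subseteq> W" "compactin X (X closure_of W)" "X closure_of W \<subseteq> U"
    using compact_nbhd[OF _ U(1)] z by blast
  obtain N where N: "openin X N" "{z} \<subseteq> N" "compactin X (X closure_of N)" "X closure_of N \<subseteq> W"
    using compact_nbhd[OF \<open>compactin X {z}\<close> W(1,2)] by blast
  have WW: "W \<subseteq> X closure_of W" by (rule closure_of_subset[OF openin_subset[OF W(1)]])
  have WU: "W \<subseteq> U" "W \<subseteq> U'" using WW W(4) U'(2) by auto
  \<comment> \<open>A compact set that contains W - N. The barrier is at least 1/4 on it, and the
    loss of 1/8 in its resolvent leaves the 1/8 that the comparison asks for.\<close>
  let ?K = "X closure_of W - N"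
  have K: "compactin X ?K" "?K \<subseteq> U'" "z \<notin> ?K"
  proof -
    have "closedin X ?K" using N(1) by (intro closedin_diff) auto
    then show "compactin X ?K" using W(3) by (intro closed_compactin[OF W(3)]) auto
  qed (use W U' N in auto)
  have zU': "z \<in> U'" using z U' by auto
  obtain \<rho> where \<rho>: "V.barrier z \<rho>" "AE x in V.DU.m. x \<in> ?K \<longrightarrow> 1 / 4 \<le> \<rho> x"
    using V.barrier_exists[OF zU' K] by blast
  have \<rho>L2: "\<rho> \<in> L2 V.DU.m" by (rule V.barrier_L2[OF \<rho>(1)])
  have \<rho>0: "AE x in V.DU.m. 0 \<le> \<rho> x" using V.barrier_bound[OF \<rho>(1)] by (auto elim: eventually_mono)
  \<comment> \<open>Bounds f once a \<ge> 1, hence u, and hence |u - w| since 0 \<le> w \<le>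
    1.\<close>
  define B where "B = 1 + lam"
  have B: "1 \<le> B" using lam by (simp add: B_def)
  obtain a0 where a0: "0 < a0" "\<And>a. a0 \<le> a \<Longrightarrow> AE x in V.DU.m. \<rho> x - 1 / 8 \<le> V.DU.R a \<rho> x"
    and small: "\<And>e. 0 < e \<Longrightarrow> \<exists>N a1. openin X N \<and> z \<in> N \<and> N \<subseteq> U' \<and>
      (\<forall>a\<ge>a1. 0 < a \<longrightarrow> (AE x in V.DU.m. x \<in> N \<longrightarrow> V.DU.R a \<rho> x \<le> e))"
    by (rule V.barrier_resolvent[OF \<rho>(1)]) simp
  \<comment> \<open>8 B times this is e / 2; the other half of e is left for the oscillation of the
    continuous version of u.\<close>
  have "0 < e / (16 * B)" using e B by simp
  from small[OF this] obtain N' a1 where N': "openin X N'" "z \<in> N'"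
    "\<And>a. a1 \<le> a \<Longrightarrow> 0 < a \<Longrightarrow> AE x in V.DU.m. x \<in> N' \<longrightarrow> V.DU.R a \<rho> x \<le> e / (16 * B)"
    by (elim exE conjE) blast
  define a where "a = max 1 (max a0 a1)"
  have a: "0 < a" "1 \<le> a" "a0 \<le> a" "a1 \<le> a" by (auto simp: a_def)
  define f where "f = w + (lam / a) *\<^sub>R (indicator U - w)"
  have 1: "indicator U \<in> L2 m" by (rule O.indicator_U_L2[OF U(2)])
  have fL2: "f \<in> L2 m" using 1 wF by (simp add: f_def)
  have fb: "AE x in m. 0 \<le> f x \<and> f x \<le> B"
    using w(2,3) FU_zero_outside[OF w(1) U(1)]
  proof eventually_elim
    case (elim x)
    have la: "0 \<le> lam / a" "lam / a \<le> lam"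
      using lam a mult_left_mono[OF a(2) lam] by (auto simp: pos_divide_le_eq)
    show ?case
    proof (cases "x \<in> U")
      case True
      have "0 \<le> lam / a * (1 - w x)" using la elim by (intro mult_nonneg_nonneg) auto
      moreover have "lam / a * (1 - w x) \<le> lam * 1" using la elim lam by (intro mult_mono) auto
      ultimately show ?thesis using elim True by (simp add: f_def fun_ops B_def)
    qed (use elim B in \<open>simp add: f_def fun_ops\<close>)
  qed
  have fV: "f \<in> L2 V.DU.m" using fL2 by (simp add: V.DU_simps V.L2_U)
  have fVb: "AE x in V.DU.m. 0 \<le> f x" "AE x in V.DU.m. f x \<le> B" "AE x in V.DU.m. \<bar>f x\<bar> \<le> B"
    unfolding V.AE_DU using fb by (auto elim: eventually_mono)
  have B0: "0 \<le> B" using B by simp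
  obtain c where c: "continuous_map (subtopology X U') euclideanreal c" "AE x in V.DU.m. V.DU.R a f x = c x"
    using V.R_continuous[OF fV fVb(3) B0 a(1)] by blast
  define u where "u = V.RU a f"
  have zf: "V.zext f \<in> L2 m" using fL2 by simp
  have uU: "u \<in> FU U'" unfolding u_def by (rule V.RU_FU[OF zf a(1)])
  have uF: "u \<in> F" by (rule FU_F[OF uU])
  have ub: "AE x in m. 0 \<le> u x \<and> u x \<le> B"
    using V.DU.R_nonneg[OF fV a(1) fVb(1)] V.DU.R_le_const[OF fV a(1) B0 fVb(2)]
    unfolding V.AE_DU u_def V.RU_def
    by eventually_elim (auto simp: V.zext_apply indicator_def B0)
  have eq: "E (u - w) v + a * ip2 m (u - w) v = 0" if v: "v \<in> FU W" for v
  proof -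
    have vU: "v \<in> FU U" "v \<in> FU U'" using FU_mono[OF WU(1)] FU_mono[OF WU(2)] v by auto
    note vF = FU_F[OF v]
    have "E u v = a * ip2 m f v - a * ip2 m u v"
      using V.RU_eq[OF zf a(1) vU(2)] V.ip2_zext[OF fL2 vU(2)] zf uF vF
      by (simp add: u_def[symmetric] L2.ip_simps algebra_simps)
    moreover have "a * ip2 m f v = a * ip2 m w v + lam * ip2 m (indicator U - w) v"
      using a(1) 1 wF vF by (simp add: f_def L2.ip_simps algebra_simps)
    ultimately show ?thesis using w(4)[OF vU(1)] uF wF vF by (simp add: EE.ip_simps L2.ip_simps algebra_simps)
  qed
  have R_ge: "AE x in V.DU.m. x \<in> W - N \<longrightarrow> 1 / 8 \<le> V.DU.R a \<rho> x"
    using \<rho>(2) a0(2)[OF a(3)] by eventually_elim (use WW in force)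
  have le1: "AE x in m. x \<in> W \<longrightarrow> (u - w) x \<le> 8 * B * V.DU.R a \<rho> x"
  proof (rule V.barrier_comparison[OF W(1) WU(2) N(1,3,4) \<rho>L2 \<rho>0 R_ge a(1) B0 _ _ eq])
    show "u - w \<in> F" using uF wF by simp
    show "AE x in m. (u - w) x \<le> B" using ub w(2) by eventually_elim (simp add: fun_ops)
  qed
  have le2: "AE x in m. x \<in> W \<longrightarrow> (w - u) x \<le> 8 * B * V.DU.R a \<rho> x"
  proof (rule V.barrier_comparison[OF W(1) WU(2) N(1,3,4) \<rho>L2 \<rho>0 R_ge a(1) B0])
    show "w - u \<in> F" using uF wF by simp
    show "AE x in m. (w - u) x \<le> B" using ub w(3) by eventually_elim (use B in \<open>simp add: fun_ops\<close>)
    show "E (w - u) v + a * ip2 m (w - u) v = 0" if "v \<in> FU W" for v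
      using eq[OF that] uF wF FU_F[OF that] by (simp add: EE.ip_simps L2.ip_simps algebra_simps)
  qed
  obtain N'' where N'': "openin X N''" "z \<in> N''" "N'' \<subseteq> U'" "\<And>y. y \<in> N'' \<Longrightarrow> \<bar>c y - c z\<bar> < e / 2"
    using V.continuous_nbhd[OF c(1) zU', of "e / 2"] e by auto
  have "AE y in m. y \<in> W \<inter> N' \<inter> N'' \<longrightarrow> \<bar>w y - c z\<bar> \<le> e"
    using le1 le2 N'(3)[OF a(4,1)] c(2) unfolding V.AE_DU
  proof eventually_elim
    case (elim y)
    show ?case
    proof
      assume y: "y \<in> W \<inter> N' \<inter> N''"
      then have yU: "y \<in> U'" using N'' by blast
      have "8 * B * V.DU.R a \<rho> y \<le> 8 * B * (e / (16 * B))"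
        using elim(3) y yU B by (intro mult_left_mono) auto
      also have "\<dots> = e / 2" using B by simp
      finally have R_le: "8 * B * V.DU.R a \<rho> y \<le> e / 2" .
      have "u y - w y \<le> 8 * B * V.DU.R a \<rho> y" "w y - u y \<le> 8 * B * V.DU.R a \<rho> y"
        using elim(1,2) y by (auto simp: fun_ops)
      then have "\<bar>u y - w y\<bar> \<le> e / 2" using R_le by linarith
      moreover have "u y = c y" using elim(4) yU by (simp add: u_def V.RU_def)
      moreover have "\<bar>c y - c z\<bar> < e / 2" using N''(4) y by blast
      ultimately show "\<bar>w y - c z\<bar> \<le> e" by linarith
    qed
  qed
  moreover have "openin X (W \<inter> N' \<inter> N'')" "z \<in> W \<inter> N' \<inter> N''" using W N' N'' by auto
  ultimately show ?thesis by blast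
qed

text \<open>The oscillation estimate at the points of U gives a continuous version on U, and by full
  support the bounds 0 and 1 pass from almost every point to every point.\<close>

lemma potential_continuous:
  assumes lam: "0 \<le> lam" and ls: "locally_smoothing D" and U: "rel_compact_open X U"
    and w: "open_subset.potential_of_one D U lam w"
  shows "\<exists>c\<in>Cb (subtopology X U). AE x in m. x \<in> U \<longrightarrow> w x = c x"
proof -
  have Uo: "openin X U" using U by (simp add: rel_compact_open_def)
  have fin: "emeasure m U < \<infinity>" by (rule rel_compact_finite[OF U])
  interpret O: open_subset D U by unfold_locales (rule Uo)
  obtain U' where U': "openin X U'" "U \<subseteq> U'" "doubly_feller (restrict_dirichlet D U')"
    using ls U unfolding locally_smoothing_def by blast
  have V: "feller_subset D U'" by unfold_locales (use U' in auto)
  note wD = O.potential_of_oneD[OF w]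
  have zw: "O.zext w \<in> borel_measurable m" by (intro O.zext_measurable F_measurable FU_F[OF wD(1)])
  obtain c where c: "continuous_map (subtopology X U) euclideanreal c" "AE x in m. x \<in> U \<longrightarrow> w x = c x"
    using O.continuous_representative[OF zw potential_oscillation[OF lam Uo fin V U'(2) w]] by blast
  have "\<bar>c x\<bar> \<le> 1" if x: "x \<in> U" for x
  proof -
    have "AE x in m. x \<in> U \<longrightarrow> c x \<le> 1" "AE x in m. x \<in> U \<longrightarrow> - c x \<le> 0"
      using c(2) wD(2,3) by (eventually_elim, auto)+
    moreover have "continuous_map (subtopology X U) euclideanreal (\<lambda>x. - c x)"
      using c(1) by (intro continuous_map_minus) simp
    ultimately show ?thesis
      using O.continuous_le_of_AE[OF c(1) _ x, of 1] O.continuous_le_of_AE[OF _ _ x, of "\<lambda>x. - c x" 0] by simp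
  qed
  then have "c \<in> Cb (subtopology X U)" using c(1) unfolding Cb_def Cont_def O.topspace_U by blast
  then show ?thesis using c(2) by blast
qed

end

theorem theorem4p8:
  fixes D :: "'a dirichlet" and lam :: real
  assumes "lam \<ge> 0"
    and "strongly_local_dirichlet_space D"
    and "locally_smoothing D"
  shows "(\<forall>f. f \<in> L1loc (top_of D) (msr D) \<and> locally_shift_defective lam D f \<and> f \<in> Floc D
            \<longrightarrow> weakly_subharmonic lam D f)
       \<and> (\<forall>f. f \<in> Linfloc (top_of D) (msr D) \<and> locally_shift_defective lam D f
            \<longrightarrow> weakly_subharmonic lam D f)
       \<and> (\<forall>f. f \<in> Floc D \<and> weakly_subharmonic lam D f \<and>
              locally_bounded_above (top_of D) (msr D) f
            \<longrightarrow> locally_shift_defective lam D f)"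
proof -
  interpret dirichlet_space D by unfold_locales (rule assms(2))
  show ?thesis
    using subharmonic_of_shift_defective[OF assms(3,1)] Floc_of_shift_defective[OF assms(3,1)]
      shift_defective_of_subharmonic[OF assms(1) _ _ potential_continuous[OF assms(1,3)]]
    by blast
qed

end
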